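(* For every $\varepsilon>0$ there exists $n_0$ such that the following holds for every $n\ge n_0$. If $\mathcal H$ is an $n$-vertex $C_5^{3-}$-free $3$-graph with exactly $\mathrm{ex}(n,C_5^{3-})$ edges, then there is a partition $V_1\cup V_2\cup V_3=V(\mathcal H)$ such that (i) $\big||V_i|-\frac n3\big|\le\varepsilon n$ for every $i\in\{1,2,3\}$, and (ii) $\mathcal H\setminus\bigcup_{i=1}^3\mathcal H[V_i]=\mathcal K[V_1,V_2,V_3]$.
   Context: $C_5^{3-}$ is the $3$-graph on $\{1,\dots,5\}$ with edges $\{1,2,3\},\{2,3,4\},\{3,4,5\},\{4,5,1\}$; $\mathrm{ex}(n,C_5^{3-})$ is the maximum number of edges of an $n$-vertex $3$-graph containing no copy of $C_5^{3-}$. $\mathcal H[V_i]$ denotes the set of edges of $\mathcal H$ contained in $V_i$, and $\mathcal K[V_1,V_2,V_3]$ is the set of all triples meeting each of $V_1,V_2,V_3$ in exactly one vertex. *)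

theory Defs
  imports Complex_Main "HOL-Library.Ramsey" "HOL-Library.Disjoint_Sets"
begin

definition three_graph :: "'a set \<Rightarrow> 'a set set \<Rightarrow> bool" where
  "three_graph V E \<longleftrightarrow> finite V \<and> E \<subseteq> nsets V 3"

text \<open>A copy is a not necessarily induced subgraph.\<close>

definition contains_copy :: "'b set \<Rightarrow> 'b set set \<Rightarrow> 'a set \<Rightarrow> 'a set set \<Rightarrow> bool" where
  "contains_copy U F V E \<longleftrightarrow>
     (\<exists>f. inj_on f U \<and> f ` U \<subseteq> V \<and> (\<forall>e\<in>F. f ` e \<in> E))"

definition C5m_verts :: "nat set" where
  "C5m_verts = {1, 2, 3, 4, 5}"

definition C5m_edges :: "nat set set" where
  "C5m_edges = {{1, 2, 3}, {2, 3, 4}, {3, 4, 5}, {4, 5, 1}}"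

definition C5m_free :: "'a set \<Rightarrow> 'a set set \<Rightarrow> bool" where
  "C5m_free V E \<longleftrightarrow> \<not> contains_copy C5m_verts C5m_edges V E"

text \<open>Up to isomorphism, every \<open>n\<close>-vertex 3-graph has vertex set \<open>{..<n}\<close>.\<close>

definition ex_C5m :: "nat \<Rightarrow> nat" where
  "ex_C5m n = Max {card E | E. three_graph {..<n} E \<and> C5m_free {..<n} E}"

definition induced_edges :: "'a set set \<Rightarrow> 'a set \<Rightarrow> 'a set set" where
  "induced_edges E W = {e \<in> E. e \<subseteq> W}"

definition transversal_triples :: "'a set \<Rightarrow> 'a set \<Rightarrow> 'a set \<Rightarrow> 'a set set" where
  "transversal_triples A B C =
     {e. card e = 3 \<and> card (e \<inter> A) = 1 \<and> card (e \<inter> B) = 1 \<and> card (e \<inter> C) = 1}"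

end

theory Submission
  imports Defs "HOL-Library.FuncSet"
begin

text \<open>
  Blowing up an extremal 3-graph shows that the edge density of an extremal 3-graph tends to some
  \<open>L \<ge> 1/4\<close>, with a matching bound on every vertex subset. A flag algebra computation on six vertices,
  in which the hereditary bound is applied to the codegree neighbourhoods, yields an edge \<open>xyz\<close> such that
  the three sets of vertices attached to exactly one of its pairs span more than
  \<open>(1/27 - 0.00073) n\<^sup>3\<close> transversal edges. Take a partition with the most transversal edges, after
  deleting the few vertices of small degree or with many link triangles. Forbidden copies through a
  vertex limit its non-transversal edges in terms of the missing transversal triples, and Mantel's
  theorem for the links makes all bad edges together fewer than \<open>0.77\<close> times the missing triples plus
  an error. Replacing all bad edges by the missing triples creates no forbidden copy, so extremality
  forces both quantities to be small. With an almost complete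
  cut the same replacement is strictly profitable unless nothing is bad or missing: vertices of
  small deficit are handled by counting, and for the remaining ones the edges inside the parts
  force many non-edges in the link.
\<close>

section \<open>Blow-ups and the extremal function\<close>

text \<open>The limit density \<open>L\<close> is not known to be 1/4 beforehand, so one certificate
  must serve every \<open>L\<close> \<ge> 1/4. In the iterated construction the common neighbourhood
  of two vertices in different top-level parts is the third part, which has density \<open>L\<close>
  again; hence the hereditary bound loses nothing on codegree neighbourhoods. All terms in
  \<open>L\<close> combine to a multiple of 4 \<open>L\<close> - 1, and a second, smaller flag
  computation (\<open>star_average\<close>) shows that the other factor is nonnegative up to lower
  order.

  Three edges on four vertices are not forbidden, yet each triple is a triangle in the link of at
  most one vertex. Such quadruples are therefore negligible in the flag computation, and nearly all
  links are almost triangle-free, which gives access to Mantel's theorem.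

  The flag computation has to find an edge of the top level. In the iterated construction an edge of
  depth k (with k = 0 on top) sees only about n / 3^k vertices attached to exactly one of its pairs;
  the factor (4 D - n)^2 in the objective keeps the negative contribution of these deeper edges
  small.

  What matters about 0.77 is that it is below 1: extremality bounds the missing triples by the bad
  edges.\<close>

lemma C5m_free_iff:
  "C5m_free V E \<longleftrightarrow> (\<forall>p q r s t. distinct [p, q, r, s, t] \<longrightarrow> {p, q, r, s, t} \<subseteq> V \<longrightarrow>
     {p, q, r} \<in> E \<longrightarrow> {q, r, s} \<in> E \<longrightarrow> {r, s, t} \<in> E \<longrightarrow> {s, t, p} \<notin> E)"
proof -
  have "contains_copy C5m_verts C5m_edges V E \<longleftrightarrow> (\<exists>p q r s t. distinct [p, q, r, s, t] \<and>
     {p, q, r, s, t} \<subseteq> V \<and> {p, q, r} \<in> E \<and> {q, r, s} \<in> E \<and> {r, s, t} \<in> E \<and> {s, t, p} \<in> E)"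
    (is "?L \<longleftrightarrow> ?R")
  proof
    assume ?L
    then obtain f where f: "inj_on f C5m_verts" "f ` C5m_verts \<subseteq> V" "\<forall>e\<in>C5m_edges. f ` e \<in> E"
      unfolding contains_copy_def by blast
    have "distinct [f 1, f 2, f 3, f 4, f 5]"
      using f(1) by (auto simp: C5m_verts_def inj_on_def)
    then show ?R
      using f(2,3) unfolding C5m_verts_def C5m_edges_def
      by (intro exI[of _ "f 1"] exI[of _ "f 2"] exI[of _ "f 3"] exI[of _ "f 4"] exI[of _ "f 5"]) simp
  next
    assume ?R
    then obtain p q r s t where *: "distinct [p, q, r, s, t]" "{p, q, r, s, t} \<subseteq> V" "{p, q, r} \<in> E"
       "{q, r, s} \<in> E" "{r, s, t} \<in> E" "{s, t, p} \<in> E" by blast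
    define f where "f = (\<lambda>i::nat. if i = 1 then p else if i = 2 then q else if i = 3 then r
      else if i = 4 then s else t)"
    have [simp]: "f 1 = p" "f (Suc 0) = p" "f 2 = q" "f 3 = r" "f 4 = s" "f 5 = t" by (auto simp: f_def)
    show ?L unfolding contains_copy_def C5m_verts_def C5m_edges_def
      using * by (intro exI[of _ f]) (auto simp: inj_on_def)
  qed
  then show ?thesis unfolding C5m_free_def by blast
qed

section \<open>Induced subgraphs and relabelling\<close>

lemma three_graph_edgeD:
  assumes "three_graph V E" "e \<in> E"
  shows "e \<subseteq> V" "finite e" "card e = 3"
  using assms by (auto simp: three_graph_def nsets_def)

lemma three_graph_finite: "three_graph V E \<Longrightarrow> finite V" "three_graph V E \<Longrightarrow> finite E"
  by (auto simp: three_graph_def nsets_def intro: finite_subset[of _ "Pow V"])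

lemma three_graph_induced: "three_graph V E \<Longrightarrow> W \<subseteq> V \<Longrightarrow> three_graph W (induced_edges E W)"
  by (auto simp: three_graph_def nsets_def induced_edges_def intro: finite_subset)

lemma C5m_free_induced:
  assumes "C5m_free V E" "W \<subseteq> V"
  shows "C5m_free W (induced_edges E W)"
  unfolding C5m_free_iff
proof (intro allI impI notI)
  fix p q r s t
  assume d: "distinct [p, q, r, s, t]" "{p, q, r, s, t} \<subseteq> W"
    and e: "{p, q, r} \<in> induced_edges E W" "{q, r, s} \<in> induced_edges E W"
      "{r, s, t} \<in> induced_edges E W" "{s, t, p} \<in> induced_edges E W"
  have "{p, q, r} \<in> E" "{q, r, s} \<in> E" "{r, s, t} \<in> E" "{s, t, p} \<in> E"
    using e by (simp_all add: induced_edges_def)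
  with assms(1)[unfolded C5m_free_iff, rule_format, OF d(1)] d(2) assms(2) show False by auto
qed

lemma card_three_eq: "card {x, y, z} = 3 \<longleftrightarrow> x \<noteq> y \<and> x \<noteq> z \<and> y \<noteq> z"
  by (auto simp: card_insert_if)

lemma three_graph_image:
  assumes "three_graph V E" "C5m_free V E" "bij_betw f V W"
  shows "three_graph W ((`) f ` E)" "C5m_free W ((`) f ` E)" "card ((`) f ` E) = card E"
proof -
  have inj: "inj_on f V" and im: "f ` V = W" using assms(3) by (auto simp: bij_betw_def)
  have EV: "e \<subseteq> V" "card e = 3" "finite e" if "e \<in> E" for e
    using that assms(1) by (auto dest: three_graph_edgeD)
  show "three_graph W ((`) f ` E)"
    using assms(1) im EV inj unfolding three_graph_def nsets_def
    by (auto simp: card_image inj_on_subset[OF inj])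
  have injE: "inj_on ((`) f) E"
    using EV inj by (intro inj_onI) (metis inj_on_image_eq_iff)
  then show "card ((`) f ` E) = card E" by (rule card_image)
  show "C5m_free W ((`) f ` E)"
    unfolding C5m_free_iff
  proof (intro allI impI notI)
    fix p q r s t
    assume d: "distinct [p, q, r, s, t]" and sub: "{p, q, r, s, t} \<subseteq> W"
      and e: "{p, q, r} \<in> (`) f ` E" "{q, r, s} \<in> (`) f ` E" "{r, s, t} \<in> (`) f ` E" "{s, t, p} \<in> (`) f ` E"
    obtain p' q' r' s' t' where V: "{p', q', r', s', t'} \<subseteq> V"
      and eq: "p = f p'" "q = f q'" "r = f r'" "s = f s'" "t = f t'"
    proof -
      have "p \<in> f ` V" "q \<in> f ` V" "r \<in> f ` V" "s \<in> f ` V" "t \<in> f ` V" using sub im by auto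
      then show thesis by (elim imageE) (rule that, auto)
    qed
    have pre: "{x, y, z} \<in> E" if a: "{f x, f y, f z} \<in> (`) f ` E" "{x, y, z} \<subseteq> V" for x y z
    proof -
      obtain e where "e \<in> E" "f ` e = f ` {x, y, z}" using a(1) by auto
      then show ?thesis using inj_on_image_eq_iff[OF inj EV(1) a(2)] by auto
    qed
    have "{p', q', r'} \<in> E" "{q', r', s'} \<in> E" "{r', s', t'} \<in> E" "{s', t', p'} \<in> E"
      using e V by (auto simp: eq intro!: pre)
    moreover have "distinct [p', q', r', s', t']" using d by (auto simp: eq)
    ultimately show False using assms(2)[unfolded C5m_free_iff, rule_format, of p' q' r' s' t'] V by simp
  qed
qed

section \<open>Extremal numbers\<close>

lemma finite_ex_set: "finite {card E | E. three_graph {..<n::nat} E \<and> C5m_free {..<n} E}"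
proof -
  have "{card E | E. three_graph {..<n} E \<and> C5m_free {..<n} E} \<subseteq> card ` Pow (Pow {..<n})"
    by (auto simp: three_graph_def nsets_def)
  then show ?thesis by (rule finite_subset) auto
qed

lemma empty_C5m_free: "finite V \<Longrightarrow> three_graph V {}" "C5m_free V {}"
  by (auto simp: three_graph_def C5m_free_iff)

lemma card_le_ex_C5m:
  assumes "three_graph V E" "C5m_free V E"
  shows "card E \<le> ex_C5m (card V)"
proof -
  have "finite V" using assms(1) by (rule three_graph_finite)
  then obtain f where f: "bij_betw f V {..<card V}"
    using ex_bij_betw_finite_nat[of V] by (auto simp: atLeast0LessThan)
  have "card E \<in> {card E | E. three_graph {..<card V} E \<and> C5m_free {..<card V} E}"
    using three_graph_image[OF assms f] by (metis (mono_tags, lifting) mem_Collect_eq)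
  then show ?thesis unfolding ex_C5m_def by (rule Max_ge[OF finite_ex_set])
qed

lemma ex_C5m_attained:
  assumes "finite V"
  obtains E where "three_graph V E" "C5m_free V E" "card E = ex_C5m (card V)"
proof -
  let ?S = "{card E | E. three_graph {..<card V} E \<and> C5m_free {..<card V} E}"
  have "?S \<noteq> {}" using empty_C5m_free[of "{..<card V}"] by auto
  then have "ex_C5m (card V) \<in> ?S" unfolding ex_C5m_def by (rule Max_in[OF finite_ex_set])
  then obtain E where E: "three_graph {..<card V} E" "C5m_free {..<card V} E" "card E = ex_C5m (card V)" by auto
  obtain f where f: "bij_betw f {..<card V} V"
    using ex_bij_betw_nat_finite[OF assms] by (auto simp: atLeast0LessThan)
  show thesis using three_graph_image[OF E(1,2) f] E(3) by (intro that) auto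
qed

text \<open>Double counting of the pairs of a vertex and an edge avoiding it, in an extremal
  3-graph. Equivalently, the extremal number divided by the number of triples does not increase with
  \<open>n\<close>.\<close>

lemma ex_C5m_averaging:
  assumes "n \<ge> 1"
  shows "(n - 3) * ex_C5m n \<le> n * ex_C5m (n - 1)"
proof -
  obtain E where E: "three_graph {..<n} E" "C5m_free {..<n} E" "card E = ex_C5m n"
    using ex_C5m_attained[of "{..<n}"] by auto
  have fE: "finite E" using E(1) by (rule three_graph_finite)
  have "(\<Sum>v<n. card {e \<in> E. v \<notin> e}) = (\<Sum>v<n. \<Sum>e\<in>E. of_bool (v \<notin> e))"
    using fE by (simp add: Int_def)
  also have "\<dots> = (\<Sum>e\<in>E. \<Sum>v<n. of_bool (v \<notin> e))" by (rule sum.swap)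
  also have "\<dots> = (\<Sum>e\<in>E. n - 3)"
  proof (rule sum.cong[OF refl])
    fix e assume "e \<in> E"
    then have e: "e \<subseteq> {..<n}" "card e = 3" "finite e" using three_graph_edgeD[OF E(1)] by auto
    have "(\<Sum>v<n. of_bool (v \<notin> e)) = card ({..<n} - e)"
      by (simp add: Diff_eq Int_def Collect_neg_eq flip: Compl_eq)
    also have "\<dots> = n - 3" using e by (simp add: card_Diff_subset)
    finally show "(\<Sum>v<n. of_bool (v \<notin> e)) = n - 3" .
  qed
  finally have "(n - 3) * ex_C5m n = (\<Sum>v<n. card {e \<in> E. v \<notin> e})" using E(3) by simp
  also have "\<dots> \<le> (\<Sum>v<n. ex_C5m (n - 1))"
  proof (rule sum_mono)
    fix v assume v: "v \<in> {..<n}"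
    have "{e \<in> E. v \<notin> e} = induced_edges E ({..<n} - {v})"
      using three_graph_edgeD(1)[OF E(1)] by (auto simp: induced_edges_def)
    then show "card {e \<in> E. v \<notin> e} \<le> ex_C5m (n - 1)"
      using card_le_ex_C5m[OF three_graph_induced[OF E(1)] C5m_free_induced[OF E(2)], of "{..<n} - {v}"] v
      by auto
  qed
  finally show ?thesis by simp
qed

section \<open>Transversal triples and blow-ups\<close>

lemma transversal_triples_eq:
  assumes "A \<inter> B = {}" "A \<inter> C = {}" "B \<inter> C = {}"
  shows "transversal_triples A B C = (\<lambda>(x, y, z). {x, y, z}) ` (A \<times> B \<times> C)"
proof
  show "transversal_triples A B C \<subseteq> (\<lambda>(x, y, z). {x, y, z}) ` (A \<times> B \<times> C)"
  proof
    fix e assume "e \<in> transversal_triples A B C"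
    then have e: "card e = 3" "card (e \<inter> A) = 1" "card (e \<inter> B) = 1" "card (e \<inter> C) = 1"
      by (auto simp: transversal_triples_def)
    obtain x y z where xyz: "e \<inter> A = {x}" "e \<inter> B = {y}" "e \<inter> C = {z}"
      using e by (metis card_1_singletonE)
    then have "{x, y, z} \<subseteq> e" "x \<in> A" "y \<in> B" "z \<in> C" by auto
    moreover from this assms have "card {x, y, z} = 3" by (auto simp: card_three_eq)
    moreover have "finite e" using e(1) by (metis card.infinite zero_neq_numeral)
    ultimately have "e = {x, y, z}" using e(1) by (metis card_subset_eq)
    with \<open>x \<in> A\<close> \<open>y \<in> B\<close> \<open>z \<in> C\<close> show "e \<in> (\<lambda>(x, y, z). {x, y, z}) ` (A \<times> B \<times> C)" by auto
  qed
  show "(\<lambda>(x, y, z). {x, y, z}) ` (A \<times> B \<times> C) \<subseteq> transversal_triples A B C"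
  proof
    fix e assume "e \<in> (\<lambda>(x, y, z). {x, y, z}) ` (A \<times> B \<times> C)"
    then obtain x y z where e: "e = {x, y, z}" and m: "x \<in> A" "y \<in> B" "z \<in> C" by auto
    have "e \<inter> A = {x}" "e \<inter> B = {y}" "e \<inter> C = {z}" using m assms by (auto simp: e)
    moreover have "card e = 3" using m assms by (auto simp: e card_three_eq)
    ultimately show "e \<in> transversal_triples A B C" by (simp add: transversal_triples_def)
  qed
qed

lemma inj_on_triple:
  assumes "A \<inter> B = {}" "A \<inter> C = {}" "B \<inter> C = {}"
  shows "inj_on (\<lambda>(x, y, z). {x, y, z}) (A \<times> B \<times> C)"
proof (rule inj_onI)
  fix p q assume "p \<in> A \<times> B \<times> C" "q \<in> A \<times> B \<times> C" and eq: "(case p of (x, y, z) \<Rightarrow> {x, y, z}) = (case q of (x, y, z) \<Rightarrow> {x, y, z})"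
  then obtain x y z x' y' z' where pq: "p = (x, y, z)" "q = (x', y', z')"
    "x \<in> A" "y \<in> B" "z \<in> C" "x' \<in> A" "y' \<in> B" "z' \<in> C" by auto
  have "{x, y, z} \<inter> A = {x}" "{x', y', z'} \<inter> A = {x'}" "{x, y, z} \<inter> B = {y}" "{x', y', z'} \<inter> B = {y'}"
     "{x, y, z} \<inter> C = {z}" "{x', y', z'} \<inter> C = {z'}"
    using pq(3-8) assms by auto
  then show "p = q" using eq unfolding pq by (metis case_prod_conv singleton_inject)
qed

lemma card_transversal_triples:
  assumes "A \<inter> B = {}" "A \<inter> C = {}" "B \<inter> C = {}"
  shows "card (transversal_triples A B C) = card A * card B * card C"
  by (simp add: transversal_triples_eq[OF assms] card_image[OF inj_on_triple[OF assms]] card_cartesian_product)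

text \<open>Consecutive edges of the pattern share two vertices, whereas a transversal triple meets an
  edge inside a part in at most one vertex; so a copy would be entirely transversal, and then
  its vertices 1 and 4 would lie in the same part.\<close>

lemma blow_up_C5m_free:
  assumes d: "A \<inter> B = {}" "A \<inter> C = {}" "B \<inter> C = {}" and V: "A \<union> B \<union> C = V"
    and A: "three_graph A EA" "C5m_free A EA" and B: "three_graph B EB" "C5m_free B EB"
    and C: "three_graph C EC" "C5m_free C EC"
  defines "F \<equiv> transversal_triples A B C \<union> EA \<union> EB \<union> EC"
  shows "three_graph V F" "C5m_free V F" "card F = card A * card B * card C + card EA + card EB + card EC"
proof -
  have fin: "finite A" "finite B" "finite C" "finite EA" "finite EB" "finite EC"
    using A B C three_graph_finite by auto
  note T = transversal_triples_eq[OF d]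
  have sub: "e \<subseteq> A" "card e = 3" if "e \<in> EA" for e using that A three_graph_edgeD by auto
  have subB: "e \<subseteq> B" "card e = 3" if "e \<in> EB" for e using that B three_graph_edgeD by auto
  have subC: "e \<subseteq> C" "card e = 3" if "e \<in> EC" for e using that C three_graph_edgeD by auto
  have sT: "e \<subseteq> A \<union> B \<union> C" "card e = 3" if "e \<in> transversal_triples A B C" for e
    using that d by (auto simp: T card_three_eq)
  show "three_graph V F"
  proof -
    have "finite e \<and> card e = 3 \<and> e \<subseteq> V" if "e \<in> F" for e
      using that V sub subB subC sT unfolding F_def by (metis (no_types, lifting) UnE card.infinite le_supI1
        subset_trans sup.cobounded1 sup.cobounded2 sup.coboundedI1 zero_neq_numeral)
    then show ?thesis using fin V unfolding three_graph_def nsets_def by auto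
  qed
  have eq: "F = EA \<union> (EB \<union> (EC \<union> transversal_triples A B C))" by (auto simp: F_def)
  have disj: "EA \<inter> (EB \<union> (EC \<union> transversal_triples A B C)) = {}" "EB \<inter> (EC \<union> transversal_triples A B C) = {}"
     "EC \<inter> transversal_triples A B C = {}"
  proof -
    have nA: "e \<noteq> {}" "e \<subseteq> A" if "e \<in> EA" for e using sub[OF that] by auto
    have nB: "e \<noteq> {}" "e \<subseteq> B" if "e \<in> EB" for e using subB[OF that] by auto
    have nC: "e \<noteq> {}" "e \<subseteq> C" if "e \<in> EC" for e using subC[OF that] by auto
    have nT: "e \<inter> A \<noteq> {}" "e \<inter> B \<noteq> {}" if "e \<in> transversal_triples A B C" for e using that by (auto simp: T)
    have 1: "False" if "e \<in> EA" "e \<in> EB" for e using nA[OF that(1)] nB[OF that(2)] d by blast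
    have 2: "False" if "e \<in> EA" "e \<in> EC" for e using nA[OF that(1)] nC[OF that(2)] d by blast
    have 3: "False" if "e \<in> EB" "e \<in> EC" for e using nB[OF that(1)] nC[OF that(2)] d by blast
    have 4: "False" if "e \<in> EA" "e \<in> transversal_triples A B C" for e
      using nA[OF that(1)] nT(2)[OF that(2)] d by blast
    have 5: "False" if "e \<in> EB" "e \<in> transversal_triples A B C" for e
      using nB[OF that(1)] nT(1)[OF that(2)] d by blast
    have 6: "False" if "e \<in> EC" "e \<in> transversal_triples A B C" for e
      using nC[OF that(1)] nT(1)[OF that(2)] d by blast
    show "EA \<inter> (EB \<union> (EC \<union> transversal_triples A B C)) = {}" "EB \<inter> (EC \<union> transversal_triples A B C) = {}"
      "EC \<inter> transversal_triples A B C = {}" using 1 2 3 4 5 6 by auto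
  qed
  have "finite (transversal_triples A B C)" using fin by (simp add: T)
  then show "card F = card A * card B * card C + card EA + card EB + card EC"
    unfolding eq using fin disj by (simp add: card_Un_disjoint card_transversal_triples[OF d])
  show "C5m_free V F"
    unfolding C5m_free_iff
  proof (intro allI impI notI)
    fix p q r s t
    assume dd: "distinct [p, q, r, s, t]" and "{p, q, r, s, t} \<subseteq> V"
      and e: "{p, q, r} \<in> F" "{q, r, s} \<in> F" "{r, s, t} \<in> F" "{s, t, p} \<in> F"
    define c where "c = (\<lambda>x. if x \<in> A then 0 else if x \<in> B then 1 else (2::nat))"
    have cT: "c x \<noteq> c y \<and> c x \<noteq> c z \<and> c y \<noteq> c z" if a: "{x, y, z} \<in> transversal_triples A B C" "distinct [x, y, z]" for x y z
    proof -
      obtain a b c' where abc: "{x, y, z} = {a, b, c'}" "a \<in> A" "b \<in> B" "c' \<in> C" using a(1) unfolding T by auto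
      have "inj_on c {a, b, c'}" using abc(2-4) d by (auto simp: c_def inj_on_def)
      then have "inj_on c {x, y, z}" by (simp add: abc(1))
      then show ?thesis using a(2) by (auto simp: inj_on_def)
    qed
    have cS: "c x = i \<Longrightarrow> x \<in> V \<Longrightarrow> (i = 0 \<longrightarrow> x \<in> A) \<and> (i = 1 \<longrightarrow> x \<in> B) \<and> (i = 2 \<longrightarrow> x \<in> C)" for x i
      using V by (auto simp: c_def split: if_splits)
    have cases4: "{x, y, z} \<in> transversal_triples A B C \<or> {x, y, z} \<in> EA \<or> {x, y, z} \<in> EB \<or> {x, y, z} \<in> EC"
      if "{x, y, z} \<in> F" for x y z using that unfolding F_def by blast
    have colA: "c x = 0 \<and> c y = 0 \<and> c z = 0" if "{x, y, z} \<in> EA" for x y z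
      using sub[OF that] by (auto simp: c_def)
    have colB: "c x = 1 \<and> c y = 1 \<and> c z = 1" if "{x, y, z} \<in> EB" for x y z
      using subB[OF that] d by (auto simp: c_def)
    have colC: "c x = 2 \<and> c y = 2 \<and> c z = 2" if "{x, y, z} \<in> EC" for x y z
      using subC[OF that] d by (auto simp: c_def)
    have cE: "(c x = c y \<and> c y = c z) \<or> (c x \<noteq> c y \<and> c x \<noteq> c z \<and> c y \<noteq> c z)"
      if "{x, y, z} \<in> F" "distinct [x, y, z]" for x y z
      using cases4[OF that(1)] cT[OF _ that(2)] colA colB colC by metis
    have cI: "(c x = 0 \<longrightarrow> {x, y, z} \<in> EA) \<and> (c x = 1 \<longrightarrow> {x, y, z} \<in> EB) \<and> (c x = 2 \<longrightarrow> {x, y, z} \<in> EC)"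
      if "{x, y, z} \<in> F" "distinct [x, y, z]" "c x = c y" for x y z
      using cases4[OF that(1)] cT[OF _ that(2)] colA[of x y z] colB[of x y z] colC[of x y z] that(3)
      by (metis One_nat_def Suc_1 n_not_Suc_n numeral_1_eq_Suc_0 zero_neq_numeral zero_neq_one)
    have c3: "c x < 3" for x by (auto simp: c_def)
    have m: "p \<in> V" "q \<in> V" "r \<in> V" "s \<in> V" "t \<in> V" using \<open>{p, q, r, s, t} \<subseteq> V\<close> by auto
    have ds: "distinct [p, q, r]" "distinct [q, r, s]" "distinct [r, s, t]" "distinct [s, t, p]" using dd by auto
    note E4 = cE[OF e(1) ds(1)] cE[OF e(2) ds(2)] cE[OF e(3) ds(3)] cE[OF e(4) ds(4)]
    have same: "c p = c q \<and> c q = c r \<and> c r = c s \<and> c s = c t"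
    proof (cases "c p = c q")
      case True
      with E4(1) have 1: "c q = c r" by auto
      with E4(2) have 2: "c r = c s" by auto
      with E4(3) have "c s = c t" by auto
      with True 1 2 show ?thesis by simp
    next
      case False
      with E4(1) have 1: "c p \<noteq> c q" "c p \<noteq> c r" "c q \<noteq> c r" by auto
      with E4(2) have 2: "c q \<noteq> c s" "c r \<noteq> c s" by auto
      then have sp: "c s = c p" using 1 c3[of p] c3[of q] c3[of r] c3[of s] by linarith
      from 2 E4(3) have 3: "c r \<noteq> c t" "c s \<noteq> c t" by auto
      with sp E4(4) show ?thesis by auto
    qed
    then have s4: "c p = c q" "c q = c r" "c r = c s" "c s = c t" by auto
    note I4 = cI[OF e(1) ds(1) s4(1)] cI[OF e(2) ds(2) s4(2)] cI[OF e(3) ds(3) s4(3)] cI[OF e(4) ds(4) s4(4)]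
    have set5: "{p, q, r, s, t} \<subseteq> X" if "p \<in> X" "q \<in> X" "r \<in> X" "s \<in> X" "t \<in> X" for X using that by auto
    consider "c p = 0" | "c p = 1" | "c p = 2" using c3[of p] by (auto simp: less_Suc_eq numeral_eq_Suc)
    then show False
    proof cases
      case 1
      then have c0: "c p = 0" "c q = 0" "c r = 0" "c s = 0" "c t = 0" using same by auto
      then have "{p, q, r, s, t} \<subseteq> A" using m cS by (intro set5) auto
      moreover have "{p, q, r} \<in> EA" "{q, r, s} \<in> EA" "{r, s, t} \<in> EA" "{s, t, p} \<in> EA"
        using I4 c0 by simp_all
      ultimately show False using A(2)[unfolded C5m_free_iff, rule_format, OF dd] by simp
    next
      case 2
      then have c0: "c p = 1" "c q = 1" "c r = 1" "c s = 1" "c t = 1" using same by auto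
      then have "{p, q, r, s, t} \<subseteq> B" using m cS by (intro set5) auto
      moreover have "{p, q, r} \<in> EB" "{q, r, s} \<in> EB" "{r, s, t} \<in> EB" "{s, t, p} \<in> EB"
        using I4 c0 by simp_all
      ultimately show False using B(2)[unfolded C5m_free_iff, rule_format, OF dd] by simp
    next
      case 3
      then have c0: "c p = 2" "c q = 2" "c r = 2" "c s = 2" "c t = 2" using same by auto
      then have "{p, q, r, s, t} \<subseteq> C" using m cS by (intro set5) auto
      moreover have "{p, q, r} \<in> EC" "{q, r, s} \<in> EC" "{r, s, t} \<in> EC" "{s, t, p} \<in> EC"
        using I4 c0 by simp_all
      ultimately show False using C(2)[unfolded C5m_free_iff, rule_format, OF dd] by simp
    qed
  qed
qed

text \<open>Three parts of size \<open>m\<close>, each filled with an extremal 3-graph. This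
  recursion is what forces the limit density up to 1/4.\<close>

lemma ex_C5m_blow_up: "m ^ 3 + 3 * ex_C5m m \<le> ex_C5m (3 * m)"
proof -
  obtain EA where A: "three_graph {..<m} EA" "C5m_free {..<m} EA" "card EA = ex_C5m m"
    using ex_C5m_attained[of "{..<m}"] by auto
  obtain EB where B: "three_graph {m..<2*m} EB" "C5m_free {m..<2*m} EB" "card EB = ex_C5m m"
    using ex_C5m_attained[of "{m..<2*m}"] by auto
  obtain EC where C: "three_graph {2*m..<3*m} EC" "C5m_free {2*m..<3*m} EC" "card EC = ex_C5m m"
    using ex_C5m_attained[of "{2*m..<3*m}"] by auto
  have V: "{..<m} \<union> {m..<2*m} \<union> {2*m..<3*m} = {..<3*m}" by auto
  note F = blow_up_C5m_free[OF _ _ _ V A(1,2) B(1,2) C(1,2)]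
  have "card (transversal_triples {..<m} {m..<2*m} {2*m..<3*m} \<union> EA \<union> EB \<union> EC) \<le> ex_C5m (card {..<3*m})"
    by (rule card_le_ex_C5m) (rule F; auto)+
  also have "card (transversal_triples {..<m} {m..<2*m} {2*m..<3*m} \<union> EA \<union> EB \<union> EC) = m ^ 3 + 3 * ex_C5m m"
    by (subst F(3)) (auto simp: A(3) B(3) C(3) power3_eq_cube)
  finally show ?thesis by simp
qed

text \<open>The normalized extremal numbers decrease to \<open>L\<close>; comparing both sides of
  \<open>ex_C5m_blow_up\<close> at leading order gives 1 + 3 (L/6) \<le> 27 (L/6), that is
  \<open>L\<close> \<ge> 1/4. The upper bound covers all \<open>m\<close> \<le> \<open>n\<close>
  with an error measured by \<open>n\<close>, because it is meant for vertex subsets of arbitrary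
  size.\<close>

lemma ex_C5m_density:
  obtains L :: real where "L \<ge> 1/4"
    "\<And>\<delta>. \<delta> > 0 \<Longrightarrow> \<exists>n0. \<forall>n\<ge>n0. (L / 6 - \<delta>) * real n ^ 3 \<le> ex_C5m n \<and>
       (\<forall>m\<le>n. ex_C5m m \<le> L / 6 * real m ^ 3 + \<delta> * real n ^ 3)"
proof -
  define p where "p n = (real n + 3) * (real n + 2) * (real n + 1)" for n
  \<comment> \<open>The shift by 3 keeps the falling factorial in the denominator positive.\<close>
  define a where "a n = 6 * real (ex_C5m (n + 3)) / p n" for n
  have p_pos: "p n > 0" for n by (simp add: p_def)
  note ppos = p_def
  have "decseq a"
  proof (rule decseq_SucI)
    fix n
    have "(n + 1) * ex_C5m (n + 4) \<le> (n + 4) * ex_C5m (n + 3)"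
    proof -
      have "n + 4 - 3 = n + 1" "n + 4 - 1 = n + 3" by simp_all
      with ex_C5m_averaging[of "n + 4"] show ?thesis by (metis One_nat_def add_gr_0 less_eq_Suc_le zero_less_numeral)
    qed
    then have "real ((n + 1) * ex_C5m (n + 4)) \<le> real ((n + 4) * ex_C5m (n + 3))" by (rule of_nat_mono)
    then have *: "(real n + 1) * real (ex_C5m (n + 4)) \<le> (real n + 4) * real (ex_C5m (n + 3))" by (simp add: algebra_simps)
    have "real (ex_C5m (n + 4)) * p n = (real n + 2) * (real n + 3) * ((real n + 1) * real (ex_C5m (n + 4)))"
      by (simp add: ppos algebra_simps)
    also have "\<dots> \<le> (real n + 2) * (real n + 3) * ((real n + 4) * real (ex_C5m (n + 3)))"
      by (intro mult_left_mono *) auto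
    also have "\<dots> = real (ex_C5m (n + 3)) * p (Suc n)" by (simp add: ppos algebra_simps)
    finally show "a (Suc n) \<le> a n"
      unfolding a_def using p_pos[of n] p_pos[of "Suc n"] by (simp add: field_simps)
  qed
  moreover have "0 \<le> a n" for n using p_pos[of n] by (simp add: a_def)
  ultimately obtain L where L: "a \<longlonglongrightarrow> L" "\<forall>i. L \<le> a i"
    using decseq_convergent[of a 0] by metis
  have L0: "L \<ge> 0" by (rule LIMSEQ_le_const[OF L(1)]) (use \<open>\<And>n. 0 \<le> a n\<close> in auto)
  have main: "\<exists>n0. \<forall>n\<ge>n0. (L / 6 - \<delta>) * real n ^ 3 \<le> ex_C5m n \<and>
       (\<forall>m\<le>n. ex_C5m m \<le> L / 6 * real m ^ 3 + \<delta> * real n ^ 3)" if "\<delta> > 0" for \<delta>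
  proof -
    have "eventually (\<lambda>n. a n < L + 6 * \<delta>) sequentially"
      using L(1) that by (intro order_tendstoD) auto
    then obtain N where N: "a n < L + 6 * \<delta>" if "n \<ge> N" for n by (auto simp: eventually_sequentially)
    \<comment> \<open>For the finitely many small \<open>m\<close>, whose density may still be far
      above \<open>L\<close>, the error term alone has to pay; \<open>n0\<close> is chosen
      accordingly.\<close>
    define K where "K = Max (ex_C5m ` {..N+3})"
    have K: "ex_C5m m \<le> K" if "m \<le> N + 3" for m unfolding K_def using that by (intro Max_ge) auto
    define n0 where "n0 = nat \<lceil>real K / \<delta>\<rceil> + nat \<lceil>L / \<delta>\<rceil> + 3"
    show ?thesis
    proof (intro exI[of _ n0] allI impI conjI)
      fix n assume n: "n \<ge> n0"
      have n3: "n \<ge> 3" "real n \<ge> real K / \<delta>" "real n \<ge> L / \<delta>" using n unfolding n0_def by linarith+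
      have n1: "real n \<ge> 1" "real n \<le> real n ^ 3" using n3(1) self_le_power[of "real n" 3] by auto
      have "L \<le> a (n - 3)" using L(2) by blast
      then have "L * p (n - 3) \<le> 6 * real (ex_C5m n)"
        using p_pos[of "n - 3"] n3(1) by (simp add: a_def field_simps)
      moreover have "p (n - 3) = real n ^ 3 - 3 * real n ^ 2 + 2 * real n"
        using n3(1) by (simp add: p_def of_nat_diff power3_eq_cube power2_eq_square algebra_simps)
      moreover have "L * real n ^ 2 \<le> \<delta> * real n ^ 3"
      proof -
        have "L \<le> \<delta> * real n" using n3(3) that by (simp add: field_simps)
        then have "L * real n ^ 2 \<le> (\<delta> * real n) * real n ^ 2" by (rule mult_right_mono) simp
        then show ?thesis by (simp add: power3_eq_cube power2_eq_square mult.assoc)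
      qed
      moreover have "L * real n \<ge> 0" using L0 by simp
      ultimately have "L * real n ^ 3 - 3 * (\<delta> * real n ^ 3) \<le> 6 * real (ex_C5m n)"
        by (simp add: algebra_simps)
      moreover have "\<delta> * real n ^ 3 \<ge> 0" using that by simp
      ultimately show "(L / 6 - \<delta>) * real n ^ 3 \<le> ex_C5m n" by (simp add: algebra_simps)
    next
      fix n m assume n: "n \<ge> n0" and m: "m \<le> n"
      have n3: "n \<ge> 3" "real n \<ge> real K / \<delta>" using n unfolding n0_def by linarith+
      have n1: "real n \<ge> 1" "real n \<le> real n ^ 3" using n3(1) self_le_power[of "real n" 3] by auto
      show "ex_C5m m \<le> L / 6 * real m ^ 3 + \<delta> * real n ^ 3"
      proof (cases "m \<le> N + 3")
        case True
        have "real K \<le> \<delta> * real n" using n3(2) that by (simp add: field_simps)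
        also have "\<dots> \<le> \<delta> * real n ^ 3" using n1 that by (intro mult_left_mono) auto
        finally show ?thesis using K[OF True] L0 by (smt (verit) mult_nonneg_nonneg of_nat_0_le_iff of_nat_mono
            zero_le_power divide_nonneg_pos)
      next
        case False
        have "a (m - 3) < L + 6 * \<delta>" using False by (intro N) auto
        then have "6 * real (ex_C5m m) \<le> (L + 6 * \<delta>) * p (m - 3)"
          using p_pos[of "m - 3"] False by (simp add: a_def field_simps)
        also have "p (m - 3) \<le> real m ^ 3"
          using False by (simp add: p_def of_nat_diff power3_eq_cube power2_eq_square algebra_simps)
        then have "(L + 6 * \<delta>) * p (m - 3) \<le> (L + 6 * \<delta>) * real m ^ 3"
          using L0 that by (intro mult_left_mono) auto
        finally have "6 * real (ex_C5m m) \<le> L * real m ^ 3 + 6 * (\<delta> * real m ^ 3)" by (simp add: algebra_simps)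
        moreover have "\<delta> * real m ^ 3 \<le> \<delta> * real n ^ 3" using m that by (intro mult_left_mono power_mono) auto
        ultimately show ?thesis by simp
      qed
    qed
  qed
  have "L \<ge> 1/4"
  proof (rule field_le_epsilon)
    fix e :: real assume e: "e > 0"
    obtain n0 where n0: "\<And>n. n \<ge> n0 \<Longrightarrow> (L / 6 - e / 10) * real n ^ 3 \<le> ex_C5m n \<and>
       (\<forall>m\<le>n. ex_C5m m \<le> L / 6 * real m ^ 3 + e / 10 * real n ^ 3)"
      using main[of "e / 10"] e by auto
    define m where "m = n0 + 1"
    have 1: "(L / 6 - e / 10) * real m ^ 3 \<le> ex_C5m m" using n0[of m] by (simp add: m_def)
    have 2: "ex_C5m (3 * m) \<le> L / 6 * real (3 * m) ^ 3 + e / 10 * real (3 * m) ^ 3"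
    proof -
      have "n0 \<le> 3 * m" by (simp add: m_def)
      from n0[OF this] show ?thesis by blast
    qed
    have 3: "real m ^ 3 + 3 * real (ex_C5m m) \<le> ex_C5m (3 * m)"
      using ex_C5m_blow_up[of m] by (metis (mono_tags, lifting) of_nat_add of_nat_le_iff of_nat_mult of_nat_numeral of_nat_power)
    have "real m ^ 3 * (1 + 3 * (L / 6 - e / 10)) \<le> real m ^ 3 * (27 * (L / 6 + e / 10))"
      using 1 2 3 by (simp add: algebra_simps power_mult_distrib)
    then have "1 + 3 * (L / 6 - e / 10) \<le> 27 * (L / 6 + e / 10)" by (simp add: m_def)
    then show "1/4 \<le> L + e" using e by (simp add: field_simps)
  qed
  then show thesis using that main by blast
qed

section \<open>Flag algebra certificate\<close>

datatype vtx6 = V0 | V1 | V2 | V3 | V4 | V5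

text \<open>The bits list the 20 triples in colexicographic order, so the first 1, 4 and 10 bits
  describe the subgraphs on the first three, four and five vertices, and adding a vertex only
  appends bits.\<close>

datatype (plugins only: code) gr6 = Gr bool bool bool bool bool bool bool bool bool bool
  bool bool bool bool bool bool bool bool bool bool

definition adj6 :: "gr6 \<Rightarrow> vtx6 \<Rightarrow> vtx6 \<Rightarrow> vtx6 \<Rightarrow> bool" where
"adj6 g i j k = (case g of Gr b0 b1 b2 b3 b4 b5 b6 b7 b8 b9 b10 b11 b12 b13 b14 b15 b16 b17 b18
  b19 \<Rightarrow> (case i of V0 \<Rightarrow> (case j of V0 \<Rightarrow> False | V1
  \<Rightarrow> (case k of V0 \<Rightarrow> False | V1 \<Rightarrow> False | V2 \<Rightarrow>
  b0 | V3 \<Rightarrow> b1 | V4 \<Rightarrow> b4 | V5 \<Rightarrow> b10) | V2 \<Rightarrow>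
  (case k of V0 \<Rightarrow> False | V1 \<Rightarrow> b0 | V2 \<Rightarrow> False | V3
  \<Rightarrow> b2 | V4 \<Rightarrow> b5 | V5 \<Rightarrow> b11) | V3 \<Rightarrow> (case k of
  V0 \<Rightarrow> False | V1 \<Rightarrow> b1 | V2 \<Rightarrow> b2 | V3 \<Rightarrow> False |
  V4 \<Rightarrow> b7 | V5 \<Rightarrow> b13) | V4 \<Rightarrow> (case k of V0 \<Rightarrow>
  False | V1 \<Rightarrow> b4 | V2 \<Rightarrow> b5 | V3 \<Rightarrow> b7 | V4 \<Rightarrow>
  False | V5 \<Rightarrow> b16) | V5 \<Rightarrow> (case k of V0 \<Rightarrow> False | V1
  \<Rightarrow> b10 | V2 \<Rightarrow> b11 | V3 \<Rightarrow> b13 | V4 \<Rightarrow> b16 | V5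
  \<Rightarrow> False)) | V1 \<Rightarrow> (case j of V0 \<Rightarrow> (case k of V0
  \<Rightarrow> False | V1 \<Rightarrow> False | V2 \<Rightarrow> b0 | V3 \<Rightarrow> b1 | V4
  \<Rightarrow> b4 | V5 \<Rightarrow> b10) | V1 \<Rightarrow> False | V2 \<Rightarrow> (case k
  of V0 \<Rightarrow> b0 | V1 \<Rightarrow> False | V2 \<Rightarrow> False | V3 \<Rightarrow>
  b3 | V4 \<Rightarrow> b6 | V5 \<Rightarrow> b12) | V3 \<Rightarrow> (case k of V0
  \<Rightarrow> b1 | V1 \<Rightarrow> False | V2 \<Rightarrow> b3 | V3 \<Rightarrow> False | V4
  \<Rightarrow> b8 | V5 \<Rightarrow> b14) | V4 \<Rightarrow> (case k of V0 \<Rightarrow> b4 |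
  V1 \<Rightarrow> False | V2 \<Rightarrow> b6 | V3 \<Rightarrow> b8 | V4 \<Rightarrow> False |
  V5 \<Rightarrow> b17) | V5 \<Rightarrow> (case k of V0 \<Rightarrow> b10 | V1 \<Rightarrow>
  False | V2 \<Rightarrow> b12 | V3 \<Rightarrow> b14 | V4 \<Rightarrow> b17 | V5 \<Rightarrow>
  False)) | V2 \<Rightarrow> (case j of V0 \<Rightarrow> (case k of V0 \<Rightarrow> False | V1
  \<Rightarrow> b0 | V2 \<Rightarrow> False | V3 \<Rightarrow> b2 | V4 \<Rightarrow> b5 | V5
  \<Rightarrow> b11) | V1 \<Rightarrow> (case k of V0 \<Rightarrow> b0 | V1 \<Rightarrow> False
  | V2 \<Rightarrow> False | V3 \<Rightarrow> b3 | V4 \<Rightarrow> b6 | V5 \<Rightarrow> b12)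
  | V2 \<Rightarrow> False | V3 \<Rightarrow> (case k of V0 \<Rightarrow> b2 | V1 \<Rightarrow>
  b3 | V2 \<Rightarrow> False | V3 \<Rightarrow> False | V4 \<Rightarrow> b9 | V5 \<Rightarrow>
  b15) | V4 \<Rightarrow> (case k of V0 \<Rightarrow> b5 | V1 \<Rightarrow> b6 | V2
  \<Rightarrow> False | V3 \<Rightarrow> b9 | V4 \<Rightarrow> False | V5 \<Rightarrow> b18) |
  V5 \<Rightarrow> (case k of V0 \<Rightarrow> b11 | V1 \<Rightarrow> b12 | V2 \<Rightarrow>
  False | V3 \<Rightarrow> b15 | V4 \<Rightarrow> b18 | V5 \<Rightarrow> False)) | V3
  \<Rightarrow> (case j of V0 \<Rightarrow> (case k of V0 \<Rightarrow> False | V1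
  \<Rightarrow> b1 | V2 \<Rightarrow> b2 | V3 \<Rightarrow> False | V4 \<Rightarrow> b7 | V5
  \<Rightarrow> b13) | V1 \<Rightarrow> (case k of V0 \<Rightarrow> b1 | V1 \<Rightarrow> False
  | V2 \<Rightarrow> b3 | V3 \<Rightarrow> False | V4 \<Rightarrow> b8 | V5 \<Rightarrow> b14)
  | V2 \<Rightarrow> (case k of V0 \<Rightarrow> b2 | V1 \<Rightarrow> b3 | V2 \<Rightarrow>
  False | V3 \<Rightarrow> False | V4 \<Rightarrow> b9 | V5 \<Rightarrow> b15) | V3
  \<Rightarrow> False | V4 \<Rightarrow> (case k of V0 \<Rightarrow> b7 | V1 \<Rightarrow> b8 |
  V2 \<Rightarrow> b9 | V3 \<Rightarrow> False | V4 \<Rightarrow> False | V5 \<Rightarrow> b19)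
  | V5 \<Rightarrow> (case k of V0 \<Rightarrow> b13 | V1 \<Rightarrow> b14 | V2 \<Rightarrow>
  b15 | V3 \<Rightarrow> False | V4 \<Rightarrow> b19 | V5 \<Rightarrow> False)) | V4
  \<Rightarrow> (case j of V0 \<Rightarrow> (case k of V0 \<Rightarrow> False | V1
  \<Rightarrow> b4 | V2 \<Rightarrow> b5 | V3 \<Rightarrow> b7 | V4 \<Rightarrow> False | V5
  \<Rightarrow> b16) | V1 \<Rightarrow> (case k of V0 \<Rightarrow> b4 | V1 \<Rightarrow> False
  | V2 \<Rightarrow> b6 | V3 \<Rightarrow> b8 | V4 \<Rightarrow> False | V5 \<Rightarrow> b17)
  | V2 \<Rightarrow> (case k of V0 \<Rightarrow> b5 | V1 \<Rightarrow> b6 | V2 \<Rightarrow>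
  False | V3 \<Rightarrow> b9 | V4 \<Rightarrow> False | V5 \<Rightarrow> b18) | V3
  \<Rightarrow> (case k of V0 \<Rightarrow> b7 | V1 \<Rightarrow> b8 | V2 \<Rightarrow> b9 | V3
  \<Rightarrow> False | V4 \<Rightarrow> False | V5 \<Rightarrow> b19) | V4 \<Rightarrow> False
  | V5 \<Rightarrow> (case k of V0 \<Rightarrow> b16 | V1 \<Rightarrow> b17 | V2 \<Rightarrow>
  b18 | V3 \<Rightarrow> b19 | V4 \<Rightarrow> False | V5 \<Rightarrow> False)) | V5
  \<Rightarrow> (case j of V0 \<Rightarrow> (case k of V0 \<Rightarrow> False | V1
  \<Rightarrow> b10 | V2 \<Rightarrow> b11 | V3 \<Rightarrow> b13 | V4 \<Rightarrow> b16 | V5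
  \<Rightarrow> False) | V1 \<Rightarrow> (case k of V0 \<Rightarrow> b10 | V1 \<Rightarrow>
  False | V2 \<Rightarrow> b12 | V3 \<Rightarrow> b14 | V4 \<Rightarrow> b17 | V5 \<Rightarrow>
  False) | V2 \<Rightarrow> (case k of V0 \<Rightarrow> b11 | V1 \<Rightarrow> b12 | V2
  \<Rightarrow> False | V3 \<Rightarrow> b15 | V4 \<Rightarrow> b18 | V5 \<Rightarrow> False) |
  V3 \<Rightarrow> (case k of V0 \<Rightarrow> b13 | V1 \<Rightarrow> b14 | V2 \<Rightarrow>
  b15 | V3 \<Rightarrow> False | V4 \<Rightarrow> b19 | V5 \<Rightarrow> False) | V4
  \<Rightarrow> (case k of V0 \<Rightarrow> b16 | V1 \<Rightarrow> b17 | V2 \<Rightarrow> b18 |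
  V3 \<Rightarrow> b19 | V4 \<Rightarrow> False | V5 \<Rightarrow> False) | V5 \<Rightarrow>
  False)))"

text \<open>One rewrite rule per triple of vertices lets \<open>code_simp\<close> read off a bit in
  a single step instead of descending through three nested case distinctions.\<close>

lemma adj6_code [code]:
  "adj6 (Gr b0 b1 b2 b3 b4 b5 b6 b7 b8 b9 b10 b11 b12 b13 b14 b15 b16 b17 b18 b19) V0 V0 V0 = False"
  "adj6 (Gr b0 b1 b2 b3 b4 b5 b6 b7 b8 b9 b10 b11 b12 b13 b14 b15 b16 b17 b18 b19) V0 V0 V1 = False"
  "adj6 (Gr b0 b1 b2 b3 b4 b5 b6 b7 b8 b9 b10 b11 b12 b13 b14 b15 b16 b17 b18 b19) V0 V0 V2 = False"
  "adj6 (Gr b0 b1 b2 b3 b4 b5 b6 b7 b8 b9 b10 b11 b12 b13 b14 b15 b16 b17 b18 b19) V0 V0 V3 = False"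
  "adj6 (Gr b0 b1 b2 b3 b4 b5 b6 b7 b8 b9 b10 b11 b12 b13 b14 b15 b16 b17 b18 b19) V0 V0 V4 = False"
  "adj6 (Gr b0 b1 b2 b3 b4 b5 b6 b7 b8 b9 b10 b11 b12 b13 b14 b15 b16 b17 b18 b19) V0 V0 V5 = False"
  "adj6 (Gr b0 b1 b2 b3 b4 b5 b6 b7 b8 b9 b10 b11 b12 b13 b14 b15 b16 b17 b18 b19) V0 V1 V0 = False"
  "adj6 (Gr b0 b1 b2 b3 b4 b5 b6 b7 b8 b9 b10 b11 b12 b13 b14 b15 b16 b17 b18 b19) V0 V1 V1 = False"
  "adj6 (Gr b0 b1 b2 b3 b4 b5 b6 b7 b8 b9 b10 b11 b12 b13 b14 b15 b16 b17 b18 b19) V0 V1 V2 = b0"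
  "adj6 (Gr b0 b1 b2 b3 b4 b5 b6 b7 b8 b9 b10 b11 b12 b13 b14 b15 b16 b17 b18 b19) V0 V1 V3 = b1"
  "adj6 (Gr b0 b1 b2 b3 b4 b5 b6 b7 b8 b9 b10 b11 b12 b13 b14 b15 b16 b17 b18 b19) V0 V1 V4 = b4"
  "adj6 (Gr b0 b1 b2 b3 b4 b5 b6 b7 b8 b9 b10 b11 b12 b13 b14 b15 b16 b17 b18 b19) V0 V1 V5 = b10"
  "adj6 (Gr b0 b1 b2 b3 b4 b5 b6 b7 b8 b9 b10 b11 b12 b13 b14 b15 b16 b17 b18 b19) V0 V2 V0 = False"
  "adj6 (Gr b0 b1 b2 b3 b4 b5 b6 b7 b8 b9 b10 b11 b12 b13 b14 b15 b16 b17 b18 b19) V0 V2 V1 = b0"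
  "adj6 (Gr b0 b1 b2 b3 b4 b5 b6 b7 b8 b9 b10 b11 b12 b13 b14 b15 b16 b17 b18 b19) V0 V2 V2 = False"
  "adj6 (Gr b0 b1 b2 b3 b4 b5 b6 b7 b8 b9 b10 b11 b12 b13 b14 b15 b16 b17 b18 b19) V0 V2 V3 = b2"
  "adj6 (Gr b0 b1 b2 b3 b4 b5 b6 b7 b8 b9 b10 b11 b12 b13 b14 b15 b16 b17 b18 b19) V0 V2 V4 = b5"
  "adj6 (Gr b0 b1 b2 b3 b4 b5 b6 b7 b8 b9 b10 b11 b12 b13 b14 b15 b16 b17 b18 b19) V0 V2 V5 = b11"
  "adj6 (Gr b0 b1 b2 b3 b4 b5 b6 b7 b8 b9 b10 b11 b12 b13 b14 b15 b16 b17 b18 b19) V0 V3 V0 = False"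
  "adj6 (Gr b0 b1 b2 b3 b4 b5 b6 b7 b8 b9 b10 b11 b12 b13 b14 b15 b16 b17 b18 b19) V0 V3 V1 = b1"
  "adj6 (Gr b0 b1 b2 b3 b4 b5 b6 b7 b8 b9 b10 b11 b12 b13 b14 b15 b16 b17 b18 b19) V0 V3 V2 = b2"
  "adj6 (Gr b0 b1 b2 b3 b4 b5 b6 b7 b8 b9 b10 b11 b12 b13 b14 b15 b16 b17 b18 b19) V0 V3 V3 = False"
  "adj6 (Gr b0 b1 b2 b3 b4 b5 b6 b7 b8 b9 b10 b11 b12 b13 b14 b15 b16 b17 b18 b19) V0 V3 V4 = b7"
  "adj6 (Gr b0 b1 b2 b3 b4 b5 b6 b7 b8 b9 b10 b11 b12 b13 b14 b15 b16 b17 b18 b19) V0 V3 V5 = b13"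
  "adj6 (Gr b0 b1 b2 b3 b4 b5 b6 b7 b8 b9 b10 b11 b12 b13 b14 b15 b16 b17 b18 b19) V0 V4 V0 = False"
  "adj6 (Gr b0 b1 b2 b3 b4 b5 b6 b7 b8 b9 b10 b11 b12 b13 b14 b15 b16 b17 b18 b19) V0 V4 V1 = b4"
  "adj6 (Gr b0 b1 b2 b3 b4 b5 b6 b7 b8 b9 b10 b11 b12 b13 b14 b15 b16 b17 b18 b19) V0 V4 V2 = b5"
  "adj6 (Gr b0 b1 b2 b3 b4 b5 b6 b7 b8 b9 b10 b11 b12 b13 b14 b15 b16 b17 b18 b19) V0 V4 V3 = b7"
  "adj6 (Gr b0 b1 b2 b3 b4 b5 b6 b7 b8 b9 b10 b11 b12 b13 b14 b15 b16 b17 b18 b19) V0 V4 V4 = False"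
  "adj6 (Gr b0 b1 b2 b3 b4 b5 b6 b7 b8 b9 b10 b11 b12 b13 b14 b15 b16 b17 b18 b19) V0 V4 V5 = b16"
  "adj6 (Gr b0 b1 b2 b3 b4 b5 b6 b7 b8 b9 b10 b11 b12 b13 b14 b15 b16 b17 b18 b19) V0 V5 V0 = False"
  "adj6 (Gr b0 b1 b2 b3 b4 b5 b6 b7 b8 b9 b10 b11 b12 b13 b14 b15 b16 b17 b18 b19) V0 V5 V1 = b10"
  "adj6 (Gr b0 b1 b2 b3 b4 b5 b6 b7 b8 b9 b10 b11 b12 b13 b14 b15 b16 b17 b18 b19) V0 V5 V2 = b11"
  "adj6 (Gr b0 b1 b2 b3 b4 b5 b6 b7 b8 b9 b10 b11 b12 b13 b14 b15 b16 b17 b18 b19) V0 V5 V3 = b13"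
  "adj6 (Gr b0 b1 b2 b3 b4 b5 b6 b7 b8 b9 b10 b11 b12 b13 b14 b15 b16 b17 b18 b19) V0 V5 V4 = b16"
  "adj6 (Gr b0 b1 b2 b3 b4 b5 b6 b7 b8 b9 b10 b11 b12 b13 b14 b15 b16 b17 b18 b19) V0 V5 V5 = False"
  "adj6 (Gr b0 b1 b2 b3 b4 b5 b6 b7 b8 b9 b10 b11 b12 b13 b14 b15 b16 b17 b18 b19) V1 V0 V0 = False"
  "adj6 (Gr b0 b1 b2 b3 b4 b5 b6 b7 b8 b9 b10 b11 b12 b13 b14 b15 b16 b17 b18 b19) V1 V0 V1 = False"
  "adj6 (Gr b0 b1 b2 b3 b4 b5 b6 b7 b8 b9 b10 b11 b12 b13 b14 b15 b16 b17 b18 b19) V1 V0 V2 = b0"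
  "adj6 (Gr b0 b1 b2 b3 b4 b5 b6 b7 b8 b9 b10 b11 b12 b13 b14 b15 b16 b17 b18 b19) V1 V0 V3 = b1"
  "adj6 (Gr b0 b1 b2 b3 b4 b5 b6 b7 b8 b9 b10 b11 b12 b13 b14 b15 b16 b17 b18 b19) V1 V0 V4 = b4"
  "adj6 (Gr b0 b1 b2 b3 b4 b5 b6 b7 b8 b9 b10 b11 b12 b13 b14 b15 b16 b17 b18 b19) V1 V0 V5 = b10"
  "adj6 (Gr b0 b1 b2 b3 b4 b5 b6 b7 b8 b9 b10 b11 b12 b13 b14 b15 b16 b17 b18 b19) V1 V1 V0 = False"
  "adj6 (Gr b0 b1 b2 b3 b4 b5 b6 b7 b8 b9 b10 b11 b12 b13 b14 b15 b16 b17 b18 b19) V1 V1 V1 = False"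
  "adj6 (Gr b0 b1 b2 b3 b4 b5 b6 b7 b8 b9 b10 b11 b12 b13 b14 b15 b16 b17 b18 b19) V1 V1 V2 = False"
  "adj6 (Gr b0 b1 b2 b3 b4 b5 b6 b7 b8 b9 b10 b11 b12 b13 b14 b15 b16 b17 b18 b19) V1 V1 V3 = False"
  "adj6 (Gr b0 b1 b2 b3 b4 b5 b6 b7 b8 b9 b10 b11 b12 b13 b14 b15 b16 b17 b18 b19) V1 V1 V4 = False"
  "adj6 (Gr b0 b1 b2 b3 b4 b5 b6 b7 b8 b9 b10 b11 b12 b13 b14 b15 b16 b17 b18 b19) V1 V1 V5 = False"
  "adj6 (Gr b0 b1 b2 b3 b4 b5 b6 b7 b8 b9 b10 b11 b12 b13 b14 b15 b16 b17 b18 b19) V1 V2 V0 = b0"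
  "adj6 (Gr b0 b1 b2 b3 b4 b5 b6 b7 b8 b9 b10 b11 b12 b13 b14 b15 b16 b17 b18 b19) V1 V2 V1 = False"
  "adj6 (Gr b0 b1 b2 b3 b4 b5 b6 b7 b8 b9 b10 b11 b12 b13 b14 b15 b16 b17 b18 b19) V1 V2 V2 = False"
  "adj6 (Gr b0 b1 b2 b3 b4 b5 b6 b7 b8 b9 b10 b11 b12 b13 b14 b15 b16 b17 b18 b19) V1 V2 V3 = b3"
  "adj6 (Gr b0 b1 b2 b3 b4 b5 b6 b7 b8 b9 b10 b11 b12 b13 b14 b15 b16 b17 b18 b19) V1 V2 V4 = b6"
  "adj6 (Gr b0 b1 b2 b3 b4 b5 b6 b7 b8 b9 b10 b11 b12 b13 b14 b15 b16 b17 b18 b19) V1 V2 V5 = b12"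
  "adj6 (Gr b0 b1 b2 b3 b4 b5 b6 b7 b8 b9 b10 b11 b12 b13 b14 b15 b16 b17 b18 b19) V1 V3 V0 = b1"
  "adj6 (Gr b0 b1 b2 b3 b4 b5 b6 b7 b8 b9 b10 b11 b12 b13 b14 b15 b16 b17 b18 b19) V1 V3 V1 = False"
  "adj6 (Gr b0 b1 b2 b3 b4 b5 b6 b7 b8 b9 b10 b11 b12 b13 b14 b15 b16 b17 b18 b19) V1 V3 V2 = b3"
  "adj6 (Gr b0 b1 b2 b3 b4 b5 b6 b7 b8 b9 b10 b11 b12 b13 b14 b15 b16 b17 b18 b19) V1 V3 V3 = False"
  "adj6 (Gr b0 b1 b2 b3 b4 b5 b6 b7 b8 b9 b10 b11 b12 b13 b14 b15 b16 b17 b18 b19) V1 V3 V4 = b8"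
  "adj6 (Gr b0 b1 b2 b3 b4 b5 b6 b7 b8 b9 b10 b11 b12 b13 b14 b15 b16 b17 b18 b19) V1 V3 V5 = b14"
  "adj6 (Gr b0 b1 b2 b3 b4 b5 b6 b7 b8 b9 b10 b11 b12 b13 b14 b15 b16 b17 b18 b19) V1 V4 V0 = b4"
  "adj6 (Gr b0 b1 b2 b3 b4 b5 b6 b7 b8 b9 b10 b11 b12 b13 b14 b15 b16 b17 b18 b19) V1 V4 V1 = False"
  "adj6 (Gr b0 b1 b2 b3 b4 b5 b6 b7 b8 b9 b10 b11 b12 b13 b14 b15 b16 b17 b18 b19) V1 V4 V2 = b6"
  "adj6 (Gr b0 b1 b2 b3 b4 b5 b6 b7 b8 b9 b10 b11 b12 b13 b14 b15 b16 b17 b18 b19) V1 V4 V3 = b8"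
  "adj6 (Gr b0 b1 b2 b3 b4 b5 b6 b7 b8 b9 b10 b11 b12 b13 b14 b15 b16 b17 b18 b19) V1 V4 V4 = False"
  "adj6 (Gr b0 b1 b2 b3 b4 b5 b6 b7 b8 b9 b10 b11 b12 b13 b14 b15 b16 b17 b18 b19) V1 V4 V5 = b17"
  "adj6 (Gr b0 b1 b2 b3 b4 b5 b6 b7 b8 b9 b10 b11 b12 b13 b14 b15 b16 b17 b18 b19) V1 V5 V0 = b10"
  "adj6 (Gr b0 b1 b2 b3 b4 b5 b6 b7 b8 b9 b10 b11 b12 b13 b14 b15 b16 b17 b18 b19) V1 V5 V1 = False"
  "adj6 (Gr b0 b1 b2 b3 b4 b5 b6 b7 b8 b9 b10 b11 b12 b13 b14 b15 b16 b17 b18 b19) V1 V5 V2 = b12"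
  "adj6 (Gr b0 b1 b2 b3 b4 b5 b6 b7 b8 b9 b10 b11 b12 b13 b14 b15 b16 b17 b18 b19) V1 V5 V3 = b14"
  "adj6 (Gr b0 b1 b2 b3 b4 b5 b6 b7 b8 b9 b10 b11 b12 b13 b14 b15 b16 b17 b18 b19) V1 V5 V4 = b17"
  "adj6 (Gr b0 b1 b2 b3 b4 b5 b6 b7 b8 b9 b10 b11 b12 b13 b14 b15 b16 b17 b18 b19) V1 V5 V5 = False"
  "adj6 (Gr b0 b1 b2 b3 b4 b5 b6 b7 b8 b9 b10 b11 b12 b13 b14 b15 b16 b17 b18 b19) V2 V0 V0 = False"
  "adj6 (Gr b0 b1 b2 b3 b4 b5 b6 b7 b8 b9 b10 b11 b12 b13 b14 b15 b16 b17 b18 b19) V2 V0 V1 = b0"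
  "adj6 (Gr b0 b1 b2 b3 b4 b5 b6 b7 b8 b9 b10 b11 b12 b13 b14 b15 b16 b17 b18 b19) V2 V0 V2 = False"
  "adj6 (Gr b0 b1 b2 b3 b4 b5 b6 b7 b8 b9 b10 b11 b12 b13 b14 b15 b16 b17 b18 b19) V2 V0 V3 = b2"
  "adj6 (Gr b0 b1 b2 b3 b4 b5 b6 b7 b8 b9 b10 b11 b12 b13 b14 b15 b16 b17 b18 b19) V2 V0 V4 = b5"
  "adj6 (Gr b0 b1 b2 b3 b4 b5 b6 b7 b8 b9 b10 b11 b12 b13 b14 b15 b16 b17 b18 b19) V2 V0 V5 = b11"
  "adj6 (Gr b0 b1 b2 b3 b4 b5 b6 b7 b8 b9 b10 b11 b12 b13 b14 b15 b16 b17 b18 b19) V2 V1 V0 = b0"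
  "adj6 (Gr b0 b1 b2 b3 b4 b5 b6 b7 b8 b9 b10 b11 b12 b13 b14 b15 b16 b17 b18 b19) V2 V1 V1 = False"
  "adj6 (Gr b0 b1 b2 b3 b4 b5 b6 b7 b8 b9 b10 b11 b12 b13 b14 b15 b16 b17 b18 b19) V2 V1 V2 = False"
  "adj6 (Gr b0 b1 b2 b3 b4 b5 b6 b7 b8 b9 b10 b11 b12 b13 b14 b15 b16 b17 b18 b19) V2 V1 V3 = b3"
  "adj6 (Gr b0 b1 b2 b3 b4 b5 b6 b7 b8 b9 b10 b11 b12 b13 b14 b15 b16 b17 b18 b19) V2 V1 V4 = b6"
  "adj6 (Gr b0 b1 b2 b3 b4 b5 b6 b7 b8 b9 b10 b11 b12 b13 b14 b15 b16 b17 b18 b19) V2 V1 V5 = b12"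
  "adj6 (Gr b0 b1 b2 b3 b4 b5 b6 b7 b8 b9 b10 b11 b12 b13 b14 b15 b16 b17 b18 b19) V2 V2 V0 = False"
  "adj6 (Gr b0 b1 b2 b3 b4 b5 b6 b7 b8 b9 b10 b11 b12 b13 b14 b15 b16 b17 b18 b19) V2 V2 V1 = False"
  "adj6 (Gr b0 b1 b2 b3 b4 b5 b6 b7 b8 b9 b10 b11 b12 b13 b14 b15 b16 b17 b18 b19) V2 V2 V2 = False"
  "adj6 (Gr b0 b1 b2 b3 b4 b5 b6 b7 b8 b9 b10 b11 b12 b13 b14 b15 b16 b17 b18 b19) V2 V2 V3 = False"
  "adj6 (Gr b0 b1 b2 b3 b4 b5 b6 b7 b8 b9 b10 b11 b12 b13 b14 b15 b16 b17 b18 b19) V2 V2 V4 = False"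
  "adj6 (Gr b0 b1 b2 b3 b4 b5 b6 b7 b8 b9 b10 b11 b12 b13 b14 b15 b16 b17 b18 b19) V2 V2 V5 = False"
  "adj6 (Gr b0 b1 b2 b3 b4 b5 b6 b7 b8 b9 b10 b11 b12 b13 b14 b15 b16 b17 b18 b19) V2 V3 V0 = b2"
  "adj6 (Gr b0 b1 b2 b3 b4 b5 b6 b7 b8 b9 b10 b11 b12 b13 b14 b15 b16 b17 b18 b19) V2 V3 V1 = b3"
  "adj6 (Gr b0 b1 b2 b3 b4 b5 b6 b7 b8 b9 b10 b11 b12 b13 b14 b15 b16 b17 b18 b19) V2 V3 V2 = False"
  "adj6 (Gr b0 b1 b2 b3 b4 b5 b6 b7 b8 b9 b10 b11 b12 b13 b14 b15 b16 b17 b18 b19) V2 V3 V3 = False"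
  "adj6 (Gr b0 b1 b2 b3 b4 b5 b6 b7 b8 b9 b10 b11 b12 b13 b14 b15 b16 b17 b18 b19) V2 V3 V4 = b9"
  "adj6 (Gr b0 b1 b2 b3 b4 b5 b6 b7 b8 b9 b10 b11 b12 b13 b14 b15 b16 b17 b18 b19) V2 V3 V5 = b15"
  "adj6 (Gr b0 b1 b2 b3 b4 b5 b6 b7 b8 b9 b10 b11 b12 b13 b14 b15 b16 b17 b18 b19) V2 V4 V0 = b5"
  "adj6 (Gr b0 b1 b2 b3 b4 b5 b6 b7 b8 b9 b10 b11 b12 b13 b14 b15 b16 b17 b18 b19) V2 V4 V1 = b6"
  "adj6 (Gr b0 b1 b2 b3 b4 b5 b6 b7 b8 b9 b10 b11 b12 b13 b14 b15 b16 b17 b18 b19) V2 V4 V2 = False"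
  "adj6 (Gr b0 b1 b2 b3 b4 b5 b6 b7 b8 b9 b10 b11 b12 b13 b14 b15 b16 b17 b18 b19) V2 V4 V3 = b9"
  "adj6 (Gr b0 b1 b2 b3 b4 b5 b6 b7 b8 b9 b10 b11 b12 b13 b14 b15 b16 b17 b18 b19) V2 V4 V4 = False"
  "adj6 (Gr b0 b1 b2 b3 b4 b5 b6 b7 b8 b9 b10 b11 b12 b13 b14 b15 b16 b17 b18 b19) V2 V4 V5 = b18"
  "adj6 (Gr b0 b1 b2 b3 b4 b5 b6 b7 b8 b9 b10 b11 b12 b13 b14 b15 b16 b17 b18 b19) V2 V5 V0 = b11"
  "adj6 (Gr b0 b1 b2 b3 b4 b5 b6 b7 b8 b9 b10 b11 b12 b13 b14 b15 b16 b17 b18 b19) V2 V5 V1 = b12"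
  "adj6 (Gr b0 b1 b2 b3 b4 b5 b6 b7 b8 b9 b10 b11 b12 b13 b14 b15 b16 b17 b18 b19) V2 V5 V2 = False"
  "adj6 (Gr b0 b1 b2 b3 b4 b5 b6 b7 b8 b9 b10 b11 b12 b13 b14 b15 b16 b17 b18 b19) V2 V5 V3 = b15"
  "adj6 (Gr b0 b1 b2 b3 b4 b5 b6 b7 b8 b9 b10 b11 b12 b13 b14 b15 b16 b17 b18 b19) V2 V5 V4 = b18"
  "adj6 (Gr b0 b1 b2 b3 b4 b5 b6 b7 b8 b9 b10 b11 b12 b13 b14 b15 b16 b17 b18 b19) V2 V5 V5 = False"
  "adj6 (Gr b0 b1 b2 b3 b4 b5 b6 b7 b8 b9 b10 b11 b12 b13 b14 b15 b16 b17 b18 b19) V3 V0 V0 = False"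
  "adj6 (Gr b0 b1 b2 b3 b4 b5 b6 b7 b8 b9 b10 b11 b12 b13 b14 b15 b16 b17 b18 b19) V3 V0 V1 = b1"
  "adj6 (Gr b0 b1 b2 b3 b4 b5 b6 b7 b8 b9 b10 b11 b12 b13 b14 b15 b16 b17 b18 b19) V3 V0 V2 = b2"
  "adj6 (Gr b0 b1 b2 b3 b4 b5 b6 b7 b8 b9 b10 b11 b12 b13 b14 b15 b16 b17 b18 b19) V3 V0 V3 = False"
  "adj6 (Gr b0 b1 b2 b3 b4 b5 b6 b7 b8 b9 b10 b11 b12 b13 b14 b15 b16 b17 b18 b19) V3 V0 V4 = b7"
  "adj6 (Gr b0 b1 b2 b3 b4 b5 b6 b7 b8 b9 b10 b11 b12 b13 b14 b15 b16 b17 b18 b19) V3 V0 V5 = b13"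
  "adj6 (Gr b0 b1 b2 b3 b4 b5 b6 b7 b8 b9 b10 b11 b12 b13 b14 b15 b16 b17 b18 b19) V3 V1 V0 = b1"
  "adj6 (Gr b0 b1 b2 b3 b4 b5 b6 b7 b8 b9 b10 b11 b12 b13 b14 b15 b16 b17 b18 b19) V3 V1 V1 = False"
  "adj6 (Gr b0 b1 b2 b3 b4 b5 b6 b7 b8 b9 b10 b11 b12 b13 b14 b15 b16 b17 b18 b19) V3 V1 V2 = b3"
  "adj6 (Gr b0 b1 b2 b3 b4 b5 b6 b7 b8 b9 b10 b11 b12 b13 b14 b15 b16 b17 b18 b19) V3 V1 V3 = False"
  "adj6 (Gr b0 b1 b2 b3 b4 b5 b6 b7 b8 b9 b10 b11 b12 b13 b14 b15 b16 b17 b18 b19) V3 V1 V4 = b8"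
  "adj6 (Gr b0 b1 b2 b3 b4 b5 b6 b7 b8 b9 b10 b11 b12 b13 b14 b15 b16 b17 b18 b19) V3 V1 V5 = b14"
  "adj6 (Gr b0 b1 b2 b3 b4 b5 b6 b7 b8 b9 b10 b11 b12 b13 b14 b15 b16 b17 b18 b19) V3 V2 V0 = b2"
  "adj6 (Gr b0 b1 b2 b3 b4 b5 b6 b7 b8 b9 b10 b11 b12 b13 b14 b15 b16 b17 b18 b19) V3 V2 V1 = b3"
  "adj6 (Gr b0 b1 b2 b3 b4 b5 b6 b7 b8 b9 b10 b11 b12 b13 b14 b15 b16 b17 b18 b19) V3 V2 V2 = False"
  "adj6 (Gr b0 b1 b2 b3 b4 b5 b6 b7 b8 b9 b10 b11 b12 b13 b14 b15 b16 b17 b18 b19) V3 V2 V3 = False"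
  "adj6 (Gr b0 b1 b2 b3 b4 b5 b6 b7 b8 b9 b10 b11 b12 b13 b14 b15 b16 b17 b18 b19) V3 V2 V4 = b9"
  "adj6 (Gr b0 b1 b2 b3 b4 b5 b6 b7 b8 b9 b10 b11 b12 b13 b14 b15 b16 b17 b18 b19) V3 V2 V5 = b15"
  "adj6 (Gr b0 b1 b2 b3 b4 b5 b6 b7 b8 b9 b10 b11 b12 b13 b14 b15 b16 b17 b18 b19) V3 V3 V0 = False"
  "adj6 (Gr b0 b1 b2 b3 b4 b5 b6 b7 b8 b9 b10 b11 b12 b13 b14 b15 b16 b17 b18 b19) V3 V3 V1 = False"
  "adj6 (Gr b0 b1 b2 b3 b4 b5 b6 b7 b8 b9 b10 b11 b12 b13 b14 b15 b16 b17 b18 b19) V3 V3 V2 = False"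
  "adj6 (Gr b0 b1 b2 b3 b4 b5 b6 b7 b8 b9 b10 b11 b12 b13 b14 b15 b16 b17 b18 b19) V3 V3 V3 = False"
  "adj6 (Gr b0 b1 b2 b3 b4 b5 b6 b7 b8 b9 b10 b11 b12 b13 b14 b15 b16 b17 b18 b19) V3 V3 V4 = False"
  "adj6 (Gr b0 b1 b2 b3 b4 b5 b6 b7 b8 b9 b10 b11 b12 b13 b14 b15 b16 b17 b18 b19) V3 V3 V5 = False"
  "adj6 (Gr b0 b1 b2 b3 b4 b5 b6 b7 b8 b9 b10 b11 b12 b13 b14 b15 b16 b17 b18 b19) V3 V4 V0 = b7"
  "adj6 (Gr b0 b1 b2 b3 b4 b5 b6 b7 b8 b9 b10 b11 b12 b13 b14 b15 b16 b17 b18 b19) V3 V4 V1 = b8"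
  "adj6 (Gr b0 b1 b2 b3 b4 b5 b6 b7 b8 b9 b10 b11 b12 b13 b14 b15 b16 b17 b18 b19) V3 V4 V2 = b9"
  "adj6 (Gr b0 b1 b2 b3 b4 b5 b6 b7 b8 b9 b10 b11 b12 b13 b14 b15 b16 b17 b18 b19) V3 V4 V3 = False"
  "adj6 (Gr b0 b1 b2 b3 b4 b5 b6 b7 b8 b9 b10 b11 b12 b13 b14 b15 b16 b17 b18 b19) V3 V4 V4 = False"
  "adj6 (Gr b0 b1 b2 b3 b4 b5 b6 b7 b8 b9 b10 b11 b12 b13 b14 b15 b16 b17 b18 b19) V3 V4 V5 = b19"
  "adj6 (Gr b0 b1 b2 b3 b4 b5 b6 b7 b8 b9 b10 b11 b12 b13 b14 b15 b16 b17 b18 b19) V3 V5 V0 = b13"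
  "adj6 (Gr b0 b1 b2 b3 b4 b5 b6 b7 b8 b9 b10 b11 b12 b13 b14 b15 b16 b17 b18 b19) V3 V5 V1 = b14"
  "adj6 (Gr b0 b1 b2 b3 b4 b5 b6 b7 b8 b9 b10 b11 b12 b13 b14 b15 b16 b17 b18 b19) V3 V5 V2 = b15"
  "adj6 (Gr b0 b1 b2 b3 b4 b5 b6 b7 b8 b9 b10 b11 b12 b13 b14 b15 b16 b17 b18 b19) V3 V5 V3 = False"
  "adj6 (Gr b0 b1 b2 b3 b4 b5 b6 b7 b8 b9 b10 b11 b12 b13 b14 b15 b16 b17 b18 b19) V3 V5 V4 = b19"
  "adj6 (Gr b0 b1 b2 b3 b4 b5 b6 b7 b8 b9 b10 b11 b12 b13 b14 b15 b16 b17 b18 b19) V3 V5 V5 = False"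
  "adj6 (Gr b0 b1 b2 b3 b4 b5 b6 b7 b8 b9 b10 b11 b12 b13 b14 b15 b16 b17 b18 b19) V4 V0 V0 = False"
  "adj6 (Gr b0 b1 b2 b3 b4 b5 b6 b7 b8 b9 b10 b11 b12 b13 b14 b15 b16 b17 b18 b19) V4 V0 V1 = b4"
  "adj6 (Gr b0 b1 b2 b3 b4 b5 b6 b7 b8 b9 b10 b11 b12 b13 b14 b15 b16 b17 b18 b19) V4 V0 V2 = b5"
  "adj6 (Gr b0 b1 b2 b3 b4 b5 b6 b7 b8 b9 b10 b11 b12 b13 b14 b15 b16 b17 b18 b19) V4 V0 V3 = b7"
  "adj6 (Gr b0 b1 b2 b3 b4 b5 b6 b7 b8 b9 b10 b11 b12 b13 b14 b15 b16 b17 b18 b19) V4 V0 V4 = False"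
  "adj6 (Gr b0 b1 b2 b3 b4 b5 b6 b7 b8 b9 b10 b11 b12 b13 b14 b15 b16 b17 b18 b19) V4 V0 V5 = b16"
  "adj6 (Gr b0 b1 b2 b3 b4 b5 b6 b7 b8 b9 b10 b11 b12 b13 b14 b15 b16 b17 b18 b19) V4 V1 V0 = b4"
  "adj6 (Gr b0 b1 b2 b3 b4 b5 b6 b7 b8 b9 b10 b11 b12 b13 b14 b15 b16 b17 b18 b19) V4 V1 V1 = False"
  "adj6 (Gr b0 b1 b2 b3 b4 b5 b6 b7 b8 b9 b10 b11 b12 b13 b14 b15 b16 b17 b18 b19) V4 V1 V2 = b6"
  "adj6 (Gr b0 b1 b2 b3 b4 b5 b6 b7 b8 b9 b10 b11 b12 b13 b14 b15 b16 b17 b18 b19) V4 V1 V3 = b8"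
  "adj6 (Gr b0 b1 b2 b3 b4 b5 b6 b7 b8 b9 b10 b11 b12 b13 b14 b15 b16 b17 b18 b19) V4 V1 V4 = False"
  "adj6 (Gr b0 b1 b2 b3 b4 b5 b6 b7 b8 b9 b10 b11 b12 b13 b14 b15 b16 b17 b18 b19) V4 V1 V5 = b17"
  "adj6 (Gr b0 b1 b2 b3 b4 b5 b6 b7 b8 b9 b10 b11 b12 b13 b14 b15 b16 b17 b18 b19) V4 V2 V0 = b5"
  "adj6 (Gr b0 b1 b2 b3 b4 b5 b6 b7 b8 b9 b10 b11 b12 b13 b14 b15 b16 b17 b18 b19) V4 V2 V1 = b6"
  "adj6 (Gr b0 b1 b2 b3 b4 b5 b6 b7 b8 b9 b10 b11 b12 b13 b14 b15 b16 b17 b18 b19) V4 V2 V2 = False"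
  "adj6 (Gr b0 b1 b2 b3 b4 b5 b6 b7 b8 b9 b10 b11 b12 b13 b14 b15 b16 b17 b18 b19) V4 V2 V3 = b9"
  "adj6 (Gr b0 b1 b2 b3 b4 b5 b6 b7 b8 b9 b10 b11 b12 b13 b14 b15 b16 b17 b18 b19) V4 V2 V4 = False"
  "adj6 (Gr b0 b1 b2 b3 b4 b5 b6 b7 b8 b9 b10 b11 b12 b13 b14 b15 b16 b17 b18 b19) V4 V2 V5 = b18"
  "adj6 (Gr b0 b1 b2 b3 b4 b5 b6 b7 b8 b9 b10 b11 b12 b13 b14 b15 b16 b17 b18 b19) V4 V3 V0 = b7"
  "adj6 (Gr b0 b1 b2 b3 b4 b5 b6 b7 b8 b9 b10 b11 b12 b13 b14 b15 b16 b17 b18 b19) V4 V3 V1 = b8"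
  "adj6 (Gr b0 b1 b2 b3 b4 b5 b6 b7 b8 b9 b10 b11 b12 b13 b14 b15 b16 b17 b18 b19) V4 V3 V2 = b9"
  "adj6 (Gr b0 b1 b2 b3 b4 b5 b6 b7 b8 b9 b10 b11 b12 b13 b14 b15 b16 b17 b18 b19) V4 V3 V3 = False"
  "adj6 (Gr b0 b1 b2 b3 b4 b5 b6 b7 b8 b9 b10 b11 b12 b13 b14 b15 b16 b17 b18 b19) V4 V3 V4 = False"
  "adj6 (Gr b0 b1 b2 b3 b4 b5 b6 b7 b8 b9 b10 b11 b12 b13 b14 b15 b16 b17 b18 b19) V4 V3 V5 = b19"
  "adj6 (Gr b0 b1 b2 b3 b4 b5 b6 b7 b8 b9 b10 b11 b12 b13 b14 b15 b16 b17 b18 b19) V4 V4 V0 = False"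
  "adj6 (Gr b0 b1 b2 b3 b4 b5 b6 b7 b8 b9 b10 b11 b12 b13 b14 b15 b16 b17 b18 b19) V4 V4 V1 = False"
  "adj6 (Gr b0 b1 b2 b3 b4 b5 b6 b7 b8 b9 b10 b11 b12 b13 b14 b15 b16 b17 b18 b19) V4 V4 V2 = False"
  "adj6 (Gr b0 b1 b2 b3 b4 b5 b6 b7 b8 b9 b10 b11 b12 b13 b14 b15 b16 b17 b18 b19) V4 V4 V3 = False"
  "adj6 (Gr b0 b1 b2 b3 b4 b5 b6 b7 b8 b9 b10 b11 b12 b13 b14 b15 b16 b17 b18 b19) V4 V4 V4 = False"
  "adj6 (Gr b0 b1 b2 b3 b4 b5 b6 b7 b8 b9 b10 b11 b12 b13 b14 b15 b16 b17 b18 b19) V4 V4 V5 = False"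
  "adj6 (Gr b0 b1 b2 b3 b4 b5 b6 b7 b8 b9 b10 b11 b12 b13 b14 b15 b16 b17 b18 b19) V4 V5 V0 = b16"
  "adj6 (Gr b0 b1 b2 b3 b4 b5 b6 b7 b8 b9 b10 b11 b12 b13 b14 b15 b16 b17 b18 b19) V4 V5 V1 = b17"
  "adj6 (Gr b0 b1 b2 b3 b4 b5 b6 b7 b8 b9 b10 b11 b12 b13 b14 b15 b16 b17 b18 b19) V4 V5 V2 = b18"
  "adj6 (Gr b0 b1 b2 b3 b4 b5 b6 b7 b8 b9 b10 b11 b12 b13 b14 b15 b16 b17 b18 b19) V4 V5 V3 = b19"
  "adj6 (Gr b0 b1 b2 b3 b4 b5 b6 b7 b8 b9 b10 b11 b12 b13 b14 b15 b16 b17 b18 b19) V4 V5 V4 = False"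
  "adj6 (Gr b0 b1 b2 b3 b4 b5 b6 b7 b8 b9 b10 b11 b12 b13 b14 b15 b16 b17 b18 b19) V4 V5 V5 = False"
  "adj6 (Gr b0 b1 b2 b3 b4 b5 b6 b7 b8 b9 b10 b11 b12 b13 b14 b15 b16 b17 b18 b19) V5 V0 V0 = False"
  "adj6 (Gr b0 b1 b2 b3 b4 b5 b6 b7 b8 b9 b10 b11 b12 b13 b14 b15 b16 b17 b18 b19) V5 V0 V1 = b10"
  "adj6 (Gr b0 b1 b2 b3 b4 b5 b6 b7 b8 b9 b10 b11 b12 b13 b14 b15 b16 b17 b18 b19) V5 V0 V2 = b11"
  "adj6 (Gr b0 b1 b2 b3 b4 b5 b6 b7 b8 b9 b10 b11 b12 b13 b14 b15 b16 b17 b18 b19) V5 V0 V3 = b13"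
  "adj6 (Gr b0 b1 b2 b3 b4 b5 b6 b7 b8 b9 b10 b11 b12 b13 b14 b15 b16 b17 b18 b19) V5 V0 V4 = b16"
  "adj6 (Gr b0 b1 b2 b3 b4 b5 b6 b7 b8 b9 b10 b11 b12 b13 b14 b15 b16 b17 b18 b19) V5 V0 V5 = False"
  "adj6 (Gr b0 b1 b2 b3 b4 b5 b6 b7 b8 b9 b10 b11 b12 b13 b14 b15 b16 b17 b18 b19) V5 V1 V0 = b10"
  "adj6 (Gr b0 b1 b2 b3 b4 b5 b6 b7 b8 b9 b10 b11 b12 b13 b14 b15 b16 b17 b18 b19) V5 V1 V1 = False"
  "adj6 (Gr b0 b1 b2 b3 b4 b5 b6 b7 b8 b9 b10 b11 b12 b13 b14 b15 b16 b17 b18 b19) V5 V1 V2 = b12"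
  "adj6 (Gr b0 b1 b2 b3 b4 b5 b6 b7 b8 b9 b10 b11 b12 b13 b14 b15 b16 b17 b18 b19) V5 V1 V3 = b14"
  "adj6 (Gr b0 b1 b2 b3 b4 b5 b6 b7 b8 b9 b10 b11 b12 b13 b14 b15 b16 b17 b18 b19) V5 V1 V4 = b17"
  "adj6 (Gr b0 b1 b2 b3 b4 b5 b6 b7 b8 b9 b10 b11 b12 b13 b14 b15 b16 b17 b18 b19) V5 V1 V5 = False"
  "adj6 (Gr b0 b1 b2 b3 b4 b5 b6 b7 b8 b9 b10 b11 b12 b13 b14 b15 b16 b17 b18 b19) V5 V2 V0 = b11"
  "adj6 (Gr b0 b1 b2 b3 b4 b5 b6 b7 b8 b9 b10 b11 b12 b13 b14 b15 b16 b17 b18 b19) V5 V2 V1 = b12"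
  "adj6 (Gr b0 b1 b2 b3 b4 b5 b6 b7 b8 b9 b10 b11 b12 b13 b14 b15 b16 b17 b18 b19) V5 V2 V2 = False"
  "adj6 (Gr b0 b1 b2 b3 b4 b5 b6 b7 b8 b9 b10 b11 b12 b13 b14 b15 b16 b17 b18 b19) V5 V2 V3 = b15"
  "adj6 (Gr b0 b1 b2 b3 b4 b5 b6 b7 b8 b9 b10 b11 b12 b13 b14 b15 b16 b17 b18 b19) V5 V2 V4 = b18"
  "adj6 (Gr b0 b1 b2 b3 b4 b5 b6 b7 b8 b9 b10 b11 b12 b13 b14 b15 b16 b17 b18 b19) V5 V2 V5 = False"
  "adj6 (Gr b0 b1 b2 b3 b4 b5 b6 b7 b8 b9 b10 b11 b12 b13 b14 b15 b16 b17 b18 b19) V5 V3 V0 = b13"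
  "adj6 (Gr b0 b1 b2 b3 b4 b5 b6 b7 b8 b9 b10 b11 b12 b13 b14 b15 b16 b17 b18 b19) V5 V3 V1 = b14"
  "adj6 (Gr b0 b1 b2 b3 b4 b5 b6 b7 b8 b9 b10 b11 b12 b13 b14 b15 b16 b17 b18 b19) V5 V3 V2 = b15"
  "adj6 (Gr b0 b1 b2 b3 b4 b5 b6 b7 b8 b9 b10 b11 b12 b13 b14 b15 b16 b17 b18 b19) V5 V3 V3 = False"
  "adj6 (Gr b0 b1 b2 b3 b4 b5 b6 b7 b8 b9 b10 b11 b12 b13 b14 b15 b16 b17 b18 b19) V5 V3 V4 = b19"
  "adj6 (Gr b0 b1 b2 b3 b4 b5 b6 b7 b8 b9 b10 b11 b12 b13 b14 b15 b16 b17 b18 b19) V5 V3 V5 = False"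
  "adj6 (Gr b0 b1 b2 b3 b4 b5 b6 b7 b8 b9 b10 b11 b12 b13 b14 b15 b16 b17 b18 b19) V5 V4 V0 = b16"
  "adj6 (Gr b0 b1 b2 b3 b4 b5 b6 b7 b8 b9 b10 b11 b12 b13 b14 b15 b16 b17 b18 b19) V5 V4 V1 = b17"
  "adj6 (Gr b0 b1 b2 b3 b4 b5 b6 b7 b8 b9 b10 b11 b12 b13 b14 b15 b16 b17 b18 b19) V5 V4 V2 = b18"
  "adj6 (Gr b0 b1 b2 b3 b4 b5 b6 b7 b8 b9 b10 b11 b12 b13 b14 b15 b16 b17 b18 b19) V5 V4 V3 = b19"
  "adj6 (Gr b0 b1 b2 b3 b4 b5 b6 b7 b8 b9 b10 b11 b12 b13 b14 b15 b16 b17 b18 b19) V5 V4 V4 = False"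
  "adj6 (Gr b0 b1 b2 b3 b4 b5 b6 b7 b8 b9 b10 b11 b12 b13 b14 b15 b16 b17 b18 b19) V5 V4 V5 = False"
  "adj6 (Gr b0 b1 b2 b3 b4 b5 b6 b7 b8 b9 b10 b11 b12 b13 b14 b15 b16 b17 b18 b19) V5 V5 V0 = False"
  "adj6 (Gr b0 b1 b2 b3 b4 b5 b6 b7 b8 b9 b10 b11 b12 b13 b14 b15 b16 b17 b18 b19) V5 V5 V1 = False"
  "adj6 (Gr b0 b1 b2 b3 b4 b5 b6 b7 b8 b9 b10 b11 b12 b13 b14 b15 b16 b17 b18 b19) V5 V5 V2 = False"
  "adj6 (Gr b0 b1 b2 b3 b4 b5 b6 b7 b8 b9 b10 b11 b12 b13 b14 b15 b16 b17 b18 b19) V5 V5 V3 = False"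
  "adj6 (Gr b0 b1 b2 b3 b4 b5 b6 b7 b8 b9 b10 b11 b12 b13 b14 b15 b16 b17 b18 b19) V5 V5 V4 = False"
  "adj6 (Gr b0 b1 b2 b3 b4 b5 b6 b7 b8 b9 b10 b11 b12 b13 b14 b15 b16 b17 b18 b19) V5 V5 V5 = False"
  by (simp_all add: adj6_def)

text \<open>Numbers the possible edge sets on two roots \<open>y\<close>, \<open>z\<close> and two
  free vertices, up to exchanging the free ones. Index 8 collects everything with at least three
  edges on these four vertices; the corresponding row and column of \<open>tab_pair\<close>
  vanish.\<close>

definition flag_pair :: "('b \<Rightarrow> 'b \<Rightarrow> 'b \<Rightarrow> bool) \<Rightarrow> 'b \<Rightarrow> 'b \<Rightarrow> 'b \<Rightarrow> 'b \<Rightarrow> nat" where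
"flag_pair a y z u w = (if a y z u then (if a y z w then (if a y u w then 8 else (if a z u w
  then 8 else 4)) else (if a y u w then (if a z u w then 8 else 5) else (if a z u w then 6 else
  1))) else (if a y z w then (if a y u w then (if a z u w then 8 else 5) else (if a z u w then
  6 else 1)) else (if a y u w then (if a z u w then 7 else 2) else (if a z u w then 3 else
  0))))"

text \<open>Numbers the link graphs of \<open>u\<close> on four roots, up to exchanging
  \<open>x0\<close> with \<open>x1\<close> and \<open>x2\<close> with \<open>x3\<close>. Index 18,
  with zero entries in \<open>tab_empty\<close>, stands for the links with a triangle, that is,
  three edges on four vertices.\<close>

definition flag_empty :: "('b \<Rightarrow> 'b \<Rightarrow> 'b \<Rightarrow> bool) \<Rightarrow> 'b \<Rightarrow> 'b \<Rightarrow> 'b \<Rightarrow> 'b \<Rightarrow> 'b \<Rightarrow> nat" where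
"flag_empty a x0 x1 x2 x3 u = (if a x0 x1 u then (if a x0 x2 u then (if a x0 x3 u then (if a x1
  x2 u then 18 else (if a x1 x3 u then 18 else (if a x2 x3 u then 18 else 10))) else (if a x1
  x2 u then 18 else (if a x1 x3 u then (if a x2 x3 u then 16 else 11) else (if a x2 x3 u then
  12 else 4)))) else (if a x0 x3 u then (if a x1 x2 u then (if a x1 x3 u then 18 else (if a x2
  x3 u then 16 else 11)) else (if a x1 x3 u then 18 else (if a x2 x3 u then 12 else 4))) else
  (if a x1 x2 u then (if a x1 x3 u then (if a x2 x3 u then 18 else 10) else (if a x2 x3 u then
  12 else 4)) else (if a x1 x3 u then (if a x2 x3 u then 12 else 4) else (if a x2 x3 u then 5
  else 1))))) else (if a x0 x2 u then (if a x0 x3 u then (if a x1 x2 u then (if a x1 x3 u then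
  (if a x2 x3 u then 18 else 17) else (if a x2 x3 u then 18 else 13)) else (if a x1 x3 u then
  (if a x2 x3 u then 18 else 13) else (if a x2 x3 u then 18 else 6))) else (if a x1 x2 u then
  (if a x1 x3 u then (if a x2 x3 u then 18 else 13) else (if a x2 x3 u then 14 else 7)) else
  (if a x1 x3 u then (if a x2 x3 u then 15 else 8) else (if a x2 x3 u then 9 else 2)))) else
  (if a x0 x3 u then (if a x1 x2 u then (if a x1 x3 u then (if a x2 x3 u then 18 else 13) else
  (if a x2 x3 u then 15 else 8)) else (if a x1 x3 u then (if a x2 x3 u then 14 else 7) else (if
  a x2 x3 u then 9 else 2))) else (if a x1 x2 u then (if a x1 x3 u then (if a x2 x3 u then 18
  else 6) else (if a x2 x3 u then 9 else 2)) else (if a x1 x3 u then (if a x2 x3 u then 9 else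
  2) else (if a x2 x3 u then 3 else 0))))))"

text \<open>Meant for four roots whose only edge is \<open>x1 x2 x3\<close>. Together with this
  edge, the links of index 20 contain three edges on four vertices or a forbidden copy; again their
  entries in the table are zero.\<close>

definition flag_edge :: "('b \<Rightarrow> 'b \<Rightarrow> 'b \<Rightarrow> bool) \<Rightarrow> 'b \<Rightarrow> 'b \<Rightarrow> 'b \<Rightarrow> 'b \<Rightarrow> 'b \<Rightarrow> nat" where
"flag_edge a x0 x1 x2 x3 u = (if a x0 x1 u then (if a x0 x2 u then (if a x0 x3 u then (if a x1
  x2 u then 20 else (if a x1 x3 u then 20 else (if a x2 x3 u then 20 else 19))) else (if a x1
  x2 u then 20 else (if a x1 x3 u then 20 else (if a x2 x3 u then 20 else 7)))) else (if a x0
  x3 u then (if a x1 x2 u then 20 else (if a x1 x3 u then 20 else (if a x2 x3 u then 20 else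
  8))) else (if a x1 x2 u then (if a x1 x3 u then 20 else (if a x2 x3 u then 20 else 9)) else
  (if a x1 x3 u then (if a x2 x3 u then 20 else 10) else (if a x2 x3 u then 11 else 1))))) else
  (if a x0 x2 u then (if a x0 x3 u then (if a x1 x2 u then 20 else (if a x1 x3 u then 20 else
  (if a x2 x3 u then 20 else 12))) else (if a x1 x2 u then (if a x1 x3 u then 20 else (if a x2
  x3 u then 20 else 13)) else (if a x1 x3 u then (if a x2 x3 u then 20 else 14) else (if a x2
  x3 u then 15 else 2)))) else (if a x0 x3 u then (if a x1 x2 u then (if a x1 x3 u then 20 else
  (if a x2 x3 u then 20 else 16)) else (if a x1 x3 u then (if a x2 x3 u then 20 else 17) else
  (if a x2 x3 u then 18 else 3))) else (if a x1 x2 u then (if a x1 x3 u then 20 else (if a x2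
  x3 u then 20 else 4)) else (if a x1 x3 u then (if a x2 x3 u then 20 else 5) else (if a x2 x3
  u then 6 else 0))))))"

text \<open>Rounded integer factors of the positive semidefinite matrices found by a semidefinite solver; the
  tables are their Gram matrices, indexed by the flags over two vertices, over four vertices without an
  edge, and over four vertices with exactly one edge.\<close>

definition vecs_pair :: "int list list" where
  "vecs_pair =
[[1118, 1211, -321, -321, -1760, -501, -501, -3392, 0], [0, 0, 0, 0, -1, 0, 0, 0, 0], [0, 0, 0,
  0, -1, 0, 0, 0, 0], [0, 0, 0, 0, 2, 0, 0, 0, 0], [0, 0, 2656, -2656, 0, 836, -836, 0, 0], [0,
  0, 0, 0, 0, 711, -711, 0, 0]]"

definition tab_pair :: "int list list" where
  "tab_pair =
[[1249924, 1353898, -358878, -358878, -1967680, -560118, -560118, -3792256, 0], [1353898,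
  1466521, -388731, -388731, -2131360, -606711, -606711, -4107712, 0], [-358878, -388731,
  7157377, -6951295, 564960, 2381237, -2059595, 1088832, 0], [-358878, -388731, -6951295,
  7157377, 564960, -2059595, 2381237, 1088832, 0], [-1967680, -2131360, 564960, 564960,
  3097606, 881760, 881760, 5969920, 0], [-560118, -606711, 2381237, -2059595, 881760, 1455418,
  -953416, 1699392, 0], [-560118, -606711, -2059595, 2381237, 881760, -953416, 1455418,
  1699392, 0], [-3792256, -4107712, 1088832, 1088832, 5969920, 1699392, 1699392, 11505664, 0],
  [0, 0, 0, 0, 0, 0, 0, 0, 0]]"

definition vecs_empty :: "int list list" where
  "vecs_empty =
[[102, 1139, -1461, 1139, 283, 4657, 35, 35, -4641, 283, -214, 294, 1881, -2168, -214, 294,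
  582, -732, 0], [0, 1210, -81, -886, 204, 580, -149, 118, -290, -189, 70, 1444, 176, -203,
  -70, -1390, 41, -82, 0], [0, 0, 206, -825, 58, -1474, -13, 92, 737, -97, 28, 488, -447, 516,
  -28, -627, -104, 208, 0], [0, 0, 0, 3, 0, 3, 0, 0, -2, 0, 0, -2, 1, -1, 0, 2, 0, -1, 0], [0,
  0, 0, 0, 0, 0, 0, 0, -1, 0, 0, 1, 0, 0, 0, -1, 0, 0, 0], [0, 0, 0, 0, 0, 17, 0, 0, 0, 0, 0,
  0, 0, 0, 0, 0, 0, 0, 0], [0, 0, 0, 0, 0, 0, 0, 0, 0, 0, 0, -1, 0, 0, 0, 1, 0, 0, 0], [0, 0,
  0, 0, 0, 0, 0, 0, 12, 0, 0, 0, 0, 0, 0, 0, 0, 0, 0], [0, 0, 0, 0, 0, 0, 0, 0, 0, 0, 0, -1, 0,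
  0, 0, 1, 0, 0, 0], [0, 0, 0, 0, 0, 0, 0, 0, 0, 0, 0, 4, 0, 0, 0, -4, 0, 0, 0], [0, 0, 0, 0,
  0, 0, 0, 0, 0, 0, 0, 0, 1, -1, 0, 0, 0, 0, 0], [0, 0, 0, 0, 0, 0, 0, 0, 0, 0, 0, 0, 0, 1, 0,
  0, 0, 0, 0], [0, 0, 0, 0, 0, 0, 0, 0, 0, 0, 0, 0, 0, 0, 0, 2, 0, 0, 0]]"

definition tab_empty :: "int list list" where
  "tab_empty =
[[10404, 116178, -149022, 116178, 28866, 475014, 3570, 3570, -473382, 28866, -21828, 29988,
  191862, -221136, -21828, 29988, 59364, -74664, 0], [116178, 2761421, -1762089, 225261,
  569177, 6006123, -140425, 182645, -5636999, 93647, -159046, 2082106, 2355419, -2714982,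
  -328446, -1347034, 712508, -932968, 0], [-149022, -1762089, 2183518, -1762263, -418039,
  -7154501, -41744, -41741, 6955813, -418136, 312752, -445970, -2854479, 3290187, 312556,
  -446106, -875047, 1118942, 0], [116178, 225261, -1762263, 2762951, 93743, 6006502, 182604,
  -140583, -5637190, 569816, -328866, -1347124, 2355301, -2715197, -158626, 2083687, 712372,
  -932699, 0], [28866, 569177, -418039, 93743, 125069, 1350759, -21245, 39313, -1329817, 35907,
  -44658, 406082, 542301, -625028, -76466, -236724, 167038, -211820, 0], [475014, 6006123,
  -7154501, 6006502, 1350759, 24197023, 95737, 95827, -22867681, 1351289, -997270, 1487360,
  9520778, -10974703, -995926, 1487162, 2887450, -3763079, 0], [3570, -140425, -41744, 182604,
  -21245, 95737, 23595, -17553, -128806, 39327, -18284, -211210, 45422, -52341, 3304, 225551,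
  15613, -16106, 0], [3570, 182645, -41741, -140583, 39313, 95827, -17553, 23613, -128851,
  -21321, 3346, 225578, 45479, -52362, -18326, -211414, 15640, -16160, 0], [-473382, -5636999,
  6955813, -5637190, -1329817, -22867681, -128806, -128851, 22166299, -1330082, 993510,
  -1423555, -9110202, 10500852, 992838, -1423456, -2789600, 3574290, 0], [28866, 93647,
  -418136, 569816, 35907, 1351289, 39327, -21321, -1330082, 125219, -76508, -237050, 542418,
  -625229, -44616, 406731, 167045, -211834, 0], [-21828, -159046, 312752, -328866, -44658,
  -997270, -18284, 3346, 993510, -76508, 51480, 51828, -402730, 464190, 40112, -177772,
  -124590, 156732, 0], [29988, 2082106, -445970, -1347124, 406082, 1487360, -211210, 225578,
  -1423555, -237050, 51828, 2409739, 589020, -678714, -177660, -2226723, 179560, -232110, 0],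
  [191862, 2355419, -2854479, 2355301, 542301, 9520778, 45422, 45479, -9110202, 542418,
  -402730, 589020, 3768948, -4344390, -402338, 588645, 1148446, -1484301, 0], [-221136,
  -2714982, 3290187, -2715197, -625028, -10974703, -52341, -52362, 10500852, -625229, 464190,
  -678714, -4344390, 5007692, 463714, -678756, -1323763, 1710951, 0], [-21828, -328446, 312556,
  -158626, -76466, -995926, 3304, -18326, 992838, -44616, 40112, -177660, -402338, 463714,
  51480, 51940, -124506, 156564, 0], [29988, -1347034, -446106, 2083687, -236724, 1487162,
  225551, -211414, -1423456, 406731, -177772, -2226723, 588645, -678756, 51940, 2411692,
  179326, -231646, 0], [59364, 712508, -875047, 712372, 167038, 2887450, 15613, 15640,
  -2789600, 167045, -124590, 179560, 1148446, -1323763, -124506, 179326, 351221, -451018, 0],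
  [-74664, -932968, 1118942, -932699, -211820, -3763079, -16106, -16160, 3574290, -211834,
  156732, -232110, -1484301, 1710951, 156564, -231646, -451018, 585813, 0], [0, 0, 0, 0, 0, 0,
  0, 0, 0, 0, 0, 0, 0, 0, 0, 0, 0, 0, 0]]"

definition vecs_edge :: "int list list" where
  "vecs_edge =
[[1236, -1221, -1221, -1221, 2060, 2060, 2060, -1484, -1484, -420, -420, -2128, -1484, -420,
  -2128, -420, -2128, -420, -420, -3277, 0], [0, 1183, 1183, 1183, -49, -49, -49, -1590, -1590,
  459, 459, 990, -1590, 459, 990, 459, 990, 459, 459, 48, 0], [0, 0, 0, 0, 0, 0, 0, 2, 2, -1,
  -1, -2, 2, -1, -2, -1, -2, -1, -1, 0, 0], [0, 0, 0, 0, 0, 0, 0, 4, 4, -1, -1, -3, 4, -1, -3,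
  -1, -3, -1, -1, 0, 0], [0, 0, 0, 0, 0, 0, 0, 0, 0, 1, 1, 0, 0, 1, 0, 1, 0, 1, 1, 0, 0], [0,
  0, 0, 0, 0, 0, 0, 0, 0, 0, 0, 1, 0, 0, 1, 0, 1, 0, 0, 0, 0], [0, 0, 4932, -4932, 335, -335,
  0, 3153, -3153, 1425, -1425, 0, 0, 3527, 5759, 2102, -5759, -3527, -2102, 0, 0], [0, 0, 0, 0,
  2121, -2121, 0, 2255, -2255, 4005, -4005, 0, 0, 3437, -3431, -568, 3431, -3437, 568, 0, 0],
  [0, 0, 0, 0, 0, 0, 0, 3, -3, 1, -1, 0, 0, 3, 5, 2, -5, -3, -2, 0, 0], [0, 0, 0, 0, 0, 0, 0,
  0, 0, 3, -3, 0, 0, 0, 0, 1, 0, 0, -1, 0, 0], [0, 0, 0, 0, 0, 0, 0, 0, 0, 0, 0, 0, 0, 3, 2,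
  -1, -2, -3, 1, 0, 0], [0, 0, 0, 0, 0, 0, 0, 0, 0, 0, 0, 0, 0, 0, 4, 1, -4, 0, -1, 0, 0], [0,
  0, 0, 0, 0, 0, 0, 0, 0, 0, 0, 0, 0, 0, 0, 2, 0, 0, -2, 0, 0]]"

definition tab_edge :: "int list list" where
  "tab_edge =
[[1527696, -1509156, -1509156, -1509156, 2546160, 2546160, 2546160, -1834224, -1834224,
  -519120, -519120, -2630208, -1834224, -519120, -2630208, -519120, -2630208, -519120, -519120,
  -4050372, 0], [-1509156, 2890330, 2890330, 2890330, -2573227, -2573227, -2573227, -69006,
  -69006, 1055817, 1055817, 3769458, -69006, 1055817, 3769458, 1055817, 3769458, 1055817,
  1055817, 4058001, 0], [-1509156, 2890330, 27214954, -21434294, -921007, -4225447, -2573227,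
  15481590, -15619602, 8083917, -5972283, 3769458, -69006, 18450981, 32172846, 11422881,
  -24633930, -16339347, -9311247, 4058001, 0], [-1509156, 2890330, -21434294, 27214954,
  -4225447, -921007, -2573227, -15619602, 15481590, -5972283, 8083917, 3769458, -69006,
  -16339347, -24633930, -9311247, 32172846, 18450981, 11422881, 4058001, 0], [2546160,
  -2573227, -921007, -4225447, 8856867, -364865, 4246001, 2859980, -8818240, 8084289, -9859671,
  -4432190, -2979130, 7583731, -9780076, -1388249, 915696, -9359113, -387133, -6752972, 0],
  [2546160, -2573227, -4225447, -921007, -364865, 8856867, 4246001, -8818240, 2859980,
  -9859671, 8084289, -4432190, -2979130, -9359113, 915696, -387133, -9780076, 7583731,
  -1388249, -6752972, 0], [2546160, -2573227, -2573227, -2573227, 4246001, 4246001, 4246001,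
  -2979130, -2979130, -887691, -887691, -4432190, -2979130, -887691, -4432190, -887691,
  -4432190, -887691, -887691, -6752972, 0], [-1834224, -69006, 15481590, -15619602, 2859980,
  -8818240, -2979130, 19756819, -10296067, 13417767, -13630839, 1583836, 4730376, 18764539,
  12005073, 5240236, -8837401, -18977611, -5453308, 4786748, 0], [-1834224, -69006, -15619602,
  15481590, -8818240, 2859980, -2979130, -10296067, 19756819, -13630839, 13417767, 1583836,
  4730376, -18977611, -8837401, -5453308, 12005073, 18764539, 5240236, 4786748, 0], [-519120,
  1055817, 8083917, -5972283, 8084289, -9859671, -887691, 13417767, -13630839, 18457744,
  -17683576, 1348175, -106536, 19178247, -4186400, 1107599, 6882750, -18404079, -333431,
  1398372, 0], [-519120, 1055817, -5972283, 8083917, -9859671, 8084289, -887691, -13630839,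
  13417767, -17683576, 18457744, 1348175, -106536, -18404079, 6882750, -333431, -4186400,
  19178247, 1107599, 1398372, 0], [-2630208, 3769458, 3769458, 3769458, -4432190, -4432190,
  -4432190, 1583836, 1583836, 1348175, 1348175, 5508498, 1583836, 1348175, 5508498, 1348175,
  5508498, 1348175, 1348175, 7020976, 0], [-1834224, -69006, -69006, -69006, -2979130,
  -2979130, -2979130, 4730376, 4730376, -106536, -106536, 1583836, 4730376, -106536, 1583836,
  -106536, 1583836, -106536, -106536, 4786748, 0], [-519120, 1055817, 18450981, -16339347,
  7583731, -9359113, -887691, 18764539, -18977611, 19178247, -18404079, 1348175, -106536,
  24639800, 9867842, 5848625, -7171492, -23865632, -5074457, 1398372, 0], [-2630208, 3769458,
  32172846, -24633930, -9780076, 915696, -4432190, 12005073, -8837401, -4186400, 6882750,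
  5508498, 1583836, 9867842, 50446385, 15402413, -39429389, -7171492, -12706063, 7020976, 0],
  [-519120, 1055817, 11422881, -9311247, -1388249, -387133, -887691, 5240236, -5453308,
  1107599, -333431, 1348175, -106536, 5848625, 15402413, 5128123, -12706063, -5074457,
  -4353955, 1398372, 0], [-2630208, 3769458, -24633930, 32172846, 915696, -9780076, -4432190,
  -8837401, 12005073, 6882750, -4186400, 5508498, 1583836, -7171492, -39429389, -12706063,
  50446385, 9867842, 15402413, 7020976, 0], [-519120, 1055817, -16339347, 18450981, -9359113,
  7583731, -887691, -18977611, 18764539, -18404079, 19178247, 1348175, -106536, -23865632,
  -7171492, -5074457, 9867842, 24639800, 5848625, 1398372, 0], [-519120, 1055817, -9311247,
  11422881, -387133, -1388249, -887691, -5453308, 5240236, -333431, 1107599, 1348175, -106536,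
  -5074457, -12706063, -4353955, 15402413, 5848625, 5128123, 1398372, 0], [-4050372, 4058001,
  4058001, 4058001, -6752972, -6752972, -6752972, 4786748, 4786748, 1398372, 1398372, 7020976,
  4786748, 1398372, 7020976, 1398372, 7020976, 1398372, 1398372, 10741033, 0], [0, 0, 0, 0, 0,
  0, 0, 0, 0, 0, 0, 0, 0, 0, 0, 0, 0, 0, 0, 0, 0]]"

text \<open>Seen from the edge \<open>x y z\<close>, such a vertex plays the role of
  \<open>x\<close>: in a blow-up it would lie in the part of \<open>x\<close>.\<close>

definition part6 :: "('b \<Rightarrow> 'b \<Rightarrow> 'b \<Rightarrow> bool) \<Rightarrow> 'b \<Rightarrow> 'b \<Rightarrow> 'b \<Rightarrow> 'b \<Rightarrow> bool" where
  "part6 a x y z u \<longleftrightarrow> a y z u \<and> \<not> a x z u \<and> \<not> a x y u"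

definition cov6 :: "('b \<Rightarrow> 'b \<Rightarrow> 'b \<Rightarrow> bool) \<Rightarrow> 'b \<Rightarrow> 'b \<Rightarrow> 'b \<Rightarrow> 'b \<Rightarrow> int" where
  "cov6 a x y z u = of_bool (part6 a x y z u \<or> part6 a y x z u \<or> part6 a z x y u)"

text \<open>Summed over \<open>u, v, w\<close>, this becomes \<open>162000 c - 6000 D\<^sup>3 + (4 D - n)\<^sup>2 (2000 D - 1987 n)\<close>, where \<open>D\<close> vertices are
  attached to exactly one pair of the edge \<open>xyz\<close> and \<open>c\<close> transversal edges run between the three classes.\<close>

definition obj6 :: "('b \<Rightarrow> 'b \<Rightarrow> 'b \<Rightarrow> bool) \<Rightarrow> 'b \<Rightarrow> 'b \<Rightarrow> 'b \<Rightarrow> 'b \<Rightarrow> 'b \<Rightarrow> 'b \<Rightarrow> int" where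
  "obj6 a x y z u v w =
    (if a x y z then
       162000 * of_bool (part6 a x y z u \<and> part6 a y x z v \<and> part6 a z x y w \<and> a u v w)
       - 6000 * (cov6 a x y z u * cov6 a x y z v * cov6 a x y z w)
       + (4 * cov6 a x y z u - 1) * (4 * cov6 a x y z v - 1) * (2000 * cov6 a x y z w - 1987)
     else 0)"

text \<open>Two flags over common roots have to fit on six vertices: flags of order 4 over two
  roots, or of order 5 over four roots.\<close>

definition sos_pair where
  "sos_pair a x0 x1 x2 x3 x4 x5 = tab_pair ! flag_pair a x0 x1 x2 x3 ! flag_pair a x0 x1 x4 x5"

definition sos_empty where
  "sos_empty a x0 x1 x2 x3 x4 x5 =
    (if a x0 x1 x2 \<or> a x0 x1 x3 \<or> a x0 x2 x3 \<or> a x1 x2 x3 then 0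
     else tab_empty ! flag_empty a x0 x1 x2 x3 x4 ! flag_empty a x0 x1 x2 x3 x5)"

definition sos_edge where
  "sos_edge a x0 x1 x2 x3 x4 x5 =
    (if a x1 x2 x3 \<and> \<not> a x0 x1 x2 \<and> \<not> a x0 x1 x3 \<and> \<not> a x0 x2 x3
     then tab_edge ! flag_edge a x0 x1 x2 x3 x4 ! flag_edge a x0 x1 x2 x3 x5 else 0)"

text \<open>Integrand of the cube of the codegree of \<open>y\<close>, \<open>z\<close>; multiplied
  by the indicator of an edge \<open>u v w\<close> it counts the edges inside the common
  neighbourhood.\<close>

definition star3 :: "('b \<Rightarrow> 'b \<Rightarrow> 'b \<Rightarrow> bool) \<Rightarrow> 'b \<Rightarrow> 'b \<Rightarrow> 'b \<Rightarrow> 'b \<Rightarrow> 'b \<Rightarrow> int" where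
  "star3 a y z u v w = of_bool (a y z u \<and> a y z v \<and> a y z w)"

text \<open>The multipliers of the edge density and of the codegree stars come from the dual solution.\<close>

definition cert6 :: "('b \<Rightarrow> 'b \<Rightarrow> 'b \<Rightarrow> bool) \<Rightarrow> 'b \<Rightarrow> 'b \<Rightarrow> 'b \<Rightarrow> 'b \<Rightarrow> 'b \<Rightarrow> 'b \<Rightarrow> int" where
  "cert6 a x0 x1 x2 x3 x4 x5 = 169 * obj6 a x0 x1 x2 x3 x4 x5
     - sos_pair a x0 x1 x2 x3 x4 x5 - sos_empty a x0 x1 x2 x3 x4 x5 - sos_edge a x0 x1 x2 x3 x4 x5
     - 1260504 * (4 * of_bool (a x0 x1 x2) - 1)
     - 4919621 * (star3 a x0 x1 x2 x3 x4 * (1 - 4 * of_bool (a x2 x3 x4)))"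


text \<open>Each entry is paired with the list of the others, so six nested selections run through
  all orderings without any test for distinctness.\<close>

fun selects :: "'b list \<Rightarrow> 'b list \<Rightarrow> ('b \<times> 'b list) list" where
  "selects ys [] = []"
| "selects ys (x # xs) = (x, ys @ xs) # selects (ys @ [x]) xs"

definition sum6 :: "'b list \<Rightarrow> ('b \<Rightarrow> 'b \<Rightarrow> 'b \<Rightarrow> 'b \<Rightarrow> 'b \<Rightarrow> 'b \<Rightarrow> int) \<Rightarrow> int" where
  "sum6 vs f = (\<Sum>(x0, r0)\<leftarrow>selects [] vs. \<Sum>(x1, r1)\<leftarrow>selects [] r0. \<Sum>(x2, r2)\<leftarrow>selects [] r1.
     \<Sum>(x3, r3)\<leftarrow>selects [] r2. \<Sum>(x4, r4)\<leftarrow>selects [] r3. \<Sum>(x5, r5)\<leftarrow>selects [] r4. f x0 x1 x2 x3 x4 x5)"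

definition pull :: "('a \<Rightarrow> 'a \<Rightarrow> 'a \<Rightarrow> bool) \<Rightarrow> ('b \<Rightarrow> 'a) \<Rightarrow> 'b \<Rightarrow> 'b \<Rightarrow> 'b \<Rightarrow> bool" where
  "pull a f x y z = a (f x) (f y) (f z)"

definition gr_of :: "(vtx6 \<Rightarrow> vtx6 \<Rightarrow> vtx6 \<Rightarrow> bool) \<Rightarrow> gr6" where
  "gr_of b = Gr (b V0 V1 V2) (b V0 V1 V3) (b V0 V2 V3) (b V1 V2 V3) (b V0 V1 V4) (b V0 V2 V4) (b V1 V2 V4) (b V0 V3 V4) (b V1 V3 V4) (b V2 V3 V4) (b V0 V1 V5) (b V0 V2 V5) (b V1 V2 V5) (b V0 V3 V5) (b V1 V3 V5) (b V2 V3 V5) (b V0 V4 V5) (b V1 V4 V5) (b V2 V4 V5) (b V3 V4 V5)"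

text \<open>These lists cover, up to isomorphism, the 3-graphs on three to six vertices with neither
  a forbidden copy nor three edges on four vertices. Bits beyond the current number of vertices are
  false.\<close>

definition reps3 :: "gr6 list" where
  "reps3 =
  [Gr False False False False False False False False False False False False False False False
  False False False False False, Gr True False False False False False False False False False
  False False False False False False False False False False]"

definition reps4 :: "gr6 list" where
  "reps4 =
  [Gr False False False False False False False False False False False False False False False
  False False False False False, Gr False False False True False False False False False False
  False False False False False False False False False False, Gr False False True True False
  False False False False False False False False False False False False False False False]"

definition reps5 :: "gr6 list" where
  "reps5 =
  [Gr False False False False False False False False False False False False False False False
  False False False False False, Gr False False False False False False False False False True
  False False False False False False False False False False, Gr False False False False True
  False False False False True False False False False False False False False False False, Gr
  False False False False False False False False True True False False False False False False
  False False False False, Gr True False False False False False False False True True False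
  False False False False False False False False False, Gr False False False False False True
  False False True True False False False False False False False False False False, Gr False
  False False False False False False True True True False False False False False False False
  False False False, Gr True False False False False False False True True True False False
  False False False False False False False False, Gr False False False False True True False
  False True True False False False False False False False False False False]"

definition reps6 :: "gr6 list" where
  "reps6 =
  [Gr False False False False False False False False False False False False False False False
  False False False False False, Gr False False False False False False False False False False
  False False False False False False False False False True, Gr True False False False False
  False False False False False False False False False False False False False False True, Gr
  False False False False False False False False False False False False True False False
  False False False False True, Gr False False False False False False False False False False
  False False False False False False False False True True, Gr False True False False False
  False False False False False False False False False False False False False True True, Gr
  False False False False False False False False False False True False False False False
  False False False True True, Gr False False False False False False False True False False
  False False False False True False False False True False, Gr False False False True False
  False False False False False False False False False False False False False True True, Gr
  False False False False False False False False False False False False False False True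
  False False False True True, Gr False False False False False False False False False False
  False False False False False False False True True True, Gr True True False False False
  False False False False False False False False False False False False False True True, Gr
  True False False False False False False True False False False False False False True False
  False False True False, Gr True False False False False False False False False False False
  False False False True False False False True True, Gr False False False True False False
  False False False False True False False False False False False False True True, Gr False
  False False False False False False False False True True False True False False False False
  False False True, Gr False False True False False False False False False False False False
  False False False False False True True True, Gr False False False False False True False
  False False False False False False False True False False False True True, Gr False False
  False False False True False False False False False False False False False True False True
  False True, Gr False False False False False False False False False False False True False
  False True False False False True True, Gr False False False False False False False True
  False False False False False False True False False False True True, Gr False False False
  False False False False False False False False False False True False False False True True
  True, Gr False False False False False False False False False True False False False False
  False True True True False False, Gr False False False False False False False False False
  False False False False False False False True True True True, Gr False False False True
  False False False False False False False False False False False False False True True True,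
  Gr False False False False False False False False False False False False True False True
  False False False True True, Gr True False False False False False False True False False
  False False False False True False False False True True, Gr True False False False False
  False False False False False False False False True False False False True True True, Gr
  False True True False False False False False False False False False False False False False
  False True True True, Gr False True False False False True False False False False False
  False False False True False False False True True, Gr False True False False False True
  False False False False False False False False False True False True False True, Gr False
  True False False False False False True False False False False False False False True False
  True True False, Gr False True False False False False False False False True False False
  False False False True True True False False, Gr False False False False True False False
  False False False False True False False True False False False True True, Gr False False
  False False True False False False False False False True False False False True False True
  False True, Gr False False False False False False False False False False True True False
  False True False False False True True, Gr False False True True False False False False
  False False False False False False False False False True True True, Gr False False False
  False False False False True False False False False True False True False False False True
  True, Gr False False False False False False False True False False False False False False
  True True False True True False, Gr False False False True False False False False False
  False False False False True False False False True True True, Gr False False False True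
  False False False False False False False False False False False False True True True True,
  Gr False False False False False False False False False False False False True False True
  False True False True True, Gr True True False False False True False False False False False
  False False False True False False False True True, Gr True True False False False True False
  False False False False False False False False True False True False True, Gr True True
  False False False False False False False True False False False False False True True True
  False False, Gr True False False False False False False True False False False False True
  False True False False False True True, Gr True False False False False False False True
  False False False False False False True True False True True False, Gr True False False True
  False False False False False False False False False True False False False True True True,
  Gr False False True True False False False False False False False False False False False
  False True True True True, Gr False False True False False False False False False False
  False False True False True False True False True True, Gr False False False False False True
  False True False False False False True False True False False False True True, Gr False
  False False False False False False False False False False False False True True True True
  True True False, Gr True False False False False False False False False False False False
  False True True True True True True False, Gr False True False False False True False True
  False False False False True False True False False False True True, Gr True True False False
  False True False True False False False False True False True False False False True True]"

text \<open>An extension is either isomorphic to a listed representative or excluded, by exhibiting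
  a forbidden copy or a vertex whose link contains a triangle.\<close>

datatype (plugins only: code) hint = Iso nat vtx6 vtx6 vtx6 vtx6 vtx6 vtx6 | Copy vtx6 vtx6 vtx6 vtx6 vtx6 | Apex vtx6 vtx6 vtx6 vtx6

text \<open>For every one-vertex extension of a representative, the hint names a representative isomorphic to it
  together with the isomorphism, so the classification is only checked and not searched for.\<close>

definition hints4 :: "hint list list" where
  "hints4 =
  [[Iso 0 V0 V1 V2 V3 V4 V5, Iso 1 V0 V1 V2 V3 V4 V5, Iso 1 V1 V0 V2 V3 V4 V5, Iso 2 V0 V1 V2 V3
  V4 V5, Iso 1 V2 V0 V1 V3 V4 V5, Iso 2 V0 V2 V1 V3 V4 V5, Iso 2 V1 V2 V0 V3 V4 V5, Apex V3 V0
  V1 V2], [Iso 1 V3 V0 V1 V2 V4 V5, Iso 2 V0 V3 V1 V2 V4 V5, Iso 2 V1 V3 V0 V2 V4 V5, Iso 2 V2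
  V3 V0 V1 V4 V5]]"

definition hints5 :: "hint list list" where
  "hints5 =
  [[Iso 0 V0 V1 V2 V3 V4 V5, Iso 1 V0 V1 V2 V3 V4 V5, Iso 1 V0 V2 V1 V3 V4 V5, Iso 3 V0 V1 V2 V3
  V4 V5, Iso 1 V1 V2 V0 V3 V4 V5, Iso 3 V1 V0 V2 V3 V4 V5, Iso 3 V2 V0 V1 V3 V4 V5, Iso 6 V0 V1
  V2 V3 V4 V5, Iso 1 V0 V3 V1 V2 V4 V5, Iso 3 V0 V1 V3 V2 V4 V5, Iso 3 V0 V2 V3 V1 V4 V5, Apex
  V4 V1 V2 V3, Iso 2 V0 V3 V1 V2 V4 V5, Iso 5 V0 V1 V3 V2 V4 V5, Iso 5 V0 V2 V3 V1 V4 V5, Apex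
  V4 V1 V2 V3, Iso 1 V1 V3 V0 V2 V4 V5, Iso 3 V1 V0 V3 V2 V4 V5, Iso 2 V0 V2 V1 V3 V4 V5, Iso 5
  V0 V1 V2 V3 V4 V5, Iso 3 V1 V2 V3 V0 V4 V5, Apex V4 V0 V2 V3, Iso 5 V1 V2 V3 V0 V4 V5, Apex
  V4 V0 V2 V3, Iso 3 V3 V0 V1 V2 V4 V5, Iso 6 V0 V1 V3 V2 V4 V5, Iso 5 V0 V3 V2 V1 V4 V5, Apex
  V4 V1 V2 V3, Iso 5 V1 V3 V2 V0 V4 V5, Apex V4 V0 V2 V3, Iso 8 V0 V2 V3 V1 V4 V5, Apex V4 V0
  V2 V3, Iso 1 V2 V3 V0 V1 V4 V5, Iso 2 V0 V1 V2 V3 V4 V5, Iso 3 V2 V0 V3 V1 V4 V5, Iso 5 V0 V2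
  V1 V3 V4 V5, Iso 3 V2 V1 V3 V0 V4 V5, Iso 5 V1 V2 V0 V3 V4 V5, Apex V4 V0 V1 V3, Apex V4 V0
  V1 V3, Iso 3 V3 V0 V2 V1 V4 V5, Iso 5 V0 V3 V1 V2 V4 V5, Iso 6 V0 V2 V3 V1 V4 V5, Apex V4 V1
  V2 V3, Iso 5 V2 V3 V1 V0 V4 V5, Iso 8 V0 V1 V3 V2 V4 V5, Apex V4 V0 V1 V3, Apex V4 V0 V1 V3,
  Iso 3 V3 V1 V2 V0 V4 V5, Iso 5 V1 V3 V0 V2 V4 V5, Iso 5 V2 V3 V0 V1 V4 V5, Iso 8 V0 V1 V2 V3
  V4 V5, Iso 6 V1 V2 V3 V0 V4 V5, Apex V4 V0 V2 V3, Apex V4 V0 V1 V3, Apex V4 V0 V1 V3, Apex V4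
  V0 V1 V2, Apex V4 V0 V1 V2, Apex V4 V0 V1 V2, Apex V4 V0 V1 V2, Apex V4 V0 V1 V2, Apex V4 V0
  V1 V2, Apex V4 V0 V1 V2, Apex V4 V0 V1 V2], [Iso 1 V0 V4 V1 V2 V3 V5, Iso 3 V0 V1 V4 V2 V3
  V5, Iso 3 V0 V2 V4 V1 V3 V5, Iso 2 V0 V4 V1 V2 V3 V5, Iso 5 V0 V1 V4 V2 V3 V5, Iso 5 V0 V2 V4
  V1 V3 V5, Iso 3 V0 V3 V4 V1 V2 V5, Iso 4 V0 V3 V4 V1 V2 V5, Iso 2 V0 V4 V1 V3 V2 V5, Iso 5 V0
  V1 V4 V3 V2 V5, Iso 4 V0 V2 V4 V1 V3 V5, Iso 4 V1 V2 V3 V0 V4 V5, Apex V4 V0 V2 V3, Copy V2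
  V0 V4 V3 V1, Iso 5 V0 V3 V4 V1 V2 V5, Copy V3 V0 V4 V2 V1, Iso 2 V0 V4 V2 V3 V1 V5, Iso 4 V0
  V1 V4 V2 V3 V5, Iso 5 V0 V2 V4 V3 V1 V5, Iso 4 V2 V1 V3 V0 V4 V5, Copy V1 V0 V4 V3 V2, Apex
  V4 V0 V1 V3, Iso 5 V0 V3 V4 V2 V1 V5, Copy V3 V0 V4 V1 V2, Iso 4 V3 V1 V2 V0 V4 V5, Copy V1
  V0 V4 V2 V3, Copy V2 V0 V4 V1 V3, Iso 7 V1 V2 V3 V0 V4 V5, Apex V4 V0 V2 V3, Apex V4 V0 V1
  V3, Apex V4 V0 V1 V2, Apex V4 V0 V1 V2], [Iso 3 V4 V0 V1 V2 V3 V5, Iso 6 V0 V1 V4 V2 V3 V5,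
  Iso 5 V0 V4 V2 V1 V3 V5, Iso 5 V1 V4 V2 V0 V3 V5, Iso 8 V0 V2 V4 V1 V3 V5, Iso 5 V0 V4 V3 V1
  V2 V5, Copy V4 V0 V3 V2 V1, Iso 5 V1 V4 V3 V0 V2 V5, Copy V4 V0 V2 V3 V1, Iso 8 V0 V3 V4 V1
  V2 V5, Iso 4 V4 V0 V1 V2 V3 V5, Iso 7 V0 V1 V4 V2 V3 V5, Copy V0 V2 V3 V1 V4, Copy V1 V2 V3
  V0 V4, Apex V4 V0 V1 V3, Copy V0 V3 V2 V1 V4, Copy V0 V3 V2 V1 V4, Copy V1 V3 V2 V0 V4, Copy
  V0 V2 V3 V1 V4, Apex V4 V0 V1 V2]]"

definition hints6 :: "hint list list" where
  "hints6 =
  [[Iso 0 V0 V1 V2 V3 V4 V5], [Iso 1 V0 V1 V5 V2 V3 V4, Iso 2 V0 V1 V5 V2 V3 V4], [Iso 3 V5 V0 V1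
  V2 V3 V4, Iso 6 V0 V1 V2 V5 V3 V4, Iso 6 V0 V1 V3 V5 V2 V4, Iso 6 V2 V3 V0 V5 V1 V4, Iso 6 V2
  V3 V1 V5 V0 V4, Iso 5 V0 V1 V5 V4 V2 V3, Iso 7 V0 V2 V5 V4 V1 V3, Iso 7 V1 V2 V5 V4 V0 V3,
  Iso 7 V0 V3 V5 V4 V1 V2, Iso 12 V0 V1 V4 V5 V3 V2, Iso 7 V1 V3 V5 V4 V0 V2, Iso 12 V0 V1 V4
  V5 V2 V3, Iso 5 V2 V3 V5 V4 V0 V1, Iso 11 V0 V1 V4 V5 V2 V3], [Iso 4 V0 V5 V1 V2 V3 V4, Iso 6
  V0 V5 V1 V2 V3 V4, Iso 6 V0 V5 V1 V2 V4 V3, Iso 5 V0 V5 V1 V2 V3 V4, Iso 5 V0 V5 V2 V1 V3 V4,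
  Iso 11 V0 V5 V1 V2 V3 V4], [Iso 8 V5 V0 V1 V2 V3 V4, Iso 16 V0 V5 V1 V2 V3 V4, Iso 18 V0 V5
  V1 V3 V2 V4, Iso 18 V0 V5 V2 V3 V1 V4, Iso 14 V5 V0 V1 V2 V3 V4, Iso 27 V0 V1 V2 V5 V3 V4,
  Iso 33 V0 V1 V5 V3 V2 V4, Iso 33 V0 V2 V5 V3 V1 V4, Iso 18 V0 V5 V1 V4 V2 V3, Iso 30 V0 V1 V5
  V2 V4 V3, Iso 18 V0 V5 V2 V4 V1 V3, Iso 30 V0 V2 V5 V1 V4 V3, Iso 14 V5 V0 V1 V2 V4 V3, Iso
  27 V0 V1 V2 V5 V4 V3, Iso 30 V0 V1 V5 V2 V3 V4, Iso 30 V0 V2 V5 V1 V3 V4, Iso 32 V1 V2 V5 V0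
  V3 V4, Iso 33 V0 V1 V5 V4 V2 V3, Iso 33 V0 V2 V5 V4 V1 V3, Iso 22 V0 V5 V3 V4 V1 V2, Iso 32
  V0 V5 V3 V4 V1 V2, Iso 32 V0 V5 V4 V3 V1 V2, Iso 44 V0 V5 V3 V4 V1 V2, Iso 15 V5 V0 V1 V3 V4
  V2, Iso 28 V0 V1 V5 V2 V3 V4, Iso 34 V1 V3 V0 V5 V4 V2, Iso 31 V0 V5 V3 V2 V1 V4, Iso 31 V3
  V1 V5 V4 V2 V0, Iso 34 V1 V4 V0 V5 V3 V2, Iso 31 V0 V5 V4 V2 V1 V3, Iso 43 V0 V2 V5 V1 V4 V3,
  Iso 31 V4 V1 V5 V3 V2 V0, Iso 43 V0 V2 V5 V1 V3 V4, Iso 15 V5 V0 V2 V3 V4 V1, Iso 28 V0 V2 V5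
  V1 V3 V4, Iso 31 V0 V5 V3 V1 V2 V4, Iso 34 V2 V3 V0 V5 V4 V1, Iso 31 V3 V2 V5 V4 V1 V0, Iso
  31 V0 V5 V4 V1 V2 V3, Iso 43 V0 V1 V5 V2 V4 V3, Iso 34 V2 V4 V0 V5 V3 V1, Iso 31 V4 V2 V5 V3
  V1 V0, Iso 43 V0 V1 V5 V2 V3 V4], [Iso 9 V5 V0 V1 V2 V3 V4, Iso 21 V0 V1 V5 V2 V3 V4, Iso 21
  V1 V0 V5 V3 V2 V4, Iso 19 V0 V5 V2 V1 V3 V4, Iso 19 V1 V5 V3 V0 V2 V4, Iso 35 V0 V2 V5 V3 V1
  V4, Iso 20 V0 V1 V5 V4 V2 V3, Iso 17 V0 V5 V2 V1 V4 V3, Iso 34 V5 V1 V0 V2 V3 V4, Iso 18 V5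
  V1 V0 V2 V3 V4, Iso 33 V0 V5 V2 V1 V3 V4, Iso 34 V0 V2 V5 V1 V4 V3, Iso 18 V5 V0 V1 V3 V2 V4,
  Iso 33 V1 V5 V3 V0 V2 V4, Iso 30 V5 V0 V1 V3 V2 V4, Iso 17 V1 V5 V3 V0 V4 V2, Iso 34 V5 V0 V1
  V3 V2 V4, Iso 29 V5 V0 V1 V2 V3 V4, Iso 34 V1 V3 V5 V0 V4 V2, Iso 13 V5 V0 V1 V2 V3 V4, Iso
  27 V0 V1 V5 V2 V3 V4, Iso 27 V1 V0 V5 V3 V2 V4, Iso 34 V0 V5 V2 V3 V1 V4, Iso 34 V1 V5 V3 V2
  V0 V4, Iso 26 V0 V1 V5 V4 V2 V3, Iso 29 V0 V2 V5 V4 V1 V3, Iso 31 V5 V1 V2 V0 V3 V4, Iso 31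
  V5 V0 V3 V1 V2 V4, Iso 43 V4 V2 V3 V0 V1 V5, Iso 29 V1 V3 V5 V4 V0 V2, Iso 42 V0 V2 V5 V4 V1
  V3], [Iso 10 V5 V0 V1 V2 V3 V4, Iso 23 V0 V1 V2 V5 V3 V4, Iso 21 V5 V0 V1 V2 V3 V4, Iso 21 V5
  V0 V2 V1 V3 V4, Iso 21 V5 V1 V2 V0 V3 V4, Iso 21 V5 V0 V1 V2 V4 V3, Iso 21 V5 V0 V2 V1 V4 V3,
  Iso 21 V5 V1 V2 V0 V4 V3, Iso 16 V5 V0 V1 V2 V3 V4, Iso 27 V5 V1 V2 V0 V3 V4, Iso 27 V5 V1 V2
  V0 V4 V3, Iso 16 V5 V1 V0 V2 V3 V4, Iso 27 V5 V0 V2 V1 V3 V4, Iso 27 V5 V0 V2 V1 V4 V3, Iso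
  28 V5 V0 V1 V2 V3 V4, Iso 16 V5 V2 V0 V1 V3 V4, Iso 27 V5 V0 V1 V2 V3 V4, Iso 27 V5 V0 V1 V2
  V4 V3, Iso 28 V5 V0 V2 V1 V3 V4, Iso 28 V5 V1 V2 V0 V3 V4, Apex V5 V0 V1 V2], [Iso 24 V5 V0
  V1 V2 V3 V4, Iso 40 V5 V0 V1 V2 V3 V4, Iso 39 V5 V0 V1 V2 V3 V4, Iso 39 V5 V0 V2 V1 V3 V4,
  Iso 49 V0 V5 V1 V2 V3 V4, Iso 39 V5 V1 V2 V0 V3 V4, Iso 49 V1 V5 V0 V2 V3 V4, Iso 49 V2 V5 V0
  V1 V3 V4, Iso 52 V0 V1 V2 V3 V5 V4, Iso 39 V5 V0 V1 V2 V4 V3, Copy V5 V1 V4 V3 V2, Copy V5 V0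
  V4 V3 V2, Copy V5 V0 V4 V3 V2, Iso 39 V5 V0 V2 V1 V4 V3, Copy V5 V1 V3 V4 V2, Copy V5 V0 V4
  V3 V1, Copy V5 V0 V4 V3 V1, Iso 49 V0 V5 V1 V2 V4 V3, Copy V5 V0 V4 V3 V1, Iso 39 V5 V1 V2 V0
  V4 V3, Copy V5 V0 V3 V4 V2, Copy V5 V0 V3 V4 V1, Copy V5 V0 V3 V4 V1, Iso 49 V1 V5 V0 V2 V4
  V3, Copy V5 V0 V3 V4 V1, Iso 49 V2 V5 V0 V1 V4 V3, Copy V5 V0 V3 V4 V2, Iso 52 V0 V1 V2 V4 V5
  V3, Iso 36 V5 V0 V1 V2 V3 V4, Iso 48 V0 V5 V1 V2 V3 V4, Copy V1 V3 V4 V2 V5, Copy V2 V3 V4 V1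
  V5, Iso 47 V5 V1 V2 V0 V3 V4, Copy V0 V1 V2 V5 V4, Copy V0 V2 V1 V5 V4, Copy V1 V4 V3 V2 V5,
  Copy V1 V4 V3 V2 V5, Copy V2 V4 V3 V1 V5, Copy V2 V4 V3 V1 V5, Iso 47 V5 V1 V2 V0 V4 V3, Copy
  V1 V3 V4 V2 V5, Copy V2 V3 V4 V1 V5, Copy V0 V1 V2 V5 V3, Copy V0 V2 V1 V5 V3, Iso 36 V5 V1
  V0 V2 V3 V4, Iso 48 V1 V5 V0 V2 V3 V4, Copy V0 V3 V4 V2 V5, Iso 47 V5 V0 V2 V1 V3 V4, Copy V0
  V3 V4 V2 V5, Copy V2 V3 V4 V0 V5, Copy V1 V2 V0 V5 V4, Copy V0 V4 V3 V2 V5, Copy V0 V4 V3 V2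
  V5, Iso 47 V5 V0 V2 V1 V4 V3, Copy V0 V3 V4 V2 V5, Copy V2 V3 V4 V0 V5, Copy V0 V4 V3 V2 V5,
  Copy V2 V4 V3 V0 V5, Copy V2 V4 V3 V0 V5, Copy V1 V2 V0 V5 V3, Iso 36 V5 V2 V0 V1 V3 V4, Iso
  48 V2 V5 V0 V1 V3 V4, Iso 47 V5 V0 V1 V2 V3 V4, Copy V0 V3 V4 V1 V5, Copy V0 V3 V4 V1 V5,
  Copy V1 V3 V4 V0 V5, Copy V1 V3 V4 V0 V5, Iso 47 V5 V0 V1 V2 V4 V3, Copy V0 V3 V4 V1 V5, Copy
  V1 V3 V4 V0 V5, Copy V0 V4 V3 V1 V5, Copy V0 V4 V3 V1 V5, Copy V0 V4 V3 V1 V5, Copy V1 V4 V3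
  V0 V5, Copy V1 V4 V3 V0 V5, Copy V1 V4 V3 V0 V5], [Iso 25 V5 V0 V1 V2 V3 V4, Iso 41 V5 V0 V1
  V2 V3 V4, Iso 41 V5 V1 V0 V3 V2 V4, Iso 41 V5 V2 V0 V3 V1 V4, Iso 51 V0 V3 V5 V1 V2 V4, Iso
  41 V5 V3 V1 V2 V0 V4, Iso 51 V1 V2 V5 V0 V3 V4, Iso 37 V5 V0 V1 V2 V3 V4, Copy V5 V1 V4 V3
  V2, Copy V5 V0 V4 V2 V3, Iso 37 V5 V0 V2 V1 V3 V4, Copy V5 V1 V3 V4 V2, Copy V5 V0 V4 V1 V3,
  Iso 50 V0 V5 V1 V2 V4 V3, Copy V5 V0 V4 V1 V3, Iso 38 V5 V1 V2 V0 V3 V4, Copy V0 V1 V4 V3 V5,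
  Iso 49 V5 V1 V0 V3 V2 V4, Iso 49 V5 V2 V0 V3 V1 V4, Iso 52 V0 V3 V5 V1 V2 V4, Copy V3 V1 V4
  V0 V5, Copy V0 V4 V2 V3 V5, Copy V0 V4 V2 V3 V5, Copy V0 V4 V1 V3 V5, Copy V0 V4 V1 V3 V5,
  Copy V0 V4 V1 V3 V5, Iso 38 V5 V0 V3 V1 V2 V4, Iso 49 V5 V0 V1 V2 V3 V4, Copy V1 V0 V4 V2 V5,
  Copy V2 V0 V4 V1 V5, Iso 49 V5 V3 V1 V2 V0 V4, Iso 52 V1 V2 V5 V0 V3 V4, Copy V1 V4 V3 V2 V5,
  Copy V1 V4 V3 V2 V5, Copy V2 V4 V3 V1 V5, Copy V2 V4 V3 V1 V5, Iso 46 V5 V0 V3 V1 V2 V4, Copy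
  V0 V1 V4 V3 V5, Copy V1 V0 V4 V2 V5, Copy V2 V0 V4 V1 V5, Copy V3 V1 V4 V0 V5, Copy V0 V4 V2
  V3 V5, Copy V0 V4 V1 V3 V5, Iso 37 V5 V1 V3 V0 V2 V4, Copy V5 V0 V2 V4 V3, Copy V5 V1 V4 V0
  V2, Iso 50 V1 V5 V0 V3 V4 V2, Copy V5 V1 V4 V0 V2, Iso 45 V5 V0 V2 V1 V3 V4, Iso 53 V0 V1 V5
  V4 V2 V3, Copy V3 V4 V2 V0 V5, Copy V3 V4 V2 V0 V5, Copy V0 V4 V1 V3 V5, Copy V1 V4 V0 V2 V5,
  Copy V1 V4 V0 V2 V5, Copy V1 V4 V0 V2 V5, Copy V1 V4 V0 V2 V5, Copy V1 V4 V0 V2 V5, Copy V0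
  V4 V1 V3 V5, Iso 37 V5 V2 V3 V0 V1 V4, Copy V5 V0 V1 V4 V3, Copy V5 V1 V0 V4 V2, Iso 45 V5 V0
  V1 V2 V3 V4, Iso 50 V2 V5 V0 V3 V4 V1, Copy V5 V1 V0 V4 V2, Iso 53 V0 V2 V5 V4 V1 V3, Copy V3
  V4 V1 V0 V5, Copy V3 V4 V1 V0 V5, Copy V0 V4 V2 V3 V5, Copy V2 V4 V0 V1 V5, Copy V2 V4 V0 V1
  V5, Copy V1 V4 V3 V2 V5, Copy V2 V4 V0 V1 V5, Copy V2 V4 V0 V1 V5, Copy V0 V4 V2 V3 V5, Iso
  50 V3 V5 V1 V2 V4 V0, Copy V5 V0 V1 V4 V3, Iso 53 V1 V3 V5 V4 V0 V2, Iso 53 V2 V3 V5 V4 V0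
  V1, Iso 54 V0 V1 V4 V5 V2 V3, Copy V3 V4 V1 V0 V5]]"

text \<open>Two link edges of the new vertex that share an endpoint must not be completed by an edge
  of \<open>g\<close> to three edges on four vertices. Triangles in the link of the new vertex
  itself are left to the \<open>Apex\<close> hints.\<close>

definition compat :: "gr6 \<Rightarrow> vtx6 \<times> vtx6 \<Rightarrow> vtx6 \<times> vtx6 \<Rightarrow> bool" where
  "compat g p q = (case p of (i, j) \<Rightarrow> case q of (k, l) \<Rightarrow>
     (if i = k then \<not> adj6 g i j l else if i = l then \<not> adj6 g i j k
      else if j = k then \<not> adj6 g j i l else if j = l then \<not> adj6 g j i k else True))"

text \<open>The list \<open>fs\<close> is fuel: its length bounds the number of chosen link edges,
  and consuming a list needs no arithmetic during evaluation.\<close>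

fun grow :: "gr6 \<Rightarrow> bool list \<Rightarrow> (vtx6 \<times> vtx6) list \<Rightarrow> (vtx6 \<times> vtx6) list \<Rightarrow> bool list list" where
  "grow g fs [] ch = [[]]"
| "grow g fs (p # ps) ch = map ((#) False) (grow g fs ps ch) @
     (case fs of [] \<Rightarrow> [] | f # fs' \<Rightarrow>
        if list_all (compat g p) ch then map ((#) True) (grow g fs' ps (p # ch)) else [])"

text \<open>Fuel for the last stage, one entry per edge on the first five vertices: a vertex of
  minimum degree cannot have larger degree than that, by \<open>min_deg\<close>.\<close>

definition edge_list5 :: "gr6 \<Rightarrow> bool list" where
  "edge_list5 g = (case g of Gr b0 b1 b2 b3 b4 b5 b6 b7 b8 b9 b10 b11 b12 b13 b14 b15 b16 b17 b18 b19 \<Rightarrow>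
    filter (\<lambda>b. b) [b0, b1, b2, b3, b4, b5, b6, b7, b8, b9])"

text \<open>The vertices in \<open>fx\<close> have not been treated yet and must stay fixed. This
  keeps the vertex of minimum degree at \<open>V5\<close> until the last stage.\<close>

definition hint_ok :: "vtx6 list \<Rightarrow> gr6 list \<Rightarrow> gr6 \<Rightarrow> hint \<Rightarrow> bool" where
  "hint_ok fx rs g h = (case h of
     Iso i x0 x1 x2 x3 x4 x5 \<Rightarrow> distinct [x0, x1, x2, x3, x4, x5] \<and> i < length rs \<and>
       list_all (\<lambda>v. case_vtx6 x0 x1 x2 x3 x4 x5 v = v) fx \<and>
       gr_of (pull (adj6 g) (case_vtx6 x0 x1 x2 x3 x4 x5)) = rs ! i
   | Copy p q r s t \<Rightarrow> adj6 g p q r \<and> adj6 g q r s \<and> adj6 g r s t \<and> adj6 g s t p \<and> q \<noteq> t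
   | Apex v x y z \<Rightarrow> adj6 g v x y \<and> adj6 g v x z \<and> adj6 g v y z)"

definition link4 :: "gr6 \<Rightarrow> bool list \<Rightarrow> gr6" where
  "link4 g l = (case g of Gr b0 b1 b2 b3 b4 b5 b6 b7 b8 b9 b10 b11 b12 b13 b14 b15 b16 b17 b18 b19 \<Rightarrow>
    Gr b0 (l ! 0) (l ! 1) (l ! 2) False False False False False False False False False False False False False False False False)"

lemma link4_code [code]: "link4 (Gr b0 b1 b2 b3 b4 b5 b6 b7 b8 b9 b10 b11 b12 b13 b14 b15 b16 b17 b18 b19) [c0, c1, c2] =
    Gr b0 c0 c1 c2 False False False False False False False False False False False False False False False False"
  by (simp add: link4_def)

definition link5 :: "gr6 \<Rightarrow> bool list \<Rightarrow> gr6" where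
  "link5 g l = (case g of Gr b0 b1 b2 b3 b4 b5 b6 b7 b8 b9 b10 b11 b12 b13 b14 b15 b16 b17 b18 b19 \<Rightarrow>
    Gr b0 b1 b2 b3 (l ! 0) (l ! 1) (l ! 2) (l ! 3) (l ! 4) (l ! 5) False False False False False False False False False False)"

lemma link5_code [code]: "link5 (Gr b0 b1 b2 b3 b4 b5 b6 b7 b8 b9 b10 b11 b12 b13 b14 b15 b16 b17 b18 b19) [c0, c1, c2, c3, c4, c5] =
    Gr b0 b1 b2 b3 c0 c1 c2 c3 c4 c5 False False False False False False False False False False"
  by (simp add: link5_def)

definition link6 :: "gr6 \<Rightarrow> bool list \<Rightarrow> gr6" where
  "link6 g l = (case g of Gr b0 b1 b2 b3 b4 b5 b6 b7 b8 b9 b10 b11 b12 b13 b14 b15 b16 b17 b18 b19 \<Rightarrow>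
    Gr b0 b1 b2 b3 b4 b5 b6 b7 b8 b9 (l ! 0) (l ! 1) (l ! 2) (l ! 3) (l ! 4) (l ! 5) (l ! 6) (l ! 7) (l ! 8) (l ! 9) )"

lemma link6_code [code]: "link6 (Gr b0 b1 b2 b3 b4 b5 b6 b7 b8 b9 b10 b11 b12 b13 b14 b15 b16 b17 b18 b19) [c0, c1, c2, c3, c4, c5, c6, c7, c8, c9] =
    Gr b0 b1 b2 b3 b4 b5 b6 b7 b8 b9 c0 c1 c2 c3 c4 c5 c6 c7 c8 c9 "
  by (simp add: link6_def)

definition hints_ok :: "vtx6 list \<Rightarrow> (gr6 \<Rightarrow> bool list \<Rightarrow> gr6) \<Rightarrow> (vtx6 \<times> vtx6) list \<Rightarrow> (gr6 \<Rightarrow> bool) \<Rightarrow>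
    (gr6 \<Rightarrow> bool list) \<Rightarrow> gr6 list \<Rightarrow> gr6 \<Rightarrow> hint list \<Rightarrow> bool" where
  "hints_ok fx lk ps ok fu rs r hs \<longleftrightarrow> list_all2 (hint_ok fx rs) (filter ok (map (lk r) (grow r (fu r) ps []))) hs"

abbreviation (input) "pairs4 \<equiv> [(V0, V1), (V0, V2), (V1, V2)]"
abbreviation (input) "pairs5 \<equiv> [(V0, V1), (V0, V2), (V1, V2), (V0, V3), (V1, V3), (V2, V3)]"
abbreviation (input) "pairs6 \<equiv> [(V0, V1), (V0, V2), (V1, V2), (V0, V3), (V1, V3), (V2, V3), (V0, V4), (V1, V4), (V2, V4), (V3, V4)]"

definition cle :: "bool list \<Rightarrow> bool list \<Rightarrow> bool" where
  "cle xs ys \<longleftrightarrow> length (filter (\<lambda>b. b) xs) \<le> length (filter (\<lambda>b. b) ys)"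

text \<open>Compares, for each other vertex, the triples through \<open>V5\<close> but not through
  that vertex with the triples through that vertex but not through \<open>V5\<close>; the common
  triples cancel in the comparison of degrees.\<close>

definition min_deg6 :: "gr6 \<Rightarrow> bool" where
  "min_deg6 g \<longleftrightarrow> (case g of Gr b0 b1 b2 b3 b4 b5 b6 b7 b8 b9 b10 b11 b12 b13 b14 b15 b16 b17 b18 b19 \<Rightarrow>
    cle [b12, b14, b15, b17, b18, b19] [b0, b1, b2, b4, b5, b7] \<and>
    cle [b11, b13, b15, b16, b18, b19] [b0, b1, b3, b4, b6, b8] \<and>
    cle [b10, b13, b14, b16, b17, b19] [b0, b2, b3, b5, b6, b9] \<and>
    cle [b10, b11, b12, b16, b17, b18] [b1, b2, b3, b7, b8, b9] \<and>
    cle [b10, b11, b12, b13, b14, b15] [b4, b5, b6, b7, b8, b9])"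

section \<open>Classification of the admissible 3-graphs on six vertices\<close>

lemma hints4_ok: "list_all2 (hints_ok [V4, V5] link4 pairs4 (\<lambda>_. True) (\<lambda>_. [True, True, True]) reps4) reps3 hints4"
  by code_simp

lemma hints5_ok: "list_all2 (hints_ok [V5] link5 pairs5 (\<lambda>_. True) (\<lambda>_. [True, True, True, True, True, True]) reps5) reps4 hints5"
  by code_simp

lemma hints6_ok: "list_all2 (hints_ok [] link6 pairs6 min_deg6 edge_list5 reps6) reps5 hints6"
  by code_simp

lemma UNIV_vtx6: "UNIV = {V0, V1, V2, V3, V4, V5}"
  by (auto intro: vtx6.exhaust)

instance vtx6 :: finite
  by standard (simp add: UNIV_vtx6)

text \<open>The last clause concludes only \<open>q = t\<close> because every other pair among the
  five vertices lies in one of the four edges and is distinct by irreflexivity. The clause before it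
  rules out three edges on four vertices.\<close>

definition good6 :: "('b \<Rightarrow> 'b \<Rightarrow> 'b \<Rightarrow> bool) \<Rightarrow> bool" where
  "good6 b \<longleftrightarrow> (\<forall>x y z. b x y z = b y x z) \<and> (\<forall>x y z. b x y z = b x z y) \<and> (\<forall>x y. \<not> b x x y) \<and>
    (\<forall>v x y z. \<not> (b v x y \<and> b v x z \<and> b v y z)) \<and>
    (\<forall>p q r s t. b p q r \<longrightarrow> b q r s \<longrightarrow> b r s t \<longrightarrow> b s t p \<longrightarrow> q = t)"

lemma good6D:
  assumes "good6 b"
  shows "b x y z = b y x z" "b x y z = b x z y" "\<not> b x x y" "\<not> (b v x y \<and> b v x z \<and> b v y z)"
    "b p q r \<Longrightarrow> b q r s \<Longrightarrow> b r s t \<Longrightarrow> b s t p \<Longrightarrow> q = t"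
proof -
  note G = assms[unfolded good6_def]
  show "b x y z = b y x z" by (rule G[THEN conjunct1, rule_format])
  show "b x y z = b x z y" by (rule G[THEN conjunct2, THEN conjunct1, rule_format])
  show "\<not> b x x y" by (rule G[THEN conjunct2, THEN conjunct2, THEN conjunct1, rule_format])
  show "\<not> (b v x y \<and> b v x z \<and> b v y z)"
    by (rule G[THEN conjunct2, THEN conjunct2, THEN conjunct2, THEN conjunct1, rule_format])
  show "b p q r \<Longrightarrow> b q r s \<Longrightarrow> b r s t \<Longrightarrow> b s t p \<Longrightarrow> q = t"
    by (rule G[THEN conjunct2, THEN conjunct2, THEN conjunct2, THEN conjunct2, rule_format])
qed

lemma good6_pull:
  assumes "good6 b" "inj f"
  shows "good6 (pull b f)"
proof -
  have "q = t" if "b (f p) (f q) (f r)" "b (f q) (f r) (f s)" "b (f r) (f s) (f t)" "b (f s) (f t) (f p)" for p q r s t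
    using good6D(5)[OF assms(1) that] assms(2) by (rule injD[rotated])
  then show ?thesis unfolding good6_def pull_def
    using good6D(1-4)[OF assms(1)] by (intro conjI allI impI) assumption+
qed

definition trunc :: "'b set \<Rightarrow> ('b \<Rightarrow> 'b \<Rightarrow> 'b \<Rightarrow> bool) \<Rightarrow> 'b \<Rightarrow> 'b \<Rightarrow> 'b \<Rightarrow> bool" where
  "trunc S b x y z \<longleftrightarrow> b x y z \<and> x \<in> S \<and> y \<in> S \<and> z \<in> S"

lemma adj6_gr_of:
  assumes "\<And>x y z. b x y z = b y x z" "\<And>x y z. b x y z = b x z y" "\<And>x y. \<not> b x x y"
  shows "adj6 (gr_of b) = b"
proof (intro ext)
  fix i j k
  have n: "\<not> b x y x" "\<not> b x y y" for x y using assms by metis+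
  show "adj6 (gr_of b) i j k = b i j k"
    by (cases i; cases j; cases k) (simp_all add: gr_of_def adj6_code assms(3) n, (metis assms(1,2))+)
qed

lemma adj6_gr_of_trunc:
  assumes "good6 b"
  shows "adj6 (gr_of (trunc S b)) = trunc S b"
  by (rule adj6_gr_of) (use assms in \<open>auto simp: good6_def trunc_def\<close>)

lemma grow_complete:
  assumes "distinct ps"
    and "\<And>p q. p \<in> set ps \<Longrightarrow> P p \<Longrightarrow> q \<in> set ch \<Longrightarrow> compat g p q"
    and "\<And>p q. p \<in> set ps \<Longrightarrow> q \<in> set ps \<Longrightarrow> p \<noteq> q \<Longrightarrow> P p \<Longrightarrow> P q \<Longrightarrow> compat g p q"
    and "length (filter P ps) \<le> length fs"
  shows "map P ps \<in> set (grow g fs ps ch)"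
  using assms
proof (induction ps arbitrary: ch fs)
  case (Cons p ps)
  show ?case
  proof (cases "P p")
    case True
    then obtain f fs' where fs: "fs = f # fs'" using Cons.prems(4) by (cases fs) auto
    have "map P ps \<in> set (grow g fs' ps (p # ch))"
    proof (rule Cons.IH)
      show "compat g p' q" if "p' \<in> set ps" "P p'" "q \<in> set (p # ch)" for p' q
        using Cons.prems(1) Cons.prems(2)[of p' q] Cons.prems(3)[of p' p] that True by (cases "q = p") auto
      show "compat g p' q" if "p' \<in> set ps" "q \<in> set ps" "p' \<noteq> q" "P p'" "P q" for p' q
        using Cons.prems(3)[of p' q] that by simp
    qed (use Cons.prems(1,4) True fs in auto)
    moreover have "list_all (compat g p) ch" using Cons.prems(2) True by (auto simp: list_all_iff)
    ultimately show ?thesis using True fs by auto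
  next
    case False
    have "map P ps \<in> set (grow g fs ps ch)" using Cons.prems False by (intro Cons.IH) auto
    then show ?thesis using False by auto
  qed
qed simp

text \<open>One stage of the classification. By \<open>grow_complete\<close> the actual link of the
  new vertex is among those enumerated; its hint cannot be a copy or an apex, since
  \<open>good6 b\<close> excludes both, so it supplies the permutation.\<close>

lemma hints_ok_step:
  assumes ho: "list_all2 (hints_ok fx lk ps ok fu rs) rs0 hss"
    and r: "gr_of (trunc S b) \<in> set rs0"
    and link: "lk (gr_of (trunc S b)) (map (\<lambda>(i, j). b v i j) ps) = gr_of (trunc S' b)"
    and ok: "ok (gr_of (trunc S' b))"
    and ps: "distinct ps" "\<And>i j. (i, j) \<in> set ps \<Longrightarrow> i \<in> S \<and> j \<in> S"
       "\<And>i j. (i, j) \<in> set ps \<Longrightarrow> (j, i) \<notin> set ps"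
    and fu: "length (filter (\<lambda>(i, j). b v i j) ps) \<le> length (fu (gr_of (trunc S b)))"
    and fx: "set fx = - S'"
    and b: "good6 b"
  obtains \<rho> where "bij \<rho>" "gr_of (trunc S' (pull b \<rho>)) \<in> set rs" "\<And>x. x \<notin> S' \<Longrightarrow> \<rho> x = x"
proof -
  let ?r = "gr_of (trunc S b)" and ?g = "gr_of (trunc S' b)" and ?P = "\<lambda>(i, j). b v i j"
  obtain hs where hs: "hints_ok fx lk ps ok fu rs ?r hs"
    using ho r by (metis in_set_conv_nth list_all2_conv_all_nth)
  have sy: "b x y z = b y x z" "b x y z = b x z y" and ir: "\<not> b x x y"
    and k4: "\<not> (b u x y \<and> b u x z \<and> b u y z)" for x y z u by (rule good6D[OF b])+
  have comp: "compat ?r p q" if "p \<in> set ps" "q \<in> set ps" "p \<noteq> q" "?P p" "?P q" for p q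
  proof -
    obtain i j k l where pq: "p = (i, j)" "q = (k, l)" by (cases p; cases q)
    have K: "\<not> b c x y" if "b v c x" "b v c y" for c x y using that k4[of c v x y] sy by metis
    show ?thesis using that K sy unfolding pq compat_def adj6_gr_of_trunc[OF b] trunc_def
      by (auto; metis)
  qed
  have "map ?P ps \<in> set (grow ?r (fu ?r) ps [])"
    by (rule grow_complete) (use ps(1) comp fu in auto)
  then have "?g \<in> set (filter ok (map (lk ?r) (grow ?r (fu ?r) ps [])))"
    using link ok by (auto simp: image_iff) metis
  then obtain h where h: "hint_ok fx rs ?g h"
    using hs unfolding hints_ok_def by (metis in_set_conv_nth list_all2_conv_all_nth)
  have c5: "b p q r \<Longrightarrow> b q r s \<Longrightarrow> b r s t \<Longrightarrow> b s t p \<Longrightarrow> q = t" for p q r s t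
    by (rule good6D[OF b])
  show thesis
  proof (cases h)
    case (Iso i x0 x1 x2 x3 x4 x5)
    let ?\<rho> = "case_vtx6 x0 x1 x2 x3 x4 x5"
    have d: "distinct [x0, x1, x2, x3, x4, x5]" and i: "i < length rs"
      and f: "\<And>v. v \<in> - S' \<Longrightarrow> ?\<rho> v = v" and e: "gr_of (pull (adj6 ?g) ?\<rho>) = rs ! i"
      using h Iso fx by (auto simp: hint_ok_def list_all_iff)
    have inj: "inj ?\<rho>" using d by (intro injI) (auto split: vtx6.splits)
    then have bij: "bij ?\<rho>" by (simp add: bij_def finite_UNIV_inj_surj)
    have S: "?\<rho> x \<in> S' \<longleftrightarrow> x \<in> S'" for x using f inj by (metis ComplI injD)
    have "pull (trunc S' b) ?\<rho> = trunc S' (pull b ?\<rho>)" using S by (auto simp: pull_def trunc_def fun_eq_iff)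
    then have "gr_of (trunc S' (pull b ?\<rho>)) \<in> set rs"
      using e i unfolding adj6_gr_of_trunc[OF b] by simp
    then show thesis using that[OF bij] f by blast
  next
    case (Copy p q r s t)
    then show thesis using h c5 unfolding hint_ok_def adj6_gr_of_trunc[OF b] trunc_def by (auto; metis)
  next
    case (Apex u x y z)
    then show thesis using h k4 unfolding hint_ok_def adj6_gr_of_trunc[OF b] trunc_def by (auto; metis)
  qed
qed

definition dgv :: "(vtx6 \<Rightarrow> vtx6 \<Rightarrow> vtx6 \<Rightarrow> bool) \<Rightarrow> vtx6 \<Rightarrow> nat" where
  "dgv b v = (\<Sum>x\<in>UNIV. \<Sum>y\<in>UNIV. of_bool (b v x y))"

lemma dgv_pull: "bij \<rho> \<Longrightarrow> dgv (pull b \<rho>) v = dgv b (\<rho> v)"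
proof -
  assume b: "bij \<rho>"
  have "(\<Sum>x\<in>UNIV. \<Sum>y\<in>UNIV. of_bool (b (\<rho> v) (\<rho> x) (\<rho> y)) :: nat) =
     (\<Sum>x\<in>UNIV. \<Sum>y\<in>UNIV. of_bool (b (\<rho> v) (\<rho> x) y))"
    by (intro sum.cong refl sum.reindex_bij_betw[OF b])
  also have "\<dots> = (\<Sum>x\<in>UNIV. \<Sum>y\<in>UNIV. of_bool (b (\<rho> v) x y))"
    by (rule sum.reindex_bij_betw[OF b])
  finally show ?thesis by (simp add: dgv_def pull_def)
qed

lemma length_filter_id_Cons: "length (filter (\<lambda>b. b) (x # xs)) = of_bool x + length (filter (\<lambda>b. b) xs)"
  by simp

lemma length_filter_pair_Cons: "length (filter P (x # xs)) = of_bool (P x) + length (filter P xs)"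
  by simp

text \<open>If \<open>V5\<close> has degree d and the other five vertices span e edges, the degrees
  of those five add up to 3 e + 2 d and each is at least d; hence d \<le> e. Note that
  \<open>dgv\<close> counts every edge through a vertex twice.\<close>

lemma min_deg:
  assumes "good6 b" "\<And>v. dgv b V5 \<le> dgv b v"
  shows "min_deg6 (gr_of b)"
    "length (filter (\<lambda>(i, j). b V5 i j) pairs6) \<le> length (edge_list5 (gr_of (trunc {V0, V1, V2, V3, V4} b)))"
proof -
  have sy: "\<And>x y z. b x y z = b y x z" "\<And>x y z. b x y z = b x z y" and ir: "\<And>x y. \<not> b x x y"
    by (rule good6D[OF assms(1)])+
  have n: "\<not> b x y x" "\<not> b x y y" for x y using sy ir by metis+
  have g: "good6 b" by fact
  have D: "dgv b V5 \<le> dgv b V0" "dgv b V5 \<le> dgv b V1" "dgv b V5 \<le> dgv b V2" "dgv b V5 \<le> dgv b V3" "dgv b V5 \<le> dgv b V4"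
    using assms(2) by auto
  \<comment> \<open>Every indicator is brought to increasing order of its arguments, so that each
    edge is a single unknown for \<open>linarith\<close>.\<close>
  have s: "b V1 V0 x = b V0 V1 x" "b V2 V0 x = b V0 V2 x" "b V3 V0 x = b V0 V3 x" "b V4 V0 x = b V0 V4 x" "b V5 V0 x = b V0 V5 x"
     "b V2 V1 x = b V1 V2 x" "b V3 V1 x = b V1 V3 x" "b V4 V1 x = b V1 V4 x" "b V5 V1 x = b V1 V5 x"
     "b V3 V2 x = b V2 V3 x" "b V4 V2 x = b V2 V4 x" "b V5 V2 x = b V2 V5 x"
     "b V4 V3 x = b V3 V4 x" "b V5 V3 x = b V3 V5 x" "b V5 V4 x = b V4 V5 x" for x by (rule sy)+
  have s': "b x V1 V0 = b x V0 V1" "b x V2 V0 = b x V0 V2" "b x V3 V0 = b x V0 V3" "b x V4 V0 = b x V0 V4" "b x V5 V0 = b x V0 V5"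
     "b x V2 V1 = b x V1 V2" "b x V3 V1 = b x V1 V3" "b x V4 V1 = b x V1 V4" "b x V5 V1 = b x V1 V5"
     "b x V3 V2 = b x V2 V3" "b x V4 V2 = b x V2 V4" "b x V5 V2 = b x V2 V5"
     "b x V4 V3 = b x V3 V4" "b x V5 V3 = b x V3 V5" "b x V5 V4 = b x V4 V5" for x by (rule sy)+
  have S6: "(\<Sum>x\<in>{V0, V1, V2, V3, V4, V5}. f x) = f V0 + f V1 + f V2 + f V3 + f V4 + f V5" for f :: "vtx6 \<Rightarrow> nat"
    by (simp add: add.assoc)
  have ff: "b x x y = False" "b x y x = False" "b x y y = False" for x y using ir n by auto
  note D' = D[unfolded dgv_def UNIV_vtx6 S6, unfolded s s' ff of_bool_eq(1) add_0_left add_0_right]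
  have F: "filter (\<lambda>b. b) [] = []" "filter P [] = []" for P :: "vtx6 \<times> vtx6 \<Rightarrow> bool" by simp_all
  have M: "(V0 \<in> {V0, V1, V2, V3, V4}) = True" "(V1 \<in> {V0, V1, V2, V3, V4}) = True" "(V2 \<in> {V0, V1, V2, V3, V4}) = True"
    "(V3 \<in> {V0, V1, V2, V3, V4}) = True" "(V4 \<in> {V0, V1, V2, V3, V4}) = True" by simp_all
  show "min_deg6 (gr_of b)"
    unfolding min_deg6_def gr_of_def gr6.case cle_def length_filter_id_Cons F list.size
    using D' by (intro conjI; linarith)
  show "length (filter (\<lambda>(i, j). b V5 i j) pairs6) \<le> length (edge_list5 (gr_of (trunc {V0, V1, V2, V3, V4} b)))"
    unfolding edge_list5_def gr_of_def gr6.case length_filter_id_Cons length_filter_pair_Cons trunc_def M F list.size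
      simp_thms case_prod_conv s s'
    using D' by linarith
qed

lemma good6_classification:
  fixes b :: "vtx6 \<Rightarrow> vtx6 \<Rightarrow> vtx6 \<Rightarrow> bool"
  assumes "good6 b"
  obtains \<rho> g where "bij \<rho>" "g \<in> set reps6" "pull b \<rho> = adj6 g"
proof -
  obtain v where v: "\<And>w. dgv b v \<le> dgv b w"
    using ex_min_if_finite[of "range (dgv b)"] by (auto simp: not_less)
  \<comment> \<open>A vertex of minimum degree is moved to the last place. The first two stages fix
    \<open>V5\<close>, so its degree is still minimal when the last vertex is added.\<close>
  define \<sigma> where "\<sigma> = (\<lambda>x. if x = v then V5 else if x = V5 then v else x)"
  have bs: "bij \<sigma>" by (rule involuntory_imp_bij) (simp add: \<sigma>_def)
  define b0 where "b0 = pull b \<sigma>"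
  have g0: "good6 b0" using assms bs by (simp add: b0_def good6_pull bij_is_inj)
  have m0: "dgv b0 V5 \<le> dgv b0 w" for w 
  proof -
    have "\<sigma> V5 = v" by (simp add: \<sigma>_def)
    then show ?thesis using v by (simp add: b0_def dgv_pull[OF bs])
  qed
  have cS: "set [V4, V5] = - {V0, V1, V2, V3}" "set [V5] = - {V0, V1, V2, V3, V4}" "set [] = - (UNIV :: vtx6 set)"
    using UNIV_vtx6 by auto
  have r3: "gr_of (trunc {V0, V1, V2} b0) \<in> set reps3" by (auto simp: gr_of_def trunc_def reps3_def)
  have sy: "c V3 x y = c x y V3" "c V4 x y = c x y V4" "c V5 x y = c x y V5" if "good6 c" for c :: "vtx6 \<Rightarrow> vtx6 \<Rightarrow> vtx6 \<Rightarrow> bool" and x y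
    using good6D(1)[OF that, of _ x y] good6D(2)[OF that, of x _ y] by blast+
  have l4: "link4 (gr_of (trunc {V0, V1, V2} b0)) (map (\<lambda>(i, j). b0 V3 i j) pairs4) = gr_of (trunc {V0, V1, V2, V3} b0)"
    by (simp add: link4_def gr_of_def trunc_def sy(1)[OF g0])
  obtain \<rho>1 where 1: "bij \<rho>1" "gr_of (trunc {V0, V1, V2, V3} (pull b0 \<rho>1)) \<in> set reps4" "\<And>x. x \<notin> {V0, V1, V2, V3} \<Longrightarrow> \<rho>1 x = x"
    by (rule hints_ok_step[OF hints4_ok r3 l4 _ _ _ _ _ cS(1) g0]) auto
  define b1 where "b1 = pull b0 \<rho>1"
  have g1: "good6 b1" using g0 1(1) by (simp add: b1_def good6_pull bij_is_inj)
  have m1: "dgv b1 V5 \<le> dgv b1 w" for w using m0 1(3)[of V5] by (simp add: b1_def dgv_pull[OF 1(1)])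
  have l5: "link5 (gr_of (trunc {V0, V1, V2, V3} b1)) (map (\<lambda>(i, j). b1 V4 i j) pairs5) = gr_of (trunc {V0, V1, V2, V3, V4} b1)"
    by (simp add: link5_def gr_of_def trunc_def sy(2)[OF g1])
  obtain \<rho>2 where 2: "bij \<rho>2" "gr_of (trunc {V0, V1, V2, V3, V4} (pull b1 \<rho>2)) \<in> set reps5" "\<And>x. x \<notin> {V0, V1, V2, V3, V4} \<Longrightarrow> \<rho>2 x = x"
    by (rule hints_ok_step[OF hints5_ok 1(2)[folded b1_def] l5 _ _ _ _ _ cS(2) g1]) auto
  define b2 where "b2 = pull b1 \<rho>2"
  have g2: "good6 b2" using g1 2(1) by (simp add: b2_def good6_pull bij_is_inj)
  have m2: "dgv b2 V5 \<le> dgv b2 w" for w using m1 2(3)[of V5] by (simp add: b2_def dgv_pull[OF 2(1)])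
  have tU: "trunc UNIV b2 = b2" by (auto simp: trunc_def fun_eq_iff)
  have l6: "link6 (gr_of (trunc {V0, V1, V2, V3, V4} b2)) (map (\<lambda>(i, j). b2 V5 i j) pairs6) = gr_of (trunc UNIV b2)"
    by (simp add: link6_def gr_of_def trunc_def sy(3)[OF g2])
  have mU: "min_deg6 (gr_of (trunc UNIV b2))" using min_deg(1)[OF g2 m2] tU by simp
  obtain \<rho>3 where 3: "bij \<rho>3" "gr_of (trunc UNIV (pull b2 \<rho>3)) \<in> set reps6"
    by (rule hints_ok_step[OF hints6_ok 2(2)[folded b2_def] l6 mU _ _ _ min_deg(2)[OF g2 m2] cS(3) g2]) auto
  have g3: "good6 (pull b2 \<rho>3)" using g2 3(1) by (simp add: good6_pull bij_is_inj)
  have "pull b (\<sigma> \<circ> \<rho>1 \<circ> \<rho>2 \<circ> \<rho>3) = pull b2 \<rho>3" by (simp add: b2_def b1_def b0_def pull_def fun_eq_iff)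
  also have "\<dots> = trunc UNIV (pull b2 \<rho>3)" by (auto simp: trunc_def fun_eq_iff)
  also have "\<dots> = adj6 (gr_of (trunc UNIV (pull b2 \<rho>3)))" by (rule adj6_gr_of_trunc[OF g3, symmetric])
  finally show thesis
    using 3(2) by (intro that[of "\<sigma> \<circ> \<rho>1 \<circ> \<rho>2 \<circ> \<rho>3"]) (auto intro!: bij_comp bs 1(1) 2(1) 3(1))
qed

section \<open>Sums over permutations of six vertices and over samples of six vertices\<close>

definition vs6 :: "vtx6 list" where "vs6 = [V0, V1, V2, V3, V4, V5]"

lemma sum_selects:
  "distinct (ys @ xs) \<Longrightarrow> (\<Sum>(x, r)\<leftarrow>selects ys xs. f x r) = (\<Sum>x\<in>set xs. f x (remove1 x (ys @ xs)))"
proof (induction xs arbitrary: ys)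
  case (Cons x xs)
  have "(\<Sum>(x, r)\<leftarrow>selects (ys @ [x]) xs. f x r) = (\<Sum>z\<in>set xs. f z (remove1 z (ys @ x # xs)))"
    using Cons by simp
  moreover have "remove1 x (ys @ x # xs) = ys @ xs" using Cons.prems by (simp add: remove1_append)
  ultimately show ?case using Cons.prems by simp
qed simp

lemma sum_selects_Nil:
  assumes "distinct xs" "\<And>x r. x \<in> set xs \<Longrightarrow> distinct r \<Longrightarrow> set r = set xs - {x} \<Longrightarrow> f x r = g x"
  shows "(\<Sum>(x, r)\<leftarrow>selects [] xs. f x r) = (\<Sum>x\<in>set xs. g x)"
  using assms by (subst sum_selects) (auto intro!: sum.cong)

lemma sum6_eq_set:
  "distinct vs \<Longrightarrow> sum6 vs f = (\<Sum>x0\<in>set vs. \<Sum>x1\<in>set vs - {x0}. \<Sum>x2\<in>set vs - {x0} - {x1}.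
     \<Sum>x3\<in>set vs - {x0} - {x1} - {x2}. \<Sum>x4\<in>set vs - {x0} - {x1} - {x2} - {x3}.
     \<Sum>x5\<in>set vs - {x0} - {x1} - {x2} - {x3} - {x4}. f x0 x1 x2 x3 x4 x5)"
  unfolding sum6_def by (intro sum_selects_Nil) (simp_all add: sum_selects_Nil)

abbreviation "ap6 f \<phi> \<equiv> f (\<phi> V0) (\<phi> V1) (\<phi> V2) (\<phi> V3) (\<phi> V4) (\<phi> V5)"

lemma sum_bij_eq_sum6: "(\<Sum>\<rho>\<in>{\<rho> :: vtx6 \<Rightarrow> vtx6. bij \<rho>}. ap6 f \<rho>) = sum6 vs6 f"
proof -
  let ?D = "SIGMA x0:(UNIV :: vtx6 set). SIGMA x1:UNIV - {x0}. SIGMA x2:UNIV - {x0} - {x1}. SIGMA x3:UNIV - {x0} - {x1} - {x2}.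
     SIGMA x4:UNIV - {x0} - {x1} - {x2} - {x3}. UNIV - {x0} - {x1} - {x2} - {x3} - {x4}"
  have "bij_betw (\<lambda>\<rho>. (\<rho> V0, \<rho> V1, \<rho> V2, \<rho> V3, \<rho> V4, \<rho> V5)) {\<rho> :: vtx6 \<Rightarrow> vtx6. bij \<rho>} ?D"
  proof (rule bij_betwI[where g = "\<lambda>(x0, x1, x2, x3, x4, x5). case_vtx6 x0 x1 x2 x3 x4 x5"])
    show "(\<lambda>\<rho>. (\<rho> V0, \<rho> V1, \<rho> V2, \<rho> V3, \<rho> V4, \<rho> V5)) \<in> {\<rho>. bij \<rho>} \<rightarrow> ?D"
      by (auto simp: bij_def inj_eq)
    show "(\<lambda>(x0, x1, x2, x3, x4, x5). case_vtx6 x0 x1 x2 x3 x4 x5) \<in> ?D \<rightarrow> {\<rho>. bij \<rho>}"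
    proof (rule funcsetI)
      fix p assume "p \<in> ?D"
      obtain x0 x1 x2 x3 x4 x5 where p: "p = (x0, x1, x2, x3, x4, x5)" by (cases p) auto
      have *: "distinct [x0, x1, x2, x3, x4, x5]" using \<open>p \<in> ?D\<close> unfolding p by auto
      have "inj (case_vtx6 x0 x1 x2 x3 x4 x5)" using * by (intro injI) (auto split: vtx6.splits)
      with finite_UNIV_inj_surj[OF finite this]
      show "(case p of (x0, x1, x2, x3, x4, x5) \<Rightarrow> case_vtx6 x0 x1 x2 x3 x4 x5) \<in> {\<rho>. bij \<rho>}"
        by (simp add: p bij_def)
    qed
  qed (auto simp: fun_eq_iff split: vtx6.split)
  then have "(\<Sum>\<rho>\<in>{\<rho> :: vtx6 \<Rightarrow> vtx6. bij \<rho>}. ap6 f \<rho>) = (\<Sum>(x0, x1, x2, x3, x4, x5)\<in>?D. f x0 x1 x2 x3 x4 x5)"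
    by (subst sum.reindex_bij_betw[symmetric, where h = "\<lambda>\<rho>. (\<rho> V0, \<rho> V1, \<rho> V2, \<rho> V3, \<rho> V4, \<rho> V5)"]) auto
  also have "\<dots> = sum6 vs6 f"
    by (subst sum6_eq_set) (simp_all add: vs6_def sum.Sigma flip: UNIV_vtx6)
  finally show ?thesis .
qed

definition maps :: "'a set \<Rightarrow> (vtx6 \<Rightarrow> 'a) set" where "maps S = {\<phi>. \<forall>i. \<phi> i \<in> S}"

lemma sum_maps:
  "(\<Sum>\<phi>\<in>maps S. ap6 f \<phi>) = (\<Sum>x0\<in>S. \<Sum>x1\<in>S. \<Sum>x2\<in>S. \<Sum>x3\<in>S. \<Sum>x4\<in>S. \<Sum>x5\<in>S. f x0 x1 x2 x3 x4 x5)"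
proof -
  have "bij_betw (\<lambda>\<phi>. (\<phi> V0, \<phi> V1, \<phi> V2, \<phi> V3, \<phi> V4, \<phi> V5)) (maps S) (S \<times> S \<times> S \<times> S \<times> S \<times> S)"
    by (rule bij_betwI[where g = "\<lambda>(x0, x1, x2, x3, x4, x5). case_vtx6 x0 x1 x2 x3 x4 x5"])
      (auto simp: maps_def fun_eq_iff split: vtx6.split)
  then have "(\<Sum>\<phi>\<in>maps S. ap6 f \<phi>) = (\<Sum>(x0, x1, x2, x3, x4, x5)\<in>S \<times> S \<times> S \<times> S \<times> S \<times> S. f x0 x1 x2 x3 x4 x5)"
    by (subst sum.reindex_bij_betw[symmetric, where h = "\<lambda>\<phi>. (\<phi> V0, \<phi> V1, \<phi> V2, \<phi> V3, \<phi> V4, \<phi> V5)"]) auto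
  also have "\<dots> = (\<Sum>x0\<in>S. \<Sum>x1\<in>S. \<Sum>x2\<in>S. \<Sum>x3\<in>S. \<Sum>x4\<in>S. \<Sum>x5\<in>S. f x0 x1 x2 x3 x4 x5)"
    by (simp add: sum.cartesian_product split_def)
  finally show ?thesis .
qed

lemma sum_maps_perm:
  assumes "bij \<rho>"
  shows "(\<Sum>\<phi>\<in>maps S. g (\<phi> \<circ> \<rho>)) = (\<Sum>\<phi>\<in>maps S. g \<phi>)"
  by (rule sum.reindex_bij_witness[where i = "\<lambda>\<phi>. \<phi> \<circ> inv \<rho>" and j = "\<lambda>\<phi>. \<phi> \<circ> \<rho>"])
    (use assms in \<open>auto simp: maps_def fun_eq_iff bij_is_surj surj_f_inv_f bij_is_inj\<close>)

lemma bij_extension: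
  fixes f :: "'b::finite \<Rightarrow> 'b"
  assumes "inj_on f A"
  obtains \<rho> where "bij \<rho>" "\<And>x. x \<in> A \<Longrightarrow> \<rho> x = f x"
proof -
  have "card (- A) = card (- f ` A)" using assms by (simp add: Compl_eq_Diff_UNIV card_Diff_subset card_image)
  then obtain h where h: "bij_betw h (- A) (- f ` A)" using finite_same_card_bij[of "- A" "- f ` A"] by auto
  have "bij_betw f A (f ` A)" using assms by (simp add: bij_betw_def)
  then have "bij_betw (\<lambda>x. if x \<in> A then f x else h x) (A \<union> - A) (f ` A \<union> - f ` A)"
    using h by (intro bij_betw_disjoint_Un) auto
  then show thesis by (intro that[of "\<lambda>x. if x \<in> A then f x else h x"]) auto
qed


lemma card_bij_vtx6: "card {\<rho> :: vtx6 \<Rightarrow> vtx6. bij \<rho>} = 720"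
proof -
  have "int (card {\<rho> :: vtx6 \<Rightarrow> vtx6. bij \<rho>}) = (\<Sum>\<rho>\<in>{\<rho> :: vtx6 \<Rightarrow> vtx6. bij \<rho>}. ap6 (\<lambda>_ _ _ _ _ _. 1) \<rho>)" by simp
  also have "\<dots> = sum6 vs6 (\<lambda>_ _ _ _ _ _. 1)" by (rule sum_bij_eq_sum6)
  also have "\<dots> = 720" by code_simp
  finally show ?thesis by simp
qed

locale c5graph =
  fixes V :: "'a set" and E :: "'a set set"
  assumes tg: "three_graph V E" and fr: "C5m_free V E"
begin

definition adj :: "'a \<Rightarrow> 'a \<Rightarrow> 'a \<Rightarrow> bool" where "adj x y z \<longleftrightarrow> {x, y, z} \<in> E"

lemma finV: "finite V" and finE: "finite E"
  using three_graph_finite[OF tg] by auto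

lemma adj_sym: "adj x y z = adj y x z" "adj x y z = adj x z y"
  unfolding adj_def by (simp_all add: insert_commute)

lemma adjD:
  assumes "adj x y z"
  shows "x \<in> V" "y \<in> V" "z \<in> V" "x \<noteq> y" "x \<noteq> z" "y \<noteq> z"
  using three_graph_edgeD[OF tg assms[unfolded adj_def]] by (auto simp: card_three_eq)

text \<open>The form in which freeness is used from here on: exhibit four edges in the pattern and
  conclude that two vertices coincide.\<close>

lemma adj_C5:
  assumes "adj p q r" "adj q r s" "adj r s t" "adj s t p"
  shows "q = t"
proof (rule ccontr)
  assume "q \<noteq> t"
  then have "distinct [p, q, r, s, t]" "{p, q, r, s, t} \<subseteq> V"
    using assms[THEN adjD(1)] assms[THEN adjD(2)] assms[THEN adjD(3)] assms[THEN adjD(4)] assms[THEN adjD(5)]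
      assms[THEN adjD(6)] by auto
  then show False
    using fr[unfolded C5m_free_iff, rule_format, of p q r s t] assms unfolding adj_def by blast
qed

text \<open>The vertices \<open>x\<close>, \<open>v\<close>, \<open>y\<close>, \<open>z\<close>,
  \<open>w\<close>, in this order, would form a forbidden copy. Consequently at most n^3 of the n^4
  ordered quadruples satisfy \<open>K4\<close>.\<close>

lemma one_apex:
  assumes "adj v x y" "adj v x z" "adj v y z" "adj w x y" "adj w x z" "adj w y z"
  shows "v = w"
  using adj_C5[of x v y z w] assms adj_sym by metis

definition K4 :: "'a \<Rightarrow> 'a \<Rightarrow> 'a \<Rightarrow> 'a \<Rightarrow> bool" where
  "K4 v x y z \<longleftrightarrow> adj v x y \<and> adj v x z \<and> adj v y z"

lemma K4_count: "(\<Sum>v\<in>V. of_bool (K4 v x y z) :: int) \<le> 1"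
proof (cases "\<exists>w\<in>V. K4 w x y z")
  case True
  then obtain w where w: "w \<in> V" "K4 w x y z" by blast
  have "(\<Sum>v\<in>V. of_bool (K4 v x y z) :: int) \<le> (\<Sum>v\<in>V. of_bool (v = w))"
    using w one_apex unfolding K4_def by (intro sum_mono) auto
  also have "\<dots> = 1" using w finV by (simp add: of_bool_def)
  finally show ?thesis .
next
  case False
  then have "(\<Sum>v\<in>V. of_bool (K4 v x y z) :: int) = 0" by (intro sum.neutral) auto
  then show ?thesis by simp
qed

lemma good6_pull_adj:
  assumes "inj \<phi>" "\<And>i j k l. distinct [i, j, k, l] \<Longrightarrow> \<not> K4 (\<phi> i) (\<phi> j) (\<phi> k) (\<phi> l)"
  shows "good6 (pull adj \<phi>)"
  unfolding good6_def pull_def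
proof (intro conjI allI impI notI)
  show "adj (\<phi> x) (\<phi> y) (\<phi> z) = adj (\<phi> y) (\<phi> x) (\<phi> z)" "adj (\<phi> x) (\<phi> y) (\<phi> z) = adj (\<phi> x) (\<phi> z) (\<phi> y)" for x y z
    by (rule adj_sym)+
  show False if "adj (\<phi> x) (\<phi> x) (\<phi> y)" for x y using adjD(4)[OF that] by simp
  show False if a: "adj (\<phi> v) (\<phi> x) (\<phi> y) \<and> adj (\<phi> v) (\<phi> x) (\<phi> z) \<and> adj (\<phi> v) (\<phi> y) (\<phi> z)" for v x y z
  proof -
    have "distinct [v, x, y, z]" using a adjD(4-6)[of "\<phi> v" "\<phi> x" "\<phi> y"] adjD(4-6)[of "\<phi> v" "\<phi> x" "\<phi> z"] adjD(4-6)[of "\<phi> v" "\<phi> y" "\<phi> z"]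
      by auto
    from assms(2)[OF this] a show False unfolding K4_def by blast
  qed
  show "q = t" if "adj (\<phi> p) (\<phi> q) (\<phi> r)" "adj (\<phi> q) (\<phi> r) (\<phi> s)" "adj (\<phi> r) (\<phi> s) (\<phi> t)" "adj (\<phi> s) (\<phi> t) (\<phi> p)" for p q r s t
    using adj_C5[OF that] assms(1) by (simp add: inj_eq)
qed

text \<open>Averages over all maps of six points into \<open>V\<close>. Symmetrized over the 720
  permutations, an injective sample without \<open>K4\<close> contributes at least 720
  \<open>c\<close> by the classification, and any other sample at least -720 \<open>C\<close>. The
  exceptional samples are of order n^5. The naturality assumptions say that the integrand depends
  only on the sampled 3-graph.\<close>

lemma flag_average:
  fixes G :: "'a \<Rightarrow> 'a \<Rightarrow> 'a \<Rightarrow> 'a \<Rightarrow> 'a \<Rightarrow> 'a \<Rightarrow> int"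
    and Gv :: "(vtx6 \<Rightarrow> vtx6 \<Rightarrow> vtx6 \<Rightarrow> bool) \<Rightarrow> vtx6 \<Rightarrow> vtx6 \<Rightarrow> vtx6 \<Rightarrow> vtx6 \<Rightarrow> vtx6 \<Rightarrow> vtx6 \<Rightarrow> int"
  assumes nat: "\<And>\<phi> x0 x1 x2 x3 x4 x5. G (\<phi> x0) (\<phi> x1) (\<phi> x2) (\<phi> x3) (\<phi> x4) (\<phi> x5) = Gv (pull adj \<phi>) x0 x1 x2 x3 x4 x5"
    and natv: "\<And>b \<rho> x0 x1 x2 x3 x4 x5. Gv b (\<rho> x0) (\<rho> x1) (\<rho> x2) (\<rho> x3) (\<rho> x4) (\<rho> x5) = Gv (pull b \<rho>) x0 x1 x2 x3 x4 x5"
    and bd: "\<And>x0 x1 x2 x3 x4 x5. - C \<le> G x0 x1 x2 x3 x4 x5"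
    and reps: "\<And>g. g \<in> set reps6 \<Longrightarrow> 720 * c \<le> sum6 vs6 (Gv (adj6 g))" and c: "0 \<le> c" "0 \<le> C"
  shows "c * int (card V) ^ 6 - (C + c) * 1440 * int (card V) ^ 5 \<le>
    (\<Sum>x0\<in>V. \<Sum>x1\<in>V. \<Sum>x2\<in>V. \<Sum>x3\<in>V. \<Sum>x4\<in>V. \<Sum>x5\<in>V. G x0 x1 x2 x3 x4 x5)"
proof -
  let ?B = "{\<rho> :: vtx6 \<Rightarrow> vtx6. bij \<rho>}" and ?n = "int (card V)"
  have finB: "finite ?B" by simp
  define t where "t \<phi> = (\<Sum>\<rho>\<in>?B. ap6 G (\<phi> \<circ> \<rho>))" for \<phi>
  \<comment> \<open>Summing over all permutations moves a coincidence or a \<open>K4\<close> in any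
    positions to the first ones, so every exceptional sample is counted at least once.\<close>
  define bad where "bad \<phi> = (\<Sum>\<rho>\<in>?B. of_bool (\<phi> (\<rho> V0) = \<phi> (\<rho> V1)) +
     of_bool (K4 (\<phi> (\<rho> V0)) (\<phi> (\<rho> V1)) (\<phi> (\<rho> V2)) (\<phi> (\<rho> V3))) :: int)" for \<phi>
  have bad_nonneg: "bad \<phi> \<ge> 0" for \<phi> unfolding bad_def by (intro sum_nonneg) auto
  have t_lower: "t \<phi> \<ge> 720 * c - 720 * (C + c) * bad \<phi>" for \<phi>
  proof (cases "inj \<phi> \<and> (\<forall>i j k l. distinct [i, j, k, l] \<longrightarrow> \<not> K4 (\<phi> i) (\<phi> j) (\<phi> k) (\<phi> l))")
    case True
    then have "good6 (pull adj \<phi>)" by (intro good6_pull_adj) auto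
    then obtain \<rho>0 g where g: "bij \<rho>0" "g \<in> set reps6" "pull (pull adj \<phi>) \<rho>0 = adj6 g" by (rule good6_classification)
    have "t \<phi> = (\<Sum>\<rho>\<in>?B. ap6 (Gv (pull adj \<phi>)) \<rho>)" unfolding t_def comp_def nat ..
    also have "\<dots> = (\<Sum>\<rho>\<in>?B. ap6 (Gv (pull adj \<phi>)) (\<rho>0 \<circ> \<rho>))"
      by (rule sum.reindex_bij_witness[where i = "\<lambda>\<rho>. \<rho>0 \<circ> \<rho>" and j = "\<lambda>\<rho>. inv \<rho>0 \<circ> \<rho>"])
        (use g(1) in \<open>auto simp: fun_eq_iff bij_is_surj surj_f_inv_f bij_is_inj intro!: bij_comp bij_imp_bij_inv\<close>)
    also have "\<dots> = (\<Sum>\<rho>\<in>?B. ap6 (Gv (adj6 g)) \<rho>)" unfolding comp_def natv g(3) ..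
    also have "\<dots> = sum6 vs6 (Gv (adj6 g))" by (rule sum_bij_eq_sum6)
    finally have "t \<phi> \<ge> 720 * c" using reps[OF g(2)] by simp
    moreover have "720 * (C + c) * bad \<phi> \<ge> 0" using c bad_nonneg by simp
    ultimately show ?thesis by linarith
  next
    case False
    have "bad \<phi> \<ge> 1"
    proof -
      have *: "bad \<phi> \<ge> 1" if "\<rho> \<in> ?B" "\<phi> (\<rho> V0) = \<phi> (\<rho> V1) \<or> K4 (\<phi> (\<rho> V0)) (\<phi> (\<rho> V1)) (\<phi> (\<rho> V2)) (\<phi> (\<rho> V3))" for \<rho>
      proof -
        have "1 \<le> (of_bool (\<phi> (\<rho> V0) = \<phi> (\<rho> V1)) + of_bool (K4 (\<phi> (\<rho> V0)) (\<phi> (\<rho> V1)) (\<phi> (\<rho> V2)) (\<phi> (\<rho> V3))) :: int)"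
          using that(2) by auto
        also have "\<dots> \<le> bad \<phi>" unfolding bad_def by (rule member_le_sum[OF that(1)]) auto
        finally show ?thesis .
      qed
      from False consider i j where "i \<noteq> j" "\<phi> i = \<phi> j" |
        i j k l where "distinct [i, j, k, l]" "K4 (\<phi> i) (\<phi> j) (\<phi> k) (\<phi> l)" by (auto simp: inj_def)
      then show ?thesis
      proof cases
        case 1
        have "inj_on (case_vtx6 i j i i i i) {V0, V1}" using 1 by auto
        then obtain \<rho> where r: "bij \<rho>" "\<And>x. x \<in> {V0, V1} \<Longrightarrow> \<rho> x = case_vtx6 i j i i i i x" by (rule bij_extension) blast
        show ?thesis by (rule *[of \<rho>]) (use r 1 in auto)
      next
        case 2
        have "inj_on (case_vtx6 i j k l i i) {V0, V1, V2, V3}" using 2 by auto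
        then obtain \<rho> where r: "bij \<rho>" "\<And>x. x \<in> {V0, V1, V2, V3} \<Longrightarrow> \<rho> x = case_vtx6 i j k l i i x" by (rule bij_extension) blast
        show ?thesis by (rule *[of \<rho>]) (use r 2 in auto)
      qed
    qed
    then have "720 * (C + c) * bad \<phi> \<ge> 720 * (C + c) * 1" using c by (intro mult_left_mono) auto
    moreover have "t \<phi> \<ge> (\<Sum>\<rho>\<in>?B. - C)" unfolding t_def by (intro sum_mono bd)
    ultimately show ?thesis by (simp add: card_bij_vtx6 algebra_simps)
  qed
  have sum_const: "(\<Sum>\<phi>\<in>maps V. K) = K * ?n ^ 6" for K :: int
  proof -
    have "(\<Sum>\<phi>\<in>maps V. K) = (\<Sum>x0\<in>V. \<Sum>x1\<in>V. \<Sum>x2\<in>V. \<Sum>x3\<in>V. \<Sum>x4\<in>V. \<Sum>x5\<in>V. K)"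
      by (rule sum_maps[where f = "\<lambda>_ _ _ _ _ _. K"])
    also have "\<dots> = K * ?n ^ 6" by (simp add: power_numeral_reduce algebra_simps)
    finally show ?thesis .
  qed
  have "(\<Sum>\<phi>\<in>maps V. bad \<phi>) = (\<Sum>\<rho>\<in>?B. \<Sum>\<phi>\<in>maps V. ap6 (\<lambda>x0 x1 x2 x3 x4 x5. of_bool (x0 = x1) + of_bool (K4 x0 x1 x2 x3)) (\<phi> \<circ> \<rho>))"
    unfolding bad_def by (subst sum.swap) (simp add: comp_def)
  also have "\<dots> = 720 * (\<Sum>\<phi>\<in>maps V. ap6 (\<lambda>x0 x1 x2 x3 x4 x5. of_bool (x0 = x1) + of_bool (K4 x0 x1 x2 x3)) \<phi>)"
  proof -
    have "(\<Sum>\<phi>\<in>maps V. ap6 (\<lambda>x0 x1 x2 x3 x4 x5. of_bool (x0 = x1) + of_bool (K4 x0 x1 x2 x3)) (\<phi> \<circ> \<rho>)) =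
       (\<Sum>\<phi>\<in>maps V. ap6 (\<lambda>x0 x1 x2 x3 x4 x5. of_bool (x0 = x1) + of_bool (K4 x0 x1 x2 x3) :: int) \<phi>)" if "\<rho> \<in> ?B" for \<rho>
      using that by (intro sum_maps_perm[where g = "\<lambda>\<phi>. ap6 (\<lambda>x0 x1 x2 x3 x4 x5. of_bool (x0 = x1) + of_bool (K4 x0 x1 x2 x3)) \<phi>"]) simp
    then show ?thesis by (simp add: card_bij_vtx6)
  qed
  \<comment> \<open>One n^5 comes from \<open>x0 = x1\<close>, the other from \<open>K4\<close>,
    where the apex is determined by the other three vertices.\<close>
  also have "(\<Sum>\<phi>\<in>maps V. ap6 (\<lambda>x0 x1 x2 x3 x4 x5. of_bool (x0 = x1) + of_bool (K4 x0 x1 x2 x3) :: int) \<phi>) \<le> 2 * ?n ^ 5"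
  proof -
    have "(\<Sum>x0\<in>V. \<Sum>x1\<in>V. \<Sum>x2\<in>V. \<Sum>x3\<in>V. \<Sum>x4\<in>V. \<Sum>x5\<in>V. of_bool (x0 = x1) :: int) = ?n ^ 5"
    proof -
      have "(\<Sum>x1\<in>V. of_bool (x0 = x1) :: int) = 1" if "x0 \<in> V" for x0
        using that finV by (simp add: of_bool_def sum.delta)
      then have "(\<Sum>x0\<in>V. \<Sum>x1\<in>V. of_bool (x0 = x1) :: int) = ?n" by simp
      then show ?thesis by (simp add: power_numeral_reduce algebra_simps flip: sum_distrib_left sum_distrib_right)
    qed
    moreover have "(\<Sum>x0\<in>V. \<Sum>x1\<in>V. \<Sum>x2\<in>V. \<Sum>x3\<in>V. \<Sum>x4\<in>V. \<Sum>x5\<in>V. of_bool (K4 x0 x1 x2 x3) :: int) \<le> ?n ^ 5"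
    proof -
      have "(\<Sum>x0\<in>V. \<Sum>x1\<in>V. \<Sum>x2\<in>V. \<Sum>x3\<in>V. of_bool (K4 x0 x1 x2 x3) :: int) =
         (\<Sum>x1\<in>V. \<Sum>x2\<in>V. \<Sum>x3\<in>V. \<Sum>x0\<in>V. of_bool (K4 x0 x1 x2 x3))"
      proof -
        have "(\<Sum>x0\<in>V. \<Sum>x1\<in>V. \<Sum>x2\<in>V. \<Sum>x3\<in>V. of_bool (K4 x0 x1 x2 x3) :: int) =
          (\<Sum>x1\<in>V. \<Sum>x0\<in>V. \<Sum>x2\<in>V. \<Sum>x3\<in>V. of_bool (K4 x0 x1 x2 x3))" by (rule sum.swap)
        also have "\<dots> = (\<Sum>x1\<in>V. \<Sum>x2\<in>V. \<Sum>x0\<in>V. \<Sum>x3\<in>V. of_bool (K4 x0 x1 x2 x3))" by (intro sum.cong refl sum.swap)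
        also have "\<dots> = (\<Sum>x1\<in>V. \<Sum>x2\<in>V. \<Sum>x3\<in>V. \<Sum>x0\<in>V. of_bool (K4 x0 x1 x2 x3))" by (intro sum.cong refl sum.swap)
        finally show ?thesis .
      qed
      also have "\<dots> \<le> (\<Sum>x1\<in>V. \<Sum>x2\<in>V. \<Sum>x3\<in>V. 1)" by (intro sum_mono K4_count)
      also have "\<dots> = ?n ^ 3" by (simp add: power3_eq_cube)
      finally have le: "(\<Sum>x0\<in>V. \<Sum>x1\<in>V. \<Sum>x2\<in>V. \<Sum>x3\<in>V. of_bool (K4 x0 x1 x2 x3) :: int) \<le> ?n ^ 3" .
      have "(\<Sum>x0\<in>V. \<Sum>x1\<in>V. \<Sum>x2\<in>V. \<Sum>x3\<in>V. \<Sum>x4\<in>V. \<Sum>x5\<in>V. of_bool (K4 x0 x1 x2 x3) :: int)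
         = ?n ^ 2 * (\<Sum>x0\<in>V. \<Sum>x1\<in>V. \<Sum>x2\<in>V. \<Sum>x3\<in>V. of_bool (K4 x0 x1 x2 x3))"
        by (simp add: sum_distrib_left power2_eq_square mult.assoc)
      also have "\<dots> \<le> ?n ^ 2 * ?n ^ 3" using le by (intro mult_left_mono) auto
      finally show ?thesis by (simp flip: power_add)
    qed
    moreover have "(\<Sum>\<phi>\<in>maps V. ap6 (\<lambda>x0 x1 x2 x3 x4 x5. of_bool (x0 = x1) + of_bool (K4 x0 x1 x2 x3) :: int) \<phi>) =
      (\<Sum>x0\<in>V. \<Sum>x1\<in>V. \<Sum>x2\<in>V. \<Sum>x3\<in>V. \<Sum>x4\<in>V. \<Sum>x5\<in>V. of_bool (x0 = x1)) +
      (\<Sum>x0\<in>V. \<Sum>x1\<in>V. \<Sum>x2\<in>V. \<Sum>x3\<in>V. \<Sum>x4\<in>V. \<Sum>x5\<in>V. of_bool (K4 x0 x1 x2 x3))"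
      unfolding sum.distrib[symmetric]
      by (rule sum_maps[where f = "\<lambda>x0 x1 x2 x3 x4 x5. of_bool (x0 = x1) + of_bool (K4 x0 x1 x2 x3)"])
    ultimately show ?thesis by linarith
  qed
  finally have badsum: "(\<Sum>\<phi>\<in>maps V. bad \<phi>) \<le> 1440 * ?n ^ 5" by simp
  have "720 * (\<Sum>\<phi>\<in>maps V. ap6 G \<phi>) = (\<Sum>\<rho>\<in>?B. \<Sum>\<phi>\<in>maps V. ap6 G (\<phi> \<circ> \<rho>))"
  proof -
    have "(\<Sum>\<phi>\<in>maps V. ap6 G (\<phi> \<circ> \<rho>)) = (\<Sum>\<phi>\<in>maps V. ap6 G \<phi>)" if "\<rho> \<in> ?B" for \<rho>
      using that by (intro sum_maps_perm[where g = "\<lambda>\<phi>. ap6 G \<phi>"]) simp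
    then show ?thesis by (simp add: card_bij_vtx6)
  qed
  also have "\<dots> = (\<Sum>\<phi>\<in>maps V. t \<phi>)" unfolding t_def by (rule sum.swap)
  also have "\<dots> \<ge> (\<Sum>\<phi>\<in>maps V. 720 * c - 720 * (C + c) * bad \<phi>)" by (intro sum_mono t_lower)
  finally have "720 * (\<Sum>\<phi>\<in>maps V. ap6 G \<phi>) \<ge> 720 * c * ?n ^ 6 - 720 * (C + c) * (\<Sum>\<phi>\<in>maps V. bad \<phi>)"
    using sum_const[of 1] by (simp add: sum_subtractf mult.commute flip: sum_distrib_left sum_distrib_right)
  moreover have "(C + c) * (\<Sum>\<phi>\<in>maps V. bad \<phi>) \<le> (C + c) * (1440 * ?n ^ 5)"
    using badsum c by (intro mult_left_mono) auto
  ultimately have "c * ?n ^ 6 - (C + c) * 1440 * ?n ^ 5 \<le> (\<Sum>\<phi>\<in>maps V. ap6 G \<phi>)" by (simp add: algebra_simps)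
  then show ?thesis by (simp add: sum_maps)
qed

end

text \<open>For summands that vanish unless \<open>P\<close> holds for the first four vertices, the
  guard skips the two innermost sums and shortens the evaluation.\<close>

definition sum6g :: "'b list \<Rightarrow> ('b \<Rightarrow> 'b \<Rightarrow> 'b \<Rightarrow> 'b \<Rightarrow> bool) \<Rightarrow>
    ('b \<Rightarrow> 'b \<Rightarrow> 'b \<Rightarrow> 'b \<Rightarrow> 'b \<Rightarrow> 'b \<Rightarrow> int) \<Rightarrow> int" where
  "sum6g vs P f = (\<Sum>(x0, r0)\<leftarrow>selects [] vs. \<Sum>(x1, r1)\<leftarrow>selects [] r0. \<Sum>(x2, r2)\<leftarrow>selects [] r1.
     \<Sum>(x3, r3)\<leftarrow>selects [] r2. if P x0 x1 x2 x3 then \<Sum>(x4, r4)\<leftarrow>selects [] r3. \<Sum>(x5, r5)\<leftarrow>selects [] r4. f x0 x1 x2 x3 x4 x5 else 0)"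

lemma sum_list_0: "(\<And>x r. (x, r) \<in> set xs \<Longrightarrow> f x r = (0::int)) \<Longrightarrow> (\<Sum>(x, r)\<leftarrow>xs. f x r) = 0"
  by (induction xs) auto

lemma sum6_guard:
  assumes "\<And>x0 x1 x2 x3 x4 x5. \<not> P x0 x1 x2 x3 \<Longrightarrow> f x0 x1 x2 x3 x4 x5 = 0"
  shows "sum6 vs f = sum6g vs P f"
proof -
  have "(if P x0 x1 x2 x3 then \<Sum>(x4, r4)\<leftarrow>selects [] r3. \<Sum>(x5, r5)\<leftarrow>selects [] r4. f x0 x1 x2 x3 x4 x5 else 0) =
    (\<Sum>(x4, r4)\<leftarrow>selects [] r3. \<Sum>(x5, r5)\<leftarrow>selects [] r4. f x0 x1 x2 x3 x4 x5)" for x0 x1 x2 x3 and r3 :: "'a list"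
    using assms by (auto intro!: sum_list_0[symmetric] sum_list_0)
  then show ?thesis unfolding sum6_def sum6g_def by presburger
qed

lemma sum_list_add: "(\<Sum>(x, r)\<leftarrow>xs. f x r + g x r) = (\<Sum>(x, r)\<leftarrow>xs. f x r) + (\<Sum>(x, r)\<leftarrow>xs. g x r :: int)"
  by (induction xs) auto
lemma sum_list_mult: "(\<Sum>(x, r)\<leftarrow>xs. c * f x r) = c * (\<Sum>(x, r)\<leftarrow>xs. f x r :: int)"
  by (induction xs) (auto simp: algebra_simps)

lemma sum6_add: "sum6 vs (\<lambda>x0 x1 x2 x3 x4 x5. f x0 x1 x2 x3 x4 x5 + g x0 x1 x2 x3 x4 x5) = sum6 vs f + sum6 vs g"
  unfolding sum6_def sum_list_add ..
lemma sum6_mult: "sum6 vs (\<lambda>x0 x1 x2 x3 x4 x5. c * f x0 x1 x2 x3 x4 x5) = c * sum6 vs f"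
  unfolding sum6_def sum_list_mult ..

lemma selects_length: "(x, r) \<in> set (selects ys xs) \<Longrightarrow> Suc (length r) = length ys + length xs"
  by (induction xs arbitrary: ys) fastforce+

text \<open>The 24 orderings of the four free vertices fall into three pairings, each with eight
  orderings of equal value.\<close>

definition pair_eval :: "(vtx6 \<Rightarrow> vtx6 \<Rightarrow> vtx6 \<Rightarrow> bool) \<Rightarrow> int" where
  "pair_eval b = (\<Sum>(x0, r0)\<leftarrow>selects [] vs6. \<Sum>(x1, r1)\<leftarrow>selects [] r0. case r1 of [p, q, r, s] \<Rightarrow>
     sos_pair b x0 x1 p q r s + sos_pair b x0 x1 p r q s + sos_pair b x0 x1 p s q r | _ \<Rightarrow> 0)"

lemma tab_pair_sym: "i < 9 \<Longrightarrow> j < 9 \<Longrightarrow> tab_pair ! i ! j = tab_pair ! j ! i"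
proof -
  have "list_all (\<lambda>i. list_all (\<lambda>j. tab_pair ! i ! j = tab_pair ! j ! i) [0..<9]) [0..<9]" by code_simp
  then show "i < 9 \<Longrightarrow> j < 9 \<Longrightarrow> tab_pair ! i ! j = tab_pair ! j ! i" by (simp add: list_all_iff)
qed

lemma flag_pair_less: "flag_pair a y z u w < 9"
  by (simp add: flag_pair_def)
lemma flag_empty_less: "flag_empty a x0 x1 x2 x3 u < 19"
  by (simp add: flag_empty_def)
lemma flag_edge_less: "flag_edge a x0 x1 x2 x3 u < 21"
  by (simp add: flag_edge_def)

lemma pair_eval:
  assumes "\<And>x y z. b x y z = b x z y"
  shows "sum6 vs6 (sos_pair b) = 8 * pair_eval b"
proof -
  have f: "flag_pair b x y u w = flag_pair b x y w u" for x y u w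
    unfolding flag_pair_def assms[of _ u w] by auto
  have s1: "sos_pair b x y u w p q = sos_pair b x y w u p q" "sos_pair b x y u w p q = sos_pair b x y u w q p"
    "sos_pair b x y u w p q = sos_pair b x y p q u w" for x y u w p q
    unfolding sos_pair_def f[of _ _ u w] f[of _ _ p q] by (simp_all add: f tab_pair_sym flag_pair_less)
  have L: "(\<Sum>(x2, r2)\<leftarrow>selects [] [p, q, r, s]. \<Sum>(x3, r3)\<leftarrow>selects [] r2. \<Sum>(x4, r4)\<leftarrow>selects [] r3. \<Sum>(x5, r5)\<leftarrow>selects [] r4.
      sos_pair b x0 x1 x2 x3 x4 x5) =
      8 * (sos_pair b x0 x1 p q r s + sos_pair b x0 x1 p r q s + sos_pair b x0 x1 p s q r)" for x0 x1 p q r s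
  proof -
    have E: "sos_pair b x0 x1 w u p q = sos_pair b x0 x1 u w p q" "sos_pair b x0 x1 u w q p = sos_pair b x0 x1 u w p q"
      "sos_pair b x0 x1 w u q p = sos_pair b x0 x1 u w p q" "sos_pair b x0 x1 p q u w = sos_pair b x0 x1 u w p q"
      "sos_pair b x0 x1 q p u w = sos_pair b x0 x1 u w p q" "sos_pair b x0 x1 p q w u = sos_pair b x0 x1 u w p q"
      "sos_pair b x0 x1 q p w u = sos_pair b x0 x1 u w p q" for u w p q
      by (rule s1(1), rule s1(2), rule trans[OF s1(1) s1(2)], rule s1(3), rule trans[OF s1(1) s1(3)],
        rule trans[OF s1(2) s1(3)], rule trans[OF s1(1) trans[OF s1(2) s1(3)]])
    note E3 = E[where u = p and w = q and p = r and q = s] E[where u = p and w = r and p = q and q = s]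
      E[where u = p and w = s and p = q and q = r]
    show ?thesis by (simp add: E3)
  qed
  define I where "I x0 x1 r1 = (\<Sum>(x2, r2)\<leftarrow>selects [] r1. \<Sum>(x3, r3)\<leftarrow>selects [] r2. \<Sum>(x4, r4)\<leftarrow>selects [] r3.
    \<Sum>(x5, r5)\<leftarrow>selects [] r4. sos_pair b x0 x1 x2 x3 x4 x5)" for x0 x1 r1
  define J where "J x0 x1 r1 = (case r1 of [p, q, r, s] \<Rightarrow>
     sos_pair b x0 x1 p q r s + sos_pair b x0 x1 p r q s + sos_pair b x0 x1 p s q r | _ \<Rightarrow> 0)" for x0 x1 r1
  have IJ: "I x0 x1 r1 = 8 * J x0 x1 r1" if l: "length r1 = 4" for x0 x1 r1
  proof -
    obtain p q r s where "r1 = [p, q, r, s]" using l by (auto simp: length_Suc_conv numeral_eq_Suc)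
    then show ?thesis unfolding I_def J_def by (simp only: L list.case)
  qed
  have "(\<Sum>(x1, r1)\<leftarrow>selects [] r0. I x0 x1 r1) = (\<Sum>(x1, r1)\<leftarrow>selects [] r0. 8 * J x0 x1 r1)" if "length r0 = 5" for x0 r0
    by (rule arg_cong[of _ _ sum_list], rule map_cong) (use that IJ selects_length in \<open>fastforce+\<close>)
  then have "(\<Sum>(x0, r0)\<leftarrow>selects [] vs6. \<Sum>(x1, r1)\<leftarrow>selects [] r0. I x0 x1 r1) =
      (\<Sum>(x0, r0)\<leftarrow>selects [] vs6. \<Sum>(x1, r1)\<leftarrow>selects [] r0. 8 * J x0 x1 r1)"
    by (intro arg_cong[of _ _ sum_list] map_cong) (auto dest!: selects_length simp: vs6_def simp del: selects.simps)
  then show ?thesis unfolding sum6_def pair_eval_def I_def[symmetric] J_def[symmetric] by (simp only: sum_list_mult)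
qed

definition star_term :: "('b \<Rightarrow> 'b \<Rightarrow> 'b \<Rightarrow> bool) \<Rightarrow> 'b \<Rightarrow> 'b \<Rightarrow> 'b \<Rightarrow> 'b \<Rightarrow> 'b \<Rightarrow> 'b \<Rightarrow> int" where
  "star_term a x0 x1 x2 x3 x4 x5 = star3 a x0 x1 x2 x3 x4 * (1 - 4 * of_bool (a x2 x3 x4))"

definition edge_term :: "('b \<Rightarrow> 'b \<Rightarrow> 'b \<Rightarrow> bool) \<Rightarrow> 'b \<Rightarrow> 'b \<Rightarrow> 'b \<Rightarrow> 'b \<Rightarrow> 'b \<Rightarrow> 'b \<Rightarrow> int" where
  "edge_term a x0 x1 x2 x3 x4 x5 = of_bool (a x0 x1 x2)"

definition cert_eval :: "(vtx6 \<Rightarrow> vtx6 \<Rightarrow> vtx6 \<Rightarrow> bool) \<Rightarrow> int" where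
  "cert_eval b = 169 * sum6g vs6 (\<lambda>x y z _. b x y z) (obj6 b)
     + (- 8) * pair_eval b
     + (- 1) * sum6g vs6 (\<lambda>x0 x1 x2 x3. \<not> (b x0 x1 x2 \<or> b x0 x1 x3 \<or> b x0 x2 x3 \<or> b x1 x2 x3)) (sos_empty b)
     + (- 1) * sum6g vs6 (\<lambda>x0 x1 x2 x3. b x1 x2 x3 \<and> \<not> b x0 x1 x2 \<and> \<not> b x0 x1 x3 \<and> \<not> b x0 x2 x3) (sos_edge b)
     + (- 5042016) * sum6g vs6 (\<lambda>x y z _. b x y z) (edge_term b)
     + 1260504 * 720
     + (- 4919621) * sum6g vs6 (\<lambda>x y z u. b x y z \<and> b x y u) (star_term b)"

lemma sum6_const: "sum6 vs6 (\<lambda>_ _ _ _ _ _. c) = 720 * c"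
proof -
  have "sum6 vs6 (\<lambda>_ _ _ _ _ _. c) = sum6 vs6 (\<lambda>_ _ _ _ _ _. c * 1)" by simp
  also have "\<dots> = c * sum6 vs6 (\<lambda>_ _ _ _ _ _. 1)" by (rule sum6_mult)
  also have "sum6 vs6 (\<lambda>_ _ _ _ _ _. 1) = 720" by code_simp
  finally show ?thesis by simp
qed

lemma cert_eval:
  assumes "\<And>x y z. b x y z = b x z y"
  shows "sum6 vs6 (cert6 b) = cert_eval b"
proof -
  have "cert6 b = (\<lambda>x0 x1 x2 x3 x4 x5. 169 * obj6 b x0 x1 x2 x3 x4 x5 + (- 1) * sos_pair b x0 x1 x2 x3 x4 x5
     + (- 1) * sos_empty b x0 x1 x2 x3 x4 x5 + (- 1) * sos_edge b x0 x1 x2 x3 x4 x5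
     + (- 5042016) * edge_term b x0 x1 x2 x3 x4 x5 + 1260504 + (- 4919621) * star_term b x0 x1 x2 x3 x4 x5)"
    unfolding cert6_def star_term_def edge_term_def by (intro ext) simp
  then have "sum6 vs6 (cert6 b) = 169 * sum6 vs6 (obj6 b) + (- 1) * sum6 vs6 (sos_pair b) + (- 1) * sum6 vs6 (sos_empty b)
     + (- 1) * sum6 vs6 (sos_edge b) + (- 5042016) * sum6 vs6 (edge_term b) + 720 * 1260504 + (- 4919621) * sum6 vs6 (star_term b)"
    by (simp only: sum6_add sum6_mult sum6_const)
  moreover have "sum6 vs6 (obj6 b) = sum6g vs6 (\<lambda>x y z _. b x y z) (obj6 b)"
    by (rule sum6_guard) (simp add: obj6_def)
  moreover have "sum6 vs6 (sos_empty b) = sum6g vs6 (\<lambda>x0 x1 x2 x3. \<not> (b x0 x1 x2 \<or> b x0 x1 x3 \<or> b x0 x2 x3 \<or> b x1 x2 x3)) (sos_empty b)"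
    by (rule sum6_guard) (simp add: sos_empty_def)
  moreover have "sum6 vs6 (sos_edge b) = sum6g vs6 (\<lambda>x0 x1 x2 x3. b x1 x2 x3 \<and> \<not> b x0 x1 x2 \<and> \<not> b x0 x1 x3 \<and> \<not> b x0 x2 x3) (sos_edge b)"
    by (rule sum6_guard) (auto simp: sos_edge_def)
  moreover have "sum6 vs6 (edge_term b) = sum6g vs6 (\<lambda>x y z _. b x y z) (edge_term b)"
    by (rule sum6_guard) (simp add: edge_term_def)
  moreover have "sum6 vs6 (star_term b) = sum6g vs6 (\<lambda>x y z u. b x y z \<and> b x y u) (star_term b)"
    by (rule sum6_guard) (auto simp: star_term_def star3_def)
  ultimately show ?thesis using pair_eval[of b] assms unfolding cert_eval_def by simp
qed

lemma adj6_sym: "adj6 g x y z = adj6 g x z y"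
  by (cases g; cases x; cases y; cases z) (simp_all add: adj6_code)

text \<open>72000 is 100 for each of the 720 orderings. This margin absorbs the error terms in
  \<open>exists_good_edge\<close>.\<close>

lemma cert_reps_eval: "list_all (\<lambda>g. 72000 \<le> cert_eval (adj6 g)) reps6"
  by code_simp

text \<open>The second, smaller certificate: the weighted codegree cubes never exceed the weight
  1260504 carried by the edge density. It is needed because \<open>L\<close> may exceed 1/4.\<close>

lemma star_reps_eval: "list_all (\<lambda>g. 4919621 * sum6g vs6 (\<lambda>x y z u. adj6 g x y z \<and> adj6 g x y u)
    (\<lambda>x0 x1 x2 x3 x4 x5. star3 (adj6 g) x0 x1 x2 x3 x4) \<le> 720 * 1260504) reps6"
  by code_simp

lemma cert_reps: "g \<in> set reps6 \<Longrightarrow> 720 * 100 \<le> sum6 vs6 (cert6 (adj6 g))"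
  using cert_reps_eval by (simp add: cert_eval[OF adj6_sym] list_all_iff)

text \<open>Writing the table as a Gram matrix turns the double sum into a sum of squares of linear
  forms, one for each vector.\<close>

lemma psd_sum:
  fixes tab vecs :: "int list list" and f :: "'b \<Rightarrow> nat"
  assumes "\<And>i j. i < N \<Longrightarrow> j < N \<Longrightarrow> tab ! i ! j = (\<Sum>v\<leftarrow>vecs. v ! i * v ! j)" "\<And>u. f u < N"
  shows "0 \<le> (\<Sum>u\<in>U. \<Sum>w\<in>U. tab ! f u ! f w)"
proof -
  have "(\<Sum>u\<in>U. \<Sum>w\<in>U. tab ! f u ! f w) = (\<Sum>u\<in>U. \<Sum>w\<in>U. \<Sum>v\<leftarrow>vecs. v ! f u * v ! f w)"
    using assms by simp
  also have "\<dots> = (\<Sum>v\<leftarrow>vecs. \<Sum>u\<in>U. \<Sum>w\<in>U. v ! f u * v ! f w)"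
    by (induction vecs) (simp_all add: sum.distrib)
  also have "\<dots> = (\<Sum>v\<leftarrow>vecs. (\<Sum>u\<in>U. v ! f u) ^ 2)"
    by (simp add: power2_eq_square sum_product)
  also have "\<dots> \<ge> 0" by (rule sum_list_nonneg) auto
  finally show ?thesis .
qed

lemma tab_pair_gram: "i < 9 \<Longrightarrow> j < 9 \<Longrightarrow> tab_pair ! i ! j = (\<Sum>v\<leftarrow>vecs_pair. v ! i * v ! j)"
proof -
  have "list_all (\<lambda>i. list_all (\<lambda>j. tab_pair ! i ! j = (\<Sum>v\<leftarrow>vecs_pair. v ! i * v ! j)) [0..<9]) [0..<9]" by code_simp
  then show "i < 9 \<Longrightarrow> j < 9 \<Longrightarrow> tab_pair ! i ! j = (\<Sum>v\<leftarrow>vecs_pair. v ! i * v ! j)" by (simp add: list_all_iff)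
qed

lemma tab_empty_gram: "i < 19 \<Longrightarrow> j < 19 \<Longrightarrow> tab_empty ! i ! j = (\<Sum>v\<leftarrow>vecs_empty. v ! i * v ! j)"
proof -
  have "list_all (\<lambda>i. list_all (\<lambda>j. tab_empty ! i ! j = (\<Sum>v\<leftarrow>vecs_empty. v ! i * v ! j)) [0..<19]) [0..<19]" by code_simp
  then show "i < 19 \<Longrightarrow> j < 19 \<Longrightarrow> tab_empty ! i ! j = (\<Sum>v\<leftarrow>vecs_empty. v ! i * v ! j)" by (simp add: list_all_iff)
qed

lemma tab_edge_gram: "i < 21 \<Longrightarrow> j < 21 \<Longrightarrow> tab_edge ! i ! j = (\<Sum>v\<leftarrow>vecs_edge. v ! i * v ! j)"
proof -
  have "list_all (\<lambda>i. list_all (\<lambda>j. tab_edge ! i ! j = (\<Sum>v\<leftarrow>vecs_edge. v ! i * v ! j)) [0..<21]) [0..<21]" by code_simp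
  then show "i < 21 \<Longrightarrow> j < 21 \<Longrightarrow> tab_edge ! i ! j = (\<Sum>v\<leftarrow>vecs_edge. v ! i * v ! j)" by (simp add: list_all_iff)
qed

lemma tab_bounds:
  "i < 9 \<Longrightarrow> j < 9 \<Longrightarrow> tab_pair ! i ! j \<le> 10 ^ 9"
  "i < 19 \<Longrightarrow> j < 19 \<Longrightarrow> tab_empty ! i ! j \<le> 10 ^ 9"
  "i < 21 \<Longrightarrow> j < 21 \<Longrightarrow> tab_edge ! i ! j \<le> 10 ^ 9"
proof -
  have "list_all (\<lambda>i. list_all (\<lambda>j. tab_pair ! i ! j \<le> 10 ^ 9) [0..<9]) [0..<9]"
    "list_all (\<lambda>i. list_all (\<lambda>j. tab_empty ! i ! j \<le> 10 ^ 9) [0..<19]) [0..<19]"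
    "list_all (\<lambda>i. list_all (\<lambda>j. tab_edge ! i ! j \<le> 10 ^ 9) [0..<21]) [0..<21]" by code_simp+
  then show "i < 9 \<Longrightarrow> j < 9 \<Longrightarrow> tab_pair ! i ! j \<le> 10 ^ 9"
    "i < 19 \<Longrightarrow> j < 19 \<Longrightarrow> tab_empty ! i ! j \<le> 10 ^ 9"
    "i < 21 \<Longrightarrow> j < 21 \<Longrightarrow> tab_edge ! i ! j \<le> 10 ^ 9" by (simp_all add: list_all_iff)
qed

text \<open>A crude bound suffices, since it only enters the n^5 term of
  \<open>flag_average\<close>.\<close>

lemma cert6_bound: "- (10 ^ 10) \<le> cert6 a x0 x1 x2 x3 x4 x5"
proof -
  have cov: "cov6 a x y z u = 0 \<or> cov6 a x y z u = 1" for x y z u by (simp add: cov6_def)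
  have "obj6 a x0 x1 x2 x3 x4 x5 \<ge> - 50000"
    using cov[of x0 x1 x2 x3] cov[of x0 x1 x2 x4] cov[of x0 x1 x2 x5] unfolding obj6_def by (auto simp: of_bool_def)
  moreover have "sos_pair a x0 x1 x2 x3 x4 x5 \<le> 10 ^ 9"
    unfolding sos_pair_def by (intro tab_bounds flag_pair_less)
  moreover have "sos_empty a x0 x1 x2 x3 x4 x5 \<le> 10 ^ 9"
  proof -
    have "tab_empty ! flag_empty a x0 x1 x2 x3 x4 ! flag_empty a x0 x1 x2 x3 x5 \<le> 10 ^ 9"
      by (intro tab_bounds flag_empty_less)
    then show ?thesis unfolding sos_empty_def by simp
  qed
  moreover have "sos_edge a x0 x1 x2 x3 x4 x5 \<le> 10 ^ 9"
  proof -
    have "tab_edge ! flag_edge a x0 x1 x2 x3 x4 ! flag_edge a x0 x1 x2 x3 x5 \<le> 10 ^ 9"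
      by (intro tab_bounds flag_edge_less)
    then show ?thesis unfolding sos_edge_def by simp
  qed
  moreover have "star3 a x0 x1 x2 x3 x4 * (1 - 4 * of_bool (a x2 x3 x4)) \<le> 1" by (simp add: star3_def of_bool_def)
  moreover have "(4 * of_bool (a x0 x1 x2) - 1 :: int) \<le> 3" by (simp add: of_bool_def)
  ultimately show ?thesis unfolding cert6_def by simp
qed

lemma cert6_pull: "cert6 a (f x0) (f x1) (f x2) (f x3) (f x4) (f x5) = cert6 (pull a f) x0 x1 x2 x3 x4 x5"
  unfolding cert6_def obj6_def sos_pair_def sos_empty_def sos_edge_def star3_def cov6_def part6_def
    flag_pair_def flag_empty_def flag_edge_def pull_def ..

lemma ordered_triples:
  assumes "card e = 3"
  shows "card {(u, v, w). {u, v, w} = e} = 6"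
proof -
  obtain x y z where e: "e = {x, y, z}" "x \<noteq> y" "x \<noteq> z" "y \<noteq> z" using assms by (auto simp: card_3_iff)
  have "{(u, v, w). {u, v, w} = e} = {(x, y, z), (x, z, y), (y, x, z), (y, z, x), (z, x, y), (z, y, x)}"
  proof (intro subset_antisym subsetI)
    fix t assume "t \<in> {(u, v, w). {u, v, w} = e}"
    then obtain u v w where t: "t = (u, v, w)" and s: "{u, v, w} = {x, y, z}" using e(1) by auto
    have "u \<in> {x, y, z}" "v \<in> {x, y, z}" "w \<in> {x, y, z}" unfolding s[symmetric] by simp_all
    moreover have "u \<noteq> v" "u \<noteq> w" "v \<noteq> w" using assms unfolding e(1) s[symmetric] card_three_eq by blast+
    ultimately show "t \<in> {(x, y, z), (x, z, y), (y, x, z), (y, z, x), (z, x, y), (z, y, x)}"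
      unfolding t insert_iff empty_iff prod.inject by metis
  next
    fix t assume "t \<in> {(x, y, z), (x, z, y), (y, x, z), (y, z, x), (z, x, y), (z, y, x)}"
    then show "t \<in> {(u, v, w). {u, v, w} = e}" unfolding e(1) by (elim insertE emptyE) (simp_all add: insert_commute)
  qed
  then show ?thesis using e(2-4) by simp
qed

section \<open>From the certificate to a dense triple of vertex sets\<close>

context c5graph
begin

lemma sum_adj_eq:
  assumes "W \<subseteq> V"
  shows "(\<Sum>u\<in>W. \<Sum>v\<in>W. \<Sum>w\<in>W. of_bool (adj u v w)) = 6 * int (card (induced_edges E W))"
proof -
  have fW: "finite W" using assms finV by (rule finite_subset)
  have "(\<Sum>u\<in>W. \<Sum>v\<in>W. \<Sum>w\<in>W. of_bool (adj u v w) :: int) = (\<Sum>(u, v, w)\<in>W \<times> W \<times> W. of_bool (adj u v w))"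
    by (simp add: sum.cartesian_product split_def)
  also have "\<dots> = int (card {(u, v, w) \<in> W \<times> W \<times> W. adj u v w})"
    using fW by (simp add: split_def of_bool_def sum.If_cases Int_def mem_Times_iff conj_assoc)
  also have "{(u, v, w) \<in> W \<times> W \<times> W. adj u v w} = (\<Union>e\<in>induced_edges E W. {(u, v, w). {u, v, w} = e})"
    by (auto simp: induced_edges_def adj_def)
  also have "card \<dots> = (\<Sum>e\<in>induced_edges E W. card {(u, v, w). {u, v, w} = e})"
  proof (rule card_UN_disjoint)
    show "finite (induced_edges E W)" using finE by (simp add: induced_edges_def)
    show "\<forall>e\<in>induced_edges E W. finite {(u, v, w). {u, v, w} = e}"
    proof
      fix e assume "e \<in> induced_edges E W"
      then have "card e = 3" using three_graph_edgeD[OF tg] by (auto simp: induced_edges_def)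
      from ordered_triples[OF this] show "finite {(u, v, w). {u, v, w} = e}" by (metis card.infinite zero_neq_numeral)
    qed
  qed auto
  also have "\<dots> = (\<Sum>e\<in>induced_edges E W. 6)"
    by (intro sum.cong refl ordered_triples) (use three_graph_edgeD[OF tg] in \<open>auto simp: induced_edges_def\<close>)
  finally show ?thesis by simp
qed

lemma induced_V: "induced_edges E V = E"
  using three_graph_edgeD[OF tg] by (auto simp: induced_edges_def)

definition nbh :: "'a \<Rightarrow> 'a \<Rightarrow> 'a set" where "nbh y z = {u \<in> V. adj y z u}"

lemma nbh_sub: "nbh y z \<subseteq> V"
  by (auto simp: nbh_def)

lemma star_sum: "(\<Sum>u\<in>V. \<Sum>v\<in>V. \<Sum>w\<in>V. star3 adj y z u v w) = int (card (nbh y z)) ^ 3"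
proof -
  have "(\<Sum>u\<in>V. \<Sum>v\<in>V. \<Sum>w\<in>V. star3 adj y z u v w) = (\<Sum>u\<in>V. of_bool (adj y z u)) * (\<Sum>u\<in>V. of_bool (adj y z u)) * (\<Sum>u\<in>V. of_bool (adj y z u))"
    unfolding star3_def sum_product sum_distrib_left sum_distrib_right
    by (intro sum.cong refl) (auto simp: of_bool_def)
  also have "(\<Sum>u\<in>V. of_bool (adj y z u) :: int) = int (card (nbh y z))"
    using finV by (simp add: nbh_def of_bool_def sum.If_cases Int_def)
  finally show ?thesis by (simp add: power3_eq_cube)
qed

lemma star_adj_sum: "(\<Sum>u\<in>V. \<Sum>v\<in>V. \<Sum>w\<in>V. star3 adj y z u v w * of_bool (adj u v w)) = 6 * int (card (induced_edges E (nbh y z)))"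
proof -
  have "(\<Sum>u\<in>V. \<Sum>v\<in>V. \<Sum>w\<in>V. star3 adj y z u v w * of_bool (adj u v w)) = (\<Sum>u\<in>nbh y z. \<Sum>v\<in>nbh y z. \<Sum>w\<in>nbh y z. of_bool (adj u v w))"
  proof -
    have r: "(\<Sum>u\<in>nbh y z. g u) = (\<Sum>u\<in>V. of_bool (adj y z u) * g u)" for g :: "'a \<Rightarrow> int"
      unfolding nbh_def by (subst sum.inter_filter[OF finV]) (auto intro!: sum.cong)
    show ?thesis unfolding r sum_distrib_left
      by (intro sum.cong refl) (auto simp: star3_def of_bool_def)
  qed
  also have "\<dots> = 6 * int (card (induced_edges E (nbh y z)))" by (rule sum_adj_eq[OF nbh_sub])
  finally show ?thesis .
qed

abbreviation "sumV6 f \<equiv> (\<Sum>x0\<in>V. \<Sum>x1\<in>V. \<Sum>x2\<in>V. \<Sum>x3\<in>V. \<Sum>x4\<in>V. \<Sum>x5\<in>V. f x0 x1 x2 x3 x4 x5)"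

text \<open>With the roots fixed, the two groups of free vertices vary independently over the same
  range, which is the situation of \<open>psd_sum\<close>.\<close>

lemma sos_nonneg: "0 \<le> sumV6 (sos_pair adj)" "0 \<le> sumV6 (sos_empty adj)" "0 \<le> sumV6 (sos_edge adj)"
proof -
  have P: "0 \<le> (\<Sum>x2\<in>V. \<Sum>x3\<in>V. \<Sum>x4\<in>V. \<Sum>x5\<in>V. sos_pair adj x0 x1 x2 x3 x4 x5)" for x0 x1
  proof -
    have "(\<Sum>x2\<in>V. \<Sum>x3\<in>V. \<Sum>x4\<in>V. \<Sum>x5\<in>V. sos_pair adj x0 x1 x2 x3 x4 x5) =
      (\<Sum>p\<in>V \<times> V. \<Sum>q\<in>V \<times> V. tab_pair ! (case p of (u, w) \<Rightarrow> flag_pair adj x0 x1 u w) ! (case q of (u, w) \<Rightarrow> flag_pair adj x0 x1 u w))"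
      unfolding sos_pair_def by (simp add: sum.cartesian_product')
    also have "\<dots> \<ge> 0" by (rule psd_sum[OF tab_pair_gram]) (auto simp: flag_pair_less)
    finally show ?thesis .
  qed
  show "0 \<le> sumV6 (sos_pair adj)" by (rule sum_nonneg, rule sum_nonneg, rule P)
  have P: "0 \<le> (\<Sum>x4\<in>V. \<Sum>x5\<in>V. sos_empty adj x0 x1 x2 x3 x4 x5)" for x0 x1 x2 x3
    using psd_sum[of 19 tab_empty vecs_empty "flag_empty adj x0 x1 x2 x3" V, OF tab_empty_gram flag_empty_less] unfolding sos_empty_def
    by (cases "adj x0 x1 x2"; cases "adj x0 x1 x3"; cases "adj x0 x2 x3"; cases "adj x1 x2 x3"; simp)
  show "0 \<le> sumV6 (sos_empty adj)" by (rule sum_nonneg, rule sum_nonneg, rule sum_nonneg, rule sum_nonneg, rule P)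
  have P: "0 \<le> (\<Sum>x4\<in>V. \<Sum>x5\<in>V. sos_edge adj x0 x1 x2 x3 x4 x5)" for x0 x1 x2 x3
    using psd_sum[of 21 tab_edge vecs_edge "flag_edge adj x0 x1 x2 x3" V, OF tab_edge_gram flag_edge_less] unfolding sos_edge_def
    by (cases "adj x0 x1 x2"; cases "adj x0 x1 x3"; cases "adj x0 x2 x3"; cases "adj x1 x2 x3"; simp)
  show "0 \<le> sumV6 (sos_edge adj)" by (rule sum_nonneg, rule sum_nonneg, rule sum_nonneg, rule sum_nonneg, rule P)
qed

text \<open>Bounds the sum of the codegree cubes. In \<open>exists_good_edge\<close> this makes the
  cofactor of 4 \<open>L\<close> - 1 nonnegative up to order n^5.\<close>

lemma star_average: "4919621 * (int (card V) * (\<Sum>y\<in>V. \<Sum>z\<in>V. int (card (nbh y z)) ^ 3)) \<le> 1260504 * int (card V) ^ 6 + 10 ^ 11 * int (card V) ^ 5"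
proof -
  have "0 * int (card V) ^ 6 - (10 ^ 7 + 0) * 1440 * int (card V) ^ 5 \<le>
     sumV6 (\<lambda>x0 x1 x2 x3 x4 x5. 1260504 - 4919621 * star3 adj x0 x1 x2 x3 x4)"
  proof (rule flag_average[where Gv = "\<lambda>b x0 x1 x2 x3 x4 x5. 1260504 - 4919621 * star3 b x0 x1 x2 x3 x4"])
    fix g assume g: "g \<in> set reps6"
    have "sum6 vs6 (\<lambda>x0 x1 x2 x3 x4 x5. 1260504 - 4919621 * star3 (adj6 g) x0 x1 x2 x3 x4) =
      sum6 vs6 (\<lambda>x0 x1 x2 x3 x4 x5. 1260504 + (- 4919621) * star3 (adj6 g) x0 x1 x2 x3 x4)" by simp
    also have "\<dots> = 720 * 1260504 + (- 4919621) * sum6 vs6 (\<lambda>x0 x1 x2 x3 x4 x5. star3 (adj6 g) x0 x1 x2 x3 x4)"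
      by (simp only: sum6_add sum6_mult sum6_const)
    also have "sum6 vs6 (\<lambda>x0 x1 x2 x3 x4 x5. star3 (adj6 g) x0 x1 x2 x3 x4) =
      sum6g vs6 (\<lambda>x y z u. adj6 g x y z \<and> adj6 g x y u) (\<lambda>x0 x1 x2 x3 x4 x5. star3 (adj6 g) x0 x1 x2 x3 x4)"
      by (rule sum6_guard) (auto simp: star3_def)
    finally show "720 * 0 \<le> sum6 vs6 (\<lambda>x0 x1 x2 x3 x4 x5. 1260504 - 4919621 * star3 (adj6 g) x0 x1 x2 x3 x4)"
      using star_reps_eval g by (simp add: list_all_iff)
  qed (auto simp: star3_def pull_def)
  also have "\<dots> = 1260504 * int (card V) ^ 6 - 4919621 * (int (card V) * (\<Sum>y\<in>V. \<Sum>z\<in>V. int (card (nbh y z)) ^ 3))"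
    by (simp add: sum_subtractf sum_distrib_left[symmetric] star_sum) (simp add: power_numeral_reduce algebra_simps)
  finally have "0 * int (card V) ^ 6 - (10 ^ 7 + 0) * 1440 * int (card V) ^ 5 \<le>
    1260504 * int (card V) ^ 6 - 4919621 * (int (card V) * (\<Sum>y\<in>V. \<Sum>z\<in>V. int (card (nbh y z)) ^ 3))" .
  then have a: "- (14400000000 * int (card V) ^ 5) \<le>
    1260504 * int (card V) ^ 6 - 4919621 * (int (card V) * (\<Sum>y\<in>V. \<Sum>z\<in>V. int (card (nbh y z)) ^ 3))" by simp
  have "d \<le> c + 100000000000 * b" if "- (14400000000 * b) \<le> c - d" "0 \<le> b" for b c d :: int using that by linarith
  from this[OF a] show ?thesis by simp
qed

lemma exists_good_edge:
  fixes L \<delta> :: real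
  assumes L: "L \<ge> 1/4" and \<delta>: "0 \<le> \<delta>" "\<delta> \<le> 1 / 10 ^ 7" and n: "card V \<ge> 10 ^ 13"
    and e: "(L / 6 - \<delta>) * real (card V) ^ 3 \<le> card E"
    and her: "\<And>W. W \<subseteq> V \<Longrightarrow> card (induced_edges E W) \<le> L / 6 * real (card W) ^ 3 + \<delta> * real (card V) ^ 3"
  obtains x y z where "adj x y z" "0 < (\<Sum>u\<in>V. \<Sum>v\<in>V. \<Sum>w\<in>V. obj6 adj x y z u v w)"
proof -
  define n where "n = real (card V)"
  define S where "S = (\<Sum>y\<in>V. \<Sum>z\<in>V. real (card (nbh y z)) ^ 3)"
  have n13: "n \<ge> 10 ^ 13" using n by (simp add: n_def)
  have npos: "n > 0" using n13 by simp
  have L1: "L \<le> 2"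
  proof -
    have "6 * int (card E) = (\<Sum>u\<in>V. \<Sum>v\<in>V. \<Sum>w\<in>V. of_bool (adj u v w))"
      using sum_adj_eq[of V] by (simp add: induced_V)
    also have "\<dots> \<le> (\<Sum>u\<in>V. \<Sum>v\<in>V. \<Sum>w\<in>V. 1)" by (intro sum_mono) auto
    also have "\<dots> = int (card V) ^ 3" by (simp add: power3_eq_cube)
    finally have "6 * real (card E) \<le> n ^ 3" unfolding n_def
      by (metis (mono_tags, lifting) of_int_le_iff of_int_mult of_int_numeral of_int_of_nat_eq of_int_power)
    then have "(L - 6 * \<delta>) * n ^ 3 \<le> 1 * n ^ 3" using e unfolding n_def by (simp add: algebra_simps)
    then have "L - 6 * \<delta> \<le> 1" using npos by (simp add: mult_le_cancel_right)
    then show ?thesis using \<delta> by simp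
  qed
  have star: "4919621 * (n * S) \<le> 1260504 * n ^ 6 + 10 ^ 11 * n ^ 5"
  proof -
    have "real_of_int (4919621 * (int (card V) * (\<Sum>y\<in>V. \<Sum>z\<in>V. int (card (nbh y z)) ^ 3)))
      \<le> real_of_int (1260504 * int (card V) ^ 6 + 10 ^ 11 * int (card V) ^ 5)"
      using star_average by (simp only: of_int_le_iff)
    then show ?thesis by (simp add: n_def S_def)
  qed
  have cert: "100 * n ^ 6 - (10 ^ 10 + 100) * 1440 * n ^ 5 \<le> real_of_int (sumV6 (cert6 adj))"
  proof -
    have "100 * int (card V) ^ 6 - (10 ^ 10 + 100) * 1440 * int (card V) ^ 5 \<le> sumV6 (cert6 adj)"
      by (rule flag_average[where Gv = cert6]) (use cert_reps cert6_bound cert6_pull in auto)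
    then have "real_of_int (100 * int (card V) ^ 6 - (10 ^ 10 + 100) * 1440 * int (card V) ^ 5) \<le> real_of_int (sumV6 (cert6 adj))"
      by (simp only: of_int_le_iff)
    then show ?thesis by (simp add: n_def)
  qed
  define Q where "Q = real_of_int (sumV6 (obj6 adj))"
  define D where "D = real_of_int (sumV6 (edge_term adj))"
  define T where "T = real_of_int (sumV6 (star_term adj))"
  have "sumV6 (cert6 adj) = 169 * sumV6 (obj6 adj) - sumV6 (sos_pair adj) - sumV6 (sos_empty adj) - sumV6 (sos_edge adj)
     - (5042016 * sumV6 (edge_term adj) - 1260504 * int (card V) ^ 6) - 4919621 * sumV6 (star_term adj)"
  proof -
    have "cert6 adj x0 x1 x2 x3 x4 x5 = 169 * obj6 adj x0 x1 x2 x3 x4 x5 - sos_pair adj x0 x1 x2 x3 x4 x5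
      - sos_empty adj x0 x1 x2 x3 x4 x5 - sos_edge adj x0 x1 x2 x3 x4 x5
      - (5042016 * edge_term adj x0 x1 x2 x3 x4 x5 - 1260504) - 4919621 * star_term adj x0 x1 x2 x3 x4 x5" for x0 x1 x2 x3 x4 x5
      unfolding cert6_def edge_term_def star_term_def by simp
    then show ?thesis by (simp add: sum_subtractf sum_distrib_left[symmetric]) (simp add: power_numeral_reduce)
  qed
  then have "real_of_int (sumV6 (cert6 adj)) \<le> 169 * Q - (5042016 * D - 1260504 * n ^ 6) - 4919621 * T"
  proof -
    assume a: "sumV6 (cert6 adj) = 169 * sumV6 (obj6 adj) - sumV6 (sos_pair adj) - sumV6 (sos_empty adj) - sumV6 (sos_edge adj)
     - (5042016 * sumV6 (edge_term adj) - 1260504 * int (card V) ^ 6) - 4919621 * sumV6 (star_term adj)"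
    have "sumV6 (cert6 adj) \<le> 169 * sumV6 (obj6 adj) - (5042016 * sumV6 (edge_term adj) - 1260504 * int (card V) ^ 6) - 4919621 * sumV6 (star_term adj)"
      using sos_nonneg unfolding a by linarith
    then have "real_of_int (sumV6 (cert6 adj)) \<le> real_of_int (169 * sumV6 (obj6 adj) - (5042016 * sumV6 (edge_term adj) - 1260504 * int (card V) ^ 6) - 4919621 * sumV6 (star_term adj))"
      by (simp only: of_int_le_iff)
    then show ?thesis unfolding Q_def D_def T_def n_def
      by (simp only: of_int_diff of_int_mult of_int_numeral of_int_power of_int_of_nat_eq)
  qed
  moreover have D: "D \<ge> (L - 6 * \<delta>) * n ^ 6"
  proof -
    have "sumV6 (edge_term adj) = int (card V) ^ 3 * (6 * int (card E))"
      using sum_adj_eq[of V] unfolding edge_term_def by (simp add: induced_V power3_eq_cube sum_distrib_left[symmetric] mult.assoc)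
    then have "D = n ^ 3 * (6 * real (card E))" by (simp add: D_def n_def)
    moreover have "n ^ 3 * (6 * real (card E)) \<ge> n ^ 3 * (6 * ((L / 6 - \<delta>) * n ^ 3))"
      using e npos by (intro mult_left_mono) (auto simp: n_def)
    ultimately show ?thesis by (simp add: algebra_simps power_numeral_reduce)
  qed
  \<comment> \<open>The edges inside a common neighbourhood of size k number at most L/6 k^3 plus
    the error, which turns k^3 - 24 e into at least (1 - 4 L) k^3. For \<open>L\<close> > 1/4 this
    is negative; the surplus of the edge term has to compensate for it.\<close>
  moreover have T: "T \<ge> (1 - 4 * L) * (n * S) - 24 * \<delta> * n ^ 6"
  proof -
    have "sumV6 (star_term adj) = int (card V) * (\<Sum>y\<in>V. \<Sum>z\<in>V. int (card (nbh y z)) ^ 3 - 4 * (6 * int (card (induced_edges E (nbh y z)))))"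
      unfolding star_term_def
      by (simp add: right_diff_distrib sum_subtractf sum_distrib_left[symmetric] star_sum mult.left_commute[of _ 4] star_adj_sum)
    then have "T = n * (\<Sum>y\<in>V. \<Sum>z\<in>V. real (card (nbh y z)) ^ 3 - 24 * real (card (induced_edges E (nbh y z))))"
      by (simp add: T_def n_def)
    also have "\<dots> \<ge> n * (\<Sum>y\<in>V. \<Sum>z\<in>V. (1 - 4 * L) * real (card (nbh y z)) ^ 3 - 24 * \<delta> * n ^ 3)"
    proof (intro mult_left_mono sum_mono)
      fix y z
      show "(1 - 4 * L) * real (card (nbh y z)) ^ 3 - 24 * \<delta> * n ^ 3 \<le> real (card (nbh y z)) ^ 3 - 24 * real (card (induced_edges E (nbh y z)))"
        using her[OF nbh_sub[of y z]] by (simp add: n_def algebra_simps)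
    qed (use npos in auto)
    also have "n * (\<Sum>y\<in>V. \<Sum>z\<in>V. (1 - 4 * L) * real (card (nbh y z)) ^ 3 - 24 * \<delta> * n ^ 3) = (1 - 4 * L) * (n * S) - 24 * \<delta> * n ^ 6"
      by (simp add: sum_subtractf sum_distrib_left[symmetric] S_def power_numeral_reduce right_diff_distrib flip: n_def)
    finally show ?thesis .
  qed
  ultimately have main: "169 * Q \<ge> 100 * n ^ 6 - (10 ^ 10 + 100) * 1440 * n ^ 5 + 5042016 * D - 1260504 * n ^ 6 + 4919621 * T"
    using cert by linarith
  have "5042016 * D - 1260504 * n ^ 6 + 4919621 * T \<ge>
     (4 * L - 1) * (1260504 * n ^ 6 - 4919621 * (n * S)) - (6 * 5042016 + 24 * 4919621) * (\<delta> * n ^ 6)"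
    using D T by (simp add: algebra_simps)
  moreover have "(4 * L - 1) * (1260504 * n ^ 6 - 4919621 * (n * S)) \<ge> 7 * (- (10 ^ 11 * n ^ 5))"
  proof -
    have "(4 * L - 1) * (1260504 * n ^ 6 - 4919621 * (n * S)) \<ge> (4 * L - 1) * (- (10 ^ 11 * n ^ 5))"
      using star L by (intro mult_left_mono) auto
    moreover have "(4 * L - 1) * (10 ^ 11 * n ^ 5) \<le> 7 * (10 ^ 11 * n ^ 5)"
      using L1 npos by (intro mult_right_mono) auto
    ultimately show ?thesis by linarith
  qed
  moreover have "\<delta> * n ^ 6 \<le> 1 / 10 ^ 7 * n ^ 6" using \<delta> npos by (intro mult_right_mono) auto
  moreover have "n ^ 6 \<ge> 10 ^ 13 * n ^ 5"
  proof -
    have "n * n ^ 5 \<ge> 10 ^ 13 * n ^ 5" using n13 npos by (intro mult_right_mono) auto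
    then show ?thesis by (simp add: power_numeral_reduce)
  qed
  moreover have "n ^ 5 > 0" using npos by simp
  ultimately have fs: "(4 * L - 1) * (1260504 * n ^ 6 - 4919621 * (n * S)) - 148323000 * (\<delta> * n ^ 6)
      \<le> 5042016 * D - 1260504 * n ^ 6 + 4919621 * T"
    "- (700000000000 * n ^ 5) \<le> (4 * L - 1) * (1260504 * n ^ 6 - 4919621 * (n * S))"
    "\<delta> * n ^ 6 \<le> n ^ 6 / 10000000" "10000000000000 * n ^ 5 \<le> n ^ 6" "0 < n ^ 5"
    by simp_all
  have m: "100 * n ^ 6 - 14400000144000 * n ^ 5 + 5042016 * D - 1260504 * n ^ 6 + 4919621 * T \<le> 169 * Q"
    using main by simp
  \<comment> \<open>The powers of \<open>n\<close> are replaced by variables to obtain a linear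
    problem. The margin 100 suffices: \<delta> \<le> 10^-7 costs less than 15, and n \<ge> 10^13
    makes the n^5 terms cost less than 2.\<close>
  have "0 < Q" if "K - 148323000 * X \<le> 5042016 * D - 1260504 * N6 + 4919621 * T" "- (700000000000 * N5) \<le> K"
     "X \<le> N6 / 10000000" "10000000000000 * N5 \<le> N6" "0 < N5"
     "100 * N6 - 14400000144000 * N5 + 5042016 * D - 1260504 * N6 + 4919621 * T \<le> 169 * Q" for K X N5 N6 :: real
    using that by linarith
  from this[OF fs m] have "Q > 0" .
  then have pos: "0 < sumV6 (obj6 adj)" unfolding Q_def by (simp only: of_int_0_less_iff)
  show thesis
  proof (rule ccontr)
    assume no: "\<not> thesis"
    have P: "(\<Sum>u\<in>V. \<Sum>v\<in>V. \<Sum>w\<in>V. obj6 adj x y z u v w) \<le> 0" for x y z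
      using that no by (cases "adj x y z") (force simp: obj6_def not_less)+
    have "sumV6 (obj6 adj) \<le> 0" by (rule sum_nonpos, rule sum_nonpos, rule sum_nonpos, rule P)
    with pos show False by simp
  qed
qed

definition ct :: "'a set \<Rightarrow> 'a set \<Rightarrow> 'a set \<Rightarrow> real" where
  "ct X Y Z = (\<Sum>x\<in>X. \<Sum>y\<in>Y. \<Sum>z\<in>Z. of_bool (adj x y z))"

lemma ct_le: "finite X \<Longrightarrow> finite Y \<Longrightarrow> finite Z \<Longrightarrow> ct X Y Z \<le> real (card X) * real (card Y) * real (card Z)"
proof -
  have "ct X Y Z \<le> (\<Sum>x\<in>X. \<Sum>y\<in>Y. \<Sum>z\<in>Z. 1)" unfolding ct_def by (intro sum_mono) auto
  then show ?thesis by simp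
qed

lemma sum_filter_V: "(\<Sum>u\<in>{u \<in> V. P u}. g u) = (\<Sum>u\<in>V. of_bool (P u) * g u)" for g :: "'a \<Rightarrow> 'b::comm_semiring_1"
  by (subst sum.inter_filter[OF finV]) (auto intro!: sum.cong)

end

lemma amgm3:
  fixes a b c :: real
  assumes "a \<ge> 0" "b \<ge> 0" "c \<ge> 0"
  shows "27 * (a * b * c) \<le> (a + b + c) ^ 3"
proof -
  have "2 * ((a + b + c) ^ 3 - 27 * (a * b * c)) = (a + b + c) * ((a - b)\<^sup>2 + (b - c)\<^sup>2 + (a - c)\<^sup>2) + 6 * (a * (b - c)\<^sup>2 + b * (a - c)\<^sup>2 + c * (a - b)\<^sup>2)"
    by (simp add: power2_eq_square power3_eq_cube algebra_simps)
  also have "\<dots> \<ge> 0" using assms by (intro add_nonneg_nonneg mult_nonneg_nonneg) auto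
  finally show ?thesis by simp
qed

text \<open>The hypothesis 27 c \<le> D^3 makes the first two terms together nonpositive, so the
  last one is positive and D > 0.9935 n. On that range the resulting lower bound for
  \<open>c\<close> is smallest at D = n, where it is 6000 - 9 * 13 = 5883 over 162000. This equals
  1/27 - 13/18000, slightly more than 1/27 - 73/100000.\<close>

lemma density_of_large_objective:
  fixes c D n :: real
  assumes n: "n > 0" and D: "0 \<le> D" "D \<le> n" and c: "27 * c \<le> D ^ 3"
    and pos: "0 < 162000 * c - 6000 * D ^ 3 + (4 * D - n) ^ 2 * (2000 * D - 1987 * n)"
  shows "c \<ge> 5883 / 162000 * n ^ 3"
proof -
  define d where "d = D / n"
  have Dd: "D = d * n" using n by (simp add: d_def)
  have d: "0 \<le> d" "d \<le> 1" using D n by (auto simp: d_def)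
  have "(4 * D - n) ^ 2 * (2000 * D - 1987 * n) > 0" using pos c by linarith
  then have "2000 * D - 1987 * n > 0" by (simp add: zero_less_mult_iff)
  then have "n * (2000 * d - 1987) > 0" by (simp add: Dd algebra_simps)
  then have d1: "2000 * d > 1987" using n by (simp add: zero_less_mult_iff)
  have "1987 / 2000 * d \<le> d * d" using d d1 by (intro mult_right_mono) auto
  then have "26000 * d ^ 2 - 21792 * d - 3896 \<ge> 0" using d1 unfolding power2_eq_square by linarith
  then have "(1 - d) * (26000 * d ^ 2 - 21792 * d - 3896) \<ge> 0" using d by simp
  then have f: "6000 * d ^ 3 - (4 * d - 1) ^ 2 * (2000 * d - 1987) \<ge> 5883"
    by (simp add: power2_eq_square power3_eq_cube algebra_simps)
  have "162000 * c > (6000 * d ^ 3 - (4 * d - 1) ^ 2 * (2000 * d - 1987)) * n ^ 3"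
    using pos unfolding Dd by (simp add: power2_eq_square power3_eq_cube algebra_simps)
  moreover have "(6000 * d ^ 3 - (4 * d - 1) ^ 2 * (2000 * d - 1987)) * n ^ 3 \<ge> 5883 * n ^ 3"
    using f n by (intro mult_right_mono) auto
  ultimately show ?thesis by simp
qed

context c5graph
begin

lemma exists_dense_triple:
  fixes L \<delta> :: real
  assumes "L \<ge> 1/4" "0 \<le> \<delta>" "\<delta> \<le> 1 / 10 ^ 7" "card V \<ge> 10 ^ 13"
    and "(L / 6 - \<delta>) * real (card V) ^ 3 \<le> card E"
    and "\<And>W. W \<subseteq> V \<Longrightarrow> card (induced_edges E W) \<le> L / 6 * real (card W) ^ 3 + \<delta> * real (card V) ^ 3"
  obtains A B C where "A \<subseteq> V" "B \<subseteq> V" "C \<subseteq> V" "A \<inter> B = {}" "A \<inter> C = {}" "B \<inter> C = {}"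
    "ct A B C \<ge> 5883 / 162000 * real (card V) ^ 3"
proof -
  obtain x y z where e: "adj x y z" and pos: "0 < (\<Sum>u\<in>V. \<Sum>v\<in>V. \<Sum>w\<in>V. obj6 adj x y z u v w)"
    using exists_good_edge[OF assms] by blast
  define A where "A = {u \<in> V. part6 adj x y z u}"
  define B where "B = {u \<in> V. part6 adj y x z u}"
  define C where "C = {u \<in> V. part6 adj z x y u}"
  have sub: "A \<subseteq> V" "B \<subseteq> V" "C \<subseteq> V" by (auto simp: A_def B_def C_def)
  have dis: "A \<inter> B = {}" "A \<inter> C = {}" "B \<inter> C = {}"
    using adj_sym by (auto simp: A_def B_def C_def part6_def)
  have fin: "finite A" "finite B" "finite C" using sub finV by (auto intro: finite_subset)
  define D where "D = card (A \<union> B \<union> C)"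
  have Dsum: "D = card A + card B + card C"
    using dis fin by (simp add: D_def card_Un_disjoint Int_Un_distrib2)
  have Dn: "D \<le> card V" unfolding D_def using sub finV by (intro card_mono) auto
  have cov: "(\<Sum>u\<in>V. cov6 adj x y z u) = int D"
  proof -
    have "(\<Sum>u\<in>V. cov6 adj x y z u) = (\<Sum>u\<in>{u \<in> V. part6 adj x y z u \<or> part6 adj y x z u \<or> part6 adj z x y u}. 1)"
      unfolding sum_filter_V cov6_def by simp
    also have "{u \<in> V. part6 adj x y z u \<or> part6 adj y x z u \<or> part6 adj z x y u} = A \<union> B \<union> C"
      by (auto simp: A_def B_def C_def)
    finally show ?thesis by (simp add: D_def)
  qed
  have cov4: "(\<Sum>u\<in>V. 4 * cov6 adj x y z u - 1) = 4 * int D - int (card V)"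
    by (simp add: sum_subtractf sum_distrib_left[symmetric] cov)
  have cov2: "(\<Sum>u\<in>V. 2000 * cov6 adj x y z u - 1987) = 2000 * int D - 1987 * int (card V)"
    by (simp add: sum_subtractf sum_distrib_left[symmetric] cov)
  define c where "c = (\<Sum>u\<in>A. \<Sum>v\<in>B. \<Sum>w\<in>C. of_bool (adj u v w) :: int)"
  have c: "real_of_int c = ct A B C" unfolding c_def ct_def by simp
  have t1: "(\<Sum>u\<in>V. \<Sum>v\<in>V. \<Sum>w\<in>V. of_bool (part6 adj x y z u \<and> part6 adj y x z v \<and> part6 adj z x y w \<and> adj u v w)) = c"
    unfolding c_def A_def B_def C_def sum_filter_V sum_distrib_left
    by (intro sum.cong refl) (auto simp: of_bool_def)
  have t2: "(\<Sum>u\<in>V. \<Sum>v\<in>V. \<Sum>w\<in>V. cov6 adj x y z u * cov6 adj x y z v * cov6 adj x y z w) = int D ^ 3"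
    by (simp add: sum_distrib_left[symmetric] sum_distrib_right[symmetric] cov power3_eq_cube)
  have t3: "(\<Sum>u\<in>V. \<Sum>v\<in>V. \<Sum>w\<in>V. (4 * cov6 adj x y z u - 1) * (4 * cov6 adj x y z v - 1) * (2000 * cov6 adj x y z w - 1987))
     = (4 * int D - int (card V)) ^ 2 * (2000 * int D - 1987 * int (card V))"
    by (simp only: sum_distrib_left[symmetric] sum_distrib_right[symmetric] cov4 cov2 power2_eq_square)
  have "(\<Sum>u\<in>V. \<Sum>v\<in>V. \<Sum>w\<in>V. obj6 adj x y z u v w) =
    162000 * c - 6000 * int D ^ 3 + (4 * int D - int (card V)) ^ 2 * (2000 * int D - 1987 * int (card V))"
    unfolding t1[symmetric] t2[symmetric] t3[symmetric] sum_distrib_left obj6_def using e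
    by (simp only: if_True sum.distrib sum_subtractf)
  then have "0 < real_of_int (162000 * c - 6000 * int D ^ 3 + (4 * int D - int (card V)) ^ 2 * (2000 * int D - 1987 * int (card V)))"
    using pos by (simp only: of_int_0_less_iff)
  then have p: "0 < 162000 * ct A B C - 6000 * real D ^ 3 + (4 * real D - real (card V)) ^ 2 * (2000 * real D - 1987 * real (card V))"
    by (simp add: c)
  have "27 * ct A B C \<le> 27 * (real (card A) * real (card B) * real (card C))" using ct_le[OF fin] by simp
  also have "\<dots> \<le> real D ^ 3" unfolding Dsum of_nat_add by (intro amgm3) auto
  finally have "ct A B C \<ge> 5883 / 162000 * real (card V) ^ 3"
    using assms(4) Dn by (intro density_of_large_objective[OF _ _ _ _ p]) auto
  then show thesis using that sub dis by blast
qed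

end

section \<open>Numerical inequalities\<close>

text \<open>Here \<open>P\<close> stands for the product of the other two part sizes, and the third
  hypothesis is the inequality of the means. The function u (1 - u)^2 has its maximum at 1/3 and at
  28/100 and 39/100 has just fallen below 4 (1/27 - 73/100000).\<close>

lemma part_size_bounds:
  fixes u P :: real
  assumes "0 < u" "u < 1" "4 * P \<le> (1 - u)\<^sup>2" "u * P \<ge> 1/27 - 73/100000"
  shows "28/100 < u" "u < 39/100"
proof -
  have "4 * (u * P) \<le> u * (1 - u)\<^sup>2" using mult_left_mono[OF assms(3), of u] assms(1) by (simp add: mult_ac)
  moreover have "4 * (1/27 - 73/100000) \<le> 4 * (u * P)" using assms(4) by simp
  ultimately have f: "u * (1 - u)\<^sup>2 \<ge> 4 * (1/27 - 73/100000)" by (rule order_trans[rotated])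
  show "28/100 < u"
  proof (rule ccontr)
    assume "\<not> 28/100 < u"
    then have u: "u \<le> 28/100" by simp
    have "u * u \<ge> 0" by simp
    then have "0 \<le> u * u - 172/100 * u + 5184/10000" using u by linarith
    then have "(u - 28/100) * (u * u - 172/100 * u + 5184/10000) \<le> 0" using u by (intro mult_nonpos_nonneg) auto
    moreover have "u * (1 - u)\<^sup>2 - 145152/1000000 = (u - 28/100) * (u * u - 172/100 * u + 5184/10000)"
      by (simp add: power2_eq_square field_simps)
    ultimately have "u * (1 - u)\<^sup>2 \<le> 145152/1000000" by simp
    then show False using f by simp
  qed
  show "u < 39/100"
  proof (rule ccontr)
    assume "\<not> u < 39/100"
    then have u: "u \<ge> 39/100" by simp
    have "(u - 39/100) * (1 - u) \<ge> 0" using u assms by simp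
    moreover have "(u - 39/100) * (1 - u) = 139/100 * u - 39/100 - u * u" by (simp add: field_simps)
    ultimately have "u * u - 161/100 * u + 3721/10000 \<le> 0" using u by linarith
    then have "(u - 39/100) * (u * u - 161/100 * u + 3721/10000) \<le> 0" using u by (intro mult_nonneg_nonpos) auto
    moreover have "u * (1 - u)\<^sup>2 - 145119/1000000 = (u - 39/100) * (u * u - 161/100 * u + 3721/10000)"
      by (simp add: power2_eq_square field_simps)
    ultimately have "u * (1 - u)\<^sup>2 \<le> 145119/1000000" by simp
    then show False using f by simp
  qed
qed

lemma product_le:
  fixes u P :: real
  assumes "0 < u" "u < 1" "4 * P \<le> (1 - u)\<^sup>2"
  shows "u * P \<le> 1/27"
proof -
  have "4 * (u * P) \<le> u * (1 - u)\<^sup>2" using mult_left_mono[OF assms(3), of u] assms(1) by (simp add: mult_ac)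
  also have "u * (1 - u)\<^sup>2 = 4/27 - (u - 1/3)\<^sup>2 * (4/3 - u)" by (simp add: power2_eq_square algebra_simps)
  also have "\<dots> \<le> 4/27" using assms by simp
  finally have "4 * (u * P) \<le> 4/27" .
  then show ?thesis by linarith
qed

text \<open>The numerical core of \<open>vertex_link_density\<close>: the first term is at most
  -0.0404, the last at most 0.00522, and the two in between stay below 0.0351.\<close>

lemma degree_contradiction:
  fixes u q R ee h :: real
  assumes u: "28/100 < u" "u < 39/100" and q: "0 \<le> q" "q \<le> 64/100 * R" and R: "4 * R = (1 - u)\<^sup>2"
    and h: "h \<le> 73/100000" and ee: "0 \<le> ee" "ee \<le> 2 * q" "ee * q \<le> 53/100000"
  shows "(3 * u\<^sup>2 - 2 * u) / 8 + ee + q\<^sup>2 / (2 * R) + 2 * h / u < - 1/100000"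
proof -
  have R1: "R \<ge> 93/1000"
  proof -
    have "(61/100)\<^sup>2 \<le> (1 - u)\<^sup>2" using u by (intro power_mono) auto
    then show ?thesis using R by (simp add: power2_eq_square)
  qed
  have R2: "R \<le> 1296/10000"
  proof -
    have "(1 - u)\<^sup>2 \<le> (72/100)\<^sup>2" using u by (intro power_mono) auto
    then show ?thesis using R by (simp add: power2_eq_square)
  qed
  have c0: "(3 * u\<^sup>2 - 2 * u) / 8 \<le> - 404/10000"
  proof -
    have "(u - 28/100) * (39/100 - u) \<ge> 0" using u by simp
    moreover have "(u - 28/100) * (39/100 - u) = 67/100 * u - 1092/10000 - u * u" by (simp add: field_simps)
    ultimately have "u * u \<le> 67/100 * u - 1092/10000" by simp
    then have "3 * (u * u) - 2 * u \<le> - 3232/10000" using u by linarith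
    then show ?thesis by (simp add: power2_eq_square)
  qed
  have h1: "2 * h / u \<le> 522/100000"
  proof -
    have "2 * h \<le> 522/100000 * u" using h u by linarith
    then show ?thesis using u by (simp add: pos_divide_le_eq)
  qed
  have main: "ee + q\<^sup>2 / (2 * R) < 351/10000" 
  proof -
    have e: "ee \<le> 53/100000 / l" if "0 < l" "l \<le> q" for l
    proof -
      have "ee * l \<le> ee * q" using ee that by (intro mult_left_mono) auto
      then show ?thesis using ee that by (simp add: pos_le_divide_eq)
    qed
    have s: "q\<^sup>2 / (2 * R) \<le> r\<^sup>2 / (186/1000)" if "q \<le> r" for r
    proof -
      have "q\<^sup>2 \<le> r\<^sup>2" using q that by (intro power_mono) auto
      then show ?thesis using R1 by (intro frac_le) auto
    qed
    \<comment> \<open>\<open>ee\<close> is bounded both by 2 q and by 0.00053 / q; the bounds cross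
      near q = 0.0163, hence the fine subdivision there. For large \<open>q\<close> the bound q
      \<le> 0.64 R takes over.\<close>
    consider "q \<le> 16/1000" | "16/1000 \<le> q" "q \<le> 17/1000" | "17/1000 \<le> q" "q \<le> 19/1000" | "19/1000 \<le> q" "q \<le> 30/1000"
      | "30/1000 \<le> q" "q \<le> 50/1000" | "50/1000 \<le> q" "q \<le> 65/1000" | "65/1000 \<le> q" by linarith
    then show ?thesis
    proof cases
      case 1
      then show ?thesis using s[of "16/1000"] ee by (simp add: power2_eq_square)
    next
      case 2
      then show ?thesis using s[of "17/1000"] e[of "16/1000"] by (simp add: power2_eq_square)
    next
      case 3
      then show ?thesis using s[of "19/1000"] e[of "17/1000"] by (simp add: power2_eq_square)
    next
      case 4
      then show ?thesis using s[of "30/1000"] e[of "19/1000"] by (simp add: power2_eq_square)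
    next
      case 5
      then show ?thesis using s[of "50/1000"] e[of "30/1000"] by (simp add: power2_eq_square)
    next
      case 6
      then show ?thesis using s[of "65/1000"] e[of "50/1000"] by (simp add: power2_eq_square)
    next
      case 7
      have "q\<^sup>2 \<le> (64/100 * R)\<^sup>2" using q by (intro power_mono) auto
      then have "q\<^sup>2 / (2 * R) \<le> (64/100 * R)\<^sup>2 / (2 * R)" using R1 by (intro divide_right_mono) auto
      also have "\<dots> = 2048/10000 * R" using R1 by (simp add: power2_eq_square)
      finally have "q\<^sup>2 / (2 * R) \<le> 2048/10000 * R" .
      moreover have "ee \<le> 53/6500" using e[of "65/1000"] 7 by simp
      ultimately show ?thesis using R2 by linarith
    qed
  qed
  show ?thesis using c0 h1 main by linarith
qed

text \<open>Reduces to the case of two equal other parts, where P = R. After (1 - q/P)^2 is replaced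
  by the larger \<open>g\<close>, the difference to that case is a positive multiple of (1 - x) (g/4
  + 1 - 2 \<beta>), and this is nonpositive because g \<le> 1 and \<beta> \<ge> 5/8.\<close>

lemma inner_terms_bound:
  fixes u P R q b0 :: real
  assumes u: "0 < u" and P: "0 < P" "P \<le> R" and q: "0 \<le> q" "q \<le> P"
    and b0: "u * P \<ge> b0" "b0 \<ge> 5/8 * (u * P)"
  shows "(4 * R - 2 * P) * ((1 - q / P)\<^sup>2 / 4 + (u * P - b0) / (u * P)) \<le> R / 2 - q + q\<^sup>2 / (2 * R) + 2 * (u * R - b0) / u"
proof -
  define x where "x = P / R"
  define g where "g = (1 - q / R)\<^sup>2"
  define \<beta> where "\<beta> = b0 / (u * P)"
  have R: "R > 0" using P by simp
  have x: "0 < x" "x \<le> 1" using P R by (auto simp: x_def)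
  have Px: "P = x * R" using R by (simp add: x_def)
  have b\<beta>: "b0 = \<beta> * (u * P)" using u P by (simp add: \<beta>_def)
  have \<beta>: "5/8 \<le> \<beta>" using b0(2) u P by (simp add: \<beta>_def pos_le_divide_eq)
  have qR: "0 \<le> 1 - q / R" using q P R by simp
  have g: "0 \<le> g" "g \<le> 1"
  proof -
    show "0 \<le> g" by (simp add: g_def)
    have "1 - q / R \<le> 1" using q R by simp
    then show "g \<le> 1" unfolding g_def using qR by (intro power_le_one)
  qed
  have "(1 - q / P)\<^sup>2 \<le> g" unfolding g_def
  proof (rule power_mono)
    show "1 - q / P \<le> 1 - q / R" using q P by (simp add: frac_le)
    show "0 \<le> 1 - q / P" using q P by simp
  qed
  then have "(4 * R - 2 * P) * ((1 - q / P)\<^sup>2 / 4 + (u * P - b0) / (u * P)) \<le> (4 * R - 2 * P) * (g / 4 + (u * P - b0) / (u * P))"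
    using P by (intro mult_left_mono) auto
  also have "(4 * R - 2 * P) * (g / 4 + (u * P - b0) / (u * P)) = (4 * R - 2 * P) * (g / 4 + (1 - \<beta>))"
    using u P by (simp add: \<beta>_def diff_divide_distrib)
  also have "\<dots> = 2 * R * (g / 4 + (1 - \<beta> * x)) + 2 * R * ((1 - x) * (g / 4 + 1 - 2 * \<beta>))"
    unfolding Px by (simp add: field_simps)
  also have "\<dots> \<le> 2 * R * (g / 4 + (1 - \<beta> * x))"
  proof -
    have "(1 - x) * (g / 4 + 1 - 2 * \<beta>) \<le> 0" using x g \<beta> by (intro mult_nonneg_nonpos) auto
    then have "2 * R * ((1 - x) * (g / 4 + 1 - 2 * \<beta>)) \<le> 0" using R mult_nonneg_nonpos[of "2 * R" "(1 - x) * (g / 4 + 1 - 2 * \<beta>)"] by simp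
    then show ?thesis by simp
  qed
  also have "\<dots> = R / 2 - q + q\<^sup>2 / (2 * R) + 2 * (u * R - b0) / u"
  proof -
    have "2 * (u * R - b0) / u = 2 * R * (1 - \<beta> * x)" unfolding b\<beta> Px using u by (simp add: field_simps)
    moreover have "2 * R * (g / 4) = R / 2 - q + q\<^sup>2 / (2 * R)" using R by (simp add: g_def power2_eq_square field_simps)
    ultimately show ?thesis by (simp add: distrib_left)
  qed
  finally show ?thesis .
qed

text \<open>The variables are normalized: part sizes, missing triples \<open>M\<close>, and the link
  of a vertex of the first part, with \<open>q\<close> between the other two parts and the remaining
  link edges in \<open>e11\<close> to \<open>e33\<close>. If \<open>q\<close> were below 64 percent
  of \<open>b * c\<close>, the rest could not make up the degree: \<open>e12\<close>,
  \<open>e13\<close> are limited by \<open>matching\<close>, \<open>e11\<close> by Mantel's theorem,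
  \<open>e22\<close>, \<open>e33\<close> by \<open>lk_inner\<close>.\<close>

lemma vertex_link_density:
  fixes a b c M q e11 e12 e13 e22 e33 \<delta> :: real
  assumes pos: "0 < a" "0 < b" "0 < c" and one: "a + b + c = 1" and M: "0 \<le> M"
    and cr: "a * b * c - M \<ge> 1/27 - 73/100000" and q: "0 \<le> q" "q \<le> b * c" and \<delta>: "0 \<le> \<delta>" "\<delta> \<le> 1/10^6"
    and e12: "0 \<le> e12" "e12 \<le> q" "e12 * q \<le> b * M + \<delta>" and e13: "0 \<le> e13" "e13 \<le> q" "e13 * q \<le> c * M + \<delta>"
    and e11: "e11 \<le> a\<^sup>2 / 4 + \<delta>"
    and e22: "e22 \<le> ((b * c - q) / c)\<^sup>2 / 4 + M * b / (a * c) + \<delta>"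
    and e33: "e33 \<le> ((b * c - q) / b)\<^sup>2 / 4 + M * c / (a * b) + \<delta>"
    and deg: "1/8 - \<delta> \<le> q + e11 + e12 + e13 + e22 + e33"
  shows "q \<ge> 64/100 * (b * c)"
proof (rule ccontr)
  assume "\<not> ?thesis"
  then have q64: "q < 64/100 * (b * c)" by simp
  define P where "P = b * c"
  define R where "R = (1 - a)\<^sup>2 / 4"
  define b0 where "b0 = (1/27 - 73/100000 :: real)"
  have P0: "0 < P" using pos by (simp add: P_def)
  have a1: "a < 1" using pos one by simp
  have bc: "b + c = 1 - a" using one by simp
  have PR: "P \<le> R"
  proof -
    have "0 \<le> (b - c)\<^sup>2" by simp
    then have "4 * (b * c) \<le> (b + c)\<^sup>2" by (simp add: power2_eq_square algebra_simps)
    then show ?thesis unfolding bc by (simp add: P_def R_def)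
  qed
  have sq: "b\<^sup>2 + c\<^sup>2 = 4 * R - 2 * P"
  proof -
    have "b\<^sup>2 + c\<^sup>2 = (b + c)\<^sup>2 - 2 * (b * c)" by (simp add: power2_eq_square algebra_simps)
    then show ?thesis unfolding bc by (simp add: P_def R_def)
  qed
  have aP: "a * P - M \<ge> b0" using cr by (simp add: P_def b0_def mult.assoc)
  have aPle: "a * P \<le> 1/27" using product_le[of a P] pos a1 PR by (simp add: R_def)
  have aRle: "a * R \<le> 1/27" using product_le[of a R] pos a1 by (simp add: R_def)
  have ub: "28/100 < a" "a < 39/100"
    using part_size_bounds[of a P] pos a1 PR aP M by (simp_all add: R_def b0_def)
  have "((b * c - q) / c)\<^sup>2 / 4 + ((b * c - q) / b)\<^sup>2 / 4 = (b\<^sup>2 + c\<^sup>2) * ((1 - q / P)\<^sup>2 / 4)"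
    using pos unfolding P_def by (simp add: power2_eq_square field_simps)
  moreover have "M * b / (a * c) + M * c / (a * b) = (b\<^sup>2 + c\<^sup>2) * (M / (a * P))"
    using pos unfolding P_def by (simp add: power2_eq_square field_simps)
  moreover have "(b\<^sup>2 + c\<^sup>2) * (M / (a * P)) \<le> (b\<^sup>2 + c\<^sup>2) * ((a * P - b0) / (a * P))"
    using aP pos P0 by (intro mult_left_mono divide_right_mono) auto
  ultimately have "e22 + e33 \<le> (4 * R - 2 * P) * ((1 - q / P)\<^sup>2 / 4 + (a * P - b0) / (a * P)) + 2 * \<delta>"
    using e22 e33 unfolding sq by (simp add: distrib_left)
  also have "(4 * R - 2 * P) * ((1 - q / P)\<^sup>2 / 4 + (a * P - b0) / (a * P)) \<le> R / 2 - q + q\<^sup>2 / (2 * R) + 2 * (a * R - b0) / a"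
  proof (rule inner_terms_bound[OF pos(1) P0 PR q(1)])
    show "q \<le> P" using q(2) by (simp add: P_def)
    show "a * P \<ge> b0" using aP M by linarith
    show "b0 \<ge> 5/8 * (a * P)" unfolding b0_def using aPle by linarith
  qed
  \<comment> \<open>The -q from \<open>inner_terms_bound\<close> has cancelled the \<open>q\<close>
    of the degree condition; only the quadratic term in \<open>q\<close> is left.\<close>
  finally have "1/8 \<le> a\<^sup>2 / 4 + (e12 + e13) + (R / 2 + q\<^sup>2 / (2 * R) + 2 * (a * R - b0) / a) + 4 * \<delta>"
    using deg e11 by linarith
  moreover have "a\<^sup>2 / 4 + R / 2 - 1/8 = (3 * a\<^sup>2 - 2 * a) / 8"
    by (simp add: R_def power2_eq_square field_simps)
  ultimately have F: "0 \<le> (3 * a\<^sup>2 - 2 * a) / 8 + (e12 + e13) + q\<^sup>2 / (2 * R) + 2 * (a * R - b0) / a + 4 * \<delta>"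
    by linarith
  have "(3 * a\<^sup>2 - 2 * a) / 8 + (e12 + e13) + q\<^sup>2 / (2 * R) + 2 * (a * R - b0) / a < - 1/100000"
  proof (rule degree_contradiction[OF ub q(1)])
    show "q \<le> 64/100 * R" using q64 PR by (simp add: P_def)
    show "4 * R = (1 - a)\<^sup>2" by (simp add: R_def)
    show "a * R - b0 \<le> 73/100000" using aRle by (simp add: b0_def)
    show "0 \<le> e12 + e13" "e12 + e13 \<le> 2 * q" using e12 e13 by auto
    have "M \<le> 73/100000" using aP aPle by (simp add: b0_def)
    then have "(b + c) * M \<le> 72/100 * (73/100000)" using ub bc M pos by (intro mult_mono) auto
    moreover have "(e12 + e13) * q \<le> (b + c) * M + 2 * \<delta>" using e12(3) e13(3) by (simp add: algebra_simps)
    ultimately show "(e12 + e13) * q \<le> 53/100000" using \<delta> by simp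
  qed
  then show False using F \<delta> by simp
qed

text \<open>The origin of 0.77. As the sizes add up to 1, the two symmetric sums equal s/p - 3 and
  (s - 3 p)/p^2 with s = ab + ac + bc and p = abc; they are at most about 6.2 and 171.\<close>

lemma bad_coefficient:
  fixes a b c M :: real
  assumes pos: "0 < a" "0 < b" "0 < c" and one: "a + b + c = 1" and M: "0 \<le> M"
    and cr: "a * b * c - M \<ge> 1/27 - 73/100000"
  shows "9/100 * (b / c + c / b + a / c + c / a + a / b + b / a)
    + 16/10 * M * (1 / (a * c\<^sup>2) + 1 / (a * b\<^sup>2) + 1 / (b * c\<^sup>2) + 1 / (b * a\<^sup>2) + 1 / (c * a\<^sup>2) + 1 / (c * b\<^sup>2)) \<le> 77/100"
proof -
  define s where "s = a * b + a * c + b * c"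
  define p where "p = a * b * c"
  have p0: "0 < p" using pos by (simp add: p_def)
  have s1: "3 * s \<le> 1"
  proof -
    have "0 \<le> (a - b)\<^sup>2 + (a - c)\<^sup>2 + (b - c)\<^sup>2" by simp
    then have "6 * s \<le> 2 * (a + b + c)\<^sup>2 - 0" unfolding s_def by (simp add: power2_eq_square algebra_simps)
    then show ?thesis using one by simp
  qed
  have p1: "p \<ge> 36306/1000000" using cr M by (simp add: p_def)
  have s9: "9 * p \<le> s"
  proof -
    have "0 \<le> a * (b - c)\<^sup>2 + b * (a - c)\<^sup>2 + c * (a - b)\<^sup>2" using pos by (intro add_nonneg_nonneg mult_nonneg_nonneg) auto
    then have "9 * p \<le> (a + b + c) * s" unfolding s_def p_def by (simp add: power2_eq_square algebra_simps)
    then show ?thesis using one by simp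
  qed
  have M1: "M \<le> 73/100000" using cr s1 s9 unfolding p_def[symmetric] by simp
  have t1: "b / c + c / b + a / c + c / a + a / b + b / a = s / p - 3"
  proof -
    have "s / p - 3 = (a + b + c) * s / p - 3" using one by simp
    also have "\<dots> = b / c + c / b + a / c + c / a + a / b + b / a"
      unfolding s_def p_def using pos by (simp add: field_simps power2_eq_square)
    finally show ?thesis by simp
  qed
  have t2: "1 / (a * c\<^sup>2) + 1 / (a * b\<^sup>2) + 1 / (b * c\<^sup>2) + 1 / (b * a\<^sup>2) + 1 / (c * a\<^sup>2) + 1 / (c * b\<^sup>2) = (s - 3 * p) / p\<^sup>2"
  proof -
    have "(s - 3 * p) / p\<^sup>2 = ((a + b + c) * s - 3 * p) / p\<^sup>2" using one by simp
    also have "(a + b + c) * s - 3 * p = a * b\<^sup>2 + a * c\<^sup>2 + b * a\<^sup>2 + b * c\<^sup>2 + c * a\<^sup>2 + c * b\<^sup>2"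
      by (simp add: s_def p_def power2_eq_square algebra_simps)
    also have "\<dots> / p\<^sup>2 = a * b\<^sup>2 / p\<^sup>2 + a * c\<^sup>2 / p\<^sup>2 + b * a\<^sup>2 / p\<^sup>2 + b * c\<^sup>2 / p\<^sup>2 + c * a\<^sup>2 / p\<^sup>2 + c * b\<^sup>2 / p\<^sup>2"
      by (simp add: add_divide_distrib)
    also have "a * b\<^sup>2 / p\<^sup>2 = 1 / (a * c\<^sup>2)" unfolding p_def using pos by (simp add: power2_eq_square field_simps)
    also have "a * c\<^sup>2 / p\<^sup>2 = 1 / (a * b\<^sup>2)" unfolding p_def using pos by (simp add: power2_eq_square field_simps)
    also have "b * a\<^sup>2 / p\<^sup>2 = 1 / (b * c\<^sup>2)" unfolding p_def using pos by (simp add: power2_eq_square field_simps)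
    also have "b * c\<^sup>2 / p\<^sup>2 = 1 / (b * a\<^sup>2)" unfolding p_def using pos by (simp add: power2_eq_square field_simps)
    also have "c * a\<^sup>2 / p\<^sup>2 = 1 / (c * b\<^sup>2)" unfolding p_def using pos by (simp add: power2_eq_square field_simps)
    also have "c * b\<^sup>2 / p\<^sup>2 = 1 / (c * a\<^sup>2)" unfolding p_def using pos by (simp add: power2_eq_square field_simps)
    finally show ?thesis by simp
  qed
  have "s / p \<le> (1/3) / (36306/1000000)" using s1 p1 by (intro frac_le) auto
  then have f1: "9/100 * (s / p - 3) \<le> 557/1000" by simp
  have "(s - 3 * p) / p\<^sup>2 \<le> (1/3 - 3 * (36306/1000000)) / (36306/1000000)\<^sup>2"
    using s1 s9 p0 p1 by (intro frac_le power_mono) auto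
  also have "\<dots> \<le> (171 :: real)" by (simp add: power2_eq_square)
  finally have "(s - 3 * p) / p\<^sup>2 \<le> 171" .
  moreover have "0 \<le> (s - 3 * p) / p\<^sup>2" using s9 p0 by (intro divide_nonneg_nonneg) auto
  ultimately have "16/10 * M * ((s - 3 * p) / p\<^sup>2) \<le> 16/10 * (73/100000) * 171"
    using M M1 by (intro mult_mono) auto
  then show ?thesis unfolding t1 t2 using f1 by linarith
qed

text \<open>Here \<open>p\<close> is L/6, and for p = 1/24 the energy inequality is an equality at
  three equal parts. In terms of s = ab + ac + bc and e = abc it says s \<le> 9 e + 8 \<epsilon>,
  and with 3 e \<le> s^2 this gives s (1 - 3 s) \<le> 8 \<epsilon>. The lower bound on abc keeps
  \<open>s\<close> away from 0, the degenerate solution with one part containing everything; so 1 -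
  3 s is small, and it is 3/2 of the squared distance to (1/3, 1/3, 1/3).\<close>

lemma energy_balance:
  fixes a b c p \<epsilon> :: real
  assumes pos: "0 \<le> a" "0 \<le> b" "0 \<le> c" and one: "a + b + c = 1" and p: "p \<ge> 1/24" and \<epsilon>: "0 \<le> \<epsilon>"
    and en: "p * (1 - a ^ 3 - b ^ 3 - c ^ 3) \<le> a * b * c + \<epsilon>" and cr: "a * b * c \<ge> 36/1000"
  shows "a * b * c \<ge> 1/27 - 2 * \<epsilon>" "(a - 1/3)\<^sup>2 \<le> 17 * \<epsilon>" "(b - 1/3)\<^sup>2 \<le> 17 * \<epsilon>" "(c - 1/3)\<^sup>2 \<le> 17 * \<epsilon>"
proof -
  define s where "s = a * b + a * c + b * c"
  define e where "e = a * b * c"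
  have id3: "1 - a ^ 3 - b ^ 3 - c ^ 3 = 3 * (s - e)"
  proof -
    have "(a + b + c) ^ 3 - a ^ 3 - b ^ 3 - c ^ 3 = 3 * ((a + b + c) * s - e)"
      by (simp add: s_def e_def power3_eq_cube algebra_simps)
    then show ?thesis using one by simp
  qed
  have s9: "9 * e \<le> s"
  proof -
    have "0 \<le> a * (b - c)\<^sup>2 + b * (a - c)\<^sup>2 + c * (a - b)\<^sup>2" using pos by (intro add_nonneg_nonneg mult_nonneg_nonneg) auto
    then have "9 * e \<le> (a + b + c) * s" unfolding s_def e_def by (simp add: power2_eq_square algebra_simps)
    then show ?thesis using one by simp
  qed
  have e0: "e \<ge> 36/1000" using cr by (simp add: e_def)
  have s2: "3 * e \<le> s\<^sup>2"
  proof -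
    have "0 \<le> (a * b - a * c)\<^sup>2 + (a * b - b * c)\<^sup>2 + (a * c - b * c)\<^sup>2" by simp
    then have "3 * (e * (a + b + c)) \<le> s\<^sup>2" unfolding s_def e_def by (simp add: power2_eq_square algebra_simps)
    then show ?thesis using one by simp
  qed
  have "1/24 * (3 * (s - e)) \<le> p * (3 * (s - e))" using p s9 e0 by (intro mult_right_mono) auto
  also have "\<dots> \<le> e + \<epsilon>" using en unfolding id3 e_def[symmetric] .
  finally have "(s - e) / 8 \<le> e + \<epsilon>" by simp
  then have s8: "s \<le> 9 * e + 8 * \<epsilon>" by (simp add: field_simps)
  then have "s * (1 - 3 * s) \<le> 8 * \<epsilon>" using s2 by (simp add: power2_eq_square algebra_simps)
  moreover have sq: "(a - 1/3)\<^sup>2 + (b - 1/3)\<^sup>2 + (c - 1/3)\<^sup>2 = 2/3 * (1 - 3 * s)"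
  proof -
    have "(a - 1/3)\<^sup>2 + (b - 1/3)\<^sup>2 + (c - 1/3)\<^sup>2 = (a + b + c)\<^sup>2 - 2 * s - 2/3 * (a + b + c) + 1/3"
      by (simp add: s_def power2_eq_square field_simps)
    then show ?thesis using one by simp
  qed
  moreover have s1: "0 \<le> 1 - 3 * s"
  proof -
    have "0 \<le> (a - 1/3)\<^sup>2 + (b - 1/3)\<^sup>2 + (c - 1/3)\<^sup>2" by simp
    then show ?thesis unfolding sq by simp
  qed
  moreover have "324/1000 * (1 - 3 * s) \<le> s * (1 - 3 * s)" using s9 e0 s1 by (intro mult_right_mono) auto
  ultimately have y: "324/1000 * (1 - 3 * s) \<le> 8 * \<epsilon>" by simp
  have "x \<le> 25 * \<epsilon>" if "324/1000 * x \<le> 8 * \<epsilon>" for x using that \<epsilon> by linarith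
  from this[OF y] have k: "1 - 3 * s \<le> 25 * \<epsilon>" .
  show "a * b * c \<ge> 1/27 - 2 * \<epsilon>" using s8 k \<epsilon> unfolding e_def[symmetric] by linarith
  have "(a - 1/3)\<^sup>2 \<ge> 0" "(b - 1/3)\<^sup>2 \<ge> 0" "(c - 1/3)\<^sup>2 \<ge> 0" by simp_all
  then show "(a - 1/3)\<^sup>2 \<le> 17 * \<epsilon>" "(b - 1/3)\<^sup>2 \<le> 17 * \<epsilon>" "(c - 1/3)\<^sup>2 \<le> 17 * \<epsilon>"
    using sq[unfolded right_diff_distrib] k \<epsilon> by linarith+
qed

lemma part_size_near_third:
  fixes u P :: real
  assumes "0 < u" "u < 1" "4 * P \<le> (1 - u)\<^sup>2" "u * P \<ge> 1/27 - 1/10^10"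
  shows "\<bar>u - 1/3\<bar> \<le> 1/10000"
proof -
  have "4 * (u * P) \<le> u * (1 - u)\<^sup>2" using mult_left_mono[OF assms(3), of u] assms(1) by (simp add: mult_ac)
  also have "u * (1 - u)\<^sup>2 = 4/27 - (u - 1/3)\<^sup>2 * (4/3 - u)" by (simp add: power2_eq_square algebra_simps)
  finally have "(u - 1/3)\<^sup>2 * (4/3 - u) \<le> 4/10^10" using assms(4) by linarith
  moreover have "(u - 1/3)\<^sup>2 * (1/3) \<le> (u - 1/3)\<^sup>2 * (4/3 - u)" using assms by (intro mult_left_mono) auto
  ultimately have "(u - 1/3)\<^sup>2 \<le> (1/10000)\<^sup>2" by (simp add: power2_eq_square)
  then show ?thesis by (metis abs_le_square_iff abs_of_pos zero_less_divide_1_iff zero_less_numeral)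
qed

section \<open>Links and partitions\<close>

lemma weighted_cauchy_schwarz:
  fixes w D :: "'b \<Rightarrow> real"
  assumes "\<And>x. x \<in> U \<Longrightarrow> 0 \<le> w x"
  shows "(\<Sum>x\<in>U. w x * D x) ^ 2 \<le> (\<Sum>x\<in>U. w x) * (\<Sum>x\<in>U. w x * (D x)\<^sup>2)"
proof -
  have "0 \<le> (\<Sum>x\<in>U. \<Sum>y\<in>U. w x * w y * (D x - D y)\<^sup>2)"
    using assms by (intro sum_nonneg mult_nonneg_nonneg) auto
  also have "\<dots> = (\<Sum>x\<in>U. \<Sum>y\<in>U. (w x * (D x)\<^sup>2) * w y + w x * (w y * (D y)\<^sup>2) - 2 * ((w x * D x) * (w y * D y)))"
    by (intro sum.cong refl) (simp add: power2_eq_square algebra_simps)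
  also have "\<dots> = 2 * ((\<Sum>x\<in>U. w x) * (\<Sum>x\<in>U. w x * (D x)\<^sup>2)) - 2 * (\<Sum>x\<in>U. w x * D x) ^ 2"
    by (simp add: sum.distrib sum_subtractf sum_distrib_left[symmetric] sum_distrib_right[symmetric] power2_eq_square)
  finally show ?thesis by simp
qed

text \<open>The standard proof of Mantel's theorem with vertex weights: along an edge the weighted
  degrees add up to at most \<open>S\<close> plus the number of common neighbours, and
  Cauchy-Schwarz compares this with \<open>X\<close>. As the weights are at most 1, triangles may be
  counted without weights.\<close>

lemma weighted_mantel:
  fixes r :: "'b \<Rightarrow> 'b \<Rightarrow> bool" and w :: "'b \<Rightarrow> real"
  assumes sym: "\<And>x y. r x y = r y x" and w: "\<And>x. x \<in> U \<Longrightarrow> 0 \<le> w x \<and> w x \<le> 1"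
  defines "X \<equiv> (\<Sum>x\<in>U. \<Sum>y\<in>U. w x * w y * of_bool (r x y))" and "S \<equiv> sum w U"
    and "T \<equiv> (\<Sum>x\<in>U. \<Sum>y\<in>U. \<Sum>z\<in>U. of_bool (r x y \<and> r x z \<and> r y z))"
  shows "2 * X ^ 2 \<le> S * (X * S + T)"
proof -
  define D where "D x = (\<Sum>y\<in>U. w y * of_bool (r x y))" for x
  define Q where "Q = (\<Sum>x\<in>U. w x * (D x)\<^sup>2)"
  have XD: "X = (\<Sum>x\<in>U. w x * D x)" by (simp add: X_def D_def sum_distrib_left mult.assoc)
  have S0: "S \<ge> 0" unfolding S_def using w by (intro sum_nonneg) auto
  have Q1: "Q = (\<Sum>x\<in>U. \<Sum>y\<in>U. w x * w y * of_bool (r x y) * D x)"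
  proof -
    have "w x * (D x)\<^sup>2 = (\<Sum>y\<in>U. w x * w y * of_bool (r x y) * D x)" for x
    proof -
      have "w x * (D x)\<^sup>2 = w x * D x * (\<Sum>y\<in>U. w y * of_bool (r x y))" by (simp add: power2_eq_square flip: D_def)
      then show ?thesis by (simp add: sum_distrib_left mult_ac)
    qed
    then show ?thesis by (simp add: Q_def)
  qed
  also have "\<dots> = (\<Sum>y\<in>U. \<Sum>x\<in>U. w x * w y * of_bool (r x y) * D x)" by (rule sum.swap)
  also have "\<dots> = (\<Sum>x\<in>U. \<Sum>y\<in>U. w x * w y * of_bool (r x y) * D y)"
    by (intro sum.cong refl) (subst sym, simp)
  finally have Q2: "Q = (\<Sum>x\<in>U. \<Sum>y\<in>U. w x * w y * of_bool (r x y) * D y)" .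
  have "2 * Q = (\<Sum>x\<in>U. \<Sum>y\<in>U. w x * w y * of_bool (r x y) * (D x + D y))"
    using Q1 Q2 by (simp add: distrib_left sum.distrib)
  also have "\<dots> \<le> (\<Sum>x\<in>U. \<Sum>y\<in>U. w x * w y * of_bool (r x y) * S + (\<Sum>z\<in>U. of_bool (r x y \<and> r x z \<and> r y z)))"
  proof (intro sum_mono)
    fix x y assume xy: "x \<in> U" "y \<in> U"
    show "w x * w y * of_bool (r x y) * (D x + D y) \<le> w x * w y * of_bool (r x y) * S + (\<Sum>z\<in>U. of_bool (r x y \<and> r x z \<and> r y z))"
    proof (cases "r x y")
      case True
      have "D x + D y \<le> (\<Sum>z\<in>U. w z + of_bool (r x z \<and> r y z))"
        unfolding D_def sum.distrib[symmetric] using w by (intro sum_mono) (auto simp: of_bool_def)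
      also have "\<dots> = S + (\<Sum>z\<in>U. of_bool (r x z \<and> r y z))" by (simp add: sum.distrib S_def)
      finally have "w x * w y * (D x + D y) \<le> w x * w y * (S + (\<Sum>z\<in>U. of_bool (r x z \<and> r y z)))"
        using w xy by (intro mult_left_mono) auto
      moreover have "w x * w y * (\<Sum>z\<in>U. of_bool (r x z \<and> r y z)) \<le> 1 * (\<Sum>z\<in>U. of_bool (r x z \<and> r y z) :: real)"
        using w xy by (intro mult_right_mono sum_nonneg) (auto intro: mult_le_one)
      ultimately show ?thesis using True by (simp add: distrib_left)
    qed simp
  qed
  also have "\<dots> = X * S + T"
    by (simp add: sum.distrib sum_distrib_right[symmetric] X_def T_def)
  finally have "2 * Q \<le> X * S + T" .
  then have "S * (2 * Q) \<le> S * (X * S + T)" using S0 by (rule mult_left_mono)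
  moreover have "X ^ 2 \<le> S * Q" unfolding XD S_def Q_def using w by (intro weighted_cauchy_schwarz) auto
  ultimately show ?thesis by simp
qed

text \<open>\<open>weighted_mantel\<close> says X (2 X - S^2) \<le> S T. If \<open>X\<close>
  exceeded the claimed bound, both factors on the left would be too large for the given
  \<open>T\<close>.\<close>

lemma weighted_mantel_bound:
  fixes r :: "'b \<Rightarrow> 'b \<Rightarrow> bool" and w :: "'b \<Rightarrow> real" and N \<eta> :: real
  assumes sym: "\<And>x y. r x y = r y x" and w: "\<And>x. x \<in> U \<Longrightarrow> 0 \<le> w x \<and> w x \<le> 1"
    and N: "N > 0" "sum w U \<le> N" and \<eta>: "\<eta> > 0"
    and T: "(\<Sum>x\<in>U. \<Sum>y\<in>U. \<Sum>z\<in>U. of_bool (r x y \<and> r x z \<and> r y z)) \<le> 2 * \<eta>\<^sup>2 * N ^ 3"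
  shows "(\<Sum>x\<in>U. \<Sum>y\<in>U. w x * w y * of_bool (r x y)) \<le> (sum w U)\<^sup>2 / 2 + \<eta> * N\<^sup>2"
proof (rule ccontr)
  define X where "X = (\<Sum>x\<in>U. \<Sum>y\<in>U. w x * w y * of_bool (r x y))"
  define S where "S = sum w U"
  define T where "T = (\<Sum>x\<in>U. \<Sum>y\<in>U. \<Sum>z\<in>U. of_bool (r x y \<and> r x z \<and> r y z) :: real)"
  have S0: "0 \<le> S" unfolding S_def using w by (intro sum_nonneg) auto
  have T0: "0 \<le> T" unfolding T_def by (intro sum_nonneg) auto
  assume "\<not> ?thesis"
  then have X: "X > S\<^sup>2 / 2 + \<eta> * N\<^sup>2" by (simp add: X_def S_def)
  have p: "\<eta> * N\<^sup>2 > 0" using N \<eta> by simp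
  have "2 * X ^ 2 \<le> S * (X * S + T)"
    using weighted_mantel[of r U w, OF sym w] unfolding X_def S_def T_def by blast
  then have "X * (2 * X - S\<^sup>2) \<le> S * T" by (simp add: power2_eq_square algebra_simps)
  also have "\<dots> \<le> N * (2 * \<eta>\<^sup>2 * N ^ 3)" using S0 T0 N assms(6) by (intro mult_mono) (auto simp: S_def T_def)
  also have "\<dots> = (\<eta> * N\<^sup>2) * (2 * (\<eta> * N\<^sup>2))" by (simp add: power2_eq_square power3_eq_cube)
  finally have u: "X * (2 * X - S\<^sup>2) \<le> (\<eta> * N\<^sup>2) * (2 * (\<eta> * N\<^sup>2))" .
  have "(\<eta> * N\<^sup>2) * (2 * (\<eta> * N\<^sup>2)) < X * (2 * X - S\<^sup>2)"
  proof (rule mult_strict_mono)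
    have "S\<^sup>2 \<ge> 0" by simp
    then show "\<eta> * N\<^sup>2 < X" using X by linarith
    show "2 * (\<eta> * N\<^sup>2) < 2 * X - S\<^sup>2" using X by linarith
    show "0 < X" using \<open>\<eta> * N\<^sup>2 < X\<close> p by linarith
    show "0 \<le> 2 * (\<eta> * N\<^sup>2)" using p by linarith
  qed
  with u show False by simp
qed

section \<open>Inequalities for the link of a single vertex\<close>

context c5graph
begin

lemma adj_perm:
  assumes "adj x y z"
  shows "adj y x z" "adj x z y" "adj y z x" "adj z x y" "adj z y x"
  using assms unfolding adj_def by (simp_all add: insert_commute)

text \<open>Ordered pairs are counted: a link edge inside one set contributes 2 to
  \<open>lk v X X\<close>, and \<open>lk v V V\<close> is twice the degree of
  \<open>v\<close>.\<close>

definition lk :: "'a \<Rightarrow> 'a set \<Rightarrow> 'a set \<Rightarrow> real" where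
  "lk v X Y = (\<Sum>x\<in>X. \<Sum>y\<in>Y. of_bool (adj v x y))"

definition dg :: "'a \<Rightarrow> 'a \<Rightarrow> 'a set \<Rightarrow> real" where
  "dg v x Y = (\<Sum>y\<in>Y. of_bool (adj v x y))"

definition tri :: "'a \<Rightarrow> real" where
  "tri v = (\<Sum>x\<in>V. \<Sum>y\<in>V. \<Sum>z\<in>V. of_bool (K4 v x y z))"

lemma ct_lk: "ct X Y Z = (\<Sum>x\<in>X. lk x Y Z)" by (simp add: ct_def lk_def)
lemma lk_dg: "lk v X Y = (\<Sum>x\<in>X. dg v x Y)" by (simp add: lk_def dg_def)

lemma lk_sym: "lk v X Y = lk v Y X"
proof -
  have "lk v X Y = (\<Sum>y\<in>Y. \<Sum>x\<in>X. of_bool (adj v x y))" unfolding lk_def by (rule sum.swap)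
  also have "\<dots> = lk v Y X" unfolding lk_def by (intro sum.cong refl) (simp add: adj_sym(2)[of v])
  finally show ?thesis .
qed

lemma ct_sym: "ct X Y Z = ct Y X Z" "ct X Y Z = ct X Z Y"
proof -
  have "ct X Y Z = (\<Sum>y\<in>Y. \<Sum>x\<in>X. \<Sum>z\<in>Z. of_bool (adj x y z))" unfolding ct_def by (rule sum.swap)
  also have "\<dots> = ct Y X Z" unfolding ct_def by (intro sum.cong refl) (subst adj_sym(1), rule refl)
  finally show "ct X Y Z = ct Y X Z" .
  show "ct X Y Z = ct X Z Y" unfolding ct_lk by (intro sum.cong refl lk_sym)
qed

lemma lk_nonneg: "0 \<le> lk v X Y" unfolding lk_def by (intro sum_nonneg) auto
lemma dg_nonneg: "0 \<le> dg v x Y" unfolding dg_def by (intro sum_nonneg) auto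
lemma ct_nonneg: "0 \<le> ct X Y Z" unfolding ct_def by (intro sum_nonneg) auto

lemma dg_le: "dg v x Y \<le> card Y"
proof -
  have "dg v x Y \<le> (\<Sum>y\<in>Y. 1)" unfolding dg_def by (intro sum_mono) auto
  then show ?thesis by simp
qed

lemma lk_le: "lk v X Y \<le> real (card X) * real (card Y)"
proof -
  have "lk v X Y \<le> (\<Sum>x\<in>X. real (card Y))" unfolding lk_dg by (intro sum_mono dg_le)
  then show ?thesis by simp
qed

lemma lk_Un1: "finite X \<Longrightarrow> finite X' \<Longrightarrow> X \<inter> X' = {} \<Longrightarrow> lk v (X \<union> X') Y = lk v X Y + lk v X' Y"
  unfolding lk_def by (rule sum.union_disjoint)

lemma lk_Un2: "finite Y \<Longrightarrow> finite Y' \<Longrightarrow> Y \<inter> Y' = {} \<Longrightarrow> lk v X (Y \<union> Y') = lk v X Y + lk v X Y'"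
  by (simp add: lk_sym[of v X] lk_Un1)

lemma ct_Un1: "finite X \<Longrightarrow> finite X' \<Longrightarrow> X \<inter> X' = {} \<Longrightarrow> ct (X \<union> X') Y Z = ct X Y Z + ct X' Y Z"
  unfolding ct_def by (rule sum.union_disjoint)

lemma miss_eq: "finite Y \<Longrightarrow> (\<Sum>x\<in>X. \<Sum>y\<in>Y. of_bool (\<not> adj v x y)) = real (card X) * real (card Y) - lk v X Y"
  by (simp add: lk_def of_bool_not_iff sum_subtractf)

lemma miss3_eq: "(\<Sum>x\<in>X. \<Sum>y\<in>Y. \<Sum>z\<in>Z. of_bool (\<not> adj x y z)) = real (card X) * real (card Y) * real (card Z) - ct X Y Z"
  by (simp add: ct_def of_bool_not_iff sum_subtractf)

text \<open>Fix \<open>x\<close> in \<open>A\<close> and \<open>z\<close> in \<open>C\<close>. If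
  \<open>v x y\<close> and \<open>v z y'\<close> are edges and both \<open>x y z\<close> and
  \<open>x y' z\<close> are edges too, then \<open>v\<close>, \<open>y\<close>, \<open>x\<close>,
  \<open>z\<close>, \<open>y'\<close> form a forbidden copy unless y = y'. So one of the two
  neighbourhoods in \<open>B\<close> lies, up to one vertex, among the \<open>y\<close> with
  \<open>x y z\<close> missing. The extra product of the sizes of \<open>A\<close> and
  \<open>C\<close> pays for that vertex.\<close>

lemma matching:
  assumes fin: "finite B"
  shows "lk v A B * lk v B C \<le> card B * (real (card A) * real (card B) * real (card C) - ct A B C + real (card A) * real (card C))"
proof -
  have loc: "dg v x B * dg v z B \<le> real (card B) * ((\<Sum>y\<in>B. of_bool (\<not> adj x y z)) + 1)" for x z
  proof -
    define P where "P = {y \<in> B. adj v x y}"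
    define Q where "Q = {y \<in> B. adj v z y}"
    define N where "N = {y \<in> B. \<not> adj x y z}"
    have fins: "finite P" "finite Q" "finite N" using fin by (auto simp: P_def Q_def N_def)
    have cs: "dg v x B = card P" "dg v z B = card Q" "(\<Sum>y\<in>B. of_bool (\<not> adj x y z) :: real) = card N"
      using fin by (simp_all add: dg_def P_def Q_def N_def of_bool_def sum.If_cases Int_def)
    have eq: "y = y'" if h: "y \<in> P" "y \<notin> N" "y' \<in> Q" "y' \<notin> N" for y y'
    proof -
      have "adj v y x" "adj y x z" "adj x z y'" "adj z y' v"
        using h unfolding P_def Q_def N_def by (auto intro: adj_perm)
      then show ?thesis by (rule adj_C5)
    qed
    have le: "card P \<le> card B" "card Q \<le> card B" using fin by (auto simp: P_def Q_def intro: card_mono)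
    have "card P * card Q \<le> card B * (card N + 1)"
    proof (cases "P \<subseteq> N")
      case True
      then have "card P \<le> card N" using fins by (intro card_mono)
      then have "card P * card Q \<le> (card N + 1) * card B" using le by (intro mult_le_mono) auto
      then show ?thesis by (simp add: mult.commute)
    next
      case False
      then obtain y where "y \<in> P" "y \<notin> N" by blast
      then have "Q \<subseteq> insert y N" using eq by blast
      then have "card Q \<le> card (insert y N)" using fins by (intro card_mono) auto
      also have "\<dots> \<le> card N + 1" using fins by (simp add: card_insert_if)
      finally show ?thesis using le by (intro mult_le_mono) auto
    qed
    then have "real (card P * card Q) \<le> real (card B * (card N + 1))" by (simp only: of_nat_le_iff)
    then show ?thesis unfolding cs by (simp add: distrib_left)
  qed
  have "lk v A B * lk v B C = (\<Sum>x\<in>A. \<Sum>z\<in>C. dg v x B * dg v z B)"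
    by (subst lk_sym[of v B C], unfold lk_dg) (rule sum_product)
  also have "\<dots> \<le> (\<Sum>x\<in>A. \<Sum>z\<in>C. real (card B) * ((\<Sum>y\<in>B. of_bool (\<not> adj x y z)) + 1))"
    by (intro sum_mono loc)
  also have "\<dots> = real (card B) * ((\<Sum>x\<in>A. \<Sum>z\<in>C. \<Sum>y\<in>B. of_bool (\<not> adj x z y)) + real (card A) * real (card C))"
  proof -
    have m: "(\<Sum>y\<in>B. of_bool (\<not> adj x y z) :: real) = (\<Sum>y\<in>B. of_bool (\<not> adj x z y))" for x z
      by (intro sum.cong refl) (subst adj_sym(2), rule refl)
    show ?thesis by (simp only: m sum_distrib_left[symmetric] sum.distrib) simp
  qed
  finally show ?thesis unfolding miss3_eq ct_sym(2)[of A C B] by (simp add: mult_ac)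
qed

text \<open>For x \<noteq> v and a \<open>z\<close> in the link of \<open>v\<close> together with
  \<open>b\<close> or \<open>b'\<close>, one of \<open>b x z\<close> and \<open>b' x z\<close> must
  be missing: otherwise the edge \<open>v b b'\<close> completes a forbidden copy in which
  \<open>v\<close> and \<open>x\<close> take the places of the uncovered pair.\<close>

lemma bad_pair:
  assumes v: "v \<in> A" "finite A" "finite C" and e: "adj v b b'"
  shows "(real (card A) - 1) * (\<Sum>z\<in>C. of_bool (adj v b z \<or> adj v b' z))
    \<le> (real (card A) * real (card C) - lk b A C) + (real (card A) * real (card C) - lk b' A C)"
proof -
  have key: "of_bool (adj v b z \<or> adj v b' z) \<le> of_bool (\<not> adj b x z) + (of_bool (\<not> adj b' x z) :: real)" if x: "x \<noteq> v" for x z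
  proof (cases "adj b x z \<and> adj b' x z")
    case True
    have "\<not> adj v b' z"
    proof
      assume "adj v b' z"
      moreover have "adj b v b'" "adj b' z x" "adj z x b"
        using adj_perm(1)[OF e] adj_perm(2)[of b' x z] adj_perm(5)[of b x z] True by blast+
      ultimately have "v = x" by (intro adj_C5[of b v b' z x])
      with x show False by simp
    qed
    moreover have "\<not> adj v b z"
    proof
      assume "adj v b z"
      moreover have "adj b' v b" "adj b z x" "adj z x b'"
        using adj_perm(4)[OF e] adj_perm(2)[of b x z] adj_perm(5)[of b' x z] True by blast+
      ultimately have "v = x" by (intro adj_C5[of b' v b z x])
      with x show False by simp
    qed
    ultimately show ?thesis by simp
  next
    case False
    then show ?thesis by (auto simp: of_bool_def)
  qed
  have "(real (card A) - 1) * (\<Sum>z\<in>C. of_bool (adj v b z \<or> adj v b' z)) = (\<Sum>x\<in>A - {v}. \<Sum>z\<in>C. of_bool (adj v b z \<or> adj v b' z))"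
    proof -
    have "real (card A) - 1 = real (card (A - {v}))" using card_Suc_Diff1[OF v(2,1)] by linarith
    then show ?thesis by simp
  qed
  also have "\<dots> \<le> (\<Sum>x\<in>A - {v}. \<Sum>z\<in>C. of_bool (\<not> adj b x z) + of_bool (\<not> adj b' x z))"
    by (intro sum_mono key) auto
  also have "\<dots> \<le> (\<Sum>x\<in>A. \<Sum>z\<in>C. of_bool (\<not> adj b x z) + of_bool (\<not> adj b' x z))"
    using v by (intro sum_mono2 sum_nonneg) auto
  also have "\<dots> = (real (card A) * real (card C) - lk b A C) + (real (card A) * real (card C) - lk b' A C)"
    by (simp only: sum.distrib miss_eq[OF v(3)])
  finally show ?thesis .
qed

text \<open>Give each b in \<open>B\<close> as weight \<open>t\<close> the fraction of
  \<open>C\<close> not joined to it in the link of \<open>v\<close>. If \<open>b\<close>,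
  \<open>b'\<close> form a link edge, \<open>bad_pair\<close> leaves few vertices of
  \<open>C\<close> joined to either of them, and those joined to both lie in link triangles; so both
  weights are close to 1, and the link edges in \<open>B\<close> are nearly counted with product
  weights. Mantel's theorem then bounds them by half the square of the total weight.\<close>

lemma lk_inner:
  assumes sub: "A \<subseteq> V" "B \<subseteq> V" "C \<subseteq> V" and v: "v \<in> A" and A2: "card A \<ge> 2" and C: "C \<noteq> {}"
    and \<eta>: "\<eta> > 0" and tri: "tri v \<le> 2 * \<eta>\<^sup>2 * real (card V) ^ 3"
  shows "lk v B B \<le> ((real (card B) * real (card C) - lk v B C) / card C)\<^sup>2 / 2 + \<eta> * (real (card V))\<^sup>2 + tri v / card C
    + 2 * (\<Sum>b\<in>B. dg v b B * (real (card A) * real (card C) - lk b A C)) / ((real (card A) - 1) * card C)"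
proof -
  have fin: "finite A" "finite B" "finite C" using sub finV by (auto intro: finite_subset)
  have c0: "real (card C) > 0" using C fin by (simp add: card_gt_0_iff)
  have a0: "real (card A) - 1 > 0" using A2 by simp
  define t where "t b = (\<Sum>z\<in>C. of_bool (\<not> adj v b z)) / card C" for b
  define m where "m b = real (card A) * real (card C) - lk b A C" for b
  define i where "i b b' = (\<Sum>z\<in>C. of_bool (adj v b z \<and> adj v b' z) :: real)" for b b'
  define k where "k = (real (card A) - 1) * card C"
  have k0: "k > 0" unfolding k_def using a0 c0 by simp
  have t1: "1 - t b = dg v b C / card C" for b
    using c0 by (simp add: t_def dg_def of_bool_not_iff sum_subtractf field_simps)
  have t01: "0 \<le> t b" "t b \<le> 1" for b
  proof -
    show "0 \<le> t b" unfolding t_def by (intro divide_nonneg_nonneg sum_nonneg) auto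
    have "0 \<le> 1 - t b" unfolding t1 by (intro divide_nonneg_nonneg dg_nonneg) auto
    then show "t b \<le> 1" by simp
  qed
  have S: "sum t B = (real (card B) * real (card C) - lk v B C) / card C"
    unfolding t_def sum_divide_distrib[symmetric] by (simp only: miss_eq[OF fin(3)])
  \<comment> \<open>Rests on 1 \<le> t t' + (1 - t) + (1 - t'), that is, (1 - t) (1 - t') \<ge> 0;
    the last two summands are the degrees into \<open>C\<close> divided by its size.\<close>
  have pt: "of_bool (adj v b b') \<le> t b * t b' * of_bool (adj v b b') + (m b + m b') / k * of_bool (adj v b b') + i b b' * of_bool (adj v b b') / card C" for b b'
  proof (cases "adj v b b'")
    case True
    have "dg v b C + dg v b' C = (\<Sum>z\<in>C. of_bool (adj v b z \<or> adj v b' z)) + i b b'"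
      unfolding dg_def i_def sum.distrib[symmetric] by (intro sum.cong) (auto simp: of_bool_def)
    also have "(\<Sum>z\<in>C. of_bool (adj v b z \<or> adj v b' z)) \<le> (m b + m b') / (real (card A) - 1)"
      using bad_pair[OF v fin(1,3) True] a0 unfolding m_def by (simp add: pos_le_divide_eq mult.commute)
    finally have "(dg v b C + dg v b' C) / card C \<le> ((m b + m b') / (real (card A) - 1) + i b b') / card C"
      using c0 by (intro divide_right_mono) auto
    then have "(1 - t b) + (1 - t b') \<le> (m b + m b') / k + i b b' / card C"
      unfolding t1 k_def by (simp add: add_divide_distrib)
    moreover have "0 \<le> (1 - t b) * (1 - t b')" using t01 by simp
    ultimately show ?thesis using True by (simp add: algebra_simps)
  qed simp
  have "lk v B B \<le> (\<Sum>b\<in>B. \<Sum>b'\<in>B. t b * t b' * of_bool (adj v b b') + (m b + m b') / k * of_bool (adj v b b') + i b b' * of_bool (adj v b b') / card C)"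
    unfolding lk_def by (intro sum_mono pt)
  also have "\<dots> = (\<Sum>b\<in>B. \<Sum>b'\<in>B. t b * t b' * of_bool (adj v b b'))
     + (\<Sum>b\<in>B. \<Sum>b'\<in>B. (m b + m b') / k * of_bool (adj v b b')) + (\<Sum>b\<in>B. \<Sum>b'\<in>B. i b b' * of_bool (adj v b b')) / card C"
    by (simp add: sum.distrib sum_divide_distrib)
  also have "(\<Sum>b\<in>B. \<Sum>b'\<in>B. t b * t b' * of_bool (adj v b b')) \<le> (sum t B)\<^sup>2 / 2 + \<eta> * (real (card V))\<^sup>2"
  proof (rule weighted_mantel_bound)
    show "adj v x y = adj v y x" for x y by (rule adj_sym)
    show "0 \<le> t x \<and> t x \<le> 1" for x using t01 by blast
    show "0 < real (card V)" using v sub finV by (auto simp: card_gt_0_iff)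
    have "sum t B \<le> (\<Sum>b\<in>B. 1)" using t01 by (intro sum_mono)
    also have "\<dots> \<le> card V" using sub finV by (simp add: card_mono)
    finally show "sum t B \<le> card V" .
    have "(\<Sum>x\<in>B. \<Sum>y\<in>B. \<Sum>z\<in>B. of_bool (adj v x y \<and> adj v x z \<and> adj v y z)) \<le> (\<Sum>x\<in>B. \<Sum>y\<in>B. \<Sum>z\<in>V. of_bool (adj v x y \<and> adj v x z \<and> adj v y z) :: real)"
      using sub finV by (intro sum_mono sum_mono2) auto
    also have "\<dots> \<le> (\<Sum>x\<in>B. \<Sum>y\<in>V. \<Sum>z\<in>V. of_bool (adj v x y \<and> adj v x z \<and> adj v y z))"
      using sub finV by (intro sum_mono sum_mono2 sum_nonneg) auto
    also have "\<dots> \<le> tri v" unfolding tri_def K4_def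
      using sub finV by (intro sum_mono2 sum_nonneg) auto
    finally show "(\<Sum>x\<in>B. \<Sum>y\<in>B. \<Sum>z\<in>B. of_bool (adj v x y \<and> adj v x z \<and> adj v y z)) \<le> 2 * \<eta>\<^sup>2 * real (card V) ^ 3"
      using tri by linarith
  qed (rule \<eta>)
  also have "(\<Sum>b\<in>B. \<Sum>b'\<in>B. (m b + m b') / k * of_bool (adj v b b')) = 2 * (\<Sum>b\<in>B. dg v b B * m b) / k"
  proof -
    have "(\<Sum>b\<in>B. \<Sum>b'\<in>B. m b' / k * of_bool (adj v b b')) = (\<Sum>b\<in>B. \<Sum>b'\<in>B. m b / k * of_bool (adj v b b'))"
      by (subst sum.swap) (intro sum.cong refl, simp add: adj_sym(2)[of v])
    moreover have "(\<Sum>b\<in>B. \<Sum>b'\<in>B. m b / k * of_bool (adj v b b')) = (\<Sum>b\<in>B. dg v b B * m b) / k"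
      unfolding dg_def by (simp add: sum_distrib_left sum_distrib_right sum_divide_distrib mult_ac)
    ultimately show ?thesis by (simp add: add_divide_distrib distrib_right sum.distrib)
  qed
  also have "(\<Sum>b\<in>B. \<Sum>b'\<in>B. i b b' * of_bool (adj v b b')) / card C \<le> tri v / card C"
  proof (rule divide_right_mono)
    have "(\<Sum>b\<in>B. \<Sum>b'\<in>B. i b b' * of_bool (adj v b b')) = (\<Sum>b\<in>B. \<Sum>b'\<in>B. \<Sum>z\<in>C. of_bool (K4 v b b' z))"
      unfolding i_def sum_distrib_right K4_def by (intro sum.cong refl) auto
    also have "\<dots> \<le> (\<Sum>b\<in>B. \<Sum>b'\<in>B. \<Sum>z\<in>V. of_bool (K4 v b b' z))"
      using sub finV by (intro sum_mono sum_mono2) auto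
    also have "\<dots> \<le> (\<Sum>b\<in>B. \<Sum>b'\<in>V. \<Sum>z\<in>V. of_bool (K4 v b b' z))"
      using sub finV by (intro sum_mono sum_mono2 sum_nonneg) auto
    also have "\<dots> \<le> tri v" unfolding tri_def using sub finV by (intro sum_mono2 sum_nonneg) auto
    finally show "(\<Sum>b\<in>B. \<Sum>b'\<in>B. i b b' * of_bool (adj v b b')) \<le> tri v" .
  qed simp
  finally show ?thesis unfolding S k_def m_def by simp
qed

end

section \<open>Partitions into three parts and maximum cuts\<close>

context c5graph
begin

definition partition3 :: "'a set \<Rightarrow> 'a set \<Rightarrow> 'a set \<Rightarrow> bool" where
  "partition3 A B C \<longleftrightarrow> A \<inter> B = {} \<and> A \<inter> C = {} \<and> B \<inter> C = {} \<and> A \<union> B \<union> C = V"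

definition maxcut :: "'a set \<Rightarrow> 'a set \<Rightarrow> 'a set \<Rightarrow> bool" where
  "maxcut A B C \<longleftrightarrow> partition3 A B C \<and> (\<forall>A' B' C'. partition3 A' B' C' \<longrightarrow> ct A' B' C' \<le> ct A B C)"

definition missing :: "'a set \<Rightarrow> 'a set \<Rightarrow> 'a set \<Rightarrow> real" where
  "missing A B C = real (card A) * real (card B) * real (card C) - ct A B C"

text \<open>The edges with exactly two vertices in one part. The two vertices in the repeated part
  are ordered in \<open>ct\<close>, hence the division by 2.\<close>

definition bad :: "'a set \<Rightarrow> 'a set \<Rightarrow> 'a set \<Rightarrow> real" where
  "bad A B C = (ct A B B + ct A C C + ct B A A + ct B C C + ct C A A + ct C B B) / 2"

lemma partition3_perm: "partition3 A B C \<Longrightarrow> partition3 B A C" "partition3 A B C \<Longrightarrow> partition3 A C B"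
  by (auto simp: partition3_def)

lemma maxcut_perm:
  assumes "maxcut A B C" shows "maxcut B A C" "maxcut A C B"
proof -
  from assms have p: "partition3 A B C" and h: "\<And>A' B' C'. partition3 A' B' C' \<Longrightarrow> ct A' B' C' \<le> ct A B C"
    unfolding maxcut_def by blast+
  show "maxcut B A C" unfolding maxcut_def using partition3_perm(1)[OF p] h ct_sym(1)[of A B C] by simp
  show "maxcut A C B" unfolding maxcut_def using partition3_perm(2)[OF p] h ct_sym(2)[of A B C] by simp
qed

lemma ct_rotate: "ct X Y Z = ct Y Z X" "ct X Y Z = ct Z X Y"
  using ct_sym(1)[of X Y Z] ct_sym(2)[of Y X Z] ct_sym(2)[of X Y Z] ct_sym(1)[of X Z Y] by simp_all

lemma missing_perm: "missing A B C = missing B A C" "missing A B C = missing A C B"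
  using ct_sym(1)[of A B C] ct_sym(2)[of A B C] by (simp_all add: missing_def)

lemma partition3_finite: "partition3 A B C \<Longrightarrow> finite A" "partition3 A B C \<Longrightarrow> finite B" "partition3 A B C \<Longrightarrow> finite C"
  using finV by (auto simp: partition3_def)

lemma partition3_subset: "partition3 A B C \<Longrightarrow> A \<subseteq> V" "partition3 A B C \<Longrightarrow> B \<subseteq> V" "partition3 A B C \<Longrightarrow> C \<subseteq> V"
  by (auto simp: partition3_def)

lemma partition3_card: "partition3 A B C \<Longrightarrow> card A + card B + card C = card V"
  using partition3_finite[of A B C] unfolding partition3_def
  by (auto simp: card_Un_disjoint Int_Un_distrib2)

lemma missing_nonneg: "partition3 A B C \<Longrightarrow> 0 \<le> missing A B C"
  using ct_le partition3_finite[of A B C] by (simp add: missing_def)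

lemma exists_maxcut:
  assumes "partition3 A B C"
  obtains A' B' C' where "maxcut A' B' C'" "ct A B C \<le> ct A' B' C'"
proof -
  define S where "S = (\<lambda>(X, Y, Z). ct X Y Z) ` {(X, Y, Z). partition3 X Y Z}"
  have "{(X, Y, Z). partition3 X Y Z} \<subseteq> Pow V \<times> Pow V \<times> Pow V" by (auto simp: partition3_def)
  then have "finite {(X, Y, Z). partition3 X Y Z}" by (rule finite_subset) (simp add: finV)
  then have fS: "finite S" by (simp add: S_def)
  have inS: "ct X Y Z \<in> S" if "partition3 X Y Z" for X Y Z
    using that unfolding S_def by (intro image_eqI[of _ _ "(X, Y, Z)"]) auto
  then have "Max S \<in> S" using assms fS by (intro Max_in) auto
  then obtain X Y Z where X: "partition3 X Y Z" "Max S = ct X Y Z" unfolding S_def by auto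
  have "maxcut X Y Z" unfolding maxcut_def using X(1) Max_ge[OF fS inS] by (simp flip: X(2))
  moreover have "ct A B C \<le> ct X Y Z" using Max_ge[OF fS inS[OF assms]] by (simp add: X(2))
  ultimately show thesis by (rule that)
qed

text \<open>Moving \<open>v\<close> from \<open>A\<close> to \<open>C\<close> would gain
  \<open>lk v A B\<close> transversal edges and lose \<open>lk v B C\<close>.\<close>

lemma maxcut_link:
  assumes m: "maxcut A B C" and v: "v \<in> A"
  shows "lk v A B \<le> lk v B C" "lk v A C \<le> lk v B C"
proof -
  have *: "lk v A B \<le> lk v B C" if m: "maxcut A B C" for B C
  proof -
    have p: "partition3 A B C" using m by (simp add: maxcut_def)
    note f = partition3_finite[OF p]
    have vC: "v \<notin> C" using p v by (auto simp: partition3_def)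
    have "partition3 (A - {v}) B (insert v C)" using p v by (auto simp: partition3_def)
    then have "ct (A - {v}) B (insert v C) \<le> ct A B C" using m by (simp add: maxcut_def)
    moreover have "ct (A - {v}) B (insert v C) = ct (A - {v}) B C + lk v (A - {v}) B"
    proof -
      have "ct (A - {v}) B (insert v C) = ct (insert v C) (A - {v}) B" by (rule ct_rotate)
      also have "\<dots> = lk v (A - {v}) B + ct C (A - {v}) B" using f vC by (simp add: ct_lk)
      also have "ct C (A - {v}) B = ct (A - {v}) B C" by (rule ct_rotate)
      finally show ?thesis by simp
    qed
    moreover have "ct A B C = lk v B C + ct (A - {v}) B C" unfolding ct_lk by (rule sum.remove[OF f(1) v])
    moreover have "lk v A B = lk v (A - {v}) B"
    proof -
      have "dg v v B = 0" unfolding dg_def using adjD(4)[of v v] by (intro sum.neutral) auto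
      then show ?thesis unfolding lk_dg using sum.remove[OF f(1) v, of "\<lambda>x. dg v x B"] by simp
    qed
    ultimately show ?thesis by simp
  qed
  from *[OF m] show "lk v A B \<le> lk v B C" .
  from *[OF maxcut_perm(2)[OF m]] show "lk v A C \<le> lk v B C" by (simp add: lk_sym[of v C B])
qed

lemma lk_V:
  assumes p: "partition3 A B C"
  shows "lk v V V = lk v A A + lk v B B + lk v C C + 2 * (lk v A B + lk v A C + lk v B C)"
proof -
  note f = partition3_finite[OF p]
  have V: "V = A \<union> (B \<union> C)" and d: "A \<inter> (B \<union> C) = {}" "B \<inter> C = {}" using p by (auto simp: partition3_def)
  show ?thesis unfolding V using f d
    by (simp add: lk_Un1 lk_Un2 lk_sym[of v B A] lk_sym[of v C A] lk_sym[of v C B])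
qed

lemma ct_induced: "W \<subseteq> V \<Longrightarrow> ct W W W = 6 * real (card (induced_edges E W))"
proof -
  assume "W \<subseteq> V"
  from sum_adj_eq[OF this]
  have "real_of_int (\<Sum>u\<in>W. \<Sum>v\<in>W. \<Sum>w\<in>W. of_bool (adj u v w)) = real_of_int (6 * int (card (induced_edges E W)))" by (simp only:)
  then show ?thesis by (simp add: ct_def)
qed

lemma edge_count:
  assumes p: "partition3 A B C"
  shows "real (card E) = ct A B C + bad A B C + card (induced_edges E A) + card (induced_edges E B) + card (induced_edges E C)"
proof -
  note f = partition3_finite[OF p]
  have V: "V = A \<union> (B \<union> C)" and d: "A \<inter> (B \<union> C) = {}" "B \<inter> C = {}" using p by (auto simp: partition3_def)
  have X: "ct X V V = ct X A A + ct X B B + ct X C C + 2 * (ct X A B + ct X A C + ct X B C)" for X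
    by (simp add: ct_lk lk_V[OF p] sum.distrib sum_distrib_left[symmetric])
  have "6 * real (card E) = ct V V V" using ct_induced[of V] by (simp add: induced_V)
  also have "\<dots> = ct A V V + ct B V V + ct C V V"
    using f d by (subst (1) V) (simp add: ct_Un1)
  also have "\<dots> = ct A A A + ct B B B + ct C C C + 6 * ct A B C + 6 * bad A B C"
  proof -
    have "ct A A B = ct B A A" "ct A A C = ct C A A" "ct B A B = ct A B B" "ct B B C = ct C B B" "ct C A C = ct A C C" "ct C B C = ct B C C"
      "ct B A C = ct A B C" "ct C A B = ct A B C"
      by (rule ct_rotate ct_sym(1))+
    then show ?thesis unfolding X bad_def by simp
  qed
  finally show ?thesis using ct_induced[OF partition3_subset(1)[OF p]] ct_induced[OF partition3_subset(2)[OF p]]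
      ct_induced[OF partition3_subset(3)[OF p]] by simp
qed

text \<open>Apply \<open>blow_up_C5m_free\<close> to the 3-graphs induced on the parts: exchanging
  the bad edges for the missing triples gives a competitor for the extremal number.\<close>

lemma extremal_gap:
  assumes p: "partition3 A B C"
  shows "missing A B C \<le> bad A B C + (real (ex_C5m (card V)) - real (card E))"
proof -
  have d: "A \<inter> B = {}" "A \<inter> C = {}" "B \<inter> C = {}" "A \<union> B \<union> C = V" using p by (auto simp: partition3_def)
  note s = partition3_subset[OF p]
  note bu = blow_up_C5m_free[OF d three_graph_induced[OF tg s(1)] C5m_free_induced[OF fr s(1)]
     three_graph_induced[OF tg s(2)] C5m_free_induced[OF fr s(2)] three_graph_induced[OF tg s(3)] C5m_free_induced[OF fr s(3)]]
  have "card A * card B * card C + card (induced_edges E A) + card (induced_edges E B) + card (induced_edges E C) \<le> ex_C5m (card V)"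
    using card_le_ex_C5m[OF bu(1,2)] unfolding bu(3) .
  then have "real (card A * card B * card C + card (induced_edges E A) + card (induced_edges E B) + card (induced_edges E C)) \<le> real (ex_C5m (card V))"
    by (simp only: of_nat_le_iff)
  then show ?thesis using edge_count[OF p] by (simp add: missing_def)
qed

lemma miss_sum:
  assumes "finite C"
  shows "(\<Sum>v\<in>A. real (card B) * real (card C) - lk v B C) = missing A B C"
  by (simp add: missing_def sum_subtractf ct_lk)

end

context c5graph
begin

lemma lk_self:
  assumes "A \<subseteq> V" "V \<noteq> {}" "\<eta> > 0" "tri v \<le> 2 * \<eta>\<^sup>2 * real (card V) ^ 3"
  shows "lk v A A \<le> (real (card A))\<^sup>2 / 2 + \<eta> * (real (card V))\<^sup>2"
proof -
  have "(\<Sum>x\<in>A. \<Sum>y\<in>A. 1 * 1 * of_bool (adj v x y)) \<le> (\<Sum>x\<in>A. 1)\<^sup>2 / 2 + \<eta> * (real (card V))\<^sup>2"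
  proof (rule weighted_mantel_bound)
    show "adj v x y = adj v y x" for x y by (rule adj_sym)
    show "0 < real (card V)" using assms finV by (simp add: card_gt_0_iff)
    show "(\<Sum>x\<in>A. 1) \<le> real (card V)" using assms finV by (simp add: card_mono)
    have "(\<Sum>x\<in>A. \<Sum>y\<in>A. \<Sum>z\<in>A. of_bool (adj v x y \<and> adj v x z \<and> adj v y z)) \<le> (\<Sum>x\<in>A. \<Sum>y\<in>A. \<Sum>z\<in>V. of_bool (adj v x y \<and> adj v x z \<and> adj v y z) :: real)"
      using assms finV by (intro sum_mono sum_mono2) auto
    also have "\<dots> \<le> (\<Sum>x\<in>A. \<Sum>y\<in>V. \<Sum>z\<in>V. of_bool (adj v x y \<and> adj v x z \<and> adj v y z))"
      using assms finV by (intro sum_mono sum_mono2 sum_nonneg) auto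
    also have "\<dots> \<le> tri v" unfolding tri_def K4_def
      using assms finV by (intro sum_mono2 sum_nonneg) auto
    finally show "(\<Sum>x\<in>A. \<Sum>y\<in>A. \<Sum>z\<in>A. of_bool (adj v x y \<and> adj v x z \<and> adj v y z)) \<le> 2 * \<eta>\<^sup>2 * real (card V) ^ 3"
      using assms by linarith
  qed (use assms in auto)
  then show ?thesis by (simp add: lk_def)
qed

end

text \<open>The situation after the deletion of exceptional vertices. Since \<open>lk\<close> counts
  ordered pairs, density 1/4 corresponds to an average of n^2/4 for \<open>lk v V V\<close>. The
  condition on \<delta>^2 n allows 1/n to be absorbed into \<delta>.\<close>

locale c5graph_regular = c5graph +
  fixes \<delta> n :: real
  assumes n: "n = real (card V)" and \<delta>: "0 < \<delta>" "\<delta> \<le> 1 / 10 ^ 7" and n\<delta>: "1 \<le> \<delta>\<^sup>2 * n"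
    and deg: "\<And>v. v \<in> V \<Longrightarrow> lk v V V \<ge> (1/4 - \<delta>) * n\<^sup>2"
    and tri_le: "\<And>v. v \<in> V \<Longrightarrow> tri v \<le> 2 * \<delta>\<^sup>2 * n ^ 3"
begin

definition dense :: "'a set \<Rightarrow> 'a set \<Rightarrow> 'a set \<Rightarrow> bool" where
  "dense A B C \<longleftrightarrow> maxcut A B C \<and> ct A B C \<ge> (1/27 - 73/100000) * n ^ 3"

definition sz :: "'a set \<Rightarrow> real" where "sz X = real (card X) / n"

definition mu :: "'a set \<Rightarrow> 'a set \<Rightarrow> 'a set \<Rightarrow> real" where "mu A B C = missing A B C / n ^ 3"

lemma npos: "0 < n"
proof (rule ccontr)
  assume "\<not> 0 < n"
  then have "\<delta>\<^sup>2 * n \<le> 0" by (simp add: mult_nonneg_nonpos)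
  then show False using n\<delta> by linarith
qed

lemma inv_n: "1 / n \<le> \<delta>\<^sup>2" using n\<delta> npos by (simp add: pos_divide_le_eq)

lemma \<delta>sq: "\<delta>\<^sup>2 \<le> \<delta> / 10 ^ 7"
proof -
  have "\<delta> * \<delta> \<le> \<delta> * (1 / 10 ^ 7)" using \<delta> by (intro mult_left_mono) auto
  then show ?thesis by (simp add: power2_eq_square)
qed

lemma card_sz: "real (card X) = sz X * n" using npos by (simp add: sz_def)
lemma missing_mu: "missing A B C = mu A B C * n ^ 3" using npos by (simp add: mu_def)

lemma dense_perm:
  assumes "dense A B C" shows "dense B A C" "dense A C B"
  using assms maxcut_perm[of A B C] ct_sym(1)[of A B C] ct_sym(2)[of A B C] by (auto simp: dense_def)

lemma mu_perm: "mu A B C = mu B A C" "mu A B C = mu A C B"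
  using missing_perm[of A B C] by (simp_all add: mu_def)

lemma dense_sizes:
  assumes d: "dense A B C"
  shows "sz A + sz B + sz C = 1" "0 \<le> mu A B C" "sz A * sz B * sz C - mu A B C \<ge> 1/27 - 73/100000"
    "mu A B C \<le> 73/100000" "28/100 < sz A" "sz A < 39/100" "28/100 < sz B" "sz B < 39/100" "28/100 < sz C" "sz C < 39/100"
proof -
  have p: "partition3 A B C" using d by (simp add: dense_def maxcut_def)
  have "real (card A) + real (card B) + real (card C) = n" using partition3_card[OF p] unfolding n by linarith
  then have "(sz A + sz B + sz C) * n = 1 * n" by (simp add: card_sz algebra_simps)
  then show one: "sz A + sz B + sz C = 1" using npos by simp
  show mu0: "0 \<le> mu A B C" using missing_nonneg[OF p] npos by (simp add: mu_def)
  have "(sz A * sz B * sz C - mu A B C) * n ^ 3 = ct A B C"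
    using missing_mu[of A B C] by (simp add: missing_def card_sz power3_eq_cube algebra_simps)
  then have "(1/27 - 73/100000) * n ^ 3 \<le> (sz A * sz B * sz C - mu A B C) * n ^ 3" using d by (simp add: dense_def)
  then show cr: "sz A * sz B * sz C - mu A B C \<ge> 1/27 - 73/100000" using npos by (simp add: mult_le_cancel_right)
  have nn: "0 \<le> sz X" for X using npos by (simp add: sz_def)
  have pp: "0 < sz A * sz B * sz C" using cr mu0 by linarith
  then have pos: "0 < sz A" "0 < sz B" "0 < sz C" using nn[of A] nn[of B] nn[of C] by (auto simp: zero_less_mult_iff)
  have bd: "28/100 < a \<and> a < 39/100" "a * (b * c) \<le> 1/27"
    if "0 < a" "0 < b" "0 < c" "a + b + c = 1" "a * (b * c) \<ge> 1/27 - 73/100000" for a b c :: real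
  proof -
    have "0 \<le> (b - c)\<^sup>2" by simp
    then have "4 * (b * c) \<le> (b + c)\<^sup>2" by (simp add: power2_eq_square algebra_simps)
    moreover have "b + c = 1 - a" using that by simp
    ultimately have h: "4 * (b * c) \<le> (1 - a)\<^sup>2" by simp
    have a1: "a < 1" using that by simp
    show "28/100 < a \<and> a < 39/100" using part_size_bounds[OF that(1) a1 h that(5)] by simp
    show "a * (b * c) \<le> 1/27" by (rule product_le[OF that(1) a1 h])
  qed
  have cr': "sz A * sz B * sz C \<ge> 1/27 - 73/100000" using cr mu0 by linarith
  show "28/100 < sz A" "sz A < 39/100" using bd(1)[of "sz A" "sz B" "sz C"] pos one cr' by (simp_all add: mult_ac)
  show "28/100 < sz B" "sz B < 39/100" using bd(1)[of "sz B" "sz A" "sz C"] pos one cr' by (simp_all add: mult_ac)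
  show "28/100 < sz C" "sz C < 39/100" using bd(1)[of "sz C" "sz A" "sz B"] pos one cr' by (simp_all add: mult_ac)
  have "sz A * (sz B * sz C) \<le> 1/27" using bd(2)[of "sz A" "sz B" "sz C"] pos one cr' by (simp add: mult_ac)
  then show "mu A B C \<le> 73/100000" using cr by (simp add: mult_ac)
qed

lemma dense_basic:
  assumes d: "dense A B C"
  shows "partition3 A B C" "A \<subseteq> V" "B \<subseteq> V" "C \<subseteq> V" "finite A" "finite B" "finite C" "card A \<ge> 2" "C \<noteq> {}" "V \<noteq> {}"
    "real (card A) - 1 \<ge> 99/100 * (sz A * n)"
proof -
  show p: "partition3 A B C" using d by (simp add: dense_def maxcut_def)
  show "A \<subseteq> V" "B \<subseteq> V" "C \<subseteq> V" "finite A" "finite B" "finite C"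
    using partition3_subset[OF p] partition3_finite[OF p] by auto
  have "1 \<le> \<delta> / 10 ^ 7 * n" using n\<delta> mult_right_mono[OF \<delta>sq, of n] npos by linarith
  also have "\<dots> \<le> 1 / 10 ^ 7 / 10 ^ 7 * n" using \<delta> npos by (intro mult_right_mono divide_right_mono) auto
  finally have n14: "n \<ge> 10 ^ 14" by simp
  have "28/100 * n \<le> sz A * n" "28/100 * n \<le> sz C * n"
    using dense_sizes(5,9)[OF d] npos by (intro mult_right_mono; simp)+
  then have a: "real (card A) \<ge> 28/100 * n" "real (card C) \<ge> 28/100 * n" by (simp_all add: card_sz)
  moreover have "n \<ge> 100000000000000" using n14 by simp
  ultimately have "real (card A) \<ge> 1000" "real (card C) > 0" by linarith+
  then show "card A \<ge> 2" "C \<noteq> {}" by (linarith, auto)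
  then show "V \<noteq> {}" using \<open>C \<subseteq> V\<close> by auto
  show "real (card A) - 1 \<ge> 99/100 * (sz A * n)" using \<open>real (card A) \<ge> 1000\<close> by (simp flip: card_sz)
qed

text \<open>\<open>lk_inner\<close> in normalized sizes, with both the Mantel error and the link
  triangles absorbed in 2 \<delta> n^2.\<close>

lemma inner_bound:
  assumes d: "dense A B C" and v: "v \<in> A"
  shows "lk v B B \<le> ((sz B * sz C - lk v B C / n\<^sup>2) / sz C)\<^sup>2 / 2 * n\<^sup>2 + 2 * \<delta> * n\<^sup>2
    + 2 * (\<Sum>b\<in>B. dg v b B * (real (card A) * real (card C) - lk b A C)) / ((real (card A) - 1) * card C)"
proof -
  note s = dense_sizes[OF d] and bs = dense_basic[OF d]
  have vV: "v \<in> V" using v bs by auto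
  have "lk v B B \<le> ((real (card B) * real (card C) - lk v B C) / card C)\<^sup>2 / 2 + \<delta> * (real (card V))\<^sup>2 + tri v / card C
    + 2 * (\<Sum>b\<in>B. dg v b B * (real (card A) * real (card C) - lk b A C)) / ((real (card A) - 1) * card C)"
    using tri_le[OF vV] by (intro lk_inner bs v \<delta>) (simp add: n)
  moreover have "((real (card B) * real (card C) - lk v B C) / card C)\<^sup>2 / 2 = ((sz B * sz C - lk v B C / n\<^sup>2) / sz C)\<^sup>2 / 2 * n\<^sup>2"
    unfolding card_sz using npos s by (simp add: power2_eq_square field_simps)
  moreover have "tri v / card C \<le> \<delta> * n\<^sup>2"
  proof -
    have "tri v / card C \<le> (2 * \<delta>\<^sup>2 * n ^ 3) / (28/100 * n)"
      using tri_le[OF vV] s npos unfolding card_sz by (intro frac_le) (auto simp: tri_def intro!: sum_nonneg mult_nonneg_nonneg)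
    also have "\<dots> = (200/28 * \<delta>\<^sup>2) * n\<^sup>2" using npos by (simp add: power2_eq_square power3_eq_cube)
    also have "\<dots> \<le> \<delta> * n\<^sup>2" using \<delta>sq \<delta> by (intro mult_right_mono) auto
    finally show ?thesis .
  qed
  ultimately show ?thesis by (simp add: n)
qed

text \<open>Dividing the link counts by n^2, or by 2 n^2 within a part, leads to
  \<open>vertex_link_density\<close> with error 5 \<delta>. The local claims are stated for general
  \<open>X\<close>, \<open>Y\<close> in order to be used for both orders of the other two
  parts.\<close>

lemma link_dense:
  assumes d: "dense A B C" and v: "v \<in> A"
  shows "lk v B C \<ge> 64/100 * (real (card B) * real (card C))"
proof -
  note s = dense_sizes[OF d] and bs = dense_basic[OF d]
  have vV: "v \<in> V" using v bs by auto
  have mc: "maxcut A B C" using d by (simp add: dense_def)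
  have n2: "n\<^sup>2 > 0" "n ^ 4 > 0" using npos by auto
  define q where "q = lk v B C / n\<^sup>2"
  have match: "lk v A X / n\<^sup>2 * q \<le> sz X * mu A B C + 5 * \<delta>" if dX: "dense A X Y" "lk v X Y = lk v B C" "mu A X Y = mu A B C" for X Y
  proof -
    note sX = dense_sizes[OF dX(1)]
    have "lk v A X * lk v X Y \<le> card X * (missing A X Y + real (card A) * real (card Y))"
      using matching[of X v A Y] dense_basic(6)[OF dX(1)] by (simp add: missing_def)
    then have "lk v A X * lk v B C / n ^ 4 \<le> (sz X * n * (mu A B C * n ^ 3 + sz A * n * (sz Y * n))) / n ^ 4"
      unfolding dX(2) missing_mu dX(3) card_sz using n2 by (intro divide_right_mono) auto
    also have "\<dots> = sz X * mu A B C + sz X * sz A * sz Y * (1 / n)"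
      using npos by (simp add: power_numeral_reduce field_simps)
    also have "sz X * sz A * sz Y * (1 / n) \<le> 1 * \<delta>\<^sup>2"
      using sX npos inv_n by (intro mult_mono mult_le_one) auto
    also have "1 * \<delta>\<^sup>2 \<le> 5 * \<delta>" using \<delta>sq \<delta> by simp
    finally show ?thesis unfolding q_def by (simp add: power_numeral_reduce)
  qed
  have inner: "lk v X X / (2 * n\<^sup>2) \<le> ((sz X * sz Y - q) / sz Y)\<^sup>2 / 4 + mu A B C * sz X / (sz A * sz Y) + 5 * \<delta>"
    if dX: "dense A X Y" "lk v X Y = lk v B C" "mu A X Y = mu A B C" for X Y
  proof -
    note sX = dense_sizes[OF dX(1)] and bX = dense_basic[OF dX(1)]
    have mnn: "0 \<le> real (card A) * real (card Y) - lk b A Y" for b using lk_le[of b A Y] by simp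
    have "(\<Sum>b\<in>X. dg v b X * (real (card A) * real (card Y) - lk b A Y)) \<le> (\<Sum>b\<in>X. real (card X) * (real (card A) * real (card Y) - lk b A Y))"
      using dg_le mnn by (intro sum_mono mult_right_mono) auto
    also have "\<dots> = real (card X) * missing X A Y" using miss_sum[OF bX(7), where A = X and B = A] by (simp add: sum_distrib_left[symmetric])
    also have "\<dots> = sz X * n * (mu A B C * n ^ 3)" by (simp add: missing_mu card_sz mu_perm(1)[of X A Y] dX(3))
    finally have S: "(\<Sum>b\<in>X. dg v b X * (real (card A) * real (card Y) - lk b A Y)) \<le> sz X * n * (mu A B C * n ^ 3)" .
    have K: "(real (card A) - 1) * card Y = (sz A - 1 / n) * sz Y * n\<^sup>2"
      unfolding card_sz using npos by (simp add: power2_eq_square field_simps)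
    have a1: "1 / n \<le> 1/100" using inv_n \<delta>sq \<delta> by simp
    have a2: "27/100 \<le> sz A - 1 / n" using a1 s by linarith
    have K0: "(sz A - 1 / n) * sz Y * n\<^sup>2 > 0" 
    proof -
      have "sz A - 1 / n > 0" "sz Y > 0" "n\<^sup>2 > 0" using a1 sX npos by (linarith, linarith, simp)
      then show ?thesis by simp
    qed
    have "2 * (\<Sum>b\<in>X. dg v b X * (real (card A) * real (card Y) - lk b A Y)) / ((real (card A) - 1) * card Y)
       \<le> 2 * (sz X * n * (mu A B C * n ^ 3)) / ((sz A - 1 / n) * sz Y * n\<^sup>2)"
      unfolding K using S K0 by (intro divide_right_mono) auto
    also have "\<dots> = 2 * n\<^sup>2 * (mu A B C * sz X / ((sz A - 1 / n) * sz Y))"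
    proof -
      have "2 * (x * n * (m * n ^ 3)) / (D * n\<^sup>2) = 2 * n\<^sup>2 * (m * x / D)" for x m D :: real
        using npos by (cases "D = 0") (simp_all add: power2_eq_square power3_eq_cube field_simps)
      then show ?thesis .
    qed
    finally have "lk v X X / (2 * n\<^sup>2) \<le> (((sz X * sz Y - q) / sz Y)\<^sup>2 / 2 * n\<^sup>2 + 2 * \<delta> * n\<^sup>2 + 2 * n\<^sup>2 * (mu A B C * sz X / ((sz A - 1 / n) * sz Y))) / (2 * n\<^sup>2)"
      using inner_bound[OF dX(1) v] n2 unfolding dX(2) q_def[symmetric] by (intro divide_right_mono) auto
    also have "\<dots> = ((sz X * sz Y - q) / sz Y)\<^sup>2 / 4 + \<delta> + mu A B C * sz X / ((sz A - 1 / n) * sz Y)"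
      using n2 by (simp add: add_divide_distrib)
    \<comment> \<open>Replaces the size of \<open>A\<close> minus 1 by the size of \<open>A\<close>;
      the correction carries a further factor 1/n and vanishes in \<delta>.\<close>
    also have "mu A B C * sz X / ((sz A - 1 / n) * sz Y) = mu A B C * sz X / (sz A * sz Y) + mu A B C * sz X / sz Y * (1 / n) / (sz A * (sz A - 1 / n))"
    proof -
      have "1 / (x - y) = 1 / x + y / (x * (x - y))" if "x > 0" "x - y > 0" for x y :: real
        using that by (simp add: field_simps)
      from this[of "sz A" "1 / n"] have "1 / (sz A - 1 / n) = 1 / sz A + (1 / n) / (sz A * (sz A - 1 / n))" using a1 s by simp
      moreover have "mu A B C * sz X / (z * sz Y) = mu A B C * sz X / sz Y * (1 / z)" for z by simp
      ultimately show ?thesis by (simp only:) (simp add: distrib_left)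
    qed
    also have "mu A B C * sz X / sz Y * (1 / n) / (sz A * (sz A - 1 / n)) \<le> \<delta>"
    proof -
      have "mu A B C * sz X / sz Y * (1 / n) / (sz A * (sz A - 1 / n)) \<le> (1/100 * 1 / (28/100) * (1 / n)) / (28/100 * (27/100))"
        using s sX npos a2 by (intro frac_le mult_mono) auto
      also have "\<dots> \<le> 1 / n" using npos by (simp add: field_simps)
      also have "\<dots> \<le> \<delta>" using inv_n \<delta>sq \<delta> by simp
      finally show ?thesis .
    qed
    finally show ?thesis using \<delta> by simp
  qed
  have dC: "dense A C B" by (rule dense_perm(2)[OF d])
  have "q \<ge> 64/100 * (sz B * sz C)"
  proof (rule vertex_link_density[where a = "sz A" and M = "mu A B C" and \<delta> = "5 * \<delta>" and ?e11.0 = "lk v A A / (2 * n\<^sup>2)"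
        and ?e12.0 = "lk v A B / n\<^sup>2" and ?e13.0 = "lk v A C / n\<^sup>2" and ?e22.0 = "lk v B B / (2 * n\<^sup>2)" and ?e33.0 = "lk v C C / (2 * n\<^sup>2)"])
    show "0 < sz A" "0 < sz B" "0 < sz C" using s by linarith+
    show "sz A + sz B + sz C = 1" "0 \<le> mu A B C" "sz A * sz B * sz C - mu A B C \<ge> 1/27 - 73/100000" using s by auto
    show "0 \<le> q" "0 \<le> lk v A B / n\<^sup>2" "0 \<le> lk v A C / n\<^sup>2" unfolding q_def using lk_nonneg n2 by simp_all
    have "q \<le> (real (card B) * real (card C)) / n\<^sup>2" unfolding q_def using lk_le[of v B C] by (intro divide_right_mono) auto
    also have "\<dots> = sz B * sz C" unfolding card_sz using npos by (simp add: power2_eq_square)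
    finally show "q \<le> sz B * sz C" .
    show "0 \<le> 5 * \<delta>" "5 * \<delta> \<le> 1 / 10 ^ 6" using \<delta> by simp_all
    show "lk v A B / n\<^sup>2 \<le> q" "lk v A C / n\<^sup>2 \<le> q" unfolding q_def using maxcut_link[OF mc v] n2 by (simp_all add: divide_right_mono)
    show "lk v A B / n\<^sup>2 * q \<le> sz B * mu A B C + 5 * \<delta>" by (rule match[OF d]) auto
    show "lk v A C / n\<^sup>2 * q \<le> sz C * mu A B C + 5 * \<delta>" by (rule match[OF dC]) (auto simp: lk_sym[of v C B] mu_perm(2)[of A C B])
    have "lk v A A / (2 * n\<^sup>2) \<le> ((real (card A))\<^sup>2 / 2 + \<delta> * n\<^sup>2) / (2 * n\<^sup>2)"
      using lk_self[OF bs(2,10) \<delta>(1)] tri_le[OF vV] n2 by (intro divide_right_mono) (auto simp: n)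
    also have "\<dots> = (sz A)\<^sup>2 / 4 + \<delta> / 2" unfolding card_sz using npos by (simp add: power2_eq_square field_simps)
    finally show "lk v A A / (2 * n\<^sup>2) \<le> (sz A)\<^sup>2 / 4 + 5 * \<delta>" using \<delta> by simp
    show "lk v B B / (2 * n\<^sup>2) \<le> ((sz B * sz C - q) / sz C)\<^sup>2 / 4 + mu A B C * sz B / (sz A * sz C) + 5 * \<delta>" by (rule inner[OF d]) auto
    show "lk v C C / (2 * n\<^sup>2) \<le> ((sz B * sz C - q) / sz B)\<^sup>2 / 4 + mu A B C * sz C / (sz A * sz B) + 5 * \<delta>"
      using inner[OF dC] by (simp add: lk_sym[of v C B] mu_perm(2)[of A C B] mult.commute)
    have "(1/4 - \<delta>) * n\<^sup>2 / (2 * n\<^sup>2) \<le> lk v V V / (2 * n\<^sup>2)" using deg[OF vV] n2 by (intro divide_right_mono) auto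
    also have "\<dots> = q + lk v A A / (2 * n\<^sup>2) + lk v A B / n\<^sup>2 + lk v A C / n\<^sup>2 + lk v B B / (2 * n\<^sup>2) + lk v C C / (2 * n\<^sup>2)"
      unfolding lk_V[OF bs(1)] q_def by (simp add: add_divide_distrib)
    also have "(1/4 - \<delta>) * n\<^sup>2 / (2 * n\<^sup>2) = 1/8 - \<delta> / 2" using npos by (simp add: field_simps)
    finally show "1/8 - 5 * \<delta> \<le> q + lk v A A / (2 * n\<^sup>2) + lk v A B / n\<^sup>2 + lk v A C / n\<^sup>2 + lk v B B / (2 * n\<^sup>2) + lk v C C / (2 * n\<^sup>2)"
      using \<delta> by simp
  qed
  then have "64/100 * (sz B * sz C) * n\<^sup>2 \<le> q * n\<^sup>2" using n2 by (intro mult_right_mono) auto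
  then show ?thesis unfolding q_def card_sz using npos by (simp add: power2_eq_square mult_ac)
qed

text \<open>Sum \<open>inner_bound\<close> over \<open>A\<close>. By \<open>link_dense\<close> the
  deficit of a vertex is at most 36 percent, so its square is at most linear in the deficit, and the
  deficits add up to the missing triples. The remaining term is of second order: both the deficits
  of the vertices in \<open>B\<close> and their link edges to \<open>A\<close> are proportional to
  the number of missing triples.\<close>

lemma inner_sum:
  assumes d: "dense A B C"
  shows "ct A B B \<le> (18/100 * (sz B / sz C) * mu A B C + 32/10 * (mu A B C)\<^sup>2 / (sz A * (sz C)\<^sup>2) + 3 * \<delta>) * n ^ 3"
proof -
  note s = dense_sizes[OF d] and bs = dense_basic[OF d]
  define m where "m b = real (card A) * real (card C) - lk b A C" for b
  define k where "k v = real (card B) * real (card C) - lk v B C" for v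
  define K where "K = (real (card A) - 1) * real (card C)"
  define \<mu> where "\<mu> = mu A B C"
  have m0: "0 \<le> m b" for b using lk_le[of b A C] by (simp add: m_def)
  have k0: "0 \<le> k v" for v using lk_le[of v B C] by (simp add: k_def)
  have msum: "(\<Sum>b\<in>B. m b) = \<mu> * n ^ 3"
    using miss_sum[OF bs(7), where A = B and B = A] unfolding m_def \<mu>_def by (simp add: missing_mu mu_perm(1)[of B A C])
  have ksum: "(\<Sum>v\<in>A. k v) = \<mu> * n ^ 3"
    using miss_sum[OF bs(7), where A = A and B = B] unfolding k_def \<mu>_def by (simp add: missing_mu)
  have an: "sz A * n > 0" "sz C * n > 0" using s npos by simp_all
  have K0: "K \<ge> 99/100 * (sz A * n) * (sz C * n)"
    unfolding K_def using bs(11) an card_sz[of C] by (intro mult_mono) auto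
  have Kp: "0 < K"
  proof -
    have "0 < 99/100 * (sz A * n) * (sz C * n)" using s npos by (intro mult_pos_pos) auto
    then show ?thesis using K0 by linarith
  qed
  have vb: "lk v B B \<le> 18/100 * (sz B / sz C) * k v + 2 * \<delta> * n\<^sup>2 + 2 * (\<Sum>b\<in>B. dg v b B * m b) / K" if v: "v \<in> A" for v
  proof -
    have "((sz B * sz C - lk v B C / n\<^sup>2) / sz C)\<^sup>2 / 2 * n\<^sup>2 = k v * k v / (2 * (sz C)\<^sup>2 * n\<^sup>2)"
      unfolding k_def card_sz using npos s by (simp add: power2_eq_square field_simps)
    \<comment> \<open>One of the two factors \<open>k v\<close> is bounded by 36 percent of its
      maximum; half of 36/100 is the 18/100 of the statement.\<close>
    also have "\<dots> \<le> k v * (36/100 * (sz B * sz C * n\<^sup>2)) / (2 * (sz C)\<^sup>2 * n\<^sup>2)"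
    proof -
      have "k v \<le> 36/100 * (sz B * sz C * n\<^sup>2)"
        using link_dense[OF d v] unfolding k_def card_sz by (simp add: power2_eq_square algebra_simps)
      then show ?thesis using k0 by (intro divide_right_mono mult_left_mono) auto
    qed
    also have "\<dots> = 18/100 * (sz B / sz C) * k v" using npos s by (simp add: power2_eq_square field_simps)
    finally show ?thesis using inner_bound[OF d v] unfolding m_def K_def by linarith
  qed
  \<comment> \<open>\<open>matching\<close> at \<open>b\<close> bounds the product of
    \<open>lk b A B\<close> and \<open>lk b A C\<close>, and \<open>link_dense\<close> bounds the
    second factor from below.\<close>
  have lkb: "lk b A B \<le> (\<mu> + 1 / n) * n\<^sup>2 / (64/100 * sz C)" if b: "b \<in> B" for b
  proof -
    have "64/100 * (real (card A) * real (card C)) \<le> lk b A C" by (rule link_dense[OF dense_perm(1)[OF d] b])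
    then have "lk b A B * (64/100 * (real (card A) * real (card C))) \<le> lk b A B * lk b A C"
      using lk_nonneg by (intro mult_left_mono)
    also have "\<dots> \<le> real (card A) * (missing B A C + real (card B) * real (card C))"
      using matching[of A b B C] bs(5) by (simp add: missing_def lk_sym[of b B A])
    finally have "sz A * n * (lk b A B * (64/100 * (sz C * n))) \<le> sz A * n * (\<mu> * n ^ 3 + sz B * n * (sz C * n))"
      unfolding card_sz missing_mu \<mu>_def mu_perm(1)[of B A C] by (simp add: mult_ac)
    then have "lk b A B * (64/100 * (sz C * n)) \<le> \<mu> * n ^ 3 + sz B * n * (sz C * n)"
      by (rule mult_left_le_imp_le) (rule an)
    also have "sz B * n * (sz C * n) \<le> n\<^sup>2"
    proof -
      have "sz B * sz C \<le> 1" using s by (intro mult_le_one) auto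
      then have "sz B * sz C * n\<^sup>2 \<le> 1 * n\<^sup>2" by (intro mult_right_mono) auto
      then show ?thesis by (simp add: power2_eq_square mult_ac)
    qed
    finally have a: "lk b A B * (64/100 * (sz C * n)) \<le> \<mu> * n ^ 3 + n\<^sup>2" by simp
    have "lk b A B * (64/100 * sz C) * n \<le> ((\<mu> + 1 / n) * n\<^sup>2) * n"
    proof -
      have "((\<mu> + 1 / n) * n\<^sup>2) * n = \<mu> * n ^ 3 + n\<^sup>2"
        using npos by (simp add: power2_eq_square power3_eq_cube distrib_right)
      then show ?thesis using a by (simp add: mult_ac)
    qed
    then have "lk b A B * (64/100 * sz C) \<le> (\<mu> + 1 / n) * n\<^sup>2" using npos by simp
    then show ?thesis using s by (simp add: pos_le_divide_eq)
  qed
  \<comment> \<open>After exchanging the sums, the degrees of \<open>b\<close> in the links of all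
    \<open>v\<close> in \<open>A\<close> add up to the link edges of \<open>b\<close> between
    \<open>A\<close> and \<open>B\<close>.\<close>
  have dsum: "(\<Sum>v\<in>A. \<Sum>b\<in>B. dg v b B * m b) \<le> (\<mu> + 1 / n) * n\<^sup>2 / (64/100 * sz C) * (\<mu> * n ^ 3)"
  proof -
    have "(\<Sum>v\<in>A. \<Sum>b\<in>B. dg v b B * m b) = (\<Sum>b\<in>B. \<Sum>v\<in>A. dg v b B * m b)" by (rule sum.swap)
    also have "\<dots> = (\<Sum>b\<in>B. lk b A B * m b)"
    proof (rule sum.cong[OF refl])
      fix b
      have "(\<Sum>v\<in>A. dg v b B) = lk b A B" unfolding lk_dg dg_def
        by (intro sum.cong refl) (subst adj_sym(1), rule refl)
      then show "(\<Sum>v\<in>A. dg v b B * m b) = lk b A B * m b" by (simp add: sum_distrib_right[symmetric])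
    qed
    also have "\<dots> \<le> (\<Sum>b\<in>B. (\<mu> + 1 / n) * n\<^sup>2 / (64/100 * sz C) * m b)"
      using lkb m0 by (intro sum_mono mult_right_mono) auto
    also have "\<dots> = (\<mu> + 1 / n) * n\<^sup>2 / (64/100 * sz C) * (\<mu> * n ^ 3)"
      by (simp only: sum_distrib_left[symmetric] msum)
    finally show ?thesis .
  qed
  have third: "2 * (\<Sum>v\<in>A. \<Sum>b\<in>B. dg v b B * m b) / K \<le> (32/10 * \<mu>\<^sup>2 / (sz A * (sz C)\<^sup>2) + \<delta>) * n ^ 3"
  proof -
    have \<mu>: "0 \<le> \<mu>" "\<mu> \<le> 73/100000" using s by (simp_all add: \<mu>_def)
    define T where "T = (\<mu> + 1 / n) * n\<^sup>2 / (64/100 * sz C) * (\<mu> * n ^ 3)"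
    define Q where "Q = 99/100 * (sz A * n) * (sz C * n)"
    define D where "D = sz A * (sz C)\<^sup>2"
    define Z where "Z = \<mu> * (\<mu> + 1 / n) / D"
    have T0: "0 \<le> T" unfolding T_def using \<mu> s npos by (intro mult_nonneg_nonneg divide_nonneg_nonneg) auto
    have Z0: "0 \<le> Z" unfolding Z_def D_def using \<mu> s npos by (intro mult_nonneg_nonneg divide_nonneg_nonneg) auto
    have Q0: "0 < Q" "Q \<le> K" unfolding Q_def using s npos K0 by (auto intro!: mult_pos_pos)
    have "(\<Sum>v\<in>A. \<Sum>b\<in>B. dg v b B * m b) \<le> T" using dsum unfolding T_def .
    then have "2 * (\<Sum>v\<in>A. \<Sum>b\<in>B. dg v b B * m b) / K \<le> 2 * T / Q"
      using T0 Q0 by (intro frac_le) (simp_all)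
    \<comment> \<open>The constant is 2 / (0.64 * 0.99), rounded up to 3.2 in the next step.\<close>
    also have "\<dots> = 20000/6336 * Z * n ^ 3"
    proof -
      have "2 * (y * n\<^sup>2 / (64/100 * c) * (\<mu> * n ^ 3)) / (99/100 * (a * n) * (c * n)) = 20000/6336 * (\<mu> * y / (a * c\<^sup>2)) * n ^ 3"
        if "0 < a" "0 < c" for a c y :: real
        using that npos by (simp add: power2_eq_square power3_eq_cube field_simps)
      from this[of "sz A" "sz C" "\<mu> + 1 / n"] show ?thesis unfolding T_def Q_def Z_def D_def using s by simp
    qed
    also have "\<dots> \<le> 32/10 * Z * n ^ 3" using Z0 npos by (intro mult_right_mono) auto
    also have "\<dots> = (32/10 * \<mu>\<^sup>2 / D + 32/10 * \<mu> / D * (1 / n)) * n ^ 3"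
    proof -
      have "32/10 * (x * (x + y) / D) = 32/10 * x\<^sup>2 / D + 32/10 * x / D * y" for x y :: real
        by (cases "D = 0") (simp_all add: power2_eq_square field_simps)
      then show ?thesis unfolding Z_def by simp
    qed
    also have "\<dots> = (32/10 * \<mu>\<^sup>2 / (sz A * (sz C)\<^sup>2) + 32/10 * \<mu> / (sz A * (sz C)\<^sup>2) * (1 / n)) * n ^ 3" unfolding D_def ..
    also have "\<dots> \<le> (32/10 * \<mu>\<^sup>2 / (sz A * (sz C)\<^sup>2) + \<delta>) * n ^ 3"
    proof -
      have c2: "(28/100)\<^sup>2 \<le> (sz C)\<^sup>2" using s by (intro power_mono) auto
      have "32/10 * \<mu> / (sz A * (sz C)\<^sup>2) \<le> 32/10 * (73/100000) / (28/100 * (28/100)\<^sup>2)"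
        using \<mu> s c2 by (intro frac_le mult_mono mult_left_mono) auto
      also have "\<dots> \<le> (1::real)" by (simp add: power2_eq_square)
      finally have "32/10 * \<mu> / (sz A * (sz C)\<^sup>2) * (1 / n) \<le> 1 * (1 / n)" using npos by (intro mult_right_mono) auto
      also have "\<dots> \<le> \<delta>" using inv_n \<delta>sq \<delta> by simp
      finally show ?thesis using npos by (intro mult_right_mono) auto
    qed
    finally show ?thesis .
  qed
  define P where "P = 18/100 * (sz B / sz C)"
  define Y where "Y = 32/10 * \<mu>\<^sup>2 / (sz A * (sz C)\<^sup>2)"
  have "ct A B B \<le> (\<Sum>v\<in>A. P * k v + 2 * \<delta> * n\<^sup>2 + 2 * (\<Sum>b\<in>B. dg v b B * m b) / K)"
    unfolding ct_lk P_def by (intro sum_mono vb)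
  also have "\<dots> = (\<Sum>v\<in>A. P * k v) + (\<Sum>v\<in>A. 2 * \<delta> * n\<^sup>2) + (\<Sum>v\<in>A. 2 * (\<Sum>b\<in>B. dg v b B * m b) / K)"
    by (simp only: sum.distrib)
  also have "(\<Sum>v\<in>A. P * k v) = P * (\<mu> * n ^ 3)" by (simp only: sum_distrib_left[symmetric] ksum)
  also have "(\<Sum>v\<in>A. 2 * (\<Sum>b\<in>B. dg v b B * m b) / K) = 2 * (\<Sum>v\<in>A. \<Sum>b\<in>B. dg v b B * m b) / K"
    by (simp only: sum_distrib_left[symmetric] sum_divide_distrib[symmetric])
  also have "(\<Sum>v\<in>A. 2 * \<delta> * n\<^sup>2) \<le> 2 * \<delta> * n ^ 3"
  proof -
    have "sz A * (2 * \<delta> * n ^ 3) \<le> 1 * (2 * \<delta> * n ^ 3)" using s \<delta> npos by (intro mult_right_mono) auto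
    moreover have "(\<Sum>v\<in>A. 2 * \<delta> * n\<^sup>2) = sz A * (2 * \<delta> * n ^ 3)" by (simp add: card_sz power2_eq_square power3_eq_cube)
    ultimately show ?thesis by linarith
  qed
  finally have "ct A B B \<le> P * (\<mu> * n ^ 3) + 2 * \<delta> * n ^ 3 + (Y + \<delta>) * n ^ 3" using third unfolding Y_def by linarith
  also have "\<dots> = (P * \<mu> + Y + 3 * \<delta>) * n ^ 3" by (simp add: algebra_simps)
  finally show ?thesis unfolding P_def Y_def \<mu>_def .
qed

text \<open>Isolated so that the fractions of the part sizes appear as atoms in a polynomial
  identity.\<close>

lemma bad_sum_identity:
  fixes \<mu> d N x1 x2 x3 x4 x5 x6 y1 y2 y3 y4 y5 y6 :: real
  shows "(18/100 * x1 * \<mu> + 32/10 * \<mu>\<^sup>2 * y1 + 3 * d) * N + (18/100 * x2 * \<mu> + 32/10 * \<mu>\<^sup>2 * y2 + 3 * d) * N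
    + (18/100 * x3 * \<mu> + 32/10 * \<mu>\<^sup>2 * y3 + 3 * d) * N + (18/100 * x4 * \<mu> + 32/10 * \<mu>\<^sup>2 * y4 + 3 * d) * N
    + (18/100 * x5 * \<mu> + 32/10 * \<mu>\<^sup>2 * y5 + 3 * d) * N + (18/100 * x6 * \<mu> + 32/10 * \<mu>\<^sup>2 * y6 + 3 * d) * N
    = 2 * (\<mu> * (9/100 * (x1 + x2 + x3 + x4 + x5 + x6) + 16/10 * \<mu> * (y1 + y2 + y3 + y4 + y6 + y5)) + 9 * d) * N"
  by (simp add: power2_eq_square field_simps)

text \<open>The six instances of \<open>inner_sum\<close>, halved; \<open>bad_coefficient\<close>
  evaluates the factor of the missing triples, and six errors of 3 \<delta> become 9
  \<delta>.\<close>

lemma bad_bound: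
  assumes d: "dense A B C"
  shows "bad A B C \<le> 77/100 * missing A B C + 9 * \<delta> * n ^ 3"
proof -
  note s = dense_sizes[OF d]
  define \<mu> where "\<mu> = mu A B C"
  note d1 = d and d2 = dense_perm(2)[OF d] and d3 = dense_perm(1)[OF d]
  note d4 = dense_perm(2)[OF d3]
  note d5 = dense_perm(1)[OF d2]
  note d6 = dense_perm(2)[OF d5]
  have mus: "mu A C B = \<mu>" "mu B A C = \<mu>" "mu B C A = \<mu>" "mu C A B = \<mu>" "mu C B A = \<mu>"
    unfolding \<mu>_def using mu_perm(2)[of A B C] mu_perm(1)[of A B C] mu_perm(2)[of B A C] mu_perm(1)[of A C B] mu_perm(2)[of C A B] by simp_all
  define a b c where "a = sz A" and "b = sz B" and "c = sz C"
  have "ct A B B \<le> (18/100 * (b / c) * \<mu> + 32/10 * \<mu>\<^sup>2 / (a * c\<^sup>2) + 3 * \<delta>) * n ^ 3"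
    "ct A C C \<le> (18/100 * (c / b) * \<mu> + 32/10 * \<mu>\<^sup>2 / (a * b\<^sup>2) + 3 * \<delta>) * n ^ 3"
    "ct B A A \<le> (18/100 * (a / c) * \<mu> + 32/10 * \<mu>\<^sup>2 / (b * c\<^sup>2) + 3 * \<delta>) * n ^ 3"
    "ct B C C \<le> (18/100 * (c / a) * \<mu> + 32/10 * \<mu>\<^sup>2 / (b * a\<^sup>2) + 3 * \<delta>) * n ^ 3"
    "ct C A A \<le> (18/100 * (a / b) * \<mu> + 32/10 * \<mu>\<^sup>2 / (c * b\<^sup>2) + 3 * \<delta>) * n ^ 3"
    "ct C B B \<le> (18/100 * (b / a) * \<mu> + 32/10 * \<mu>\<^sup>2 / (c * a\<^sup>2) + 3 * \<delta>) * n ^ 3"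
    using inner_sum[OF d1] inner_sum[OF d2] inner_sum[OF d3] inner_sum[OF d4] inner_sum[OF d5] inner_sum[OF d6]
    unfolding mus a_def b_def c_def \<mu>_def by simp_all
  then have "2 * bad A B C \<le> (18/100 * (b / c) * \<mu> + 32/10 * \<mu>\<^sup>2 / (a * c\<^sup>2) + 3 * \<delta>) * n ^ 3
    + (18/100 * (c / b) * \<mu> + 32/10 * \<mu>\<^sup>2 / (a * b\<^sup>2) + 3 * \<delta>) * n ^ 3
    + (18/100 * (a / c) * \<mu> + 32/10 * \<mu>\<^sup>2 / (b * c\<^sup>2) + 3 * \<delta>) * n ^ 3
    + (18/100 * (c / a) * \<mu> + 32/10 * \<mu>\<^sup>2 / (b * a\<^sup>2) + 3 * \<delta>) * n ^ 3
    + (18/100 * (a / b) * \<mu> + 32/10 * \<mu>\<^sup>2 / (c * b\<^sup>2) + 3 * \<delta>) * n ^ 3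
    + (18/100 * (b / a) * \<mu> + 32/10 * \<mu>\<^sup>2 / (c * a\<^sup>2) + 3 * \<delta>) * n ^ 3"
    unfolding bad_def by simp
  also have "\<dots> = 2 * (\<mu> * (9/100 * (b / c + c / b + a / c + c / a + a / b + b / a)
    + 16/10 * \<mu> * (1 / (a * c\<^sup>2) + 1 / (a * b\<^sup>2) + 1 / (b * c\<^sup>2) + 1 / (b * a\<^sup>2) + 1 / (c * a\<^sup>2) + 1 / (c * b\<^sup>2))) + 9 * \<delta>) * n ^ 3"
  proof -
    have t: "32/10 * \<mu>\<^sup>2 / D = 32/10 * \<mu>\<^sup>2 * (1 / D)" for D by simp
    show ?thesis unfolding t by (rule bad_sum_identity)
  qed
  also have "\<dots> \<le> 2 * (\<mu> * (77/100) + 9 * \<delta>) * n ^ 3"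
  proof -
    have "9/100 * (b / c + c / b + a / c + c / a + a / b + b / a)
    + 16/10 * \<mu> * (1 / (a * c\<^sup>2) + 1 / (a * b\<^sup>2) + 1 / (b * c\<^sup>2) + 1 / (b * a\<^sup>2) + 1 / (c * a\<^sup>2) + 1 / (c * b\<^sup>2)) \<le> 77/100"
      using s unfolding a_def b_def c_def \<mu>_def by (intro bad_coefficient) auto
    then show ?thesis using s(2) npos unfolding \<mu>_def[symmetric] by (intro mult_right_mono mult_left_mono add_right_mono) auto
  qed
  finally show ?thesis unfolding missing_mu \<mu>_def by (simp add: algebra_simps)
qed

end

section \<open>Stability\<close>

context c5graph
begin

lemma ct_mono:
  assumes "A \<subseteq> A'" "B \<subseteq> B'" "C \<subseteq> C'" "finite A'" "finite B'" "finite C'"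
  shows "ct A B C \<le> ct A' B' C'"
proof -
  have "ct A B C \<le> ct A B C'" unfolding ct_def using assms by (intro sum_mono sum_mono2) auto
  also have "\<dots> \<le> ct A B' C'" unfolding ct_def using assms by (intro sum_mono sum_mono2 sum_nonneg) auto
  also have "\<dots> \<le> ct A' B' C'" unfolding ct_def using assms by (intro sum_mono2 sum_nonneg) auto
  finally show ?thesis .
qed

lemma edges_removed:
  assumes X: "X \<subseteq> V"
  shows "real (card E) \<le> card (induced_edges E (V - X)) + (\<Sum>v\<in>X. lk v V V) / 2"
proof -
  define W where "W = V - X"
  have f: "finite X" "finite W" "W \<subseteq> V" using X finV by (auto simp: W_def intro: finite_subset)
  have V: "V = W \<union> X" "W \<inter> X = {}" using X by (auto simp: W_def)
  have s: "ct (W \<union> X) Y Z = ct W Y Z + ct X Y Z" for Y Z using ct_Un1[OF f(2,1) V(2)] .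
  have "ct V V V = ct W V V + ct X V V" using s V by simp
  also have "ct W V V = ct V W V" by (rule ct_sym)
  also have "\<dots> = ct W W V + ct X W V" using s V by simp
  also have "ct W W V = ct V W W" by (rule ct_rotate)
  also have "\<dots> = ct W W W + ct X W W" using s V by simp
  also have "ct X W V \<le> ct X V V" using f finV by (intro ct_mono) auto
  also have "ct X W W \<le> ct X V V" using f finV by (intro ct_mono) auto
  finally have "ct V V V \<le> ct W W W + 3 * ct X V V" by simp
  then show ?thesis using ct_induced[of V] ct_induced[OF f(3)] unfolding induced_V W_def by (simp add: ct_lk)
qed

lemma lk_removed:
  assumes X: "X \<subseteq> V"
  shows "lk v V V \<le> lk v (V - X) (V - X) + 2 * (real (card X) * real (card V))"
proof -
  define W where "W = V - X"
  have f: "finite X" "finite W" "W \<subseteq> V" using X finV by (auto simp: W_def intro: finite_subset)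
  have V: "V = W \<union> X" "W \<inter> X = {}" using X by (auto simp: W_def)
  have "lk v V V = lk v W V + lk v X V" using lk_Un1[OF f(2,1) V(2), of v V] V by simp
  also have "lk v W V = lk v W W + lk v W X" using lk_Un2[OF f(2,1) V(2), of v W] V by simp
  also have "lk v W X \<le> real (card V) * real (card X)"
  proof -
    have "lk v W X \<le> real (card W) * real (card X)" by (rule lk_le)
    also have "\<dots> \<le> real (card V) * real (card X)" using f finV by (intro mult_right_mono) (auto intro: card_mono)
    finally show ?thesis .
  qed
  also have "lk v X V \<le> real (card X) * real (card V)" by (rule lk_le)
  finally show ?thesis unfolding W_def by (simp add: mult.commute)
qed

lemma tri_sum: "(\<Sum>v\<in>V. tri v) \<le> real (card V) ^ 3"
proof -
  have k: "(\<Sum>v\<in>V. of_bool (K4 v x y z) :: real) \<le> 1" for x y z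
  proof -
    have "real_of_int (\<Sum>v\<in>V. of_bool (K4 v x y z)) \<le> real_of_int 1" using K4_count[of x y z] by (simp only: of_int_le_iff)
    then show ?thesis by simp
  qed
  have "(\<Sum>v\<in>V. tri v) = (\<Sum>x\<in>V. \<Sum>v\<in>V. \<Sum>y\<in>V. \<Sum>z\<in>V. of_bool (K4 v x y z))" unfolding tri_def by (rule sum.swap)
  also have "\<dots> = (\<Sum>x\<in>V. \<Sum>y\<in>V. \<Sum>v\<in>V. \<Sum>z\<in>V. of_bool (K4 v x y z))" by (intro sum.cong refl sum.swap)
  also have "\<dots> = (\<Sum>x\<in>V. \<Sum>y\<in>V. \<Sum>z\<in>V. \<Sum>v\<in>V. of_bool (K4 v x y z))" by (intro sum.cong refl sum.swap)
  also have "\<dots> \<le> (\<Sum>x\<in>V. \<Sum>y\<in>V. \<Sum>z\<in>V. 1)" by (intro sum_mono k)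
  finally show ?thesis by (simp add: power3_eq_cube)
qed

text \<open>Markov's inequality: by \<open>tri_sum\<close> the link triangles number at most n^3 in
  total.\<close>

lemma few_special:
  assumes "t > 0" "Sp = {v \<in> V. tri v > t * real (card V) ^ 3}"
  shows "real (card Sp) \<le> 1 / t"
proof (cases "card V = 0")
  case True
  then show ?thesis using assms finV by auto
next
  case False
  have tri0: "0 \<le> tri v" for v unfolding tri_def by (intro sum_nonneg) auto
  have "real (card Sp) * (t * real (card V) ^ 3) = (\<Sum>v\<in>Sp. t * real (card V) ^ 3)" by simp
  also have "\<dots> \<le> (\<Sum>v\<in>Sp. tri v)" using assms by (intro sum_mono) auto
  also have "\<dots> \<le> (\<Sum>v\<in>V. tri v)" using assms finV tri0 by (intro sum_mono2) auto
  also have "\<dots> \<le> real (card V) ^ 3" by (rule tri_sum)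
  finally have "(real (card Sp) * t) * real (card V) ^ 3 \<le> 1 * real (card V) ^ 3" by (simp add: mult_ac)
  then have "real (card Sp) * t \<le> 1" using False by (simp add: mult_le_cancel_right)
  then show ?thesis using assms(1) by (simp add: pos_le_divide_eq)
qed

text \<open>Deleting u n vertices of low degree removes at most u (L - \<delta>/4) n^3 / 2 edges,
  whereas the hereditary bound drops by about u L n^3 / 2. The gain u \<delta>/8 exceeds the
  second-order loss of order u^2 when \<open>u\<close> is close to \<delta>/16, and the rest would
  be too dense.\<close>

lemma few_low_degree:
  fixes L \<delta> d :: real
  assumes L: "0 \<le> L" "L \<le> 2" and \<delta>: "0 < \<delta>" "\<delta> \<le> 1" and d: "d \<le> \<delta>\<^sup>2 / 1000" and n: "real (card V) * \<delta> \<ge> 1000"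
    and e: "(L / 6 - d) * real (card V) ^ 3 \<le> card E"
    and her: "\<And>W. W \<subseteq> V \<Longrightarrow> card (induced_edges E W) \<le> L / 6 * real (card W) ^ 3 + d * real (card V) ^ 3"
    and U: "U = {v \<in> V. lk v V V < (L - \<delta> / 4) * (real (card V))\<^sup>2}"
  shows "real (card U) \<le> \<delta> / 16 * card V"
proof (rule ccontr)
  assume "\<not> ?thesis"
  then have big: "\<delta> / 16 * card V < card U" by simp
  define n where "n = real (card V)"
  have npos: "n > 0" using n \<delta> by (auto simp: n_def intro: ccontr)
  \<comment> \<open>Only so many vertices are deleted: with a larger fraction the quadratic loss
    could exceed the linear gain.\<close>
  define k where "k = nat \<lfloor>\<delta> / 16 * n\<rfloor>"
  have k: "real k \<le> \<delta> / 16 * n" "\<delta> / 16 * n - 1 \<le> real k"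
  proof -
    have "0 \<le> \<delta> / 16 * n" using \<delta> npos by simp
    then show "real k \<le> \<delta> / 16 * n" unfolding k_def by (rule of_nat_floor)
    show "\<delta> / 16 * n - 1 \<le> real k" unfolding k_def by linarith
  qed
  have "real k \<le> real (card U)" using k(1) big unfolding n_def by linarith
  then have "k \<le> card U" by (simp only: of_nat_le_iff)
  then obtain U' where U': "U' \<subseteq> U" "card U' = k" by (meson obtain_subset_with_card_n)
  have sub: "U' \<subseteq> V" using U' U by auto
  define u where "u = real k / n"
  have ku: "real k = u * n" using npos by (simp add: u_def)
  have u1: "u \<le> \<delta> / 16" using k npos by (simp add: u_def pos_divide_le_eq)
  have u2: "\<delta> / 17 \<le> u"
  proof -
    have "\<delta> / 17 * n \<le> \<delta> / 16 * n - 1" using n unfolding n_def[symmetric] by (simp add: mult.commute)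
    then have "\<delta> / 17 * n \<le> u * n" using k by (simp flip: ku)
    then show ?thesis using npos by simp
  qed
  have "(\<Sum>v\<in>U'. lk v V V) \<le> (\<Sum>v\<in>U'. (L - \<delta> / 4) * n\<^sup>2)" using U' U by (intro sum_mono) (auto simp: n_def)
  also have "\<dots> = u * (L - \<delta> / 4) * n ^ 3" using U' by (simp add: ku power2_eq_square power3_eq_cube)
  finally have le: "(\<Sum>v\<in>U'. lk v V V) \<le> u * (L - \<delta> / 4) * n ^ 3" .
  have "real (card E) \<le> card (induced_edges E (V - U')) + u * (L - \<delta> / 4) * n ^ 3 / 2"
    using edges_removed[OF sub] divide_right_mono[OF le, of 2] by linarith
  also have "real (card (induced_edges E (V - U'))) \<le> L / 6 * ((1 - u) * n) ^ 3 + d * n ^ 3"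
  proof -
    have "real (card (V - U')) = n - real k" using card_Diff_subset[OF finite_subset[OF sub finV] sub] card_mono[OF finV sub] U'
      by (simp add: n_def of_nat_diff)
    then have "real (card (V - U')) = (1 - u) * n" by (simp add: ku algebra_simps)
    then show ?thesis using her[of "V - U'"] by (simp add: n_def)
  qed
  finally have "(L / 6 - d) * n ^ 3 \<le> L / 6 * ((1 - u) * n) ^ 3 + d * n ^ 3 + u * (L - \<delta> / 4) * n ^ 3 / 2"
    using e unfolding n_def by linarith
  also have "\<dots> = (L / 6 * (1 - u) ^ 3 + d + u * (L - \<delta> / 4) / 2) * n ^ 3"
    by (simp add: power_mult_distrib distrib_right)
  finally have "(L / 6 - d) * n ^ 3 \<le> (L / 6 * (1 - u) ^ 3 + d + u * (L - \<delta> / 4) / 2) * n ^ 3" .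
  then have "L / 6 - d \<le> L / 6 * (1 - u) ^ 3 + d + u * (L - \<delta> / 4) / 2" using npos by (simp add: mult_le_cancel_right)
  moreover have "L / 6 * (1 - u) ^ 3 \<le> L / 6 * (1 - 3 * u + 3 * u\<^sup>2)"
  proof -
    have "0 \<le> u ^ 3" using \<delta> u2 by (intro zero_le_power) linarith
    then show ?thesis using L by (intro mult_left_mono) (auto simp: power2_eq_square power3_eq_cube algebra_simps)
  qed
  ultimately have "u * \<delta> / 8 \<le> 2 * d + L / 2 * u\<^sup>2" by (simp add: field_simps)
  moreover have "L / 2 * u\<^sup>2 \<le> 1 * u\<^sup>2" using L by (intro mult_right_mono) auto
  moreover have "u\<^sup>2 \<le> u * (\<delta> / 16)" unfolding power2_eq_square using u1 u2 \<delta> by (intro mult_left_mono) auto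
  moreover have "\<delta> / 17 * (\<delta> / 16) \<le> u * (\<delta> / 16)" using u2 \<delta> by (intro mult_right_mono) auto
  moreover have "\<delta>\<^sup>2 > 0" using \<delta> by simp
  ultimately show False using d by (simp add: power2_eq_square)
qed

lemma c5graph_induced: "W \<subseteq> V \<Longrightarrow> c5graph W (induced_edges E W)"
  using three_graph_induced[OF tg] C5m_free_induced[OF fr] by unfold_locales auto

lemma adj_induced:
  assumes W: "W \<subseteq> V" and "x \<in> W" "y \<in> W" "z \<in> W"
  shows "c5graph.adj (induced_edges E W) x y z = adj x y z"
proof -
  interpret H: c5graph W "induced_edges E W" by (rule c5graph_induced[OF W])
  show ?thesis using assms unfolding H.adj_def adj_def by (simp add: induced_edges_def)
qed

lemma induced_counts:
  assumes W: "W \<subseteq> V"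
  shows "A \<subseteq> W \<Longrightarrow> B \<subseteq> W \<Longrightarrow> C \<subseteq> W \<Longrightarrow> c5graph.ct (induced_edges E W) A B C = ct A B C"
    and "v \<in> W \<Longrightarrow> A \<subseteq> W \<Longrightarrow> B \<subseteq> W \<Longrightarrow> c5graph.lk (induced_edges E W) v A B = lk v A B"
    and "v \<in> W \<Longrightarrow> c5graph.tri W (induced_edges E W) v \<le> tri v"
proof -
  interpret H: c5graph W "induced_edges E W" by (rule c5graph_induced[OF W])
  note a = adj_induced[OF W]
  show "H.ct A B C = ct A B C" if "A \<subseteq> W" "B \<subseteq> W" "C \<subseteq> W"
    unfolding H.ct_def ct_def using that by (intro sum.cong refl) (simp add: a subset_iff)
  show "H.lk v A B = lk v A B" if "v \<in> W" "A \<subseteq> W" "B \<subseteq> W"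
    unfolding H.lk_def lk_def using that by (intro sum.cong refl) (simp add: a subset_iff)
  show "H.tri v \<le> tri v" if "v \<in> W"
  proof -
    have "H.tri v = (\<Sum>x\<in>W. \<Sum>y\<in>W. \<Sum>z\<in>W. of_bool (K4 v x y z))"
      unfolding H.tri_def H.K4_def K4_def using that by (intro sum.cong refl) (simp add: a)
    also have "\<dots> \<le> (\<Sum>x\<in>W. \<Sum>y\<in>W. \<Sum>z\<in>V. of_bool (K4 v x y z))"
      using W finV by (intro sum_mono sum_mono2) auto
    also have "\<dots> \<le> (\<Sum>x\<in>W. \<Sum>y\<in>V. \<Sum>z\<in>V. of_bool (K4 v x y z))"
      using W finV by (intro sum_mono sum_mono2 sum_nonneg) auto
    also have "\<dots> \<le> tri v" unfolding tri_def using W finV by (intro sum_mono2 sum_nonneg) auto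
    finally show ?thesis .
  qed
qed

end

text \<open>Extremality and \<open>bad_bound\<close> give 0.23 missing \<le> 10 \<delta> n^3, so at
  most 44 \<delta> n^3 triples are missing and at most 43 \<delta> n^3 edges are bad.
  \<open>energy_balance\<close> with error 47 \<delta> puts the product of the sizes within 94
  \<delta> of 1/27, and 94 + 44 = 138.\<close>

lemma (in c5graph_regular) nearly_extremal_cut:
  fixes L :: real
  assumes L: "L \<ge> 1/4" and d: "dense A B C"
    and e: "(L / 6 - \<delta>) * n ^ 3 \<le> card E" and ex: "real (ex_C5m (card V)) - real (card E) \<le> \<delta> * n ^ 3"
    and her: "\<And>W. W \<subseteq> V \<Longrightarrow> card (induced_edges E W) \<le> L / 6 * real (card W) ^ 3 + \<delta> * n ^ 3"
  shows "ct A B C \<ge> (1/27 - 138 * \<delta>) * n ^ 3"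
proof -
  note s = dense_sizes[OF d] and bs = dense_basic[OF d]
  define a b c where "a = sz A" and "b = sz B" and "c = sz C"
  have n3: "n ^ 3 > 0" using npos by simp
  have bb: "bad A B C \<le> 77/100 * missing A B C + 9 * \<delta> * n ^ 3" by (rule bad_bound[OF d])
  have gap: "missing A B C \<le> bad A B C + \<delta> * n ^ 3" using extremal_gap[OF bs(1)] ex by linarith
  have \<delta>n: "0 \<le> \<delta> * n ^ 3" using \<delta> n3 by simp
  have m44: "missing A B C \<le> 44 * (\<delta> * n ^ 3)" using bb gap \<delta>n by linarith
  have b43: "bad A B C \<le> 43 * (\<delta> * n ^ 3)" using bb m44 \<delta>n by linarith
  have ctm: "ct A B C = a * b * c * n ^ 3 - missing A B C"
    by (simp add: missing_def a_def b_def c_def card_sz power3_eq_cube mult_ac)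
  have hx: "card (induced_edges E X) \<le> L / 6 * (sz X) ^ 3 * n ^ 3 + \<delta> * n ^ 3" if "X \<subseteq> V" for X
    using her[OF that] unfolding card_sz by (simp add: power_mult_distrib mult.assoc)
  have "(L / 6 - \<delta>) * n ^ 3 \<le> ct A B C + bad A B C + card (induced_edges E A) + card (induced_edges E B) + card (induced_edges E C)"
    using e edge_count[OF bs(1)] by simp
  also have "\<dots> \<le> a * b * c * n ^ 3 + 43 * (\<delta> * n ^ 3) + (L / 6 * a ^ 3 * n ^ 3 + \<delta> * n ^ 3) + (L / 6 * b ^ 3 * n ^ 3 + \<delta> * n ^ 3) + (L / 6 * c ^ 3 * n ^ 3 + \<delta> * n ^ 3)"
    using hx[OF bs(2)] hx[OF bs(3)] hx[OF bs(4)] ctm missing_nonneg[OF bs(1)] b43 unfolding a_def b_def c_def by linarith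
  finally have "(L / 6 - \<delta>) * n ^ 3 \<le> (a * b * c + 46 * \<delta> + L / 6 * (a ^ 3 + b ^ 3 + c ^ 3)) * n ^ 3"
    by (simp add: algebra_simps)
  then have "L / 6 - \<delta> \<le> a * b * c + 46 * \<delta> + L / 6 * (a ^ 3 + b ^ 3 + c ^ 3)" using n3 by (simp add: mult_le_cancel_right)
  then have en: "L / 6 * (1 - a ^ 3 - b ^ 3 - c ^ 3) \<le> a * b * c + 47 * \<delta>" by (simp add: algebra_simps)
  have "a * b * c \<ge> 1/27 - 2 * (47 * \<delta>)"
  proof (rule energy_balance(1)[OF _ _ _ _ _ _ en])
    show "0 \<le> a" "0 \<le> b" "0 \<le> c" "a + b + c = 1" using s unfolding a_def b_def c_def by linarith+
    show "L / 6 \<ge> 1/24" "0 \<le> 47 * \<delta>" using L \<delta> by auto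
    show "a * b * c \<ge> 36/1000" using s unfolding a_def b_def c_def by linarith
  qed
  then have "(1/27 - 94 * \<delta>) * n ^ 3 \<le> a * b * c * n ^ 3" using n3 by (intro mult_right_mono) auto
  then show ?thesis using ctm m44 by (simp add: algebra_simps)
qed

text \<open>All estimates are made in the subgraph induced on \<open>W\<close>; the at most \<delta>
  n / 8 deleted vertices are then added to one part, which cannot decrease the number of transversal
  edges. The size 10^50 is generous: it makes the 1/\<delta>^2 possible vertices with many link
  triangles fewer than \<delta> n / 16.\<close>

lemma (in c5graph) stable_partition:
  fixes L \<delta> d n :: real
  assumes L: "L \<ge> 1/4" and \<delta>: "\<delta> = 1 / 10 ^ 13" and d: "d = \<delta>\<^sup>2 / 1000" and n: "n = real (card V)" "n \<ge> 10 ^ 50"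
    and e: "(L / 6 - d) * n ^ 3 \<le> card E" and exl: "\<And>m. m \<le> card V \<Longrightarrow> ex_C5m m \<le> L / 6 * real m ^ 3 + d * n ^ 3"
  obtains A B C where "partition3 A B C" "ct A B C \<ge> (1/27 - 1 / 10 ^ 10) * n ^ 3"
proof -
  have npos: "n > 0" using n by simp
  have \<delta>0: "0 < \<delta>" "\<delta> \<le> 1 / 10 ^ 7" "\<delta> \<le> 1" by (simp_all add: \<delta>)
  have d0: "0 \<le> d" "d \<le> \<delta> / 100" by (simp_all add: d \<delta> power2_eq_square)
  have n3: "n ^ 3 > 0" "n\<^sup>2 > 0" using npos by auto
  have her: "card (induced_edges E W) \<le> L / 6 * real (card W) ^ 3 + d * n ^ 3" if W: "W \<subseteq> V" for W
  proof -
    have "card (induced_edges E W) \<le> ex_C5m (card W)"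
      by (rule card_le_ex_C5m[OF three_graph_induced[OF tg W] C5m_free_induced[OF fr W]])
    moreover have "card W \<le> card V" using W finV by (rule card_mono[rotated])
    ultimately show ?thesis using exl[of "card W"] by linarith
  qed
  have lkV: "lk v V V \<le> n\<^sup>2" for v using lk_le[of v V V] by (simp add: n power2_eq_square)
  have L2: "L \<le> 2"
  proof -
    have "6 * real (card E) \<le> n ^ 3"
      using ct_induced[of V] ct_le[OF finV finV finV] by (simp add: induced_V n power3_eq_cube)
    then have "(L - 6 * d) * n ^ 3 \<le> 1 * n ^ 3" using e by (simp add: algebra_simps)
    then have "L - 6 * d \<le> 1" using n3(1) by (simp add: mult_le_cancel_right)
    then show ?thesis using d0 \<delta>0 by linarith
  qed
  define U where "U = {v \<in> V. lk v V V < (L - \<delta> / 4) * (real (card V))\<^sup>2}"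
  define Sp where "Sp = {v \<in> V. tri v > \<delta>\<^sup>2 * real (card V) ^ 3}"
  define X where "X = U \<union> Sp"
  define W where "W = V - X"
  have XV: "X \<subseteq> V" and WV: "W \<subseteq> V" by (auto simp: X_def U_def Sp_def W_def)
  have fX: "finite X" "finite W" using XV WV finV by (auto intro: finite_subset)
  have cU: "real (card U) \<le> \<delta> / 16 * n"
    using few_low_degree[OF _ L2 \<delta>0(1,3) _ _ _ _ U_def, of d] L e her n by (simp add: d \<delta>)
  have cS: "real (card Sp) \<le> \<delta> / 16 * n"
  proof -
    have "real (card Sp) \<le> 1 / \<delta>\<^sup>2" using \<delta>0 by (intro few_special[OF _ Sp_def]) simp
    also have "\<dots> \<le> \<delta> / 16 * 10 ^ 50" by (simp add: \<delta> power2_eq_square)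
    also have "\<dots> \<le> \<delta> / 16 * n" using n \<delta>0 by (intro mult_left_mono) auto
    finally show ?thesis .
  qed
  have "real (card X) \<le> real (card U) + real (card Sp)" unfolding X_def using card_Un_le[of U Sp] by linarith
  then have cX: "real (card X) \<le> \<delta> / 8 * n" using cU cS by simp
  define w where "w = real (card W)"
  have wX: "w = n - real (card X)"
    unfolding w_def W_def n using card_Diff_subset[OF fX(1) XV] card_mono[OF finV XV] by (simp add: of_nat_diff)
  have w1: "(1 - \<delta> / 8) * n \<le> w" "w \<le> n" using wX cX by (simp_all add: algebra_simps)
  have w0: "0 < w" 
  proof -
    have "0 < (1 - \<delta> / 8) * n" using npos \<delta>0 by (intro mult_pos_pos) auto
    then show ?thesis using w1(1) by linarith
  qed
  have w3: "(1 - \<delta> / 2) * n ^ 3 \<le> w ^ 3" "w ^ 3 \<le> n ^ 3"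
  proof -
    have "1 - \<delta> / 2 \<le> 1 - 3 * (\<delta> / 8) " using \<delta>0 by simp
    also have "\<dots> \<le> (1 - \<delta> / 8) ^ 3"
    proof -
      have "(1 - x) ^ 3 = 1 - 3 * x + x\<^sup>2 * (3 - x)" for x :: real by (simp add: power2_eq_square power3_eq_cube algebra_simps)
      then show ?thesis using \<delta>0 by simp
    qed
    finally have "(1 - \<delta> / 2) * n ^ 3 \<le> (1 - \<delta> / 8) ^ 3 * n ^ 3" using n3 by (intro mult_right_mono) auto
    also have "\<dots> = ((1 - \<delta> / 8) * n) ^ 3" by (simp add: power_mult_distrib)
    also have "\<dots> \<le> w ^ 3" using w1 npos \<delta>0 by (intro power_mono mult_nonneg_nonneg) auto
    finally show "(1 - \<delta> / 2) * n ^ 3 \<le> w ^ 3" .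
    show "w ^ 3 \<le> n ^ 3" using w1 w0 by (intro power_mono) auto
  qed
  have half: "n ^ 3 \<le> 2 * w ^ 3"
  proof -
    have "1/2 * n ^ 3 \<le> (1 - \<delta> / 2) * n ^ 3" using n3 \<delta>0 by (intro mult_right_mono) auto
    then show ?thesis using w3 by linarith
  qed
  have w49: "10 ^ 49 \<le> w"
  proof -
    have "(10::real) ^ 49 \<le> 1/10 * n" using n(2) by simp
    also have "\<dots> \<le> (1 - \<delta> / 8) * n" using npos \<delta>0 by (intro mult_right_mono) auto
    also have "\<dots> \<le> w" by (rule w1)
    finally show ?thesis .
  qed
  interpret H: c5graph W "induced_edges E W" by (rule c5graph_induced[OF WV])
  note ic = induced_counts[OF WV]
  interpret R: c5graph_regular W "induced_edges E W" \<delta> w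
  proof
    show "w = real (card W)" by (rule w_def)
    show "0 < \<delta>" "\<delta> \<le> 1 / 10 ^ 7" by fact+
    have "\<delta>\<^sup>2 * 10 ^ 49 \<le> \<delta>\<^sup>2 * w" using w49 by (intro mult_left_mono) auto
    moreover have "1 \<le> \<delta>\<^sup>2 * 10 ^ 49" by (simp add: \<delta> power2_eq_square)
    ultimately show "1 \<le> \<delta>\<^sup>2 * w" by linarith
    show "H.lk v W W \<ge> (1/4 - \<delta>) * w\<^sup>2" if v: "v \<in> W" for v
    proof -
      have "v \<in> V" "v \<notin> U" using v by (auto simp: W_def X_def)
      then have "(L - \<delta> / 4) * n\<^sup>2 \<le> lk v V V" by (simp add: U_def n)
      also have "\<dots> \<le> lk v W W + 2 * (real (card X) * n)" using lk_removed[OF XV, of v] by (simp add: W_def n)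
      also have "real (card X) * n \<le> \<delta> / 8 * n\<^sup>2" using mult_right_mono[OF cX, of n] npos by (simp add: power2_eq_square)
      finally have "(L - \<delta> / 2) * n\<^sup>2 \<le> lk v W W" by (simp add: algebra_simps)
      moreover have "(1/4 - \<delta>) * w\<^sup>2 \<le> (L - \<delta> / 2) * n\<^sup>2"
        using L \<delta>0 w1 w0 by (intro mult_mono power_mono) auto
      ultimately show ?thesis using ic(2)[OF v] by simp
    qed
    show "H.tri v \<le> 2 * \<delta>\<^sup>2 * w ^ 3" if v: "v \<in> W" for v
    proof -
      have "v \<in> V" "v \<notin> Sp" using v by (auto simp: W_def X_def)
      then have "tri v \<le> \<delta>\<^sup>2 * n ^ 3" by (simp add: Sp_def n)
      also have "\<dots> \<le> \<delta>\<^sup>2 * (2 * w ^ 3)" using half by (intro mult_left_mono) auto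
      finally show ?thesis using ic(3)[OF v] by simp
    qed
  qed
  have eW: "(L / 6 - d - \<delta> / 16) * n ^ 3 \<le> card (induced_edges E W)"
  proof -
    have "(\<Sum>v\<in>X. lk v V V) \<le> (\<Sum>v\<in>X. n\<^sup>2)" by (intro sum_mono lkV)
    also have "\<dots> = real (card X) * n\<^sup>2" by simp
    also have "\<dots> \<le> \<delta> / 8 * n * n\<^sup>2" using cX by (intro mult_right_mono) auto
    finally have "(\<Sum>v\<in>X. lk v V V) \<le> \<delta> / 8 * n ^ 3" by (simp add: power2_eq_square power3_eq_cube)
    then show ?thesis using edges_removed[OF XV] e unfolding W_def by (simp add: algebra_simps)
  qed
  have e': "(L / 6 - \<delta>) * w ^ 3 \<le> card (induced_edges E W)"
  proof -
    have "(L / 6 - \<delta>) * w ^ 3 \<le> (L / 6 - d - \<delta> / 16) * n ^ 3"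
      using w3 w0 L \<delta>0 d0 by (intro mult_mono) auto
    then show ?thesis using eW by linarith
  qed
  have dn: "d * n ^ 3 \<le> \<delta> * w ^ 3"
  proof -
    have "d * n ^ 3 \<le> \<delta> / 2 * (2 * w ^ 3)" using d0 half n3 \<delta>0 by (intro mult_mono) auto
    then show ?thesis by simp
  qed
  have her': "card (induced_edges (induced_edges E W) S) \<le> L / 6 * real (card S) ^ 3 + \<delta> * w ^ 3" if S: "S \<subseteq> W" for S
  proof -
    have "induced_edges (induced_edges E W) S = induced_edges E S" using S by (auto simp: induced_edges_def)
    then show ?thesis using her[OF order_trans[OF S WV]] dn by (simp only:)
  qed
  have ex': "real (ex_C5m (card W)) - real (card (induced_edges E W)) \<le> \<delta> * w ^ 3"
  proof -
    have "real (ex_C5m (card W)) \<le> L / 6 * w ^ 3 + d * n ^ 3" using exl[of "card W"] card_mono[OF finV WV] by (simp add: w_def)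
    also have "\<dots> \<le> L / 6 * n ^ 3 + d * n ^ 3" using w3 L by (intro add_right_mono mult_left_mono) auto
    finally have "real (ex_C5m (card W)) - real (card (induced_edges E W)) \<le> (2 * d + \<delta> / 16) * n ^ 3"
      using eW by (simp add: algebra_simps)
    also have "\<dots> \<le> \<delta> / 2 * (2 * w ^ 3)" using d0 half n3 \<delta>0 by (intro mult_mono) auto
    finally show ?thesis by simp
  qed
  have w13: "card W \<ge> 10 ^ 13"
  proof -
    have "(10::real) ^ 13 \<le> 10 ^ 49" by simp
    also have "\<dots> \<le> real (card W)" using w49 unfolding w_def .
    finally have "real (10 ^ 13) \<le> real (card W)" by simp
    then show ?thesis by (simp only: of_nat_le_iff)
  qed
  obtain A B C where ABC: "A \<subseteq> W" "B \<subseteq> W" "C \<subseteq> W" "A \<inter> B = {}" "A \<inter> C = {}" "B \<inter> C = {}"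
    "H.ct A B C \<ge> 5883 / 162000 * w ^ 3"
    using H.exists_dense_triple[OF L _ \<delta>0(2) w13, of thesis] e' her' \<delta>0 unfolding w_def by force
  have "H.ct A B C \<le> H.ct A B (W - A - B)" using ABC fX by (intro H.ct_mono) (auto intro: finite_subset)
  moreover have "H.partition3 A B (W - A - B)" using ABC by (auto simp: H.partition3_def)
  ultimately obtain A' B' C' where mc: "H.maxcut A' B' C'" "H.ct A B C \<le> H.ct A' B' C'"
    using H.exists_maxcut[of A B "W - A - B"] by (metis order_trans)
  have "(1/27 - 73/100000) * w ^ 3 \<le> 5883 / 162000 * w ^ 3" using w0 by (intro mult_right_mono) auto
  then have dn': "R.dense A' B' C'" unfolding R.dense_def using mc ABC(7) by linarith
  note p' = R.dense_basic(1-4)[OF dn']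
  have "H.ct A' B' C' \<ge> (1/27 - 138 * \<delta>) * w ^ 3" by (rule R.nearly_extremal_cut[OF L dn' e' ex' her'])
  then have "ct A' B' C' \<ge> (1/27 - 138 * \<delta>) * w ^ 3" using ic(1) p' by simp
  moreover have "(1/27 - 1 / 10 ^ 10) * n ^ 3 \<le> (1/27 - 138 * \<delta>) * w ^ 3"
  proof -
    have "(1/27 - 1 / 10 ^ 10) * n ^ 3 \<le> (1/27 - 138 * \<delta>) * (1 - \<delta> / 2) * n ^ 3"
      using n3 by (intro mult_right_mono) (auto simp: \<delta>)
    also have "\<dots> \<le> (1/27 - 138 * \<delta>) * w ^ 3" using mult_left_mono[OF w3(1), of "1/27 - 138 * \<delta>"] by (simp add: \<delta>)
    finally show ?thesis .
  qed
  moreover have "ct A' B' C' \<le> ct (A' \<union> X) B' C'" using p' fX by (intro ct_mono) (auto intro: finite_subset)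
  ultimately have "ct (A' \<union> X) B' C' \<ge> (1/27 - 1 / 10 ^ 10) * n ^ 3" by linarith
  moreover have "partition3 (A' \<union> X) B' C'" using p'(1)[unfolded H.partition3_def] XV unfolding partition3_def W_def by blast
  ultimately show thesis by (rule that[rotated])
qed

section \<open>Exactness\<close>

locale c5graph_large = c5graph +
  fixes n :: real
  assumes n: "n = real (card V)" and n12: "n \<ge> 10 ^ 12"
begin

definition tight :: "'a set \<Rightarrow> 'a set \<Rightarrow> 'a set \<Rightarrow> bool" where
  "tight A B C \<longleftrightarrow> maxcut A B C \<and> ct A B C \<ge> (1/27 - 1 / 10 ^ 10) * n ^ 3"

text \<open>The deficit of \<open>v\<close> if \<open>v\<close> lies in the part other than
  \<open>X\<close> and \<open>Y\<close>.\<close>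

definition mv :: "'a set \<Rightarrow> 'a set \<Rightarrow> 'a \<Rightarrow> real" where
  "mv X Y v = real (card X) * real (card Y) - lk v X Y"

text \<open>The threshold 1/2000 is low enough for the factor 1/200 in \<open>good_bad\<close>, yet
  with at most n^3 / 10^10 missing triples only 2 n / 10^7 vertices can exceed it.\<close>

definition Rs :: "'a set \<Rightarrow> 'a set \<Rightarrow> 'a set \<Rightarrow> 'a set" where
  "Rs A B C = {v \<in> A. mv B C v > n\<^sup>2 / 2000}"

definition gd :: "'a set \<Rightarrow> 'a set \<Rightarrow> 'a set \<Rightarrow> 'a set" where
  "gd A B C = A - Rs A B C"

text \<open>The bad edges through a vertex \<open>v\<close> of \<open>A\<close>; the halves undo the
  ordered count inside one part.\<close>

definition bd :: "'a set \<Rightarrow> 'a set \<Rightarrow> 'a set \<Rightarrow> 'a \<Rightarrow> real" where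
  "bd A B C v = (lk v B B + lk v C C) / 2 + lk v A B + lk v A C"

lemma npos: "n > 0" and n2pos: "n\<^sup>2 > 0" and n3pos: "n ^ 3 > 0"
proof -
  show "n > 0" using n12 by (rule less_le_trans[rotated]) simp
  then show "n\<^sup>2 > 0" "n ^ 3 > 0" by auto
qed

lemma mv_sym: "mv X Y v = mv Y X v" by (simp add: mv_def lk_sym[of v X Y])

lemma Rs_sym: "Rs A B C = Rs A C B" unfolding Rs_def by (subst mv_sym) (rule refl)
lemma gd_sym: "gd A B C = gd A C B" unfolding gd_def by (subst Rs_sym) (rule refl)

lemma mv_nonneg: "0 \<le> mv X Y v" using lk_le[of v X Y] by (simp add: mv_def)

lemma mv_sum: "finite Y \<Longrightarrow> mv X Y v = (\<Sum>x\<in>X. \<Sum>y\<in>Y. of_bool (\<not> adj v x y))"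
  unfolding mv_def by (rule miss_eq[symmetric])

lemma mv_mono:
  assumes "X \<subseteq> X'" "Y \<subseteq> Y'" "finite X'" "finite Y'"
  shows "mv X Y v \<le> mv X' Y' v"
proof -
  have "finite Y" using assms by (auto intro: finite_subset)
  then have "mv X Y v = (\<Sum>x\<in>X. \<Sum>y\<in>Y. of_bool (\<not> adj v x y))" by (rule mv_sum)
  also have "\<dots> \<le> (\<Sum>x\<in>X. \<Sum>y\<in>Y'. of_bool (\<not> adj v x y))" using assms by (intro sum_mono sum_mono2) auto
  also have "\<dots> \<le> (\<Sum>x\<in>X'. \<Sum>y\<in>Y'. of_bool (\<not> adj v x y))" using assms by (intro sum_mono2 sum_nonneg) auto
  also have "\<dots> = mv X' Y' v" using mv_sum[OF assms(4)] by simp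
  finally show ?thesis .
qed

lemma tight_perm:
  assumes "tight A B C" shows "tight B A C" "tight A C B"
  using assms maxcut_perm[of A B C] ct_sym(1)[of A B C] ct_sym(2)[of A B C] by (auto simp: tight_def)

lemma tight_basic:
  assumes t: "tight A B C"
  shows "partition3 A B C" "A \<subseteq> V" "B \<subseteq> V" "C \<subseteq> V" "finite A" "finite B" "finite C" "0 \<le> missing A B C"
proof -
  show p: "partition3 A B C" using t by (simp add: tight_def maxcut_def)
  show "A \<subseteq> V" "B \<subseteq> V" "C \<subseteq> V" "finite A" "finite B" "finite C" "0 \<le> missing A B C"
    using partition3_subset[OF p] partition3_finite[OF p] missing_nonneg[OF p] by auto
qed

lemma tight_size:
  assumes t: "tight A B C"
  shows "3332/10000 * n \<le> card A" "card A \<le> 3335/10000 * n"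
    "real (card A) * real (card B) * real (card C) \<le> n ^ 3 / 27" "missing A B C \<le> n ^ 3 / 10 ^ 10"
proof -
  note b = tight_basic[OF t]
  define u y z where "u = real (card A) / n" and "y = real (card B) / n" and "z = real (card C) / n"
  have c: "real (card A) = u * n" "real (card B) = y * n" "real (card C) = z * n"
    using npos by (simp_all add: u_def y_def z_def)
  have "real (card A) + real (card B) + real (card C) = n" using partition3_card[OF b(1)] unfolding n by linarith
  then have "(u + y + z) * n = 1 * n" by (simp add: c algebra_simps)
  then have one: "u + y + z = 1" using npos by simp
  have nn: "0 \<le> u" "0 \<le> y" "0 \<le> z" using npos by (simp_all add: u_def y_def z_def)
  have prod: "real (card A) * real (card B) * real (card C) = u * (y * z) * n ^ 3" by (simp add: c power3_eq_cube)
  have "(1/27 - 1 / 10 ^ 10) * n ^ 3 \<le> u * (y * z) * n ^ 3" using t b(8) by (simp add: tight_def missing_def prod[symmetric])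
  then have uyz: "u * (y * z) \<ge> 1/27 - 1 / 10 ^ 10" using n3pos by (simp add: mult_le_cancel_right)
  then have "0 < u * (y * z)" by (rule less_le_trans[rotated]) simp
  then have pos: "0 < u" "0 < y" "0 < z" using nn by (auto simp: zero_less_mult_iff)
  have "0 \<le> (y - z)\<^sup>2" by simp
  then have "4 * (y * z) \<le> (y + z)\<^sup>2" by (simp add: power2_eq_square algebra_simps)
  moreover have "y + z = 1 - u" using one by simp
  ultimately have h: "4 * (y * z) \<le> (1 - u)\<^sup>2" by simp
  have u1: "u < 1" using one pos by simp
  have "\<bar>u - 1/3\<bar> \<le> 1/10000" by (rule part_size_near_third[OF pos(1) u1 h uyz])
  then have "u - 1/3 \<le> 1/10000" "- (u - 1/3) \<le> 1/10000" by (simp_all only: abs_le_iff)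
  then have "3332/10000 \<le> u" "u \<le> 3335/10000" by linarith+
  then show "3332/10000 * n \<le> card A" "card A \<le> 3335/10000 * n"
    unfolding c using npos by (simp_all add: mult_right_mono)
  have "u * (y * z) * n ^ 3 \<le> 1/27 * n ^ 3" using product_le[OF pos(1) u1 h] n3pos by (intro mult_right_mono) auto
  then show le: "real (card A) * real (card B) * real (card C) \<le> n ^ 3 / 27" unfolding prod by simp
  show "missing A B C \<le> n ^ 3 / 10 ^ 10" using t le by (simp add: tight_def missing_def algebra_simps)
qed

lemma tight_sizes:
  assumes t: "tight A B C"
  shows "3332/10000 * n \<le> card B" "card B \<le> 3335/10000 * n" "3332/10000 * n \<le> card C" "card C \<le> 3335/10000 * n"
  using tight_size(1,2)[OF tight_perm(1)[OF t]] tight_size(1,2)[OF tight_perm(1)[OF tight_perm(2)[OF t]]] by auto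

lemma Rs_card:
  assumes t: "tight A B C"
  shows "real (card (Rs A B C)) \<le> 2 / 10 ^ 7 * n"
proof -
  note b = tight_basic[OF t]
  have sub: "Rs A B C \<subseteq> A" by (auto simp: Rs_def)
  have "real (card (Rs A B C)) * (n\<^sup>2 / 2000) = (\<Sum>v\<in>Rs A B C. n\<^sup>2 / 2000)" by simp
  also have "\<dots> \<le> (\<Sum>v\<in>Rs A B C. mv B C v)" by (intro sum_mono) (auto simp: Rs_def)
  also have "\<dots> \<le> (\<Sum>v\<in>A. mv B C v)" using sub b mv_nonneg by (intro sum_mono2) auto
  also have "\<dots> = missing A B C" using miss_sum[OF b(7), where A = A and B = B] by (simp add: mv_def)
  also have "\<dots> \<le> n ^ 3 / 10 ^ 10" by (rule tight_size(4)[OF t])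
  finally have "real (card (Rs A B C)) * n\<^sup>2 \<le> (2 / 10 ^ 7 * n) * n\<^sup>2" by (simp add: power2_eq_square power3_eq_cube mult_ac)
  then show ?thesis using n2pos by (rule mult_right_le_imp_le)
qed

lemma gd_card: "tight A B C \<Longrightarrow> real (card (gd A B C)) \<ge> real (card A) - 2 / 10 ^ 7 * n"
proof -
  assume t: "tight A B C"
  have sub: "Rs A B C \<subseteq> A" by (auto simp: Rs_def)
  have "finite (Rs A B C)" using tight_basic(5)[OF t] sub by (rule finite_subset[rotated])
  from card_Diff_subset[OF this sub] card_mono[OF tight_basic(5)[OF t] sub]
  have "real (card (gd A B C)) = real (card A) - real (card (Rs A B C))" by (simp add: gd_def of_nat_diff)
  then show ?thesis using Rs_card[OF t] by linarith
qed

text \<open>Let \<open>T\<close> be the set of vertices in \<open>G\<close> on a link edge inside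
  \<open>G\<close>. By \<open>bad_pair\<close>, and since the ends of such an edge have small
  deficit, each vertex of \<open>T\<close> is joined in the link of \<open>v\<close> to almost
  nothing in \<open>H\<close>, so it accounts for at least 0.329 n missing pairs. This bounds
  \<open>T\<close>, and the link edges are at most the square of its size.\<close>

lemma good_inner:
  assumes t: "tight A B C" and v: "v \<in> A"
  defines "G \<equiv> gd B A C" and "H \<equiv> gd C A B"
  shows "lk v G G \<le> (mv G H v / (329/1000 * n))\<^sup>2"
proof -
  note b = tight_basic[OF t]
  have GB: "G \<subseteq> B" and HC: "H \<subseteq> C" by (auto simp: G_def H_def gd_def)
  have fG: "finite G" and fH: "finite H" using GB HC b by (auto intro: finite_subset)
  define T where "T = {x \<in> G. \<exists>y\<in>G. adj v x y}"
  have fT: "finite T" "T \<subseteq> G" using fG by (auto simp: T_def)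
  have low: "329/1000 * n \<le> (\<Sum>z\<in>H. of_bool (\<not> adj v x z))" if x: "x \<in> T" for x
  proof -
    obtain y where y: "x \<in> G" "y \<in> G" "adj v x y" using x by (auto simp: T_def)
    have gm: "mv A C g \<le> n\<^sup>2 / 2000" if "g \<in> G" for g using that by (auto simp: G_def gd_def Rs_def not_less)
    define Z where "Z = (\<Sum>z\<in>C. of_bool (adj v x z \<or> adj v y z) :: real)"
    have "(real (card A) - 1) * Z \<le> mv A C x + mv A C y"
      using bad_pair[OF v b(5,7) y(3)] by (simp add: mv_def Z_def)
    also have "\<dots> \<le> n\<^sup>2 / 1000" using gm[OF y(1)] gm[OF y(2)] by linarith
    finally have le: "(real (card A) - 1) * Z \<le> n\<^sup>2 / 1000" .
    have Z0: "0 \<le> Z" unfolding Z_def by (intro sum_nonneg) auto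
    have nb: "n \<ge> 1000000000000" using n12 by simp
    have "333/1000 * n \<le> real (card A) - 1" using tight_size(1)[OF t] nb by linarith
    then have "333/1000 * n * Z \<le> (real (card A) - 1) * Z" using Z0 by (intro mult_right_mono) auto
    then have "n * (333/1000 * Z) \<le> n * (n / 1000)" using le by (simp add: power2_eq_square mult_ac)
    then have "333/1000 * Z \<le> n / 1000" using npos by (rule mult_left_le_imp_le)
    then have Z1: "Z \<le> 31/10000 * n" using npos by linarith
    have "dg v x H \<le> Z" unfolding dg_def Z_def
    proof -
      have "(\<Sum>z\<in>H. of_bool (adj v x z) :: real) \<le> (\<Sum>z\<in>H. of_bool (adj v x z \<or> adj v y z))" by (intro sum_mono) auto
      also have "\<dots> \<le> (\<Sum>z\<in>C. of_bool (adj v x z \<or> adj v y z))" using HC b by (intro sum_mono2) auto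
      finally show "(\<Sum>z\<in>H. of_bool (adj v x z)) \<le> (\<Sum>z\<in>C. of_bool (adj v x z \<or> adj v y z) :: real)" .
    qed
    moreover have "(\<Sum>z\<in>H. of_bool (\<not> adj v x z)) = real (card H) - dg v x H"
      unfolding dg_def by (simp only: of_bool_not_iff sum_subtractf) simp
    moreover have "real (card H) \<ge> real (card C) - n / 5000000"
      using gd_card[OF tight_perm(1)[OF tight_perm(2)[OF t]]] by (simp add: H_def)
    ultimately show ?thesis using Z1 tight_sizes(3)[OF t] npos by linarith
  qed
  have "real (card T) * (329/1000 * n) = (\<Sum>x\<in>T. 329/1000 * n)" by simp
  also have "\<dots> \<le> (\<Sum>x\<in>T. \<Sum>z\<in>H. of_bool (\<not> adj v x z))" by (intro sum_mono low)
  also have "\<dots> \<le> (\<Sum>x\<in>G. \<Sum>z\<in>H. of_bool (\<not> adj v x z))" using fT fG by (intro sum_mono2 sum_nonneg) auto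
  also have "\<dots> = mv G H v" using mv_sum[OF fH] by simp
  finally have "real (card T) \<le> mv G H v / (329/1000 * n)" using npos by (simp add: pos_le_divide_eq)
  then have "(real (card T))\<^sup>2 \<le> (mv G H v / (329/1000 * n))\<^sup>2" by (intro power_mono) auto
  moreover have "lk v G G \<le> (real (card T))\<^sup>2"
  proof -
    have "lk v G G = lk v T T"
    proof -
      have z: "adj v x y \<Longrightarrow> x \<in> G \<Longrightarrow> y \<in> G \<Longrightarrow> x \<in> T \<and> y \<in> T" for x y
        using adj_perm(2) by (auto simp: T_def)
      have "lk v T T = (\<Sum>x\<in>T. \<Sum>y\<in>G. of_bool (adj v x y))"
        unfolding lk_def using fT fG z by (intro sum.cong refl sum.mono_neutral_left) auto
      also have "\<dots> = lk v G G"
        unfolding lk_def using fT fG z by (intro sum.mono_neutral_left ballI sum.neutral) auto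
      finally show ?thesis by simp
    qed
    then show ?thesis using lk_le[of v T T] by (simp add: power2_eq_square)
  qed
  ultimately show ?thesis by linarith
qed

text \<open>\<open>good_inner\<close> is quadratic in the deficit; a deficit of at most n^2/2000
  makes it linear with factor 500/108241 \<le> 1/200, where 0.108241 = 0.329^2.\<close>

lemma good_bad:
  assumes t: "tight A B C"
  shows "ct (gd A B C) (gd B A C) (gd B A C) \<le> missing (gd A B C) (gd B A C) (gd C A B) / 200"
proof -
  note b = tight_basic[OF t]
  define G where "G = gd B A C"
  define H where "H = gd C A B"
  have GB: "G \<subseteq> B" and HC: "H \<subseteq> C" by (auto simp: G_def H_def gd_def)
  have fH: "finite H" using HC b by (auto intro: finite_subset)
  have "lk v G G \<le> mv G H v / 200" if v: "v \<in> gd A B C" for v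
  proof -
    define k where "k = mv G H v"
    have vA: "v \<in> A" using v by (simp add: gd_def)
    have k0: "0 \<le> k" unfolding k_def by (rule mv_nonneg)
    have "k \<le> mv B C v" unfolding k_def using GB HC b by (intro mv_mono) auto
    also have "\<dots> \<le> n\<^sup>2 / 2000" using v by (auto simp: gd_def Rs_def not_less)
    finally have k1: "k \<le> n\<^sup>2 / 2000" .
    have "lk v G G \<le> (k / (329/1000 * n))\<^sup>2" using good_inner[OF t vA] by (simp add: G_def H_def k_def)
    also have "\<dots> = k * k / (108241/1000000 * n\<^sup>2)" by (simp add: power2_eq_square)
    also have "\<dots> \<le> k * (n\<^sup>2 / 2000) / (108241/1000000 * n\<^sup>2)" using k0 k1 by (intro divide_right_mono mult_left_mono) auto
    also have "\<dots> = k * (500/108241)" using npos by (simp add: field_simps)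
    also have "\<dots> \<le> k / 200" using k0 by simp
    finally show ?thesis by (simp add: k_def)
  qed
  then have "ct (gd A B C) G G \<le> (\<Sum>v\<in>gd A B C. mv G H v / 200)" unfolding ct_lk by (intro sum_mono)
  also have "\<dots> = missing (gd A B C) G H / 200"
    using miss_sum[OF fH, where A = "gd A B C" and B = G] unfolding mv_def by (simp only: sum_divide_distrib[symmetric])
  finally show ?thesis by (simp add: G_def H_def)
qed

text \<open>A bad edge with one vertex in \<open>A\<close> and two in \<open>B\<close> avoids the
  removed vertices, or has its vertex in \<open>A\<close> removed, or one of its two vertices in
  \<open>B\<close>; the last case causes the factor 2.\<close>

lemma ct_split:
  assumes t: "tight A B C"
  shows "ct A B B \<le> ct (gd A B C) (gd B A C) (gd B A C) + (\<Sum>v\<in>Rs A B C. lk v B B) + 2 * (\<Sum>v\<in>Rs B A C. lk v B A)"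
proof -
  note b = tight_basic[OF t]
  define A' where "A' = gd A B C"
  define B' where "B' = gd B A C"
  define S where "S = Rs A B C"
  define R where "R = Rs B A C"
  have A: "A = A' \<union> S" "A' \<inter> S = {}" and B: "B = B' \<union> R" "B' \<inter> R = {}"
    by (auto simp: A'_def S_def B'_def R_def gd_def Rs_def)
  have f: "finite A'" "finite S" "finite B'" "finite R" using A B b by (metis finite_Un)+
  have "ct A B B = ct A' B B + ct S B B" using ct_Un1[OF f(1,2) A(2)] A(1) by metis
  also have "ct A' B B = ct B A' B" by (rule ct_sym)
  also have "\<dots> = ct B' A' B + ct R A' B" using ct_Un1[OF f(3,4) B(2)] B(1) by metis
  also have "ct B' A' B = ct B B' A'" by (rule ct_rotate)
  also have "\<dots> = ct B' B' A' + ct R B' A'" using ct_Un1[OF f(3,4) B(2)] B(1) by metis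
  also have "ct B' B' A' = ct A' B' B'" by (rule ct_rotate)
  also have "ct R A' B \<le> ct R B A"
  proof -
    have "ct R A' B \<le> ct R A B" using A b f by (intro ct_mono) auto
    also have "\<dots> = ct R B A" by (rule ct_sym)
    finally show ?thesis .
  qed
  also have "ct R B' A' \<le> ct R B A" using A B b f by (intro ct_mono) auto
  finally have "ct A B B \<le> ct A' B' B' + ct S B B + 2 * ct R B A" by simp
  then show ?thesis unfolding A'_def B'_def S_def R_def ct_lk .
qed

text \<open>Six instances of \<open>good_bad\<close> and \<open>ct_split\<close>, halved: 6 *
  (1/200) / 2 = 15/1000.\<close>

lemma bad_split:
  assumes t: "tight A B C"
  shows "bad A B C \<le> 15/1000 * missing (gd A B C) (gd B A C) (gd C A B)
    + (\<Sum>v\<in>Rs A B C. bd A B C v) + (\<Sum>v\<in>Rs B A C. bd B A C v) + (\<Sum>v\<in>Rs C A B. bd C A B v)"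
proof -
  define M0 where "M0 = missing (gd A B C) (gd B A C) (gd C A B)"
  note t2 = tight_perm(2)[OF t] and t3 = tight_perm(1)[OF t]
  note t4 = tight_perm(2)[OF t3] and t5 = tight_perm(1)[OF t2]
  note t6 = tight_perm(2)[OF t5]
  have gs: "gd A C B = gd A B C" "gd B C A = gd B A C" "gd C B A = gd C A B"
    and rs: "Rs A C B = Rs A B C" "Rs B C A = Rs B A C" "Rs C B A = Rs C A B"
    by (rule gd_sym Rs_sym)+
  have ms: "missing (gd A B C) (gd C A B) (gd B A C) = M0" "missing (gd B A C) (gd A B C) (gd C A B) = M0"
    "missing (gd B A C) (gd C A B) (gd A B C) = M0" "missing (gd C A B) (gd A B C) (gd B A C) = M0" "missing (gd C A B) (gd B A C) (gd A B C) = M0"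
    unfolding M0_def missing_def using ct_sym ct_rotate by (simp_all add: mult_ac)
  note g = good_bad[OF t, folded M0_def] good_bad[OF t2, unfolded gs ms] good_bad[OF t3, unfolded gs ms] good_bad[OF t4, unfolded gs ms]
    good_bad[OF t5, unfolded gs ms] good_bad[OF t6, unfolded gs ms]
  note s = ct_split[OF t] ct_split[OF t2, unfolded gs rs] ct_split[OF t3, unfolded gs rs] ct_split[OF t4, unfolded gs rs]
    ct_split[OF t5, unfolded gs rs] ct_split[OF t6, unfolded gs rs]
  have bds: "(\<Sum>v\<in>S. bd X Y Z v) = ((\<Sum>v\<in>S. lk v Y Y) + (\<Sum>v\<in>S. lk v Z Z)) / 2 + (\<Sum>v\<in>S. lk v X Y) + (\<Sum>v\<in>S. lk v X Z)" for S X Y Z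
    unfolding bd_def by (simp only: sum.distrib sum_divide_distrib[symmetric])
  show ?thesis unfolding bds bad_def M0_def[symmetric] using g s by (simp only: add_divide_distrib)
qed

lemma missing_Un:
  assumes "finite X" "finite X'" "X \<inter> X' = {}"
  shows "missing (X \<union> X') Y Z = missing X Y Z + missing X' Y Z"
  using assms by (simp add: missing_def ct_Un1 card_Un_disjoint algebra_simps)

lemma mv_remove:
  assumes "X' \<subseteq> X" "finite X"
  shows "mv X Y v \<le> mv X' Y v + real (card (X - X')) * real (card Y)"
proof -
  have f: "finite X'" "finite (X - X')" and d: "X' \<inter> (X - X') = {}" and X: "X' \<union> (X - X') = X"
    using assms by (auto intro: finite_subset)
  have "lk v X Y = lk v X' Y + lk v (X - X') Y" using lk_Un1[OF f d, of v Y] X by simp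
  moreover have "card X = card X' + card (X - X')" using card_Un_disjoint[OF f d] X by simp
  moreover have "0 \<le> lk v (X - X') Y" by (rule lk_nonneg)
  ultimately show ?thesis by (simp add: mv_def algebra_simps)
qed

text \<open>The deficits of removed vertices may count a triple more than once, but only triples
  through two removed vertices. A removed vertex lies in at most 2 * (2 / 10^7) n^2 of these, which
  n^2 / 10^6 covers.\<close>

lemma missing_split:
  assumes t: "tight A B C"
  shows "missing A B C \<ge> missing (gd A B C) (gd B A C) (gd C A B) + (\<Sum>v\<in>Rs A B C. mv B C v - n\<^sup>2 / 1000000)
    + (\<Sum>v\<in>Rs B A C. mv A C v - n\<^sup>2 / 1000000) + (\<Sum>v\<in>Rs C A B. mv A B v - n\<^sup>2 / 1000000)"
proof -
  note b = tight_basic[OF t]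
  define A' B' C' where "A' = gd A B C" and "B' = gd B A C" and "C' = gd C A B"
  define S R Q where "S = Rs A B C" and "R = Rs B A C" and "Q = Rs C A B"
  have A: "A' \<union> S = A" "A' \<inter> S = {}" and B: "B' \<union> R = B" "B' \<inter> R = {}" and C: "C' \<union> Q = C" "C' \<inter> Q = {}"
    by (auto simp: A'_def S_def B'_def R_def C'_def Q_def gd_def Rs_def)
  have f: "finite A'" "finite S" "finite B'" "finite R" "finite C'" "finite Q" using A B C b by (metis finite_Un)+
  have dif: "A - A' = S" "B - B' = R" using A B by auto
  have rc: "real (card S) \<le> 2 / 10 ^ 7 * n" "real (card R) \<le> 2 / 10 ^ 7 * n"
    using Rs_card[OF t] Rs_card[OF tight_perm(1)[OF t]] by (simp_all add: S_def R_def)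
  have small: "real (card X) * real (card Y) \<le> n\<^sup>2 / 5000000" if "real (card X) \<le> 2 / 10 ^ 7 * n" "Y \<subseteq> V" for X Y
  proof -
    have "real (card Y) \<le> n" unfolding n using that(2) finV by (simp add: card_mono)
    then have "real (card X) * real (card Y) \<le> (2 / 10 ^ 7 * n) * n" using that(1) npos by (intro mult_mono) auto
    then show ?thesis by (simp add: power2_eq_square)
  qed
  have ms: "missing X Y Z = (\<Sum>v\<in>X. mv Y Z v)" if "finite Z" for X Y Z
    using miss_sum[OF that, where A = X and B = Y] by (simp add: mv_def)
  have nn: "0 \<le> n\<^sup>2" by simp
  have A'V: "A' \<subseteq> V" using A b by auto
  have "missing A B C = missing A' B C + missing S B C" using missing_Un[OF f(1,2) A(2)] A(1) by simp
  also have "missing A' B C = missing B A' C" by (rule missing_perm)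
  also have "\<dots> = missing B' A' C + missing R A' C" using missing_Un[OF f(3,4) B(2)] B(1) by simp
  also have "missing B' A' C = missing C A' B'" using missing_perm by metis
  also have "\<dots> = missing C' A' B' + missing Q A' B'" using missing_Un[OF f(5,6) C(2)] C(1) by simp
  also have "missing C' A' B' = missing A' B' C'" using missing_perm by metis
  finally have eq: "missing A B C = missing A' B' C' + missing Q A' B' + missing R A' C + missing S B C" .
  have "(\<Sum>v\<in>S. mv B C v - n\<^sup>2 / 1000000) \<le> missing S B C" unfolding ms[OF b(7)] using nn by (intro sum_mono) auto
  moreover have "(\<Sum>v\<in>R. mv A C v - n\<^sup>2 / 1000000) \<le> missing R A' C" unfolding ms[OF b(7)]
  proof (rule sum_mono)
    fix v
    have "mv A C v \<le> mv A' C v + real (card (A - A')) * real (card C)" using A b by (intro mv_remove) auto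
    then show "mv A C v - n\<^sup>2 / 1000000 \<le> mv A' C v" using small[OF rc(1) b(4)] nn unfolding dif by linarith
  qed
  moreover have "(\<Sum>v\<in>Q. mv A B v - n\<^sup>2 / 1000000) \<le> missing Q A' B'" unfolding ms[OF f(3)]
  proof (rule sum_mono)
    fix v
    have "mv A B v \<le> mv A' B v + real (card S) * real (card B)" using mv_remove[of A' A B v] A b unfolding dif by auto
    moreover have "mv A' B v \<le> mv A' B' v + real (card R) * real (card A')"
      using mv_remove[of B' B A' v] B b unfolding dif by (auto simp: mv_sym[of _ A'])
    ultimately show "mv A B v - n\<^sup>2 / 1000000 \<le> mv A' B' v"
      using small[OF rc(1) b(3)] small[OF rc(2) A'V] nn by linarith
  qed
  ultimately show ?thesis using eq unfolding A'_def B'_def C'_def S_def R_def Q_def by linarith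
qed

lemma card_le_n: "X \<subseteq> V \<Longrightarrow> real (card X) \<le> n"
  unfolding n using finV by (simp add: card_mono)

lemma lk_le_n2: "X \<subseteq> V \<Longrightarrow> Y \<subseteq> V \<Longrightarrow> lk v X Y \<le> n\<^sup>2"
proof -
  assume "X \<subseteq> V" "Y \<subseteq> V"
  then have "real (card X) * real (card Y) \<le> n * n" using card_le_n npos by (intro mult_mono) auto
  then show ?thesis using lk_le[of v X Y] by (simp add: power2_eq_square)
qed

text \<open>The quadratic estimate handles the good vertices, and the removed ones are so few that
  the trivial bound 3 n^2 on their bad edges suffices.\<close>

lemma bad_small:
  assumes t: "tight A B C"
  shows "bad A B C \<le> n ^ 3 / 100000"
proof -
  note b = tight_basic[OF t]
  define M0 where "M0 = missing (gd A B C) (gd B A C) (gd C A B)"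
  have sub: "gd A B C \<subseteq> A" "gd B A C \<subseteq> B" "gd C A B \<subseteq> C" by (auto simp: gd_def)
  have ms: "missing X Y Z = (\<Sum>v\<in>X. mv Y Z v)" if "finite Z" for X Y Z
    using miss_sum[OF that, where A = X and B = Y] by (simp add: mv_def)
  have "M0 = (\<Sum>v\<in>gd A B C. mv (gd B A C) (gd C A B) v)"
    unfolding M0_def using sub b by (intro ms) (auto intro: finite_subset)
  also have "\<dots> \<le> (\<Sum>v\<in>gd A B C. mv B C v)" using sub b by (intro sum_mono mv_mono) auto
  also have "\<dots> \<le> (\<Sum>v\<in>A. mv B C v)" using sub b mv_nonneg by (intro sum_mono2) auto
  also have "\<dots> = missing A B C" using ms[OF b(7)] by simp
  also have "\<dots> \<le> n ^ 3 / 10 ^ 10" by (rule tight_size(4)[OF t])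
  finally have M0: "M0 \<le> n ^ 3 / 10000000000" by simp
  have rb: "(\<Sum>v\<in>Rs X Y Z. bd X Y Z v) \<le> n ^ 3 / 1000000" if tX: "tight X Y Z" for X Y Z
  proof -
    note bX = tight_basic[OF tX]
    have "bd X Y Z v \<le> 3 * n\<^sup>2" for v
    proof -
      have "lk v Y Y / 2 \<le> n\<^sup>2 / 2" "lk v Z Z / 2 \<le> n\<^sup>2 / 2" "lk v X Y \<le> n\<^sup>2" "lk v X Z \<le> n\<^sup>2"
        using lk_le_n2[OF bX(3,3)] lk_le_n2[OF bX(4,4)] lk_le_n2[OF bX(2,3)] lk_le_n2[OF bX(2,4)] by simp_all
      then show ?thesis unfolding bd_def add_divide_distrib by linarith
    qed
    then have "(\<Sum>v\<in>Rs X Y Z. bd X Y Z v) \<le> (\<Sum>v\<in>Rs X Y Z. 3 * n\<^sup>2)" by (intro sum_mono)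
    also have "\<dots> = real (card (Rs X Y Z)) * (3 * n\<^sup>2)" by simp
    also have "\<dots> \<le> (2 / 10 ^ 7 * n) * (3 * n\<^sup>2)" using Rs_card[OF tX] by (intro mult_right_mono) auto
    also have "\<dots> = 6 / 10000000 * n ^ 3" by (simp add: power2_eq_square power3_eq_cube)
    also have "\<dots> \<le> n ^ 3 / 1000000" using n3pos by simp
    finally show ?thesis .
  qed
  show ?thesis
    using bad_split[OF t] M0 rb[OF t] rb[OF tight_perm(1)[OF t]] rb[OF tight_perm(1)[OF tight_perm(2)[OF t]]] n3pos
    unfolding M0_def by linarith
qed

text \<open>The transversal edges, the few bad edges and the edges that the hereditary bound allows
  in the other two parts fall short of the total edge density; the rest must lie inside
  \<open>A\<close>.\<close>

lemma inner_edges: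
  fixes L d :: real
  assumes t: "tight A B C" and L: "L \<ge> 1/4" "L \<le> 2" and d: "0 \<le> d" "d \<le> 1/1000000"
    and e: "(L / 6 - d) * n ^ 3 \<le> card E"
    and her: "\<And>W. W \<subseteq> V \<Longrightarrow> card (induced_edges E W) \<le> L / 6 * real (card W) ^ 3 + d * n ^ 3"
  shows "ct A A A \<ge> 8/1000 * n ^ 3"
proof -
  note b = tight_basic[OF t]
  have h: "real (card (induced_edges E X)) \<le> L / 6 * (371/10000 * n ^ 3) + d * n ^ 3"
    if X: "X \<subseteq> V" "real (card X) \<le> 3335/10000 * n" for X
  proof -
    have "real (card X) ^ 3 \<le> (3335/10000 * n) ^ 3" using X by (intro power_mono) auto
    also have "\<dots> = (3335/10000) ^ 3 * n ^ 3" by (rule power_mult_distrib)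
    also have "\<dots> \<le> 371/10000 * n ^ 3" using n3pos by (intro mult_right_mono) (auto simp: power3_eq_cube)
    finally have "L / 6 * real (card X) ^ 3 \<le> L / 6 * (371/10000 * n ^ 3)" using L by (intro mult_left_mono) auto
    then show ?thesis using her[OF X(1)] by linarith
  qed
  have "ct A B C \<le> n ^ 3 / 27" using tight_size(3)[OF t] b(8) by (simp add: missing_def)
  moreover have "(L / 6 - d) * n ^ 3 = L / 6 * n ^ 3 - d * n ^ 3" by (rule left_diff_distrib)
  moreover have "d * n ^ 3 \<le> 1/1000000 * n ^ 3" using d n3pos by (intro mult_right_mono) auto
  moreover have "L / 6 * (371/10000 * n ^ 3) = 371/10000 * (L / 6 * n ^ 3)" by simp
  moreover have "1/24 * n ^ 3 \<le> L / 6 * n ^ 3" using L n3pos by (intro mult_right_mono) auto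
  moreover note edge_count[OF b(1)] bad_small[OF t] h[OF b(3) tight_sizes(2)[OF t]] h[OF b(4) tight_sizes(4)[OF t]] e
  ultimately have "real (card (induced_edges E A)) \<ge> 14/10000 * n ^ 3" using n3pos by linarith
  then show ?thesis unfolding ct_induced[OF b(2)] using n3pos by linarith
qed

lemma sum_unique_le:
  assumes "finite B" "\<And>z z'. P z \<Longrightarrow> P z' \<Longrightarrow> z = z'"
  shows "(\<Sum>z\<in>B. of_bool (P z)) \<le> (1::real)"
proof (cases "\<exists>w\<in>B. P w")
  case True
  then obtain w where w: "w \<in> B" "P w" by blast
  have "(\<Sum>z\<in>B. of_bool (P z) :: real) \<le> (\<Sum>z\<in>B. of_bool (z = w))" using assms(2) w(2) by (intro sum_mono) auto
  also have "\<dots> = 1" using w assms(1) by (simp add: of_bool_def)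
  finally show ?thesis .
next
  case False
  then have "(\<Sum>z\<in>B. of_bool (P z) :: real) = 0" by (intro sum.neutral) auto
  then show ?thesis by simp
qed

text \<open>For fixed \<open>x\<close>, \<open>y\<close> at most one \<open>z\<close> makes
  \<open>x y z\<close>, \<open>v x z\<close> and \<open>v y z\<close> all edges, since two such
  vertices would give a forbidden copy. Every other edge inside \<open>B\<close> therefore charges a
  pair missing from the link of \<open>v\<close>.\<close>

lemma inner_edges_force_nonlink:
  assumes f: "finite B"
  shows "ct B B B \<le> (real (card B))\<^sup>2 + 2 * (real (card B) * mv B B v)"
proof -
  have un: "(\<Sum>z\<in>B. of_bool (adj x y z \<and> adj v x z \<and> adj v y z)) \<le> (1::real)" for x y
  proof (rule sum_unique_le[OF f])
    fix z z' assume h: "adj x y z \<and> adj v x z \<and> adj v y z" "adj x y z' \<and> adj v x z' \<and> adj v y z'"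
    have "adj v z x" "adj z x y" "adj x y z'" "adj y z' v"
      using adj_perm(2)[of v x z] adj_perm(4)[of x y z] adj_perm(3)[of v y z'] h by blast+
    then show "z = z'" by (rule adj_C5)
  qed
  have "ct B B B \<le> (\<Sum>x\<in>B. \<Sum>y\<in>B. \<Sum>z\<in>B. of_bool (adj x y z \<and> adj v x z \<and> adj v y z) + of_bool (\<not> adj v x z) + of_bool (\<not> adj v y z))"
    unfolding ct_def by (intro sum_mono) (auto simp: of_bool_def)
  also have "\<dots> = (\<Sum>x\<in>B. \<Sum>y\<in>B. \<Sum>z\<in>B. of_bool (adj x y z \<and> adj v x z \<and> adj v y z))
     + (\<Sum>x\<in>B. \<Sum>y\<in>B. \<Sum>z\<in>B. of_bool (\<not> adj v x z)) + (\<Sum>x\<in>B. \<Sum>y\<in>B. \<Sum>z\<in>B. of_bool (\<not> adj v y z))"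
    by (simp only: sum.distrib)
  also have "(\<Sum>x\<in>B. \<Sum>y\<in>B. \<Sum>z\<in>B. of_bool (adj x y z \<and> adj v x z \<and> adj v y z)) \<le> (\<Sum>x\<in>B. \<Sum>y\<in>B. 1 :: real)" by (intro sum_mono un)
  also have "(\<Sum>x\<in>B. \<Sum>y\<in>B. 1 :: real) = (real (card B))\<^sup>2" by (simp add: power2_eq_square)
  also have "(\<Sum>x\<in>B. \<Sum>y\<in>B. \<Sum>z\<in>B. of_bool (\<not> adj v x z) :: real) = real (card B) * mv B B v"
    unfolding mv_sum[OF f] by (simp only: sum_constant sum_distrib_left)
  also have "(\<Sum>x\<in>B. \<Sum>y\<in>B. \<Sum>z\<in>B. of_bool (\<not> adj v y z) :: real) = real (card B) * mv B B v"
    unfolding mv_sum[OF f] by (simp only: sum_constant)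
  finally show ?thesis by simp
qed

text \<open>Exchanging the bad edges at \<open>v\<close> for its missing transversal triples is
  profitable by a fixed multiple of n^2. The quadratic bound m^2 / (0.108241 n^2) from
  \<open>good_inner\<close> is below the deficit \<open>m\<close> only while m < 0.108 n^2, but
  \<open>m\<close> can reach the product of two part sizes, about 0.111 n^2. Close to that value the
  edges inside the parts are needed.\<close>

lemma removed_vertex:
  assumes t: "tight A B C" and v: "v \<in> Rs A B C"
    and iB: "ct B B B \<ge> 8/1000 * n ^ 3" and iC: "ct C C C \<ge> 8/1000 * n ^ 3"
  shows "bd A B C v \<le> mv B C v - n\<^sup>2 / 10000"
proof -
  note b = tight_basic[OF t]
  have vA: "v \<in> A" and m1: "mv B C v > n\<^sup>2 / 2000" using v by (auto simp: Rs_def)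
  have nb: "n \<ge> 1000000000000" using n12 by simp
  have nsq: "n\<^sup>2 * 1000000000000 \<le> n ^ 3"
    using mult_left_mono[OF nb, of "n\<^sup>2"] by (simp add: power2_eq_square power3_eq_cube mult.assoc)
  \<comment> \<open>In a maximum cut \<open>lk v A X\<close> is at most \<open>lk v X Y\<close>, so
    the product estimate of \<open>matching\<close> bounds its square by a small multiple of
    n^4.\<close>
  have cross: "lk v A X \<le> n\<^sup>2 / 100000" if tX: "tight A X Y" for X Y
  proof -
    note bX = tight_basic[OF tX]
    have mc: "maxcut A X Y" using tX by (simp add: tight_def)
    have "lk v A X * lk v A X \<le> lk v A X * lk v X Y"
      using maxcut_link(1)[OF mc vA] lk_nonneg by (intro mult_left_mono)
    also have "\<dots> \<le> real (card X) * (missing A X Y + real (card A) * real (card Y))"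
      using matching[OF bX(6), of v A Y] by (simp add: missing_def)
    also have "\<dots> \<le> (3335/10000 * n) * (n ^ 3 / 10000000000 + n\<^sup>2)"
    proof (rule mult_mono)
      show "real (card X) \<le> 3335/10000 * n" by (rule tight_sizes(2)[OF tX])
      have "real (card A) * real (card Y) \<le> n * n" using card_le_n bX npos by (intro mult_mono) auto
      moreover have "missing A X Y \<le> n ^ 3 / 10000000000" using tight_size(4)[OF tX] by simp
      ultimately show "missing A X Y + real (card A) * real (card Y) \<le> n ^ 3 / 10000000000 + n\<^sup>2" by (simp add: power2_eq_square)
      show "0 \<le> 3335/10000 * n" using npos by simp
      show "0 \<le> missing A X Y + real (card A) * real (card Y)" using bX(8) by simp
    qed
    also have "\<dots> \<le> (3335/10000 * n) * (2 * n ^ 3 / 10000000000)" 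
    proof (rule mult_left_mono)
      show "n ^ 3 / 10000000000 + n\<^sup>2 \<le> 2 * n ^ 3 / 10000000000" using nsq n3pos n2pos by linarith
    qed (use npos in simp)
    also have "\<dots> = 667/10000000000000 * (n * n ^ 3)" by simp
    also have "\<dots> \<le> 1/10000000000 * (n * n ^ 3)" using npos by (intro mult_right_mono) auto
    also have "\<dots> = (n\<^sup>2 / 100000) * (n\<^sup>2 / 100000)" by (simp add: power2_eq_square power3_eq_cube)
    finally have "(lk v A X)\<^sup>2 \<le> (n\<^sup>2 / 100000)\<^sup>2" by (simp only: power2_eq_square)
    then show ?thesis by (rule power2_le_imp_le) simp
  qed
  define m where "m = mv B C v"
  have x: "lk v A B \<le> n\<^sup>2 / 100000" "lk v A C \<le> n\<^sup>2 / 100000" using cross[OF t] cross[OF tight_perm(2)[OF t]] .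
  show ?thesis
  proof (cases "m \<le> 105/1000 * n\<^sup>2")
    case True
    have inner: "lk v X X \<le> m * m / (108241/1000000 * n\<^sup>2) + n\<^sup>2 / 1000000" if tX: "tight A X Y" and mX: "mv X Y v = m" for X Y
    proof -
      note bX = tight_basic[OF tX]
      define G where "G = gd X A Y"
      define H where "H = gd Y A X"
      define R where "R = Rs X A Y"
      have sub: "G \<subseteq> X" "H \<subseteq> Y" by (auto simp: G_def H_def gd_def)
      have X: "X = G \<union> R" "G \<inter> R = {}" by (auto simp: G_def R_def gd_def Rs_def)
      have f: "finite G" "finite R" using X bX(6) by (metis finite_Un)+
      have rc: "real (card R) \<le> 2 / 10 ^ 7 * n" unfolding R_def by (rule Rs_card[OF tight_perm(1)[OF tX]])
      have rn: "lk v R Y' \<le> n\<^sup>2 / 5000000" if "Y' \<subseteq> V" for Y'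
      proof -
        have "lk v R Y' \<le> real (card R) * real (card Y')" by (rule lk_le)
        also have "\<dots> \<le> (2 / 10 ^ 7 * n) * n" using rc card_le_n[OF that] npos by (intro mult_mono) auto
        finally show ?thesis by (simp add: power2_eq_square)
      qed
      have "lk v X X = lk v G X + lk v R X" using lk_Un1[OF f X(2), of v X] X(1) by simp
      also have "lk v G X = lk v G G + lk v G R" using lk_Un2[OF f X(2), of v G] X(1) by simp
      also have "lk v G R = lk v R G" by (rule lk_sym)
      also have "lk v R G \<le> n\<^sup>2 / 5000000" using sub bX by (intro rn) auto
      also have "lk v R X \<le> n\<^sup>2 / 5000000" using bX by (intro rn) auto
      also have "lk v G G \<le> (mv G H v / (329/1000 * n))\<^sup>2" unfolding G_def H_def by (rule good_inner[OF tX vA])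
      also have "\<dots> \<le> (m / (329/1000 * n))\<^sup>2"
        using mv_mono[OF sub bX(6,7), of v] mv_nonneg[of G H v] npos mX by (intro power_mono divide_right_mono) auto
      also have "(m / (329/1000 * n))\<^sup>2 = m * m / (108241/1000000 * n\<^sup>2)" by (simp add: power2_eq_square)
      finally show ?thesis using n2pos by linarith
    qed
    define s where "s = m / n\<^sup>2"
    have ms: "m = s * n\<^sup>2" using npos by (simp add: s_def)
    have s1: "1/2000 \<le> s" "s \<le> 105/1000" using m1 True n2pos by (simp_all add: s_def m_def pos_le_divide_eq pos_divide_le_eq)
    have "m * m / (108241/1000000 * n\<^sup>2) = 1000000/108241 * (s * s) * n\<^sup>2" unfolding ms using npos by (simp add: field_simps)
    \<comment> \<open>A chord estimate: between 1/2000 and 105/1000 the convex function s^2 lies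
      below its chord, which leaves a margin of 2/10000.\<close>
    moreover have "1000000/108241 * (s * s) \<le> s - 2/10000"
    proof -
      have "0 \<le> (s - 1/2000) * (105/1000 - s)" using s1 by simp
      moreover have "(s - 1/2000) * (105/1000 - s) = 1055/10000 * s - 525/10000000 - s * s" by (simp add: field_simps)
      ultimately have "s * s \<le> 1055/10000 * s - 525/10000000" by simp
      then show ?thesis using s1 by linarith
    qed
    then have "1000000/108241 * (s * s) * n\<^sup>2 \<le> (s - 2/10000) * n\<^sup>2" by (intro mult_right_mono) auto
    moreover have "(s - 2/10000) * n\<^sup>2 = m - 2/10000 * n\<^sup>2" unfolding ms by (rule left_diff_distrib)
    moreover note inner[OF t m_def[symmetric]] inner[OF tight_perm(2)[OF t]]
    ultimately have "lk v B B \<le> m - 199/1000000 * n\<^sup>2" "lk v C C \<le> m - 199/1000000 * n\<^sup>2"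
      using mv_sym[of C B v] by (simp_all add: m_def)
    then show ?thesis using x n2pos unfolding bd_def m_def[symmetric] add_divide_distrib by linarith
  next
    case False
    \<comment> \<open>The edges inside \<open>X\<close> force at least 0.0104 n^2 ordered pairs out
      of the link, leaving at most 0.1044 n^2 and hence less than the deficit, which here exceeds
      0.105 n^2.\<close>
    have link: "lk v X X \<le> 1044/10000 * n\<^sup>2" if X: "finite X" "real (card X) \<le> 3335/10000 * n" and i: "8/1000 * n ^ 3 \<le> ct X X X" for X
    proof -
      have c2: "(real (card X))\<^sup>2 \<le> 1113/10000 * n\<^sup>2"
      proof -
        have "(real (card X))\<^sup>2 \<le> (3335/10000 * n)\<^sup>2" using X by (intro power_mono) auto
        also have "\<dots> = (3335/10000)\<^sup>2 * n\<^sup>2" by (rule power_mult_distrib)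
        also have "\<dots> \<le> 1113/10000 * n\<^sup>2" by (intro mult_right_mono) (auto simp: power2_eq_square)
        finally show ?thesis .
      qed
      have "8/1000 * n ^ 3 \<le> (real (card X))\<^sup>2 + 2 * (real (card X) * mv X X v)" using i inner_edges_force_nonlink[OF X(1), of v] by linarith
      also have "real (card X) * mv X X v \<le> (3335/10000 * n) * mv X X v" using X mv_nonneg by (intro mult_right_mono)
      finally have "8/1000 * n ^ 3 \<le> 1113/10000 * n\<^sup>2 + 667/1000 * (n * mv X X v)" using c2 by simp
      then have "7/1000 * n ^ 3 \<le> 667/1000 * (n * mv X X v)" using nsq n2pos n3pos by linarith
      then have "n * (7/1000 * n\<^sup>2) \<le> n * (667/1000 * mv X X v)" by (simp add: power2_eq_square power3_eq_cube)
      then have "7/1000 * n\<^sup>2 \<le> 667/1000 * mv X X v" using npos by (rule mult_left_le_imp_le)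
      moreover have "lk v X X = (real (card X))\<^sup>2 - mv X X v" by (simp add: mv_def power2_eq_square)
      ultimately show ?thesis using c2 n2pos by linarith
    qed
    have "lk v B B \<le> 1044/10000 * n\<^sup>2" "lk v C C \<le> 1044/10000 * n\<^sup>2"
      using link[OF b(6) tight_sizes(2)[OF t] iB] link[OF b(7) tight_sizes(4)[OF t] iC] .
    then show ?thesis using x False n2pos unfolding bd_def m_def[symmetric] add_divide_distrib by linarith
  qed
qed

text \<open>Subtract \<open>bad_split\<close> from \<open>missing_split\<close>. By
  \<open>removed_vertex\<close> each removed vertex contributes a surplus of 1/10000 - 1/1000000 =
  99/1000000 times n^2, and the good vertices 0.985 times their missing triples; extremality leaves
  no room for either.\<close>

lemma tight_exact:
  assumes t: "tight A B C" and gap: "missing A B C \<le> bad A B C"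
    and i: "ct A A A \<ge> 8/1000 * n ^ 3" "ct B B B \<ge> 8/1000 * n ^ 3" "ct C C C \<ge> 8/1000 * n ^ 3"
  shows "missing A B C = 0" "bad A B C = 0"
proof -
  note b = tight_basic[OF t]
  note t3 = tight_perm(1)[OF t] and t5 = tight_perm(1)[OF tight_perm(2)[OF t]]
  define M0 where "M0 = missing (gd A B C) (gd B A C) (gd C A B)"
  define cR where "cR X = real (card X) * (99/1000000 * n\<^sup>2)" for X :: "'a set"
  have key: "(\<Sum>v\<in>Rs X Y Z. bd X Y Z v) + cR (Rs X Y Z) \<le> (\<Sum>v\<in>Rs X Y Z. mv Y Z v - n\<^sup>2 / 1000000)"
    if "tight X Y Z" "ct Y Y Y \<ge> 8/1000 * n ^ 3" "ct Z Z Z \<ge> 8/1000 * n ^ 3" for X Y Z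
  proof -
    have "(\<Sum>v\<in>Rs X Y Z. bd X Y Z v) + cR (Rs X Y Z) = (\<Sum>v\<in>Rs X Y Z. bd X Y Z v + 99/1000000 * n\<^sup>2)"
      by (simp add: cR_def sum.distrib)
    also have "\<dots> \<le> (\<Sum>v\<in>Rs X Y Z. mv Y Z v - n\<^sup>2 / 1000000)"
    proof (rule sum_mono)
      fix v assume "v \<in> Rs X Y Z"
      from removed_vertex[OF that(1) this that(2,3)]
      show "bd X Y Z v + 99/1000000 * n\<^sup>2 \<le> mv Y Z v - n\<^sup>2 / 1000000" by linarith
    qed
    finally show ?thesis .
  qed
  have fg: "finite (gd A B C)" "finite (gd B A C)" "finite (gd C A B)" using b by (auto simp: gd_def)
  have M0: "0 \<le> M0" unfolding M0_def missing_def using ct_le[OF fg] by simp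
  have c0: "0 \<le> cR X" for X unfolding cR_def by simp
  have s: "985/1000 * M0 + cR (Rs A B C) + cR (Rs B A C) + cR (Rs C A B) \<le> 0"
    using bad_split[OF t] missing_split[OF t] gap key[OF t i(2,3)] key[OF t3 i(1,3)] key[OF t5 i(1,2)]
    unfolding M0_def by linarith
  have "cR (Rs A B C) = 0" "cR (Rs B A C) = 0" "cR (Rs C A B) = 0" and M00: "M0 = 0"
    using s M0 c0[of "Rs A B C"] c0[of "Rs B A C"] c0[of "Rs C A B"] by linarith+
  then have "card (Rs A B C) = 0" "card (Rs B A C) = 0" "card (Rs C A B) = 0" using npos by (simp_all add: cR_def)
  moreover have "finite (Rs A B C)" "finite (Rs B A C)" "finite (Rs C A B)" using b by (auto simp: Rs_def)
  ultimately have R: "Rs A B C = {}" "Rs B A C = {}" "Rs C A B = {}" by simp_all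
  then have g: "gd A B C = A" "gd B A C = B" "gd C A B = C" by (simp_all add: gd_def)
  then show m: "missing A B C = 0" using M00 by (simp add: M0_def)
  have "bad A B C \<le> 0" using bad_split[OF t] m unfolding R g by simp
  moreover have "0 \<le> bad A B C" unfolding bad_def using ct_nonneg by (intro divide_nonneg_nonneg add_nonneg_nonneg) auto
  ultimately show "bad A B C = 0" by simp
qed

end

section \<open>The exact structure and the sizes of the parts\<close>

context c5graph
begin

lemma ct_eq_0D:
  assumes "ct X Y Z = 0" "finite X" "finite Y" "finite Z" "x \<in> X" "y \<in> Y" "z \<in> Z"
  shows "\<not> adj x y z"
proof -
  have "(\<Sum>y\<in>Y. \<Sum>z\<in>Z. of_bool (adj x y z) :: real) = 0"
    by (rule sum_nonneg_0[OF assms(2) _ assms(1)[unfolded ct_def] assms(5)]) (intro sum_nonneg, simp)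
  from sum_nonneg_0[OF assms(3) _ this assms(6)] have "(\<Sum>z\<in>Z. of_bool (adj x y z) :: real) = 0"
    by (simp add: sum_nonneg)
  from sum_nonneg_0[OF assms(4) _ this assms(7)] have "(of_bool (adj x y z) :: real) = 0" by simp
  then show ?thesis by simp
qed

lemma transversal_structure:
  assumes p: "partition3 A B C" and m: "missing A B C = 0" and b: "bad A B C = 0"
  shows "E - (induced_edges E A \<union> induced_edges E B \<union> induced_edges E C) = transversal_triples A B C"
proof -
  note f = partition3_finite[OF p]
  have d: "A \<inter> B = {}" "A \<inter> C = {}" "B \<inter> C = {}" "A \<union> B \<union> C = V" using p by (auto simp: partition3_def)
  have b0: "ct A B B + ct A C C + ct B A A + ct B C C + ct C A A + ct C B B = 0" using b by (simp add: bad_def)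
  have z: "ct A B B = 0" "ct A C C = 0" "ct B A A = 0" "ct B C C = 0" "ct C A A = 0" "ct C B B = 0"
    using b0 ct_nonneg[of A B B] ct_nonneg[of A C C] ct_nonneg[of B A A] ct_nonneg[of B C C] ct_nonneg[of C A A] ct_nonneg[of C B B] by linarith+
  note nb = ct_eq_0D[OF z(1) f(1,2,2)] ct_eq_0D[OF z(2) f(1,3,3)] ct_eq_0D[OF z(3) f(2,1,1)] ct_eq_0D[OF z(4) f(2,3,3)]
    ct_eq_0D[OF z(5) f(3,1,1)] ct_eq_0D[OF z(6) f(3,2,2)]
  have full: "adj x y z" if xyz: "x \<in> A" "y \<in> B" "z \<in> C" for x y z
  proof -
    have s: "(\<Sum>x\<in>A. \<Sum>y\<in>B. \<Sum>z\<in>C. of_bool (\<not> adj x y z) :: real) = 0" using m unfolding miss3_eq missing_def .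
    have "(\<Sum>y\<in>B. \<Sum>z\<in>C. of_bool (\<not> adj x y z) :: real) = 0"
      by (rule sum_nonneg_0[OF f(1) _ s xyz(1)]) (intro sum_nonneg, simp)
    from sum_nonneg_0[OF f(2) _ this xyz(2)] have "(\<Sum>z\<in>C. of_bool (\<not> adj x y z) :: real) = 0"
      by (simp add: sum_nonneg)
    from sum_nonneg_0[OF f(3) _ this xyz(3)] have "(of_bool (\<not> adj x y z) :: real) = 0" by simp
    then show ?thesis by simp
  qed
  define col where "col v = (if v \<in> A then 0 else if v \<in> B then 1 else 2 :: nat)" for v
  have colA: "col v = 0 \<longleftrightarrow> v \<in> A" for v by (simp add: col_def)
  have colB: "v \<in> V \<Longrightarrow> col v = 1 \<longleftrightarrow> v \<in> B" for v using d by (auto simp: col_def)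
  have colC: "v \<in> V \<Longrightarrow> col v = 2 \<longleftrightarrow> v \<in> C" for v using d by (auto simp: col_def)
  have col3: "col v = 0 \<or> col v = 1 \<or> col v = 2" for v by (simp add: col_def)
  \<comment> \<open>No edge has exactly two vertices in one part, so as soon as two of its vertices
    share a part all three do.\<close>
  have mono: "col x = col y" if a: "adj x y z" and yz: "col y = col z" for x y z
  proof (rule ccontr)
    assume ne: "col x \<noteq> col y"
    have v: "x \<in> V" "y \<in> V" "z \<in> V" using adjD[OF a] by auto
    show False
      using col3[of x] col3[of y] yz[symmetric] ne a nb[of x y z] colA[of x] colA[of y] colA[of z] colB[OF v(1)] colB[OF v(2)] colB[OF v(3)]
        colC[OF v(1)] colC[OF v(2)] colC[OF v(3)] by auto
  qed
  have T: "transversal_triples A B C = (\<lambda>(x, y, z). {x, y, z}) ` (A \<times> B \<times> C)" by (rule transversal_triples_eq[OF d(1-3)])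
  show ?thesis unfolding T
  proof (intro subset_antisym subsetI)
    fix e assume e: "e \<in> E - (induced_edges E A \<union> induced_edges E B \<union> induced_edges E C)"
    then have eE: "e \<in> E" by simp
    obtain x y z where xyz: "e = {x, y, z}" using three_graph_edgeD(3)[OF tg eE] by (auto simp: card_3_iff)
    have a: "adj x y z" using eE by (simp add: adj_def xyz)
    have v: "x \<in> V" "y \<in> V" "z \<in> V" using adjD[OF a] by auto
    have not: "\<not> (col x = col y \<and> col y = col z)"
    proof
      assume eq: "col x = col y \<and> col y = col z"
      have "e \<subseteq> A \<or> e \<subseteq> B \<or> e \<subseteq> C"
        using eq col3[of x] colA[of x] colA[of y] colA[of z] colB[OF v(1)] colB[OF v(2)] colB[OF v(3)]
          colC[OF v(1)] colC[OF v(2)] colC[OF v(3)] unfolding xyz by auto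
      then show False using e by (auto simp: induced_edges_def)
    qed
    have ne: "col y \<noteq> col z" "col x \<noteq> col z" "col x \<noteq> col y"
    proof -
      show "col y \<noteq> col z"
      proof
        assume h: "col y = col z"
        from mono[OF a h] h not show False by simp
      qed
      show "col x \<noteq> col z"
      proof
        assume h: "col x = col z"
        from mono[OF adj_perm(1)[OF a] h] h not show False by simp
      qed
      show "col x \<noteq> col y"
      proof
        assume h: "col x = col y"
        from mono[OF adj_perm(4)[OF a] h] h not show False by simp
      qed
    qed
    have key: "e \<in> (\<lambda>(x, y, z). {x, y, z}) ` (A \<times> B \<times> C)"
      if "p \<in> A" "q \<in> B" "r \<in> C" "e = {p, q, r}" for p q r
      using that by (intro image_eqI[of _ _ "(p, q, r)"]) auto
    have perms: "e = {x, z, y}" "e = {y, x, z}" "e = {y, z, x}" "e = {z, x, y}" "e = {z, y, x}" "e = {x, y, z}"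
      unfolding xyz by (simp_all add: insert_commute)
    have "col x = 0 \<and> col y = 1 \<and> col z = 2 \<or> col x = 0 \<and> col z = 1 \<and> col y = 2 \<or> col y = 0 \<and> col x = 1 \<and> col z = 2
      \<or> col y = 0 \<and> col z = 1 \<and> col x = 2 \<or> col z = 0 \<and> col x = 1 \<and> col y = 2 \<or> col z = 0 \<and> col y = 1 \<and> col x = 2"
      using col3[of x] col3[of y] col3[of z] ne by (elim disjE) simp_all
    from this[unfolded colA colB[OF v(1)] colB[OF v(2)] colB[OF v(3)] colC[OF v(1)] colC[OF v(2)] colC[OF v(3)]]
    consider "x \<in> A" "y \<in> B" "z \<in> C" | "x \<in> A" "z \<in> B" "y \<in> C" | "y \<in> A" "x \<in> B" "z \<in> C" | "y \<in> A" "z \<in> B" "x \<in> C"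
      | "z \<in> A" "x \<in> B" "y \<in> C" | "z \<in> A" "y \<in> B" "x \<in> C"
      by blast
    then show "e \<in> (\<lambda>(x, y, z). {x, y, z}) ` (A \<times> B \<times> C)"
      by cases (rule key; (assumption | rule perms))+
  next
    fix e assume "e \<in> (\<lambda>(x, y, z). {x, y, z}) ` (A \<times> B \<times> C)"
    then obtain x y z where xyz: "x \<in> A" "y \<in> B" "z \<in> C" "e = {x, y, z}" by auto
    have "e \<in> E" using full[OF xyz(1-3)] by (simp add: adj_def xyz(4))
    moreover have "\<not> e \<subseteq> A" "\<not> e \<subseteq> B" "\<not> e \<subseteq> C" using xyz d by auto
    ultimately show "e \<in> E - (induced_edges E A \<union> induced_edges E B \<union> induced_edges E C)" by (auto simp: induced_edges_def)
  qed
qed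

text \<open>With no bad edge and no missing triple, the edge count is the energy inequality up to 4
  d: one d from the lower bound and one from each part. The factor 17 of
  \<open>energy_balance\<close> then becomes 68.\<close>

lemma exact_sizes:
  fixes L d n :: real
  assumes p: "partition3 A B C" and m: "missing A B C = 0" and b: "bad A B C = 0" and n: "n = real (card V)" "n > 0"
    and L: "L \<ge> 1/4" and d: "0 \<le> d" and ct: "ct A B C \<ge> 36/1000 * n ^ 3"
    and e: "(L / 6 - d) * n ^ 3 \<le> card E"
    and her: "\<And>W. W \<subseteq> V \<Longrightarrow> card (induced_edges E W) \<le> L / 6 * real (card W) ^ 3 + d * n ^ 3"
  shows "(real (card A) / n - 1/3)\<^sup>2 \<le> 68 * d" "(real (card B) / n - 1/3)\<^sup>2 \<le> 68 * d" "(real (card C) / n - 1/3)\<^sup>2 \<le> 68 * d"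
proof -
  define u y z where "u = real (card A) / n" and "y = real (card B) / n" and "z = real (card C) / n"
  have c: "real (card A) = u * n" "real (card B) = y * n" "real (card C) = z * n"
    using n(2) by (simp_all add: u_def y_def z_def)
  note s = partition3_subset[OF p]
  have n3: "n ^ 3 > 0" using n by simp
  have "real (card A) + real (card B) + real (card C) = n" using partition3_card[OF p] unfolding n by linarith
  then have "(u + y + z) * n = 1 * n" by (simp add: c algebra_simps)
  then have one: "u + y + z = 1" using n(2) by simp
  have nn: "0 \<le> u" "0 \<le> y" "0 \<le> z" using n(2) by (simp_all add: u_def y_def z_def)
  have prod: "ct A B C = u * y * z * n ^ 3" using m by (simp add: missing_def c power3_eq_cube mult_ac)
  have "36/1000 * n ^ 3 \<le> u * y * z * n ^ 3" using ct unfolding prod .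
  then have cr: "u * y * z \<ge> 36/1000" using n3 by (rule mult_right_le_imp_le)
  have "(L / 6 - d) * n ^ 3 \<le> u * y * z * n ^ 3 + (L / 6 * (u * n) ^ 3 + d * n ^ 3) + (L / 6 * (y * n) ^ 3 + d * n ^ 3) + (L / 6 * (z * n) ^ 3 + d * n ^ 3)"
    using e edge_count[OF p] b her[OF s(1)] her[OF s(2)] her[OF s(3)] unfolding prod c by linarith
  also have "\<dots> = (u * y * z + L / 6 * (u ^ 3 + y ^ 3 + z ^ 3) + 3 * d) * n ^ 3" by (simp add: power_mult_distrib algebra_simps)
  finally have "L / 6 - d \<le> u * y * z + L / 6 * (u ^ 3 + y ^ 3 + z ^ 3) + 3 * d" using n3 by (rule mult_right_le_imp_le)
  then have en: "L / 6 * (1 - u ^ 3 - y ^ 3 - z ^ 3) \<le> u * y * z + 4 * d" by (simp add: algebra_simps)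
  have "L / 6 \<ge> 1/24" "0 \<le> 4 * d" using L d by auto
  from energy_balance(2-4)[OF nn one this en cr]
  show "(real (card A) / n - 1/3)\<^sup>2 \<le> 68 * d" "(real (card B) / n - 1/3)\<^sup>2 \<le> 68 * d" "(real (card C) / n - 1/3)\<^sup>2 \<le> 68 * d"
    unfolding u_def y_def z_def by simp_all
qed

end

theorem theorem1p3:
  shows "\<forall>\<epsilon>::real. \<epsilon> > 0 \<longrightarrow>
    (\<exists>n0::nat. \<forall>n\<ge>n0. \<forall>(V :: 'a set) (E :: 'a set set).
      three_graph V E \<and> card V = n \<and> C5m_free V E \<and> card E = ex_C5m n \<longrightarrow>
      (\<exists>W :: nat \<Rightarrow> 'a set.
         disjoint_family_on W {1, 2, 3} \<and> W 1 \<union> W 2 \<union> W 3 = V \<and>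
         (\<forall>i\<in>{1, 2, 3}. \<bar>real (card (W i)) - real n / 3\<bar> \<le> \<epsilon> * real n) \<and>
         E - (\<Union>i\<in>{1, 2, 3}. induced_edges E (W i)) =
           transversal_triples (W 1) (W 2) (W 3)))"
proof (intro allI impI)
  fix \<epsilon> :: real assume \<epsilon>: "\<epsilon> > 0"
  obtain L :: real where L: "L \<ge> 1/4" and dens: "\<And>\<delta>. \<delta> > 0 \<Longrightarrow> \<exists>n0. \<forall>n\<ge>n0. (L / 6 - \<delta>) * real n ^ 3 \<le> ex_C5m n \<and>
     (\<forall>m\<le>n. ex_C5m m \<le> L / 6 * real m ^ 3 + \<delta> * real n ^ 3)"
    using ex_C5m_density by metis
  define \<delta> :: real where "\<delta> = 1 / 10 ^ 13"
  define d where "d = \<delta>\<^sup>2 / 1000"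
  \<comment> \<open>The bound \<open>d\<close> serves the stability argument, and 68
    \<open>d2\<close> \<le> \<epsilon>^2 is what \<open>exact_sizes\<close> turns into the size
    condition.\<close>
  define d2 where "d2 = min d (\<epsilon>\<^sup>2 / 68)"
  have dpos: "0 < d" by (simp add: d_def \<delta>_def)
  have d2: "0 < d2" "d2 \<le> d" "68 * d2 \<le> \<epsilon>\<^sup>2" using dpos \<epsilon> by (auto simp: d2_def min_def)
  obtain n0 where n0: "\<And>n. n \<ge> n0 \<Longrightarrow> (L / 6 - d2) * real n ^ 3 \<le> ex_C5m n \<and>
     (\<forall>m\<le>n. ex_C5m m \<le> L / 6 * real m ^ 3 + d2 * real n ^ 3)" using dens[OF d2(1)] by blast
  show "\<exists>n0::nat. \<forall>n\<ge>n0. \<forall>(V :: 'a set) (E :: 'a set set).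
      three_graph V E \<and> card V = n \<and> C5m_free V E \<and> card E = ex_C5m n \<longrightarrow>
      (\<exists>W :: nat \<Rightarrow> 'a set.
         disjoint_family_on W {1, 2, 3} \<and> W 1 \<union> W 2 \<union> W 3 = V \<and>
         (\<forall>i\<in>{1, 2, 3}. \<bar>real (card (W i)) - real n / 3\<bar> \<le> \<epsilon> * real n) \<and>
         E - (\<Union>i\<in>{1, 2, 3}. induced_edges E (W i)) =
           transversal_triples (W 1) (W 2) (W 3))"
  proof (intro exI[of _ "max n0 (10 ^ 50)"] allI impI)
    fix k and V :: "'a set" and E :: "'a set set"
    assume k: "k \<ge> max n0 (10 ^ 50)" and a: "three_graph V E \<and> card V = k \<and> C5m_free V E \<and> card E = ex_C5m k"
    define n where "n = real k"
    have nV: "n = real (card V)" using a by (simp add: n_def)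
    have n50: "n \<ge> 10 ^ 50"
    proof -
      have "real (10 ^ 50) \<le> real k" using k by (simp only: of_nat_le_iff)
      then show ?thesis by (simp add: n_def)
    qed
    have n12: "n \<ge> 10 ^ 12" using n50 by (rule order_trans[rotated]) simp
    have npos: "n > 0" using n12 by (rule less_le_trans[rotated]) simp
    have n3: "n ^ 3 > 0" using npos by simp
    interpret c5graph V E using a by unfold_locales auto
    interpret c5graph_large V E n using nV n12 by unfold_locales
    have dk: "(L / 6 - d2) * real k ^ 3 \<le> real (ex_C5m k)"
      "\<And>m. m \<le> k \<Longrightarrow> real (ex_C5m m) \<le> L / 6 * real m ^ 3 + d2 * real k ^ 3"
      using n0[of k] k by auto
    have e2: "(L / 6 - d2) * n ^ 3 \<le> card E" using dk(1) a by (simp add: n_def)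
    have exl2: "real (ex_C5m m) \<le> L / 6 * real m ^ 3 + d2 * n ^ 3" if "m \<le> card V" for m
      using dk(2)[of m] that a by (simp add: n_def)
    have her2: "card (induced_edges E W) \<le> L / 6 * real (card W) ^ 3 + d2 * n ^ 3" if W: "W \<subseteq> V" for W
    proof -
      have "card (induced_edges E W) \<le> ex_C5m (card W)"
        by (rule card_le_ex_C5m[OF three_graph_induced[OF tg W] C5m_free_induced[OF fr W]])
      moreover have "card W \<le> card V" using W finV by (rule card_mono[rotated])
      ultimately show ?thesis using exl2[of "card W"] by linarith
    qed
    have dd: "d2 * n ^ 3 \<le> d * n ^ 3" using d2 n3 by (intro mult_right_mono) auto
    have e1: "(L / 6 - d) * n ^ 3 \<le> card E" using e2 dd unfolding left_diff_distrib by linarith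
    have exl: "real (ex_C5m m) \<le> L / 6 * real m ^ 3 + d * n ^ 3" if "m \<le> card V" for m using exl2[OF that] dd by linarith
    obtain A0 B0 C0 where P0: "partition3 A0 B0 C0" "ct A0 B0 C0 \<ge> (1/27 - 1 / 10 ^ 10) * n ^ 3"
      using stable_partition[OF L \<delta>_def d_def nV n50 e1 exl] .
    \<comment> \<open>The stable partition put the deleted vertices into an arbitrary part, so the
      cut is maximized again on the whole vertex set.\<close>
    obtain A B C where mc: "maxcut A B C" "ct A0 B0 C0 \<le> ct A B C" by (rule exists_maxcut[OF P0(1)])
    have t: "tight A B C" using mc P0(2) unfolding tight_def by linarith
    note b = tight_basic[OF t]
    have L2: "L \<le> 2"
    proof -
      have "6 * real (card E) \<le> n ^ 3"
        using ct_induced[of V] ct_le[OF finV finV finV] by (simp add: induced_V nV power3_eq_cube)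
      then have "(L / 6 - d2) * n ^ 3 \<le> 1/6 * n ^ 3" using e2 by linarith
      then have "L / 6 - d2 \<le> 1/6" using n3 by (rule mult_right_le_imp_le)
      moreover have "d \<le> 1/100" by (simp add: d_def \<delta>_def power2_eq_square)
      ultimately show ?thesis using d2(2) by linarith
    qed
    have d6: "0 \<le> d2" "d2 \<le> 1/1000000"
    proof -
      show "0 \<le> d2" using d2 by simp
      have "d \<le> 1/1000000" by (simp add: d_def \<delta>_def power2_eq_square)
      then show "d2 \<le> 1/1000000" using d2 by linarith
    qed
    have gap: "missing A B C \<le> bad A B C" using extremal_gap[OF b(1)] a by simp
    have ie: "ct X X X \<ge> 8/1000 * n ^ 3" if "tight X Y Z" for X Y Z
      by (rule inner_edges[OF that L L2 d6 e2], rule her2)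
    have ex: "missing A B C = 0" "bad A B C = 0"
      using tight_exact[OF t gap ie[OF t] ie[OF tight_perm(1)[OF t]] ie[OF tight_perm(1)[OF tight_perm(2)[OF t]]]] .
    have ct36: "ct A B C \<ge> 36/1000 * n ^ 3"
    proof -
      have "36/1000 * n ^ 3 \<le> (1/27 - 1 / 10 ^ 10) * n ^ 3" using n3 by (intro mult_right_mono) auto
      then show ?thesis using t unfolding tight_def by linarith
    qed
    have sq: "(real (card A) / n - 1/3)\<^sup>2 \<le> 68 * d2" "(real (card B) / n - 1/3)\<^sup>2 \<le> 68 * d2" "(real (card C) / n - 1/3)\<^sup>2 \<le> 68 * d2"
      by (rule exact_sizes(1)[OF b(1) ex nV npos L d6(1) ct36 e2], rule her2, assumption)
        (rule exact_sizes(2)[OF b(1) ex nV npos L d6(1) ct36 e2], rule her2, assumption,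
         rule exact_sizes(3)[OF b(1) ex nV npos L d6(1) ct36 e2], rule her2, assumption)
    have size: "\<bar>real (card X) - real k / 3\<bar> \<le> \<epsilon> * real k" if "(real (card X) / n - 1/3)\<^sup>2 \<le> 68 * d2" for X :: "'a set"
    proof -
      have "(real (card X) / n - 1/3)\<^sup>2 \<le> \<epsilon>\<^sup>2" using that d2(3) by linarith
      then have "\<bar>real (card X) / n - 1/3\<bar> \<le> \<epsilon>" using \<epsilon> abs_le_square_iff[of "real (card X) / n - 1/3" \<epsilon>] by simp
      then have "\<bar>real (card X) / n - 1/3\<bar> * n \<le> \<epsilon> * n" using npos by (intro mult_right_mono) auto
      moreover have "\<bar>real (card X) / n - 1/3\<bar> * n = \<bar>real (card X) - n / 3\<bar>"
      proof -
        have "\<bar>real (card X) / n - 1/3\<bar> * n = \<bar>(real (card X) / n - 1/3) * n\<bar>" using npos by (simp add: abs_mult)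
        also have "(real (card X) / n - 1/3) * n = real (card X) - n / 3" using npos by (simp add: left_diff_distrib)
        finally show ?thesis .
      qed
      ultimately show ?thesis by (simp add: n_def)
    qed
    define W where "W i = (if i = 1 then A else if i = 2 then B else C)" for i :: nat
    have W: "W 1 = A" "W 2 = B" "W 3 = C" by (simp_all add: W_def)
    have p: "A \<inter> B = {}" "A \<inter> C = {}" "B \<inter> C = {}" "A \<union> B \<union> C = V" using b(1) by (auto simp: partition3_def)
    have "disjoint_family_on W {1, 2, 3}" using p unfolding disjoint_family_on_def by (auto simp: W_def)
    moreover have "\<forall>i\<in>{1, 2, 3}. \<bar>real (card (W i)) - real k / 3\<bar> \<le> \<epsilon> * real k"
      using size[OF sq(1)] size[OF sq(2)] size[OF sq(3)] by (simp add: W_def)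
    moreover have "E - (\<Union>i\<in>{1, 2, 3}. induced_edges E (W i)) = transversal_triples (W 1) (W 2) (W 3)"
    proof -
      have "(\<Union>i\<in>{1, 2, 3}. induced_edges E (W i)) = induced_edges E A \<union> induced_edges E B \<union> induced_edges E C"
        by (simp add: W_def Un_assoc)
      then show ?thesis using transversal_structure[OF b(1) ex] unfolding W by simp
    qed
    ultimately show "\<exists>W :: nat \<Rightarrow> 'a set.
         disjoint_family_on W {1, 2, 3} \<and> W 1 \<union> W 2 \<union> W 3 = V \<and>
         (\<forall>i\<in>{1, 2, 3}. \<bar>real (card (W i)) - real k / 3\<bar> \<le> \<epsilon> * real k) \<and>
         E - (\<Union>i\<in>{1, 2, 3}. induced_edges E (W i)) =
           transversal_triples (W 1) (W 2) (W 3)"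
      using p(4) W by (intro exI[of _ W]) simp
  qed
qed

end
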